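(* Let $i\in\{0,1\}$. There exists a constant $C>0$, independent of the mesh $\mathcal{T}_h$ (in particular of $h$) and of $u$, such that the following holds. Let $u\in H^{2+i}(\Omega)\cap H^1_0(\Omega)$ be the exact solution of $-\Delta u=f$ in $\Omega$, $u=0$ on $\partial\Omega$, and let $u_h\in V_h^0$ be the stabilizer free weak Galerkin finite element solution, i.e. $\sum_{T\in\mathcal{T}_h}(\nabla_w u_h,\nabla_w v)_T=(f,v_0)$ for all $v=\{v_0,v_b\}\in V_h^0$. Then $$|\!|\!|Q_hu-u_h|\!|\!|\le C\,h^{1+i}\,\|u\|_{H^{2+i}(\Omega)}.$$
   Context: $\Omega\subset\mathbb{R}^2$ is a bounded polygonal domain and $f\in L^2(\Omega)$. $\mathcal{T}_h$ is a partition of $\Omega$ into triangles belonging to a quasi-uniform, shape-regular family of conforming triangulations; $h_T$ is the diameter of $T$, $h=\max_T h_T$, and $\mathcal{E}_h$ is the set of all edges. Constants $C$ may depend on $\Omega$ and on the shape-regularity/quasi-uniformity constants of the family, but not on the particular mesh. The weak Galerkin space $V_h$ consists of pairs $v=\{v_0,v_b\}$ where $v_0|_T\in P_0(T)$ for every $T\in\mathcal{T}_h$ and $v_b|_e\in P_1(e)$ for every $e\in\mathcal{E}_h$ ($v_b$ is single-valued on each edge and need not be continuous at vertices, nor related to $v_0$). $V_h^0=\{v\in V_h: v_b=0\text{ on }\partial\Omega\}$. For $v\in V_h$ the weak gradient $\nabla_w v$ is the piecewise polynomial with $\nabla_wv|_T\in[P_1(T)]^2$ uniquely determined on each $T$ by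 $$(\nabla_wv,\vec q)_T=-(v_0,\nabla\cdot\vec q)_T+\langle v_b,\vec q\cdot\vec n\rangle_{\partial T}\quad\forall\vec q\in[P_1(T)]^2,$$ where $\vec n$ is the unit outward normal to $\partial T$, and $(\cdot,\cdot)_T$, $\langle\cdot,\cdot\rangle_{\partial T}$ are the $L^2$ inner products on $T$ and $\partial T$; $(\cdot,\cdot)$ is the $L^2(\Omega)$ inner product. $Q_h\phi=\{Q_0\phi,Q_b\phi\}\in V_h$, where $Q_0$ is on each $T$ the $L^2(T)$-projection onto $P_0(T)$ and $Q_b$ is on each edge $e$ the $L^2(e)$-projection onto $P_1(e)$ (applied to the trace of $\phi$). The energy norm is $|\!|\!|v|\!|\!|^2=\sum_{T\in\mathcal{T}_h}(\nabla_wv,\nabla_wv)_T$. *)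

theory Defs
  imports "HOL-Analysis.Analysis"
begin

section \<open>Lebesgue spaces\<close>

definition L2 :: "'a measure \<Rightarrow> ('a \<Rightarrow> real) set" where
  "L2 M = {f \<in> borel_measurable M. integrable M (\<lambda>x. (f x)\<^sup>2)}"

definition L2_inner :: "'a measure \<Rightarrow> ('a \<Rightarrow> 'b::real_inner) \<Rightarrow> ('a \<Rightarrow> 'b) \<Rightarrow> real" where
  "L2_inner M f g = (LINT x|M. f x \<bullet> g x)"

definition L2_norm :: "'a measure \<Rightarrow> ('a \<Rightarrow> real) \<Rightarrow> real" where
  "L2_norm M f = sqrt (L2_inner M f f)"

definition L2_proj :: "'a measure \<Rightarrow> ('a \<Rightarrow> real) set \<Rightarrow> ('a \<Rightarrow> real) \<Rightarrow> 'a \<Rightarrow> real" where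
  "L2_proj M P \<phi> = (THE p. p \<in> P \<and> (\<forall>q\<in>P. L2_inner M (\<lambda>x. \<phi> x - p x) q = 0))"

text \<open>Arc-length measure on a segment \<open>e\<close> with distinct endpoints. The endpoints are determined by
  \<open>e\<close> up to order, and both orders give the same measure.\<close>

definition edge_measure :: "(real^2) set \<Rightarrow> (real^2) measure" where
  "edge_measure e =
     (let (a, b) = (SOME (a, b). e = closed_segment a b)
      in distr (lebesgue_on {0..dist a b}) (restrict_space borel e)
           (\<lambda>s. linepath a b (s / dist a b)))"


section \<open>Sobolev spaces on open subsets of the plane\<close>

definition partial :: "2 \<Rightarrow> (real^2 \<Rightarrow> real) \<Rightarrow> real^2 \<Rightarrow> real" where
  "partial i \<phi> x = frechet_derivative \<phi> (at x) (axis i 1)"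

definition partials :: "nat \<times> nat \<Rightarrow> (real^2 \<Rightarrow> real) \<Rightarrow> real^2 \<Rightarrow> real" where
  "partials \<alpha> \<phi> = (partial 1 ^^ fst \<alpha>) ((partial 2 ^^ snd \<alpha>) \<phi>)"

primrec C_k :: "nat \<Rightarrow> (real^2 \<Rightarrow> real) set" where
  "C_k 0 = {\<phi>. continuous_on UNIV \<phi>}"
| "C_k (Suc k) = {\<phi>. (\<forall>x. \<phi> differentiable (at x)) \<and> (\<forall>i. partial i \<phi> \<in> C_k k)}"

definition C_inf :: "(real^2 \<Rightarrow> real) set" where
  "C_inf = (\<Inter>k. C_k k)"

definition test_functions :: "(real^2) set \<Rightarrow> (real^2 \<Rightarrow> real) set" where
  "test_functions \<Omega> =
     {\<phi> \<in> C_inf. compact (closure {x. \<phi> x \<noteq> 0}) \<and> closure {x. \<phi> x \<noteq> 0} \<subseteq> \<Omega>}"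

definition has_weak_deriv ::
  "(real^2) set \<Rightarrow> nat \<times> nat \<Rightarrow> (real^2 \<Rightarrow> real) \<Rightarrow> (real^2 \<Rightarrow> real) \<Rightarrow> bool" where
  "has_weak_deriv \<Omega> \<alpha> u g \<longleftrightarrow>
     g \<in> L2 (lebesgue_on \<Omega>) \<and>
     (\<forall>\<phi>\<in>test_functions \<Omega>.
        L2_inner (lebesgue_on \<Omega>) u (partials \<alpha> \<phi>) =
        (-1) ^ (fst \<alpha> + snd \<alpha>) * L2_inner (lebesgue_on \<Omega>) g \<phi>)"

text \<open>The weak derivative is unique almost everywhere in \<open>\<Omega>\<close>; an arbitrary representative is taken.\<close>

definition weak_deriv ::
  "(real^2) set \<Rightarrow> nat \<times> nat \<Rightarrow> (real^2 \<Rightarrow> real) \<Rightarrow> real^2 \<Rightarrow> real" where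
  "weak_deriv \<Omega> \<alpha> u = (SOME g. has_weak_deriv \<Omega> \<alpha> u g)"

definition multi_indices :: "nat \<Rightarrow> (nat \<times> nat) set" where
  "multi_indices k = {\<alpha>. fst \<alpha> + snd \<alpha> \<le> k}"

definition Hk :: "nat \<Rightarrow> (real^2) set \<Rightarrow> (real^2 \<Rightarrow> real) set" where
  "Hk k \<Omega> = {u \<in> L2 (lebesgue_on \<Omega>). \<forall>\<alpha>\<in>multi_indices k. \<exists>g. has_weak_deriv \<Omega> \<alpha> u g}"

definition Hk_norm :: "nat \<Rightarrow> (real^2) set \<Rightarrow> (real^2 \<Rightarrow> real) \<Rightarrow> real" where
  "Hk_norm k \<Omega> u =
     sqrt (\<Sum>\<alpha>\<in>multi_indices k. (L2_norm (lebesgue_on \<Omega>) (weak_deriv \<Omega> \<alpha> u))\<^sup>2)"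

definition H1_0 :: "(real^2) set \<Rightarrow> (real^2 \<Rightarrow> real) set" where
  "H1_0 \<Omega> =
     {u \<in> Hk 1 \<Omega>. \<forall>\<epsilon>>0. \<exists>\<phi>\<in>test_functions \<Omega>. Hk_norm 1 \<Omega> (\<lambda>x. u x - \<phi> x) < \<epsilon>}"

definition laplacian :: "(real^2) set \<Rightarrow> (real^2 \<Rightarrow> real) \<Rightarrow> real^2 \<Rightarrow> real" where
  "laplacian \<Omega> u x = weak_deriv \<Omega> (2, 0) u x + weak_deriv \<Omega> (0, 2) u x"

text \<open>The trace of \<open>\<phi> \<in> H\<^sup>1(S)\<close> on an edge \<open>e\<close> in the boundary of a triangle with interior \<open>S\<close>:
  the continuous extension to \<open>H\<^sup>1(S)\<close> of the restriction of smooth functions to \<open>e\<close>.\<close>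

definition has_trace ::
  "(real^2) set \<Rightarrow> (real^2) set \<Rightarrow> (real^2 \<Rightarrow> real) \<Rightarrow> (real^2 \<Rightarrow> real) \<Rightarrow> bool" where
  "has_trace S e \<phi> g \<longleftrightarrow>
     \<phi> \<in> Hk 1 S \<and> g \<in> L2 (edge_measure e) \<and>
     (\<exists>w :: nat \<Rightarrow> real^2 \<Rightarrow> real.
        (\<forall>n. w n \<in> C_inf) \<and>
        (\<lambda>n. Hk_norm 1 S (\<lambda>x. w n x - \<phi> x)) \<longlonglongrightarrow> 0 \<and>
        (\<lambda>n. L2_norm (edge_measure e) (\<lambda>x. w n x - g x)) \<longlonglongrightarrow> 0)"


section \<open>Domains and meshes\<close>

text \<open>The condition \<open>interior (closure \<Omega>) = \<Omega>\<close> excludes slits and punctures.\<close>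

definition polygonal_domain :: "(real^2) set \<Rightarrow> bool" where
  "polygonal_domain \<Omega> \<longleftrightarrow>
     \<Omega> \<noteq> {} \<and> open \<Omega> \<and> connected \<Omega> \<and> bounded \<Omega> \<and> interior (closure \<Omega>) = \<Omega> \<and>
     (\<exists>F. finite F \<and> frontier \<Omega> = (\<Union>(a, b)\<in>F. closed_segment a b))"

definition conforming_mesh :: "(real^2) set \<Rightarrow> (real^2) set set \<Rightarrow> bool" where
  "conforming_mesh \<Omega> \<T> \<longleftrightarrow>
     triangulation \<T> \<and> (\<forall>T\<in>\<T>. 2 simplex T) \<and> \<Union>\<T> = closure \<Omega>"

definition edges :: "(real^2) set set \<Rightarrow> (real^2) set set" where
  "edges \<T> = {e. \<exists>T\<in>\<T>. e edge_of T}"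

definition mesh_size :: "(real^2) set set \<Rightarrow> real" where
  "mesh_size \<T> = Max (diameter ` \<T>)"

definition inscribed_diameter :: "(real^2) set \<Rightarrow> real" where
  "inscribed_diameter T = Sup {2 * r | r x. 0 \<le> r \<and> ball x r \<subseteq> T}"

definition shape_regular :: "real \<Rightarrow> (real^2) set set \<Rightarrow> bool" where
  "shape_regular \<sigma> \<T> \<longleftrightarrow> (\<forall>T\<in>\<T>. diameter T \<le> \<sigma> * inscribed_diameter T)"

definition quasi_uniform :: "real \<Rightarrow> (real^2) set set \<Rightarrow> bool" where
  "quasi_uniform \<tau> \<T> \<longleftrightarrow> (\<forall>T\<in>\<T>. mesh_size \<T> \<le> \<tau> * diameter T)"

definition outward_normal :: "(real^2) set \<Rightarrow> (real^2) set \<Rightarrow> real^2" where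
  "outward_normal T e = (THE n. norm n = 1 \<and> (\<forall>x\<in>e. \<forall>y\<in>T. n \<bullet> (y - x) \<le> 0))"


section \<open>Weak Galerkin spaces and operators\<close>

text \<open>Polynomials of total degree at most \<open>k\<close>, restricted to \<open>S\<close>. As elements of a function space on
  the plane they are extended by zero, so that equality of functions is equality on \<open>S\<close>.\<close>

definition polys :: "nat \<Rightarrow> (real^2) set \<Rightarrow> (real^2 \<Rightarrow> real) set" where
  "polys k S =
     {p. \<exists>c. p = (\<lambda>x. if x \<in> S
                      then \<Sum>\<alpha>\<in>multi_indices k. c \<alpha> * (x $ 1) ^ fst \<alpha> * (x $ 2) ^ snd \<alpha>
                      else 0)}"

definition vec_polys :: "nat \<Rightarrow> (real^2) set \<Rightarrow> (real^2 \<Rightarrow> real^2) set" where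
  "vec_polys k S = {q. \<forall>i. (\<lambda>x. q x $ i) \<in> polys k S}"

definition divergence :: "(real^2) set \<Rightarrow> (real^2 \<Rightarrow> real^2) \<Rightarrow> real^2 \<Rightarrow> real" where
  "divergence T q x = (\<Sum>i\<in>UNIV. frechet_derivative q (at x within T) (axis i 1) $ i)"

text \<open>A weak function \<open>v = {v\<^sub>0, v\<^sub>b}\<close> is a pair of families: \<open>fst v T\<close> is the polynomial \<open>v\<^sub>0\<close> on
  the triangle \<open>T\<close>, and \<open>snd v e\<close> is the polynomial \<open>v\<^sub>b\<close> on the edge \<open>e\<close>.\<close>

type_synonym weak_function =
  "((real^2) set \<Rightarrow> real^2 \<Rightarrow> real) \<times> ((real^2) set \<Rightarrow> real^2 \<Rightarrow> real)"

definition Vh :: "(real^2) set set \<Rightarrow> weak_function set" where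
  "Vh \<T> =
     {(v0, vb).
        (\<forall>T. if T \<in> \<T> then v0 T \<in> polys 0 T else v0 T = (\<lambda>_. 0)) \<and>
        (\<forall>e. if e \<in> edges \<T> then vb e \<in> polys 1 e else vb e = (\<lambda>_. 0))}"

definition Vh0 :: "(real^2) set \<Rightarrow> (real^2) set set \<Rightarrow> weak_function set" where
  "Vh0 \<Omega> \<T> = {v \<in> Vh \<T>. \<forall>e\<in>edges \<T>. e \<subseteq> frontier \<Omega> \<longrightarrow> (\<forall>x\<in>e. snd v e x = 0)}"

definition weak_grad :: "weak_function \<Rightarrow> (real^2) set \<Rightarrow> real^2 \<Rightarrow> real^2" where
  "weak_grad v T =
     (THE g. g \<in> vec_polys 1 T \<and>
        (\<forall>q\<in>vec_polys 1 T.
           L2_inner (lebesgue_on T) g q =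
             - L2_inner (lebesgue_on T) (fst v T) (divergence T q)
             + (\<Sum>e | e edge_of T.
                  L2_inner (edge_measure e) (snd v e) (\<lambda>x. q x \<bullet> outward_normal T e))))"

definition energy_norm :: "(real^2) set set \<Rightarrow> weak_function \<Rightarrow> real" where
  "energy_norm \<T> v =
     sqrt (\<Sum>T\<in>\<T>. L2_inner (lebesgue_on T) (weak_grad v T) (weak_grad v T))"

text \<open>The trace on \<open>e\<close> of \<open>\<phi> \<in> H\<^sup>1(\<Omega>)\<close>: the common trace from all (one or two) triangles having \<open>e\<close>
  as an edge. It is unique almost everywhere on \<open>e\<close>; an arbitrary representative is taken.\<close>

definition mesh_trace :: "(real^2) set set \<Rightarrow> (real^2) set \<Rightarrow> (real^2 \<Rightarrow> real) \<Rightarrow> real^2 \<Rightarrow> real" where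
  "mesh_trace \<T> e \<phi> = (SOME g. \<forall>T\<in>\<T>. e edge_of T \<longrightarrow> has_trace (interior T) e \<phi> g)"

definition Qh :: "(real^2) set set \<Rightarrow> (real^2 \<Rightarrow> real) \<Rightarrow> weak_function" where
  "Qh \<T> \<phi> =
     (\<lambda>T. if T \<in> \<T> then L2_proj (lebesgue_on T) (polys 0 T) \<phi> else (\<lambda>_. 0),
      \<lambda>e. if e \<in> edges \<T> then L2_proj (edge_measure e) (polys 1 e) (mesh_trace \<T> e \<phi>)
          else (\<lambda>_. 0))"

text \<open>The function on \<open>\<Omega>\<close> given by a family of functions on the triangles. Its values on the null
  set of points lying on edges are immaterial.\<close>

definition piecewise :: "(real^2) set set \<Rightarrow> ((real^2) set \<Rightarrow> real^2 \<Rightarrow> real) \<Rightarrow> real^2 \<Rightarrow> real" where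
  "piecewise \<T> w x = (\<Sum>T\<in>\<T>. if x \<in> interior T then w T x else 0)"

definition wg_solution ::
  "(real^2) set \<Rightarrow> (real^2) set set \<Rightarrow> (real^2 \<Rightarrow> real) \<Rightarrow> weak_function \<Rightarrow> bool" where
  "wg_solution \<Omega> \<T> f uh \<longleftrightarrow>
     uh \<in> Vh0 \<Omega> \<T> \<and>
     (\<forall>v\<in>Vh0 \<Omega> \<T>.
        (\<Sum>T\<in>\<T>. L2_inner (lebesgue_on T) (weak_grad uh T) (weak_grad v T)) =
        L2_inner (lebesgue_on \<Omega>) f (piecewise \<T> (fst v)))"

end

(* Testing the error e = Q_h u - u_h against itself, the scheme and Green's formula on every triangle
  turn |||e|||^2 into a sum over the triangles T of
   (grad u, grad_w e)_T - sum_{edges E of T} <e_b - e_0, grad u . n>_E,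
  since the fluxes of grad u cancel over interior edges and e_b vanishes on the boundary. By definition
  of the weak gradient the same expression vanishes when grad u is replaced by an affine field, so only
  grad u minus its local affine approximation enters. The stabilizer is not needed because the jump
  e_b - e_0 is controlled by grad_w e alone: testing the weak gradient with the field
  lambda_A (A - C), whose normal component vanishes on the edges BC and CA, yields the moments of the
  jump on the edge AB. The approximation error is bounded by the Poincare inequality on T, applied once
  (i = 0) or twice (i = 1).

  Traces of Sobolev functions in the edge terms are expressed by integrals over the triangle:
  integration by parts along A - C gives the moment of w on AB weighted by the hat function of A as
  the integral of lambda_A (grad w . (A - C)) + w over the triangle, divided by its doubled area. *)
theory Submission
 imports Defs
begin

text \<open>Two kinds of edge values occur. Those of \<open>u\<close> enter through
  \<open>Qh\<close>: since \<open>u\<close> lies in \<open>H1_0\<close>, one sequence of test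
  functions approximates it on all triangles at once, and its traces are limits of smooth edge
  values. The components of grad u are only weakly differentiable inside \<Omega>. A polygonal
  domain in the present sense need not be Lipschitz (it may touch itself at a vertex), so
  approximation of these components by functions smooth up to the boundary is not at hand. This is
  why their fluxes are moments over triangles, and why cancellation over an interior edge has to be
  proved as an identity between integrals over two triangles. It is obtained for mollified functions
  on copies of the triangles shrunk towards the midpoint of the edge, which leave room for the
  mollifier; continuity of the moments under small shifts removes the mollification, continuity
  under dilation the shrinking.

  The first term of the error equation is matched to grad u by a commuting property: the weak
  gradient of \<open>Qh\<close> applied to \<open>u\<close> is the L2 projection of grad u onto
  affine fields.\<close>

section \<open>Affine changes of variables in the plane\<close>

definition crs :: "real^2 => real^2 => real" where
 "crs u v = u$1 * v$2 - u$2 * v$1"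

lemma vec2_eq_iff: "(u::real^2) = v \<longleftrightarrow> u$1 = v$1 \<and> u$2 = v$2"
 by (simp add: vec_eq_iff forall_2)

lemma inner_vec2: "(u::real^2) \<bullet> v = u$1 * v$1 + u$2 * v$2"
 by (simp add: inner_vec_def sum_2)

text \<open>Both measures give a box the product of its side lengths, which determines Lebesgue
  measure. The identification carries Fubini on pairs over to the plane.\<close>

lemma lborel_distr_vector2:
 "distr (lborel::(real\<times>real) measure) borel (\<lambda>p. vector [fst p, snd p] :: real^2) = lborel"
proof (rule lborel_eqI[symmetric])
 let ?f = "\<lambda>p::real\<times>real. vector [fst p, snd p] :: real^2"
 have c: "continuous_on UNIV ?f" by (intro linear_continuous_on linear_conv_bounded_linear[THEN iffD1])
    (auto intro!: linearI simp: vec2_eq_iff)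
 have [measurable]: "?f \<in> borel_measurable borel" by (intro borel_measurable_continuous_onI c)
 fix l u :: "real^2" assume le: "\<And>b. b \<in> Basis ==> l \<bullet> b \<le> u \<bullet> b"
 have le12: "l$1 \<le> u$1" "l$2 \<le> u$2" using le[of "axis 1 1"] le[of "axis 2 1"] by (auto simp: inner_axis axis_in_Basis_iff)
 have eq: "?f -` box l u = box (l$1, l$2) (u$1, u$2)" by (auto simp: box_def Basis_vec_def Basis_prod_def inner_axis forall_2)
 have "emeasure (distr lborel borel ?f) (box l u) = emeasure lborel (box (l$1, l$2) (u$1, u$2))" by (subst emeasure_distr) (auto simp: eq)
 also have "\<dots> = (\<Prod>b\<in>Basis. ((u$1, u$2) - (l$1, l$2)) \<bullet> b)"
  by (rule emeasure_lborel_box) (use le12 in \<open>auto simp: Basis_prod_def\<close>)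
 also have "(\<Prod>b\<in>Basis. ((u$1, u$2) - (l$1, l$2)) \<bullet> b) = (u$1 - l$1) * (u$2 - l$2)" by (simp add: Basis_prod_def)
 also have "\<dots> = (\<Prod>b\<in>Basis. (u - l) \<bullet> b)"
 proof -
  have B: "(Basis::(real^2) set) = {axis 1 1, axis 2 1}" by (auto simp: Basis_vec_def UNIV_2)
  have ne: "axis 1 1 \<noteq> (axis 2 1 :: real^2)" by (simp add: axis_eq_axis)
  have "(\<Prod>b\<in>Basis. (u - l) \<bullet> b) = (u - l) \<bullet> axis 1 1 * ((u - l) \<bullet> axis 2 1)" unfolding B by (subst prod.insert) (use ne in auto)
  then show ?thesis by (simp add: inner_axis)
 qed
 finally show "emeasure (distr lborel borel ?f) (box l u) = ennreal (\<Prod>b\<in>Basis. (u - l) \<bullet> b)" .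
qed simp

text \<open>Lebesgue measure is determined by its values on boxes. The preimage of a box is its
  image under \<open>?h\<close>, the inverse map according to Cramer's rule, whose determinant is
  \<open>1 / crs u v\<close>.\<close>

lemma lborel_linear2:
 assumes "crs u v \<noteq> 0"
 shows "lborel = density (distr (lborel::(real^2) measure) borel (\<lambda>x. x$1 *\<^sub>R u + x$2 *\<^sub>R v))
   (\<lambda>_. ennreal \<bar>crs u v\<bar>)"
proof (rule lborel_eqI)
 let ?f = "\<lambda>x::real^2. x$1 *\<^sub>R u + x$2 *\<^sub>R v"
 let ?h = "\<lambda>y::real^2. vector [crs y v / crs u v, crs u y / crs u v] :: real^2"
 have lf: "linear ?f" by (rule linearI) (auto simp: algebra_simps)
 have lh: "linear ?h" by (rule linearI) (auto simp: vec2_eq_iff crs_def ring_distribs add_divide_distrib diff_divide_distrib mult_ac)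
 have [measurable]: "?f \<in> borel_measurable borel" by (intro borel_measurable_continuous_onI linear_continuous_on lf[unfolded linear_conv_bounded_linear])
 have fh: "?f (?h y) = y" for y
 proof -
  have "\<forall>k. crs y v * u$k + crs u y * v$k = crs u v * y$k" by (simp add: forall_2 crs_def algebra_simps)
  then show ?thesis using assms by (simp add: vec2_eq_iff add_divide_distrib[symmetric])
 qed
 have hf: "?h (?f x) = x" for x using assms by (simp add: vec2_eq_iff crs_def field_simps)
 have det: "det (matrix ?h) = 1 / crs u v"
 proof -
  have ax: "crs (axis 1 1) v = v$2" "crs (axis 2 1) v = - v$1"
   "crs u (axis 1 1) = - u$2" "crs u (axis 2 1) = u$1" by (simp_all add: crs_def axis_def)
  have "det (matrix ?h) = v$2 / crs u v * (u$1 / crs u v) - v$1 / crs u v * (u$2 / crs u v)" unfolding det_2 matrix_def by (simp add: ax)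
  also have "\<dots> = (v$2 * u$1 - v$1 * u$2) / (crs u v)^2" by (simp only: times_divide_times_eq power2_eq_square diff_divide_distrib)
  also have "v$2 * u$1 - v$1 * u$2 = crs u v" by (simp add: crs_def)
  also have "crs u v / (crs u v)^2 = 1 / crs u v" using assms by (simp add: power2_eq_square)
  finally show ?thesis .
 qed
 fix l w :: "real^2" assume le: "\<And>b. b \<in> Basis ==> l \<bullet> b \<le> w \<bullet> b"
 have pre: "?f -` box l w = ?h ` box l w" using fh hf by (auto simp: image_iff) metis
 have m: "?h ` box l w \<in> lmeasurable" "measure lebesgue (?h ` box l w) = \<bar>1 / crs u v\<bar> * measure lebesgue (box l w)"
  using measurable_linear_image[OF lh, of "box l w"] measure_linear_image[OF lh, of "box l w"] det by auto
 have "?f -` box l w \<in> sets borel" by (rule measurable_sets_borel[OF \<open>?f \<in> borel_measurable borel\<close>]) simp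
 then have bs: "?h ` box l w \<in> sets lborel" unfolding pre by simp
 have "emeasure lborel (?h ` box l w) = emeasure lebesgue (?h ` box l w)" by (simp only: emeasure_completion[OF sets_completionI_sets[OF bs]] main_part[OF bs])
 also have "\<dots> = ennreal (\<bar>1 / crs u v\<bar> * measure lebesgue (box l w))" by (simp only: emeasure_eq_measure2[OF m(1)] m(2))
 finally have e: "emeasure lborel (?f -` box l w) = ennreal (\<bar>1 / crs u v\<bar> * measure lebesgue (box l w))" using pre by simp
 have "emeasure (density (distr lborel borel ?f) (\<lambda>_. ennreal \<bar>crs u v\<bar>)) (box l w)
   = ennreal \<bar>crs u v\<bar> * emeasure lborel (?f -` box l w)" by (simp add: emeasure_density nn_integral_cmult_indicator emeasure_distr)
 also have "\<dots> = ennreal (measure lebesgue (box l w))" unfolding e using assms by (simp add: ennreal_mult[symmetric])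
 also have "\<dots> = (\<Prod>b\<in>Basis. (w - l) \<bullet> b)" using le by (simp add: measure_lborel_box_eq)
 finally show "emeasure (density (distr lborel borel ?f) (\<lambda>_. ennreal \<bar>crs u v\<bar>)) (box l w) = (\<Prod>b\<in>Basis. (w - l) \<bullet> b)" .
qed simp

lemma lborel_affine2:
 assumes "crs u v \<noteq> 0"
 shows "lborel = density (distr (lborel \<Otimes>\<^sub>M lborel :: (real\<times>real) measure) borel
   (\<lambda>p. a + fst p *\<^sub>R u + snd p *\<^sub>R v)) (\<lambda>_. ennreal \<bar>crs u v\<bar>)"
proof -
 let ?g = "\<lambda>x::real^2. x$1 *\<^sub>R u + x$2 *\<^sub>R v"
 let ?f = "\<lambda>p::real\<times>real. vector [fst p, snd p] :: real^2"
 have lg: "linear ?g" by (rule linearI) (auto simp: algebra_simps)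
 have lf: "linear ?f" by (rule linearI) (auto simp: vec2_eq_iff)
 have [measurable]: "?f \<in> borel_measurable borel" "?g \<in> borel_measurable borel" by (intro borel_measurable_continuous_onI linear_continuous_on
     lf[unfolded linear_conv_bounded_linear] lg[unfolded linear_conv_bounded_linear])+
 have "distr (lborel \<Otimes>\<^sub>M lborel) borel (\<lambda>p::real\<times>real. a + fst p *\<^sub>R u + snd p *\<^sub>R v)
   = distr (distr (distr lborel borel ?f) borel ?g) borel ((+) a)" by (subst distr_distr, simp, simp, subst distr_distr, simp, simp)
    (auto simp: lborel_prod o_def add.assoc intro!: distr_cong)
 also have "\<dots> = distr (distr lborel borel ?g) borel ((+) a)" by (simp add: lborel_distr_vector2)
 finally have *: "distr (lborel \<Otimes>\<^sub>M lborel) borel (\<lambda>p::real\<times>real. a + fst p *\<^sub>R u + snd p *\<^sub>R v)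
   = distr (distr lborel borel ?g) borel ((+) a)" .
 have "density (distr (lborel \<Otimes>\<^sub>M lborel) borel (\<lambda>p::real\<times>real. a + fst p *\<^sub>R u + snd p *\<^sub>R v)) (\<lambda>_. ennreal \<bar>crs u v\<bar>)
   = distr (density (distr lborel borel ?g) (\<lambda>_. ennreal \<bar>crs u v\<bar>)) borel ((+) a)" unfolding * by (subst density_distr) auto
 also have "\<dots> = lborel" using lborel_linear2[OF assms] lborel_distr_plus[of a] by metis
 finally show ?thesis ..
qed

lemma affine2_measurable [measurable]:
 "(\<lambda>p. a + fst p *\<^sub>R u + snd p *\<^sub>R v) \<in> borel_measurable (borel \<Otimes>\<^sub>M borel)" for a u v :: "real^2" by measurable

lemma
 fixes f :: "real^2 => real"
 assumes "crs u v \<noteq> 0" "integrable lborel f"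
 shows integrable_affine2: "integrable (lborel \<Otimes>\<^sub>M lborel) (\<lambda>p. f (a + fst p *\<^sub>R u + snd p *\<^sub>R v))"
  and integral_affine2: "integral\<^sup>L lborel f = \<bar>crs u v\<bar> * (LINT p|(lborel \<Otimes>\<^sub>M lborel). f (a + fst p *\<^sub>R u + snd p *\<^sub>R v))"
proof -
 let ?D = "distr (lborel \<Otimes>\<^sub>M lborel :: (real\<times>real) measure) borel (\<lambda>p. a + fst p *\<^sub>R u + snd p *\<^sub>R v)"
 have [measurable]: "f \<in> borel_measurable borel" using assms(2) by auto
 have *: "lborel = density ?D (\<lambda>_. ennreal \<bar>crs u v\<bar>)" by (rule lborel_affine2[OF assms(1)])
 have "integrable (density ?D (\<lambda>_. ennreal \<bar>crs u v\<bar>)) f" using assms(2) * by simp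
 then show "integrable (lborel \<Otimes>\<^sub>M lborel) (\<lambda>p. f (a + fst p *\<^sub>R u + snd p *\<^sub>R v))"
  using assms(1) by (simp add: integrable_density integrable_distr_eq)
 have "integral\<^sup>L lborel f = integral\<^sup>L (density ?D (\<lambda>_. ennreal \<bar>crs u v\<bar>)) f" using * by simp
 also have "\<dots> = \<bar>crs u v\<bar> * (LINT p|(lborel \<Otimes>\<^sub>M lborel). f (a + fst p *\<^sub>R u + snd p *\<^sub>R v))"
  by (simp add: integral_density integral_distr)
 finally show "integral\<^sup>L lborel f = \<bar>crs u v\<bar> * (LINT p|(lborel \<Otimes>\<^sub>M lborel). f (a + fst p *\<^sub>R u + snd p *\<^sub>R v))" .
qed

section \<open>Barycentric coordinates\<close>

text \<open>Twice the signed area. Vertices may be listed in either orientation, so formulas that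
  must not depend on it use the absolute value or the sign of this number.\<close>

definition dbl_area :: "real^2 => real^2 => real^2 => real" where
 "dbl_area A B C = crs (B - A) (C - A)"

text \<open>The hat function of the first vertex. Those of \<open>B\<close> and \<open>C\<close> are
  \<open>bary B C A\<close> and \<open>bary C A B\<close>; permuting the arguments makes one
  definition serve all three.\<close>

definition bary :: "real^2 => real^2 => real^2 => real^2 => real" where
 "bary A B C x = dbl_area x B C / dbl_area A B C"

lemma dbl_area_rotate: "dbl_area B C A = dbl_area A B C"
 by (simp add: dbl_area_def crs_def algebra_simps)

lemma dbl_area_swap: "dbl_area B A C = - dbl_area A B C"
 by (simp add: dbl_area_def crs_def algebra_simps)

lemma bary_swap: "bary A C B x = bary A B C x"
proof -
 have "dbl_area x C B = - dbl_area x B C" for x by (simp add: dbl_area_def crs_def algebra_simps)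
 then show ?thesis by (simp add: bary_def)
qed

lemma bary_sum:
 assumes "dbl_area A B C \<noteq> 0"
 shows "bary A B C x + bary B C A x + bary C A B x = 1"
proof -
 have "dbl_area x B C + dbl_area x C A + dbl_area x A B = dbl_area A B C" by (simp add: dbl_area_def crs_def algebra_simps)
 then show ?thesis using assms dbl_area_rotate[of A B C] dbl_area_rotate[of B C A] by (simp add: bary_def add_divide_distrib[symmetric])
qed

lemma bary_combination:
 assumes "dbl_area A B C \<noteq> 0"
 shows "bary A B C x *\<^sub>R A + bary B C A x *\<^sub>R B + bary C A B x *\<^sub>R C = x"
proof -
 have "\<forall>k. dbl_area x B C * A$k + dbl_area x C A * B$k + dbl_area x A B * C$k = dbl_area A B C * x$k"
  by (simp add: forall_2 dbl_area_def crs_def algebra_simps)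
 then have "\<forall>k. (bary A B C x *\<^sub>R A + bary B C A x *\<^sub>R B + bary C A B x *\<^sub>R C)$k = x$k"
  using assms dbl_area_rotate[of A B C] dbl_area_rotate[of B C A] by (simp add: bary_def add_divide_distrib[symmetric])
 then show ?thesis by (simp add: vec_eq_iff)
qed

text \<open>Exhibits the gradient of the hat function: \<open>C - B\<close> turned by a right angle,
  over the doubled area.\<close>

lemma bary_affine:
 "bary A B C x = bary A B C y + (vector [B$2 - C$2, C$1 - B$1] :: real^2) \<bullet> (x - y) / dbl_area A B C"
proof -
 have "dbl_area x B C = dbl_area y B C + (vector [B$2 - C$2, C$1 - B$1] :: real^2) \<bullet> (x - y)" by (simp add: dbl_area_def crs_def inner_vec2 algebra_simps)
 then show ?thesis by (simp add: bary_def add_divide_distrib)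
qed

lemma bary_param:
 assumes "dbl_area A B C \<noteq> 0"
 shows "bary A B C (A + s *\<^sub>R (B - A) + r *\<^sub>R (C - A)) = 1 - s - r"
  "bary B C A (A + s *\<^sub>R (B - A) + r *\<^sub>R (C - A)) = s"
  "bary C A B (A + s *\<^sub>R (B - A) + r *\<^sub>R (C - A)) = r"
proof -
 let ?x = "A + s *\<^sub>R (B - A) + r *\<^sub>R (C - A)"
 have "dbl_area ?x B C = (1 - s - r) * dbl_area A B C" "dbl_area ?x C A = s * dbl_area A B C"
  "dbl_area ?x A B = r * dbl_area A B C" by (simp_all add: dbl_area_def crs_def algebra_simps)
 then show "bary A B C ?x = 1 - s - r" "bary B C A ?x = s" "bary C A B ?x = r"
  using assms dbl_area_rotate[of A B C] dbl_area_rotate[of B C A] by (simp_all add: bary_def)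
qed

lemma continuous_on_bary [continuous_intros]:
 "continuous_on S f ==> continuous_on S (\<lambda>x. bary A B C (f x))" unfolding bary_def dbl_area_def crs_def divide_inverse by (intro continuous_intros) auto

lemma bary_measurable [measurable]: "bary A B C \<in> borel_measurable borel"
 by (intro borel_measurable_continuous_onI continuous_on_bary continuous_on_id)

lemma mem_triangle_iff:
 assumes "dbl_area A B C \<noteq> 0"
 shows "x \<in> convex hull {A, B, C} \<longleftrightarrow> 0 \<le> bary A B C x \<and> 0 \<le> bary B C A x \<and> 0 \<le> bary C A B x"
proof
 assume "x \<in> convex hull {A, B, C}"
 then obtain u v w where *: "0 \<le> u" "0 \<le> v" "0 \<le> w" "u + v + w = 1" "x = u *\<^sub>R A + v *\<^sub>R B + w *\<^sub>R C" by (auto simp: convex_hull_3)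
 have "x = A + v *\<^sub>R (B - A) + w *\<^sub>R (C - A)"
 proof -
  have u: "u = 1 - v - w" using * by simp
  show ?thesis unfolding *(5) u by (simp add: algebra_simps)
 qed
 then have "bary A B C x = 1 - v - w" "bary B C A x = v" "bary C A B x = w" using bary_param[OF assms] by simp_all
 then show "0 \<le> bary A B C x \<and> 0 \<le> bary B C A x \<and> 0 \<le> bary C A B x" using * by auto
next
 assume "0 \<le> bary A B C x \<and> 0 \<le> bary B C A x \<and> 0 \<le> bary C A B x"
 then show "x \<in> convex hull {A, B, C}" using bary_sum[OF assms, of x] bary_combination[OF assms, of x] unfolding convex_hull_3 by (smt (verit) mem_Collect_eq)
qed

lemma bary_bounds:
 assumes "dbl_area A B C \<noteq> 0" "x \<in> convex hull {A, B, C}"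
 shows "0 \<le> bary A B C x" "bary A B C x \<le> 1"
 using assms bary_sum[OF assms(1), of x] by (auto simp: mem_triangle_iff)

lemma compact_triangle: "compact (convex hull {A, B, C :: real^2})"
 by (intro compact_convex_hull) (simp add: finite_imp_compact)

section \<open>Edge moments\<close>

text \<open>For \<open>w\<close> of class \<open>C\<^sup>1\<close> with gradient \<open>G\<close> this is the integral of \<open>w\<close> over the edge \<open>AB\<close>,
 normalised to length 1, weighted by the hat function of \<open>A\<close>; but it makes sense without traces.\<close>

definition edge_mom :: "real^2 => real^2 => real^2 => (real^2 => real) => (real^2 => real^2) => real" where
 "edge_mom A B C w G =
   (LBINT x:convex hull {A, B, C}. bary A B C x * (G x \<bullet> (A - C)) + w x) / \<bar>dbl_area A B C\<bar>"

text \<open>The gradient is an explicit argument because \<open>edge_mom\<close> takes it as one,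
  and derivatives within \<open>T\<close> include the boundary points where the edge values are read
  off.\<close>

definition C1_on :: "(real^2) set => (real^2 => real) => (real^2 => real^2) => bool" where
 "C1_on T w G \<longleftrightarrow> continuous_on T G \<and> (\<forall>x\<in>T. (w has_derivative (\<lambda>h. G x \<bullet> h)) (at x within T))"

lemma C1_on_continuous: "C1_on T w G ==> continuous_on T w"
 by (rule has_derivative_continuous_on[where f' = "\<lambda>x h. G x \<bullet> h"]) (simp add: C1_on_def)

lemma set_integrable_continuous_compact:
 fixes f :: "real^2 => real"
 assumes "compact T" "continuous_on T f"
 shows "set_integrable lborel T f"
 unfolding set_integrable_def using borel_integrable_compact[OF assms] by simp

lemma set_integral_triangle:
 assumes nz: "dbl_area A B C \<noteq> 0" and f: "set_integrable lborel (convex hull {A, B, C}) f"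
 shows "(LBINT x:convex hull {A, B, C}. f x) =
   \<bar>dbl_area A B C\<bar> * (LBINT s. LBINT r.
    indicator {0..1} s * (indicator {0..1 - s} r * f (A + s *\<^sub>R (B - A) + r *\<^sub>R (C - A))))"
  (is "_ = _ * ?R")
proof -
 let ?T = "convex hull {A, B, C}"
 let ?F = "\<lambda>x. indicator ?T x *\<^sub>R f x"
 let ?x = "\<lambda>p. A + fst p *\<^sub>R (B - A) + snd p *\<^sub>R (C - A)"
 have int: "integrable lborel ?F" using f by (simp add: set_integrable_def)
 have cr: "crs (B - A) (C - A) \<noteq> 0" using nz by (simp add: dbl_area_def)
 have i2: "integrable (lborel \<Otimes>\<^sub>M lborel) (\<lambda>p. ?F (?x p))" by (rule integrable_affine2[OF cr int])
 have "integral\<^sup>L lborel ?F = \<bar>crs (B - A) (C - A)\<bar> * (LINT p|(lborel \<Otimes>\<^sub>M lborel). ?F (?x p))" by (rule integral_affine2[OF cr int])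
 also have "(LINT p|(lborel \<Otimes>\<^sub>M lborel). ?F (?x p)) = (LBINT s. LBINT r. ?F (?x (s, r)))" by (rule lborel_pair.integral_fst'[OF i2, symmetric])
 also have "\<dots> = ?R"
 proof (intro Bochner_Integration.integral_cong refl)
  fix s r :: real
  have "?x (s, r) \<in> ?T \<longleftrightarrow> s \<in> {0..1} \<and> r \<in> {0..1 - s}" using mem_triangle_iff[OF nz] bary_param[OF nz] by auto
  then show "?F (?x (s, r)) = indicator {0..1} s * (indicator {0..1 - s} r * f (A + s *\<^sub>R (B - A) + r *\<^sub>R (C - A)))" by (auto simp: indicator_def)
 qed
 finally show ?thesis by (simp add: set_lebesgue_integral_def dbl_area_def)
qed

text \<open>In the coordinates \<open>s\<close>, \<open>r\<close> along \<open>B - A\<close> and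
  \<open>C - A\<close> the hat function of \<open>A\<close> is \<open>1 - s - r\<close>, and the
  integrand is the derivative in \<open>r\<close> of \<open>?H\<close>. This primitive vanishes on
  the opposite edge \<open>r = 1 - s\<close>, so only the value at \<open>r = 0\<close>, on
  \<open>AB\<close>, is left. The Jacobian cancels the denominator of
  \<open>edge_mom\<close>.\<close>

lemma edge_mom_C1:
 assumes nz: "dbl_area A B C \<noteq> 0" and w: "C1_on (convex hull {A, B, C}) w G"
 shows "edge_mom A B C w G = (LINT s:{0..1}|lborel. (1 - s) * w (A + s *\<^sub>R (B - A)))"
proof -
 let ?T = "convex hull {A, B, C}"
 let ?x = "\<lambda>s r. A + s *\<^sub>R (B - A) + r *\<^sub>R (C - A)"
 let ?f = "\<lambda>x. bary A B C x * (G x \<bullet> (A - C)) + w x"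
 have cG: "continuous_on ?T G" and cw: "continuous_on ?T w" using w C1_on_continuous by (auto simp: C1_on_def)
 have cf: "continuous_on ?T ?f" by (intro continuous_intros cG cw)
 have xT: "?x s r \<in> ?T" if "0 \<le> s" "0 \<le> r" "s + r \<le> 1" for s r using mem_triangle_iff[OF nz] bary_param[OF nz] that by auto
 have inner: "(LBINT r. indicator {0..1} s * (indicator {0..1 - s} r * ?f (?x s r)))
   = indicator {0..1} s * ((1 - s) * w (A + s *\<^sub>R (B - A)))" for s
 proof (cases "s \<in> {0..1}")
  case True
  let ?H = "\<lambda>r. - ((1 - s - r) * w (?x s r))"
  have "(LBINT r. indicator {0..1 - s} r *\<^sub>R ?f (?x s r)) = ?H (1 - s) - ?H 0"
  proof (rule integral_FTC_Icc)
   show "0 \<le> 1 - s" using True by simp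
   fix r assume r: "0 \<le> r" "r \<le> 1 - s"
   have im: "?x s ` {0..1 - s} \<subseteq> ?T" using xT True by auto
   have d: "((?x s) has_vector_derivative (C - A)) (at r within {0..1 - s})" by (auto intro!: derivative_eq_intros)
   have "(w has_derivative (\<lambda>h. G (?x s r) \<bullet> h)) (at (?x s r) within ?x s ` {0..1 - s})"
    using w r True xT[of s r] by (intro has_derivative_subset[OF _ im]) (auto simp: C1_on_def)
   from vector_derivative_diff_chain_within[OF d this]
   have "((\<lambda>r. w (?x s r)) has_vector_derivative (G (?x s r) \<bullet> (C - A))) (at r within {0..1 - s})" by (simp add: o_def)
   then have "((\<lambda>r. w (?x s r)) has_field_derivative (G (?x s r) \<bullet> (C - A))) (at r within {0..1 - s})"
    by (simp add: has_real_derivative_iff_has_vector_derivative)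
   then have d2: "(?H has_field_derivative (- ((0 - 1) * w (?x s r) + (G (?x s r) \<bullet> (C - A)) * (1 - s - r)))) (at r within {0..1 - s})"
    by (auto intro!: derivative_eq_intros)
   have eq: "- ((0 - 1) * w (?x s r) + (G (?x s r) \<bullet> (C - A)) * (1 - s - r)) = ?f (?x s r)"
    unfolding bary_param(1)[OF nz] by (simp add: inner_diff_right ring_distribs)
   show "(?H has_vector_derivative ?f (?x s r)) (at r within {0..1 - s})" using d2 unfolding eq has_real_derivative_iff_has_vector_derivative .
  next
   show "continuous_on {0..1 - s} (\<lambda>r. ?f (?x s r))"
    by (rule continuous_on_compose2[OF cf]) (use xT True in \<open>auto intro!: continuous_intros\<close>)
  qed
  then show ?thesis using True by simp
 qed auto
 have "(LBINT x:?T. ?f x) = \<bar>dbl_area A B C\<bar> * (LINT s:{0..1}|lborel. (1 - s) * w (A + s *\<^sub>R (B - A)))"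
  using set_integral_triangle[OF nz set_integrable_continuous_compact[OF compact_triangle cf]] by (simp only: inner) (simp add: set_lebesgue_integral_def)
 then show ?thesis using nz by (simp add: edge_mom_def)
qed

section \<open>Edge normals and the divergence theorem on a triangle\<close>

text \<open>The outward normal on \<open>AB\<close> scaled to the length of \<open>AB\<close>, so
  that it absorbs the arc-length factor of edge integrals. The vertex \<open>C\<close> only decides
  the sign.\<close>

definition edge_normal :: "real^2 => real^2 => real^2 => real^2" where
 "edge_normal A B C = sgn (dbl_area A B C) *\<^sub>R vector [B$2 - A$2, A$1 - B$1]"

lemma edge_normal_swap: "edge_normal B A C = edge_normal A B C"
 by (simp add: edge_normal_def dbl_area_swap[of B A] vec2_eq_iff sgn_minus algebra_simps)

lemma bary_edge_normal:
 "dbl_area A B C \<noteq> 0 ==> bary C A B x = bary C A B y - edge_normal A B C \<bullet> (x - y) / \<bar>dbl_area A B C\<bar>"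
 unfolding bary_affine[of C A B x y] edge_normal_def dbl_area_rotate[of A B C, symmetric] dbl_area_rotate[of B C A, symmetric]
 by (cases "dbl_area C A B > 0") (auto simp: inner_vec2 field_simps sgn_if)

lemma edge_normal_sum:
 "dbl_area A B C \<noteq> 0 ==> edge_normal A B C + edge_normal B C A + edge_normal C A B = 0"
 by (simp add: edge_normal_def dbl_area_rotate[of A B C] dbl_area_rotate[of B C A] vec2_eq_iff algebra_simps)

text \<open>The gradient of the hat function of \<open>C\<close> is
  \<open>- edge_normal A B C\<close> over the doubled area, and cyclically. Hence this is the
  transposed derivative of the identity \<open>bary_combination\<close>.\<close>

lemma edge_normal_dyad:
 assumes "dbl_area A B C \<noteq> 0"
 shows "(h \<bullet> C) *\<^sub>R edge_normal A B C + (h \<bullet> A) *\<^sub>R edge_normal B C A + (h \<bullet> B) *\<^sub>R edge_normal C A B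
  = - \<bar>dbl_area A B C\<bar> *\<^sub>R h"
proof -
 have "\<forall>k. ((h \<bullet> C) *\<^sub>R vector [B$2 - A$2, A$1 - B$1] + (h \<bullet> A) *\<^sub>R vector [C$2 - B$2, B$1 - C$1]
  + (h \<bullet> B) *\<^sub>R vector [A$2 - C$2, C$1 - A$1] :: real^2) $ k = - dbl_area A B C * h $ k"
  by (simp add: forall_2 inner_vec2 dbl_area_def crs_def algebra_simps)
 then have *: "(h \<bullet> C) *\<^sub>R vector [B$2 - A$2, A$1 - B$1] + (h \<bullet> A) *\<^sub>R vector [C$2 - B$2, B$1 - C$1]
  + (h \<bullet> B) *\<^sub>R vector [A$2 - C$2, C$1 - A$1] = - dbl_area A B C *\<^sub>R h" by (simp add: vec_eq_iff)
 have "(h \<bullet> C) *\<^sub>R edge_normal A B C + (h \<bullet> A) *\<^sub>R edge_normal B C A + (h \<bullet> B) *\<^sub>R edge_normal C A B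
  = sgn (dbl_area A B C) *\<^sub>R ((h \<bullet> C) *\<^sub>R vector [B$2 - A$2, A$1 - B$1] + (h \<bullet> A) *\<^sub>R vector [C$2 - B$2, B$1 - C$1]
  + (h \<bullet> B) *\<^sub>R vector [A$2 - C$2, C$1 - A$1])" by (simp add: edge_normal_def dbl_area_rotate[of A B C] dbl_area_rotate[of B C A] algebra_simps)
 also have "\<dots> = - \<bar>dbl_area A B C\<bar> *\<^sub>R h" unfolding * by (simp add: abs_sgn mult.commute)
 finally show ?thesis .
qed

text \<open>Adding the moments weighted by the hat functions of \<open>A\<close> and
  \<open>B\<close> combines the two directions of integration into the radial direction from
  \<open>C\<close>.\<close>

lemma bary_pair:
 assumes "dbl_area A B C \<noteq> 0"
 shows "bary A B C x * (g \<bullet> (A - C)) + bary B A C x * (g \<bullet> (B - C)) = g \<bullet> (x - C)"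
proof -
 have c: "bary C A B x = 1 - bary A B C x - bary B C A x" using bary_sum[OF assms, of x] by simp
 have "x - C = bary A B C x *\<^sub>R (A - C) + bary B C A x *\<^sub>R (B - C)" using bary_combination[OF assms, of x] unfolding c by (simp add: algebra_simps)
 then have "g \<bullet> (x - C) = g \<bullet> (bary A B C x *\<^sub>R (A - C) + bary B C A x *\<^sub>R (B - C))" by simp
 then show ?thesis by (simp add: bary_swap[of B A C] inner_add_right)
qed

lemma dbl_area_perm:
 "dbl_area B C A = dbl_area A B C" "dbl_area C A B = dbl_area A B C"
 "dbl_area B A C = - dbl_area A B C" "dbl_area C B A = - dbl_area A B C" "dbl_area A C B = - dbl_area A B C" by (simp_all add: dbl_area_def crs_def algebra_simps)

lemma set_integrable_mult_bounded:
 fixes f b :: "real^2 => real"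
 assumes f: "set_integrable lborel T f" and [measurable]: "b \<in> borel_measurable borel"
  and b: "\<And>x. x \<in> T ==> \<bar>b x\<bar> \<le> K"
 shows "set_integrable lborel T (\<lambda>x. b x * f x)"
 unfolding set_integrable_def
proof (rule Bochner_Integration.integrable_bound)
 show "integrable lborel (\<lambda>x. K *\<^sub>R (indicator T x *\<^sub>R f x))" using f unfolding set_integrable_def by (rule integrable_scaleR_right)
 have [measurable]: "(\<lambda>x. indicator T x *\<^sub>R f x) \<in> borel_measurable borel"
  using borel_measurable_integrable[OF f[unfolded set_integrable_def]] by simp
 have "(\<lambda>x. b x * (indicator T x *\<^sub>R f x)) \<in> borel_measurable lborel" by measurable
 then show "(\<lambda>x. indicator T x *\<^sub>R (b x * f x)) \<in> borel_measurable lborel" by (simp add: mult.left_commute)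
 have "\<bar>b x\<bar> * \<bar>f x\<bar> \<le> \<bar>K\<bar> * \<bar>f x\<bar>" if "x \<in> T" for x using b[OF that] by (intro mult_right_mono) auto
 then show "AE x in lborel. norm (indicator T x *\<^sub>R (b x * f x)) \<le> norm (K *\<^sub>R (indicator T x *\<^sub>R f x))"
  by (auto simp: indicator_def abs_mult)
qed

lemma set_integrable_inner:
 fixes G :: "real^2 => real^2"
 assumes "set_integrable lborel T G"
 shows "set_integrable lborel T (\<lambda>x. G x \<bullet> h)"
 using integrable_inner_left[of h lborel "\<lambda>x. indicator T x *\<^sub>R G x"] assms unfolding set_integrable_def by simp

lemma edge_mom_integrable:
 assumes nz: "dbl_area A B C \<noteq> 0"
  and w: "set_integrable lborel (convex hull {A, B, C}) w"
  and G: "set_integrable lborel (convex hull {A, B, C}) G"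
 shows "set_integrable lborel (convex hull {A, B, C}) (\<lambda>x. bary A B C x * (G x \<bullet> (A - C)) + w x)"
 using bary_bounds[OF nz] by (intro set_integral_add(1) set_integrable_mult_bounded[where K = 1] set_integrable_inner w G) auto

text \<open>By \<open>bary_pair\<close> the two moments on an edge add up to the integral of
  \<open>G x \<bullet> (x - R) + 2 * w x\<close> over the doubled area, \<open>R\<close> being the
  opposite vertex. Weighted with the normals, the part independent of \<open>R\<close> drops out by
  \<open>edge_normal_sum\<close> and the rest is \<open>G\<close> by
  \<open>edge_normal_dyad\<close>. The identity is algebraic under the integral sign and does not
  tie \<open>G\<close> to \<open>w\<close>.\<close>

lemma edge_mom_divergence:
 assumes nz: "dbl_area A B C \<noteq> 0"
  and w: "set_integrable lborel (convex hull {A, B, C}) w"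
  and G: "set_integrable lborel (convex hull {A, B, C}) G"
 shows "(edge_mom A B C w G + edge_mom B A C w G) *\<^sub>R edge_normal A B C
    + (edge_mom B C A w G + edge_mom C B A w G) *\<^sub>R edge_normal B C A
    + (edge_mom C A B w G + edge_mom A C B w G) *\<^sub>R edge_normal C A B
    = (LBINT x:convex hull {A, B, C}. G x)"
proof -
 let ?T = "convex hull {A, B, C}" and ?J = "\<bar>dbl_area A B C\<bar>"
 let ?f = "\<lambda>P Q R x. bary P Q R x * (G x \<bullet> (P - R)) + w x"
 let ?g = "\<lambda>P Q R x. ?f P Q R x + ?f Q P R x"
 have pair: "edge_mom P Q R w G + edge_mom Q P R w G = (LBINT x:?T. G x \<bullet> (x - R) + 2 * w x) / ?J"
   "set_integrable lborel ?T (\<lambda>x. G x \<bullet> (x - R) + 2 * w x)"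
  if T: "convex hull {P, Q, R} = ?T" and J: "\<bar>dbl_area P Q R\<bar> = ?J" for P Q R
 proof -
  have nz1: "dbl_area P Q R \<noteq> 0" and nz2: "dbl_area Q P R \<noteq> 0" using J nz dbl_area_perm(3)[of P Q R] by auto
  have T2: "convex hull {Q, P, R} = ?T" using T by (simp add: insert_commute)
  have i: "set_integrable lborel ?T (?f P Q R)" "set_integrable lborel ?T (?f Q P R)"
   using edge_mom_integrable[OF nz1, of w G] edge_mom_integrable[OF nz2, of w G] w G T T2 by auto
  have e: "?g P Q R = (\<lambda>x. G x \<bullet> (x - R) + 2 * w x)" using bary_pair[OF nz1] by (auto simp: fun_eq_iff)
  show "set_integrable lborel ?T (\<lambda>x. G x \<bullet> (x - R) + 2 * w x)" using set_integral_add(1)[OF i] unfolding e .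
  have "edge_mom P Q R w G + edge_mom Q P R w G = (LBINT x:?T. ?g P Q R x) / ?J" unfolding edge_mom_def T T2 using J dbl_area_perm(3)[of P Q R]
   by (subst set_integral_add(2)[OF i]) (simp add: add_divide_distrib)
  then show "edge_mom P Q R w G + edge_mom Q P R w G = (LBINT x:?T. G x \<bullet> (x - R) + 2 * w x) / ?J" unfolding e .
 qed
 have T: "convex hull {B, C, A} = ?T" "convex hull {C, A, B} = ?T" by (simp_all add: insert_commute)
 let ?q = "\<lambda>R x. G x \<bullet> (x - R) + 2 * w x"
 note p1 = pair[of A B C] and p2 = pair[of B C A] and p3 = pair[of C A B]
 have J2: "\<bar>dbl_area B C A\<bar> = ?J" "\<bar>dbl_area C A B\<bar> = ?J" by (simp_all add: dbl_area_perm[of B C A] dbl_area_perm[of C A B])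
 let ?N1 = "edge_normal A B C" and ?N2 = "edge_normal B C A" and ?N3 = "edge_normal C A B"
 have pt: "?q C x *\<^sub>R ?N1 + ?q A x *\<^sub>R ?N2 + ?q B x *\<^sub>R ?N3 = ?J *\<^sub>R G x" for x
 proof -
  have "?q C x *\<^sub>R ?N1 + ?q A x *\<^sub>R ?N2 + ?q B x *\<^sub>R ?N3
   = (G x \<bullet> x + 2 * w x) *\<^sub>R (?N1 + ?N2 + ?N3) - ((G x \<bullet> C) *\<^sub>R ?N1 + (G x \<bullet> A) *\<^sub>R ?N2 + (G x \<bullet> B) *\<^sub>R ?N3)"
   by (simp add: inner_diff_right algebra_simps)
  then show ?thesis by (simp add: edge_normal_sum[OF nz] edge_normal_dyad[OF nz])
 qed
 have vi: "set_integrable lborel ?T (\<lambda>x. ?q R x *\<^sub>R N)" "(LBINT x:?T. ?q R x *\<^sub>R N) = (LBINT x:?T. ?q R x) *\<^sub>R N"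
  if "set_integrable lborel ?T (?q R)" for R N using that integrable_scaleR_left[of N lborel "\<lambda>x. indicator ?T x *\<^sub>R ?q R x"]
   integral_scaleR_left[of N lborel "\<lambda>x. indicator ?T x *\<^sub>R ?q R x"]
  unfolding set_integrable_def set_lebesgue_integral_def by (auto simp: scaleR_scaleR[symmetric] simp del: scaleR_scaleR)
 note v = vi[OF p1(2)[OF refl refl], of ?N1] vi[OF p2(2)[OF T(1) J2(1)], of ?N2] vi[OF p3(2)[OF T(2) J2(2)], of ?N3]
 have "?J *\<^sub>R (LBINT x:?T. G x) = (LBINT x:?T. ?q C x *\<^sub>R ?N1 + ?q A x *\<^sub>R ?N2 + ?q B x *\<^sub>R ?N3)" unfolding pt by simp
 also have "\<dots> = (LBINT x:?T. ?q C x) *\<^sub>R ?N1 + (LBINT x:?T. ?q A x) *\<^sub>R ?N2 + (LBINT x:?T. ?q B x) *\<^sub>R ?N3"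
  using v by (simp add: set_integral_add)
 finally have eq: "?J *\<^sub>R (LBINT x:?T. G x) = \<dots>" .
 have "(LBINT x:?T. G x) = (1 / ?J) *\<^sub>R (?J *\<^sub>R (LBINT x:?T. G x))" using nz by simp
 then show ?thesis unfolding eq p1(1)[OF refl refl] p2(1)[OF T(1) J2(1)] p3(1)[OF T(2) J2(2)] by (simp add: scaleR_add_right)
qed

text \<open>The edge moments of \<open>W = w^2\<close> with gradient \<open>H = 2 w G\<close> are
  used for both endpoints; as the weights \<open>1 - s\<close> and \<open>s\<close> add up to one,
  they give the plain edge integral. The factor \<open>?K\<close> bounds the distance of a point of
  the triangle from \<open>C\<close>, and the product in \<open>H\<close> is split by
  \<open>2 a b \<le> a^2 + b^2\<close>.\<close>

lemma trace_inequality_C1: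
 assumes nz: "dbl_area A B C \<noteq> 0" and w: "C1_on (convex hull {A, B, C}) w G"
 shows "(LINT s:{0..1}|lborel. (w (A + s *\<^sub>R (B - A)))^2)
   \<le> (2 + norm (A - C) + norm (B - C)) / \<bar>dbl_area A B C\<bar> *
    (LBINT x:convex hull {A, B, C}. (w x)^2 + (norm (G x))^2)"
proof -
 let ?T = "convex hull {A, B, C}" and ?J = "\<bar>dbl_area A B C\<bar>"
 let ?K = "norm (A - C) + norm (B - C)"
 define W where "W x = (w x)^2" for x
 define H where "H x = (2 * w x) *\<^sub>R G x" for x
 have cG: "continuous_on ?T G" and cw: "continuous_on ?T w" using w C1_on_continuous by (auto simp: C1_on_def)
 have C1: "C1_on ?T W H" unfolding C1_on_def
 proof (intro conjI ballI)
  show "continuous_on ?T H" unfolding H_def by (intro continuous_intros cw cG)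
  fix x assume "x \<in> ?T"
  then have "(w has_derivative (\<lambda>h. G x \<bullet> h)) (at x within ?T)" using w by (simp add: C1_on_def)
  then show "(W has_derivative (\<lambda>h. H x \<bullet> h)) (at x within ?T)" unfolding W_def H_def by (auto intro!: derivative_eq_intros)
 qed
 have T2: "convex hull {B, A, C} = ?T" by (simp add: insert_commute)
 have nz2: "dbl_area B A C \<noteq> 0" using nz dbl_area_perm(3)[of A B C] by simp
 have ci: "set_integrable lborel {0..1} f" if "continuous_on {0..1} f" for f :: "real => real"
  using borel_integrable_compact[of "{0..1::real}" f] that by (simp add: set_integrable_def)
 have seg: "A + s *\<^sub>R (B - A) \<in> ?T" if "s \<in> {0..1}" for s
 proof -
  have "A + s *\<^sub>R (B - A) = (1 - s) *\<^sub>R A + s *\<^sub>R B + 0 *\<^sub>R C" by (simp add: algebra_simps)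
  then show ?thesis using that unfolding convex_hull_3 by (intro CollectI exI[of _ "1 - s"] exI[of _ s] exI[of _ 0]) auto
 qed
 have cW: "continuous_on {0..1} (\<lambda>s. W (A + s *\<^sub>R (B - A)))"
  by (rule continuous_on_compose2[OF C1_on_continuous[OF C1]]) (use seg in \<open>auto intro!: continuous_intros\<close>)
 have refl_int: "(LINT s:{0..1}|lborel. (1 - s) * W (B + s *\<^sub>R (A - B))) = (LINT s:{0..1}|lborel. s * W (A + s *\<^sub>R (B - A)))"
 proof -
  have "(LBINT s. indicator {0..1} s * (s * W (A + s *\<^sub>R (B - A))))
    = \<bar>-1\<bar> *\<^sub>R (LBINT s. indicator {0..1} (1 + (-1) * s) * ((1 + (-1) * s) * W (A + (1 + (-1) * s) *\<^sub>R (B - A))))"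
   by (rule lborel_integral_real_affine) simp
  also have "\<dots> = (LBINT s. indicator {0..1} s * ((1 - s) * W (B + s *\<^sub>R (A - B))))"
   by (auto simp: indicator_def algebra_simps intro!: Bochner_Integration.integral_cong)
  finally show ?thesis by (simp add: set_lebesgue_integral_def)
 qed
 have "(LINT s:{0..1}|lborel. W (A + s *\<^sub>R (B - A)))
   = (LINT s:{0..1}|lborel. (1 - s) * W (A + s *\<^sub>R (B - A)) + s * W (A + s *\<^sub>R (B - A)))" by (simp add: algebra_simps)
 also have "\<dots> = (LINT s:{0..1}|lborel. (1 - s) * W (A + s *\<^sub>R (B - A))) + (LINT s:{0..1}|lborel. s * W (A + s *\<^sub>R (B - A)))"
  by (intro set_integral_add(2) ci continuous_intros cW)
 also have "\<dots> = edge_mom A B C W H + edge_mom B A C W H" unfolding edge_mom_C1[OF nz C1] edge_mom_C1[OF nz2 C1[folded T2]] refl_int ..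
 also have "\<dots> = ((LBINT x:?T. bary A B C x * (H x \<bullet> (A - C)) + W x) + (LBINT x:?T. bary B A C x * (H x \<bullet> (B - C)) + W x)) / ?J"
  unfolding edge_mom_def T2 using dbl_area_perm(3)[of A B C] by (simp add: add_divide_distrib)
 also have "(LBINT x:?T. bary A B C x * (H x \<bullet> (A - C)) + W x) + (LBINT x:?T. bary B A C x * (H x \<bullet> (B - C)) + W x)
   = (LBINT x:?T. H x \<bullet> (x - C) + 2 * W x)"
 proof -
  have si: "set_integrable lborel ?T W" "set_integrable lborel ?T H"
   using borel_integrable_compact[OF compact_triangle, of A B C W] borel_integrable_compact[OF compact_triangle, of A B C H]
    C1 C1_on_continuous[OF C1] by (auto simp: set_integrable_def C1_on_def)
  have "(\<lambda>x. (bary A B C x * (H x \<bullet> (A - C)) + W x) + (bary B A C x * (H x \<bullet> (B - C)) + W x)) = (\<lambda>x. H x \<bullet> (x - C) + 2 * W x)"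
   using bary_pair[OF nz] by (auto simp: fun_eq_iff)
  then show ?thesis using set_integral_add(2)[OF edge_mom_integrable[OF nz si] edge_mom_integrable[OF nz2, unfolded T2, OF si]] by simp
 qed
 also have "(LBINT x:?T. H x \<bullet> (x - C) + 2 * W x) \<le> (LBINT x:?T. (2 + ?K) * ((w x)^2 + (norm (G x))^2))"
 proof (rule set_integral_mono)
  show "set_integrable lborel ?T (\<lambda>x. H x \<bullet> (x - C) + 2 * W x)" by (rule set_integrable_continuous_compact[OF compact_triangle])
    (use C1 C1_on_continuous[OF C1] in \<open>auto simp: C1_on_def intro!: continuous_intros\<close>)
  show "set_integrable lborel ?T (\<lambda>x. (2 + ?K) * ((w x)^2 + (norm (G x))^2))" by (rule set_integrable_continuous_compact[OF compact_triangle])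
    (intro continuous_intros cw cG)
  fix x assume x: "x \<in> ?T"
  have "x - C = bary A B C x *\<^sub>R (A - C) + bary B C A x *\<^sub>R (B - C)"
  proof -
   have c: "bary C A B x = 1 - bary A B C x - bary B C A x" using bary_sum[OF nz, of x] by simp
   show ?thesis using bary_combination[OF nz, of x] unfolding c by (simp add: algebra_simps)
  qed
  moreover have "norm (bary A B C x *\<^sub>R (A - C)) \<le> norm (A - C)" using bary_bounds[OF nz x] by (simp add: mult_left_le_one_le)
  moreover have "norm (bary B C A x *\<^sub>R (B - C)) \<le> norm (B - C)"
   using bary_bounds[OF nz2, unfolded T2, OF x] by (simp add: mult_left_le_one_le bary_swap[of B A C])
  ultimately have n: "norm (x - C) \<le> ?K" by (metis add_mono norm_triangle_le)
  have "H x \<bullet> (x - C) \<le> norm (H x) * norm (x - C)" by (rule norm_cauchy_schwarz)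
  also have "\<dots> \<le> norm (H x) * ?K" by (rule mult_left_mono[OF n]) simp
  also have "norm (H x) = 2 * \<bar>w x\<bar> * norm (G x)" by (simp add: H_def abs_mult)
  also have "2 * \<bar>w x\<bar> * norm (G x) * ?K \<le> ((w x)^2 + (norm (G x))^2) * ?K"
   using sum_squares_bound[of "\<bar>w x\<bar>" "norm (G x)"] by (intro mult_right_mono) auto
  finally have "H x \<bullet> (x - C) \<le> ((w x)^2 + (norm (G x))^2) * ?K" .
  moreover have "(2 + ?K) * ((w x)^2 + (norm (G x))^2)
   = ((w x)^2 + (norm (G x))^2) * ?K + 2 * W x + 2 * (norm (G x))^2" by (simp add: W_def algebra_simps)
  moreover have "0 \<le> 2 * (norm (G x))^2" by simp
  ultimately show "H x \<bullet> (x - C) + 2 * W x \<le> (2 + ?K) * ((w x)^2 + (norm (G x))^2)" by linarith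
 qed
 also have "\<dots> = (2 + ?K) * (LBINT x:?T. (w x)^2 + (norm (G x))^2)" by (rule set_integral_mult_right)
 finally show ?thesis using nz by (simp add: W_def divide_right_mono add.assoc)
qed

section \<open>Smooth functions and test functions\<close>

definition grad :: "(real^2 => real) => real^2 => real^2" where
 "grad \<phi> x = (\<chi> i. partial i \<phi> x)"

lemma differentiable_imp_has_derivative_grad:
 assumes "\<phi> differentiable (at x)"
 shows "(\<phi> has_derivative (\<lambda>h. grad \<phi> x \<bullet> h)) (at x)"
proof -
 let ?D = "frechet_derivative \<phi> (at x)"
 have d: "(\<phi> has_derivative ?D) (at x)" using assms by (simp add: frechet_derivative_works)
 then have lin: "linear ?D" by (rule has_derivative_linear)
 have "?D h = grad \<phi> x \<bullet> h" for h
 proof -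
  have "h = h$1 *\<^sub>R axis 1 1 + h$2 *\<^sub>R axis 2 1" by (simp add: vec2_eq_iff axis_def)
  then have "?D h = ?D (h$1 *\<^sub>R axis 1 1 + h$2 *\<^sub>R axis 2 1)" by simp
  also have "\<dots> = h$1 * ?D (axis 1 1) + h$2 * ?D (axis 2 1)" by (simp add: linear_add[OF lin] linear_cmul[OF lin])
  finally show ?thesis by (simp add: grad_def partial_def inner_vec2 mult.commute)
 qed
 then have "?D = (\<lambda>h. grad \<phi> x \<bullet> h)" by auto
 then show ?thesis using d by simp
qed

lemma has_derivative_imp_partial:
 assumes "(\<phi> has_derivative D) (at x)"
 shows "partial i \<phi> x = D (axis i 1)"
 using frechet_derivative_at[OF assms] by (simp add: partial_def)

lemma has_derivative_inner_imp_grad: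
 assumes "(\<phi> has_derivative (\<lambda>h. g \<bullet> h)) (at x)"
 shows "grad \<phi> x = g"
 by (simp add: vec_eq_iff grad_def has_derivative_imp_partial[OF assms] inner_axis)

lemma C_k_mono: "\<phi> \<in> C_k (Suc k) ==> \<phi> \<in> C_k k"
proof (induction k arbitrary: \<phi>)
 case 0
 then show ?case by (auto simp: differentiable_imp_continuous_within continuous_at_imp_continuous_on)
qed auto

lemma partial_const: "partial i (\<lambda>_. c) = (\<lambda>_. 0)"
 by (auto simp: fun_eq_iff intro!: has_derivative_imp_partial has_derivative_const)

lemma partial_add:
 assumes "\<And>x. f differentiable (at x)" "\<And>x. g differentiable (at x)"
 shows "partial i (\<lambda>x. f x + g x) = (\<lambda>x. partial i f x + partial i g x)"
proof
 fix x
 show "partial i (\<lambda>x. f x + g x) x = partial i f x + partial i g x" using has_derivative_imp_partial[OF has_derivative_add[OF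
   differentiable_imp_has_derivative_grad[OF assms(1)] differentiable_imp_has_derivative_grad[OF assms(2)]], of i x] by (simp add: inner_axis grad_def)
qed

lemma partial_mult:
 assumes "\<And>x. f differentiable (at x)" "\<And>x. g differentiable (at x)"
 shows "partial i (\<lambda>x. f x * g x) = (\<lambda>x. f x * partial i g x + partial i f x * g x)"
proof
 fix x
 show "partial i (\<lambda>x. f x * g x) x = f x * partial i g x + partial i f x * g x" using has_derivative_imp_partial[OF has_derivative_mult[OF
   differentiable_imp_has_derivative_grad[OF assms(1)] differentiable_imp_has_derivative_grad[OF assms(2)]], of i x] by (simp add: inner_axis grad_def)
qed

lemma C_k_const: "(\<lambda>_. c) \<in> C_k k"
 by (induction k arbitrary: c) (auto simp: partial_const)

lemma C_k_add: "f \<in> C_k k ==> g \<in> C_k k ==> (\<lambda>x. f x + g x) \<in> C_k k"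
proof (induction k arbitrary: f g)
 case 0 then show ?case by (auto intro!: continuous_intros)
next
 case (Suc k)
 then show ?case by (auto simp: partial_add)
qed

lemma C_k_mult: "f \<in> C_k k ==> g \<in> C_k k ==> (\<lambda>x. f x * g x) \<in> C_k k"
proof (induction k arbitrary: f g)
 case 0 then show ?case by (auto intro!: continuous_intros)
next
 case (Suc k)
 have "(\<lambda>x. f x * partial i g x + partial i f x * g x) \<in> C_k k" for i using Suc.prems C_k_mono[OF Suc.prems(1)] C_k_mono[OF Suc.prems(2)]
  by (intro C_k_add Suc.IH) auto
 then show ?case using Suc.prems by (auto simp: partial_mult)
qed

text \<open>All derivatives of the one-variable function are given as a sequence, so that the
  induction on \<open>k\<close> can be general in the index \<open>n\<close>: a partial derivative
  moves from \<open>D n\<close> to a constant multiple of \<open>D (Suc n)\<close>.\<close>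

lemma C_k_coordinate:
 assumes D: "\<And>n t. (D n has_real_derivative D (Suc n) t) (at t)"
 shows "(\<lambda>x. D n (a + b * x$j)) \<in> C_k k"
proof (induction k arbitrary: n)
 have d: "((\<lambda>x. D n (a + b * x$j)) has_derivative (\<lambda>h. D (Suc n) (a + b * x$j) * (b * h$j))) (at x)" for n and x :: "real^2"
 proof -
  have "((\<lambda>x::real^2. a + b * x$j) has_derivative (\<lambda>h. b * h$j)) (at x)"
   by (auto intro!: derivative_eq_intros bounded_linear_imp_has_derivative bounded_linear_vec_nth)
  moreover have "(D n has_derivative (\<lambda>h. D (Suc n) (a + b * x$j) * h)) (at (a + b * x$j))"
   using D[of n "a + b * x$j"] by (simp add: has_field_derivative_def)
  ultimately show ?thesis using diff_chain_at by (fastforce simp: o_def)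
 qed
 case 0
 show ?case using has_derivative_continuous[OF d] by (simp add: continuous_at_imp_continuous_on)
 case (Suc k)
 have "partial i (\<lambda>x. D n (a + b * x$j)) = (\<lambda>x. (b * axis i 1 $ j) * D (Suc n) (a + b * x$j))" for i
  by (auto simp: has_derivative_imp_partial[OF d])
 then show ?case using d Suc by (auto simp: differentiable_def intro!: C_k_mult C_k_const)
qed

lemma partial_translate:
 assumes "\<And>x. f differentiable (at x)"
 shows "partial i (\<lambda>x. f (x + z)) = (\<lambda>x. partial i f (x + z))" "(\<lambda>x. f (x + z)) differentiable (at x)"
proof -
 have d: "((\<lambda>x. f (x + z)) has_derivative (\<lambda>h. grad f (x + z) \<bullet> h)) (at x)" for x
 proof -
  have "((\<lambda>x. x + z) has_derivative (\<lambda>h. h)) (at x)" by (auto intro!: derivative_eq_intros)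
  from diff_chain_at[OF this differentiable_imp_has_derivative_grad[OF assms]]
  show ?thesis by (simp add: o_def)
 qed
 show "partial i (\<lambda>x. f (x + z)) = (\<lambda>x. partial i f (x + z))" "(\<lambda>x. f (x + z)) differentiable (at x)"
  using d by (auto simp: fun_eq_iff has_derivative_imp_partial[OF d] inner_axis grad_def differentiable_def)
qed

lemma C_k_translate: "f \<in> C_k k ==> (\<lambda>x. f (x + z)) \<in> C_k k"
proof (induction k arbitrary: f)
 case 0 then show ?case by (auto intro!: continuous_on_compose2[of UNIV f] continuous_intros)
next
 case (Suc k)
 then show ?case by (auto simp: partial_translate)
qed

lemma C_inf_iff: "\<phi> \<in> C_inf \<longleftrightarrow> (\<forall>k. \<phi> \<in> C_k k)"
 by (simp add: C_inf_def)

lemma C_inf_differentiable: "\<phi> \<in> C_inf ==> \<phi> differentiable (at x)"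
 using C_inf_iff[of \<phi>] by (metis (no_types, lifting) C_k.simps(2) mem_Collect_eq)

lemma C_inf_partial: "\<phi> \<in> C_inf ==> partial i \<phi> \<in> C_inf"
 unfolding C_inf_iff by (metis (no_types, lifting) C_k.simps(2) mem_Collect_eq)

lemma C_inf_continuous: "\<phi> \<in> C_inf ==> continuous_on S \<phi>"
 using C_inf_iff[of \<phi>] by (metis (no_types, lifting) C_k.simps(1) mem_Collect_eq continuous_on_subset subset_UNIV)

lemma C_inf_add: "f \<in> C_inf ==> g \<in> C_inf ==> (\<lambda>x. f x + g x) \<in> C_inf"
 and C_inf_mult: "f \<in> C_inf ==> g \<in> C_inf ==> (\<lambda>x. f x * g x) \<in> C_inf"
 and C_inf_const: "(\<lambda>_. c) \<in> C_inf"
 and C_inf_translate: "f \<in> C_inf ==> (\<lambda>x. f (x + z)) \<in> C_inf"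
 by (auto simp: C_inf_iff C_k_add C_k_mult C_k_const C_k_translate)

lemma C_inf_diff: "f \<in> C_inf ==> g \<in> C_inf ==> (\<lambda>x. f x - g x) \<in> C_inf"
 using C_inf_add[of f "\<lambda>x. (-1) * g x"] C_inf_mult[OF C_inf_const, of g "-1"] by simp

lemma C_inf_has_derivative: "\<phi> \<in> C_inf ==> (\<phi> has_derivative (\<lambda>h. grad \<phi> x \<bullet> h)) (at x)"
 by (intro differentiable_imp_has_derivative_grad C_inf_differentiable)

lemma C_inf_continuous_grad: "\<phi> \<in> C_inf ==> continuous_on S (grad \<phi>)"
 unfolding grad_def by (intro continuous_on_vec_lambda C_inf_continuous C_inf_partial)

lemma C_inf_C1_on: "\<phi> \<in> C_inf ==> C1_on T \<phi> (grad \<phi>)"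
 by (auto simp: C1_on_def C_inf_continuous_grad intro: has_derivative_at_withinI C_inf_has_derivative)

lemma C_inf_line_derivative:
 assumes "\<phi> \<in> C_inf"
 shows "((\<lambda>s. \<phi> (x + s *\<^sub>R z)) has_real_derivative grad \<phi> (x + s *\<^sub>R z) \<bullet> z) (at s)"
proof -
 have "((\<lambda>s. x + s *\<^sub>R z) has_vector_derivative z) (at s)" by (auto intro!: derivative_eq_intros)
 from vector_derivative_diff_chain_within[OF this has_derivative_at_withinI[OF C_inf_has_derivative[OF assms]]]
 show ?thesis by (simp add: o_def has_real_derivative_iff_has_vector_derivative)
qed

text \<open>The mean value theorem is applied first in direction \<open>i\<close> to a difference in
  direction \<open>j\<close>, then in direction \<open>j\<close> to the partial derivative so
  obtained.\<close>

lemma second_difference_mean_value: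
 assumes f: "f \<in> C_inf" and h: "0 < h"
 shows "\<exists>\<xi> \<eta>. 0 < \<xi> \<and> \<xi> < h \<and> 0 < \<eta> \<and> \<eta> < h \<and>
   f (x + h *\<^sub>R axis i 1 + h *\<^sub>R axis j 1) - f (x + h *\<^sub>R axis i 1) - f (x + h *\<^sub>R axis j 1) + f x
   = h * (h * partial j (partial i f) (x + \<xi> *\<^sub>R axis i 1 + \<eta> *\<^sub>R axis j 1))"
proof -
 let ?a = "axis i 1 :: real^2" and ?b = "axis j 1 :: real^2"
 let ?g = "\<lambda>s. f ((x + h *\<^sub>R ?b) + s *\<^sub>R ?a) - f (x + s *\<^sub>R ?a)"
 let ?g' = "\<lambda>s. grad f ((x + h *\<^sub>R ?b) + s *\<^sub>R ?a) \<bullet> ?a - grad f (x + s *\<^sub>R ?a) \<bullet> ?a"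
 have "(?g has_real_derivative ?g' s) (at s)" for s by (intro DERIV_diff C_inf_line_derivative f)
 then obtain \<xi> where \<xi>: "0 < \<xi>" "\<xi> < h" "?g h - ?g 0 = (h - 0) * ?g' \<xi>" using MVT2[OF h, of ?g ?g'] by auto
 let ?k = "\<lambda>s. partial i f ((x + \<xi> *\<^sub>R ?a) + s *\<^sub>R ?b)"
 have "(?k has_real_derivative grad (partial i f) ((x + \<xi> *\<^sub>R ?a) + s *\<^sub>R ?b) \<bullet> ?b) (at s)" for s
  by (intro C_inf_line_derivative C_inf_partial f)
 then obtain \<eta> where \<eta>: "0 < \<eta>" "\<eta> < h" "?k h - ?k 0 = (h - 0) * (grad (partial i f) ((x + \<xi> *\<^sub>R ?a) + \<eta> *\<^sub>R ?b) \<bullet> ?b)"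
  using MVT2[OF h, of ?k "\<lambda>s. grad (partial i f) ((x + \<xi> *\<^sub>R ?a) + s *\<^sub>R ?b) \<bullet> ?b"] by auto
 have "?g' \<xi> = ?k h - ?k 0" by (simp add: inner_axis grad_def add_ac)
 then have "?g h - ?g 0 = h * (h * partial j (partial i f) (x + \<xi> *\<^sub>R ?a + \<eta> *\<^sub>R ?b))"
  using \<xi>(3) \<eta>(3) by (simp add: inner_axis grad_def)
 then show ?thesis using \<xi> \<eta> by (intro exI[of _ \<xi>] exI[of _ \<eta>]) (simp add: add_ac)
qed

text \<open>The second difference is symmetric in the two directions and equals \<open>h * h\<close>
  times either mixed derivative at some point close to \<open>x\<close>; continuity of both does the
  rest. Needed since \<open>partials\<close> fixes an order of differentiation.\<close>

lemma partial_commute: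
 assumes f: "f \<in> C_inf"
 shows "partial i (partial j f) = partial j (partial i f)"
proof
 fix x
 let ?F = "partial i (partial j f)" and ?G = "partial j (partial i f)"
 show "?F x = ?G x"
 proof (rule ccontr)
  assume "?F x \<noteq> ?G x"
  then have e: "dist (?F x) (?G x) / 2 > 0" by simp
  have cF: "continuous_on UNIV ?F" and cG: "continuous_on UNIV ?G" by (intro C_inf_continuous C_inf_partial f)+
  obtain d1 where d1: "d1 > 0" "\<And>y. dist y x < d1 ==> dist (?F y) (?F x) < dist (?F x) (?G x) / 2" using cF e unfolding continuous_on_iff by (metis UNIV_I)
  obtain d2 where d2: "d2 > 0" "\<And>y. dist y x < d2 ==> dist (?G y) (?G x) < dist (?F x) (?G x) / 2" using cG e unfolding continuous_on_iff by (metis UNIV_I)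
  define h where "h = min d1 d2 / 2"
  have h: "0 < h" "2 * h \<le> d1" "2 * h \<le> d2" using d1(1) d2(1) by (auto simp: h_def)
  have near: "dist (x + s *\<^sub>R axis k 1 + t *\<^sub>R axis l 1) x < 2 * h" if "0 < s" "s < h" "0 < t" "t < h" for s t and k l :: 2
   using norm_triangle_ineq[of "s *\<^sub>R axis k 1 :: real^2" "t *\<^sub>R axis l 1"] that by (simp add: dist_norm add.assoc norm_axis_1)
  obtain \<xi> \<eta> where 1: "0 < \<xi>" "\<xi> < h" "0 < \<eta>" "\<eta> < h"
   "f (x + h *\<^sub>R axis i 1 + h *\<^sub>R axis j 1) - f (x + h *\<^sub>R axis i 1) - f (x + h *\<^sub>R axis j 1) + f x
   = h * (h * ?G (x + \<xi> *\<^sub>R axis i 1 + \<eta> *\<^sub>R axis j 1))" using second_difference_mean_value[OF f h(1)] by blast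
  obtain \<xi>' \<eta>' where 2: "0 < \<xi>'" "\<xi>' < h" "0 < \<eta>'" "\<eta>' < h"
   "f (x + h *\<^sub>R axis j 1 + h *\<^sub>R axis i 1) - f (x + h *\<^sub>R axis j 1) - f (x + h *\<^sub>R axis i 1) + f x
   = h * (h * ?F (x + \<xi>' *\<^sub>R axis j 1 + \<eta>' *\<^sub>R axis i 1))" using second_difference_mean_value[OF f h(1)] by blast
  have "h * (h * ?G (x + \<xi> *\<^sub>R axis i 1 + \<eta> *\<^sub>R axis j 1)) = h * (h * ?F (x + \<xi>' *\<^sub>R axis j 1 + \<eta>' *\<^sub>R axis i 1))"
   unfolding 1(5)[symmetric] 2(5)[symmetric] by (simp add: algebra_simps)
  then have "?G (x + \<xi> *\<^sub>R axis i 1 + \<eta> *\<^sub>R axis j 1) = ?F (x + \<xi>' *\<^sub>R axis j 1 + \<eta>' *\<^sub>R axis i 1)" using h(1) by simp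
  moreover have "dist (?G (x + \<xi> *\<^sub>R axis i 1 + \<eta> *\<^sub>R axis j 1)) (?G x) < dist (?F x) (?G x) / 2"
   using near[OF 1(1-4), of i j] h by (intro d2) auto
  moreover have "dist (?F (x + \<xi>' *\<^sub>R axis j 1 + \<eta>' *\<^sub>R axis i 1)) (?F x) < dist (?F x) (?G x) / 2"
   using near[OF 2(1-4), of j i] h by (intro d1) auto
  ultimately show False using dist_triangle_half_l by (metis dist_commute less_irrefl)
 qed
qed

lemma test_functions_C_inf: "\<phi> \<in> test_functions U ==> \<phi> \<in> C_inf"
 by (simp add: test_functions_def)

lemma test_functions_mono: "U \<subseteq> V ==> \<phi> \<in> test_functions U ==> \<phi> \<in> test_functions V"
 by (auto simp: test_functions_def)

lemma test_functions_zero_outside: "\<phi> \<in> test_functions U ==> x \<notin> U ==> \<phi> x = 0"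
 using closure_subset[of "{x. \<phi> x \<noteq> 0}"] by (auto simp: test_functions_def)

lemma test_functions_subset:
 assumes "\<phi> \<in> test_functions U" "\<psi> \<in> C_inf" "{x. \<psi> x \<noteq> 0} \<subseteq> closure {x. \<phi> x \<noteq> 0}"
 shows "\<psi> \<in> test_functions U"
proof -
 have "closure {x. \<psi> x \<noteq> 0} \<subseteq> closure {x. \<phi> x \<noteq> 0}" using assms(3) by (metis closure_closure closure_mono)
 moreover from this have "closure {x. \<psi> x \<noteq> 0} = closure {x. \<phi> x \<noteq> 0} \<inter> closure {x. \<psi> x \<noteq> 0}" by auto
 ultimately have "compact (closure {x. \<psi> x \<noteq> 0})" "closure {x. \<psi> x \<noteq> 0} \<subseteq> U"
  using assms(1) compact_Int_closed[OF _ closed_closure[of "{x. \<psi> x \<noteq> 0}"], of "closure {x. \<phi> x \<noteq> 0}"]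
  unfolding test_functions_def by (metis (no_types, lifting) mem_Collect_eq, blast)
 then show ?thesis using assms(2) unfolding test_functions_def by blast
qed

lemma test_functions_partial:
 assumes "\<phi> \<in> test_functions U"
 shows "partial i \<phi> \<in> test_functions U"
proof (rule test_functions_subset[OF assms])
 show "partial i \<phi> \<in> C_inf" using assms by (intro C_inf_partial test_functions_C_inf)
 let ?K = "closure {x. \<phi> x \<noteq> 0}"
 have "partial i \<phi> x = 0" if "x \<notin> ?K" for x
 proof -
  have "(\<phi> has_derivative (\<lambda>_. 0)) (at x)" by (rule has_derivative_transform_within_open[of "\<lambda>_. 0" _ _ _ "- ?K"])
    (use that closure_subset[of "{x. \<phi> x \<noteq> 0}"] in \<open>auto intro!: derivative_eq_intros\<close>)
  then show ?thesis by (simp add: has_derivative_imp_partial)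
 qed
 then show "{x. partial i \<phi> x \<noteq> 0} \<subseteq> ?K" by auto
qed

lemma test_functions_bounded:
 assumes "\<phi> \<in> test_functions U"
 shows "\<exists>M. \<forall>x. \<bar>\<phi> x\<bar> \<le> M"
proof -
 let ?K = "closure {x. \<phi> x \<noteq> 0}"
 have "compact (\<phi> ` ?K)" using assms by (intro compact_continuous_image C_inf_continuous) (auto simp: test_functions_def)
 then obtain M where M: "\<And>y. y \<in> \<phi> ` ?K ==> norm y \<le> M" using compact_imp_bounded bounded_iff by metis
 have "\<bar>\<phi> x\<bar> \<le> max M 0" for x
  using M[of "\<phi> x"] closure_subset[of "{x. \<phi> x \<noteq> 0}"] by (cases "\<phi> x = 0") (auto simp: le_max_iff_disj)
 then show ?thesis by blast
qed

lemma C_inf_measurable: "\<phi> \<in> C_inf ==> \<phi> \<in> borel_measurable borel"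
 by (intro borel_measurable_continuous_onI C_inf_continuous)

lemma test_functions_integrable_mult:
 assumes "\<phi> \<in> test_functions U" "integrable lborel f"
 shows "integrable lborel (\<lambda>x. f x * \<phi> x)"
proof -
 obtain M where M: "\<And>x. \<bar>\<phi> x\<bar> \<le> M" using test_functions_bounded[OF assms(1)] by auto
 have [measurable]: "\<phi> \<in> borel_measurable borel" using assms by (intro C_inf_measurable test_functions_C_inf)
 have [measurable]: "f \<in> borel_measurable borel" using assms(2) by auto
 show ?thesis
 proof (rule Bochner_Integration.integrable_bound)
  show "integrable lborel (\<lambda>x. M * f x)" using assms(2) by simp
  show "AE x in lborel. norm (f x * \<phi> x) \<le> norm (M * f x)"
   using M by (intro AE_I2) (simp add: abs_mult mult.commute[of _ "\<bar>f _\<bar>"] order_trans[OF M abs_ge_self] mult_left_mono)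
 qed measurable
qed

section \<open>Cutoff functions and the fundamental lemma of the calculus of variations\<close>

text \<open>The derivative of \<open>p (1/t) exp (-1/t)\<close> is
  \<open>(1/t)^2 (p (1/t) - p' (1/t)) exp (-1/t)\<close>; this is the recursion for the polynomial
  factor.\<close>

primrec bump_poly :: "nat => real poly" where
 "bump_poly 0 = 1"
| "bump_poly (Suc n) = monom 1 2 * (bump_poly n - pderiv (bump_poly n))"

text \<open>The derivatives of \<open>exp (-1/t)\<close>, extended by zero to \<open>t \<le> 0\<close>.\<close>

definition bump :: "nat => real => real" where
 "bump n t = (if 0 < t then poly (bump_poly n) (1 / t) * exp (- (1 / t)) else 0)"

lemma tendsto_poly_mult_exp_neg: "((\<lambda>y. poly p y * exp (- y)) \<longlongrightarrow> 0) at_top" for p :: "real poly"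
proof -
 have "((\<lambda>y. \<Sum>i\<le>degree p. coeff p i * (y ^ i / exp y)) \<longlongrightarrow> (\<Sum>i\<le>degree p. coeff p i * 0)) at_top"
  by (intro tendsto_sum tendsto_mult tendsto_const tendsto_power_div_exp_0)
 then show ?thesis by (simp add: poly_altdef exp_minus sum_distrib_right divide_inverse mult.assoc)
qed

text \<open>Only the origin is delicate. From the right the difference quotient is a polynomial in
  \<open>1/h\<close> times \<open>exp (-1/h)\<close>, and the exponential wins; from the left it is
  zero.\<close>

lemma DERIV_bump: "(bump n has_real_derivative bump (Suc n) t) (at t)"
proof -
 consider "t > 0" | "t < 0" | "t = 0" by linarith
 then show ?thesis
 proof cases
  case 1
  have "((\<lambda>t. poly (bump_poly n) (1 / t) * exp (- (1 / t))) has_real_derivative bump (Suc n) t) (at t)"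
   using 1 by (auto intro!: derivative_eq_intros DERIV_chain'[of "\<lambda>t. 1 / t" _ _ _ "poly _"] poly_DERIV
     simp: bump_def poly_monom field_simps power2_eq_square)
  then show ?thesis by (rule has_field_derivative_transform_within_open[of _ _ _ "{0<..}"]) (use 1 in \<open>auto simp: bump_def\<close>)
 next
  case 2
  have "((\<lambda>t. 0) has_real_derivative bump (Suc n) t) (at t)" using 2 by (simp add: bump_def)
  then show ?thesis by (rule has_field_derivative_transform_within_open[of _ _ _ "{..<0}"]) (use 2 in \<open>auto simp: bump_def\<close>)
 next
  case 3
  have "((\<lambda>h. bump n h / h) \<longlongrightarrow> 0) (at_left 0)" by (rule tendsto_eventually) (auto simp: bump_def eventually_at_filter)
  moreover have "((\<lambda>h. bump n h / h) \<longlongrightarrow> 0) (at_right 0)"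
  proof -
   have "((\<lambda>h. poly (monom 1 1 * bump_poly n) (inverse h) * exp (- inverse h)) \<longlongrightarrow> 0) (at_right 0)"
    by (rule filterlim_compose[OF tendsto_poly_mult_exp_neg filterlim_inverse_at_top_right])
   moreover have "\<forall>\<^sub>F h in at_right 0. poly (monom 1 1 * bump_poly n) (inverse h) * exp (- inverse h) = bump n h / h"
    by (auto simp: bump_def eventually_at_filter poly_monom field_simps)
   ultimately show ?thesis by (rule Lim_transform_eventually)
  qed
  ultimately have "((\<lambda>h. bump n h / h) \<longlongrightarrow> 0) (at 0)" by (rule filterlim_split_at)
  then show ?thesis using 3 by (simp add: DERIV_def bump_def)
 qed
qed

lemma bump_bounds: "0 \<le> bump 0 t" "bump 0 t \<le> 1"
 by (auto simp: bump_def)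

lemma bump_pos_iff: "bump 0 t \<noteq> 0 \<longleftrightarrow> 0 < t"
 by (auto simp: bump_def)

lemma bump_limit: "(\<lambda>n. bump 0 (real (Suc n) * t)) \<longlonglongrightarrow> (if 0 < t then 1 else 0)"
proof (cases "0 < t")
 case True
 have "(\<lambda>n. exp (- (1 / t) * inverse (real (Suc n)))) \<longlonglongrightarrow> exp (- (1 / t) * 0)" by (intro tendsto_intros LIMSEQ_inverse_real_of_nat)
 then show ?thesis using True by (simp add: bump_def field_simps zero_less_mult_iff add_pos_nonneg)
qed (auto simp: bump_def zero_less_mult_iff)

text \<open>The factor \<open>Suc n\<close> steepens the ramps without moving the support, so that
  the indicator of an open box is a limit of test functions supported in the closed box.\<close>

definition box_bump :: "real^2 => real^2 => nat => real^2 => real" where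
 "box_bump a b n x =
   (bump 0 (real (Suc n) * (x$1 - a$1)) * bump 0 (real (Suc n) * (b$1 - x$1))) *
   (bump 0 (real (Suc n) * (x$2 - a$2)) * bump 0 (real (Suc n) * (b$2 - x$2)))"

lemma mem_box_2: "x \<in> box a b \<longleftrightarrow> a$1 < x$1 \<and> x$1 < b$1 \<and> a$2 < x$2 \<and> x$2 < b$2" for x :: "real^2"
 by (auto simp: mem_box_cart forall_2)

lemma box_bump_C_inf: "box_bump a b n \<in> C_inf"
proof -
 have 1: "(\<lambda>x. bump 0 (c + d * x$j)) \<in> C_inf" for c d j unfolding C_inf_iff by (intro allI C_k_coordinate[where D = bump] DERIV_bump)
 have 2: "(\<lambda>x. bump 0 (real (Suc n) * (x$j - c))) \<in> C_inf" "(\<lambda>x. bump 0 (real (Suc n) * (c - x$j))) \<in> C_inf" for c j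
  using 1[of "- real (Suc n) * c" "real (Suc n)" j] 1[of "real (Suc n) * c" "- real (Suc n)" j] by (simp_all add: algebra_simps)
 show ?thesis unfolding box_bump_def[abs_def] by (intro C_inf_mult 2)
qed

lemma box_bump_nonzero: "box_bump a b n x \<noteq> 0 \<longleftrightarrow> x \<in> box a b"
 by (auto simp: box_bump_def bump_pos_iff mem_box_2 zero_less_mult_iff)

lemma box_bump_test_functions:
 assumes "cbox a b \<subseteq> U"
 shows "box_bump a b n \<in> test_functions U"
proof -
 have sub: "closure {x. box_bump a b n x \<noteq> 0} \<subseteq> cbox a b" by (rule closure_minimal) (auto simp: box_bump_nonzero box_subset_cbox[THEN subsetD])
 then have "closure {x. box_bump a b n x \<noteq> 0} = cbox a b \<inter> closure {x. box_bump a b n x \<noteq> 0}" by auto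
 then have "compact (closure {x. box_bump a b n x \<noteq> 0})" using compact_Int_closed[OF compact_cbox closed_closure] by metis
 then show ?thesis using sub assms box_bump_C_inf unfolding test_functions_def by blast
qed

lemma box_bump_limit: "(\<lambda>n. box_bump a b n x) \<longlonglongrightarrow> (indicator (box a b) x :: real)"
proof -
 have "(\<lambda>n. box_bump a b n x) \<longlonglongrightarrow>
  ((if 0 < x$1 - a$1 then 1 else 0 :: real) * (if 0 < b$1 - x$1 then 1 else 0)) *
  ((if 0 < x$2 - a$2 then 1 else 0) * (if 0 < b$2 - x$2 then 1 else 0))" unfolding box_bump_def by (intro tendsto_mult bump_limit)
 moreover have "((if 0 < x$1 - a$1 then 1 else 0 :: real) * (if 0 < b$1 - x$1 then 1 else 0)) *
  ((if 0 < x$2 - a$2 then 1 else 0) * (if 0 < b$2 - x$2 then 1 else 0)) = indicator (box a b) x" by (auto simp: mem_box_2 indicator_def)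
 ultimately show ?thesis by simp
qed

lemma box_bump_le_1: "\<bar>box_bump a b n x\<bar> \<le> 1"
 unfolding box_bump_def abs_mult using bump_bounds by (intro mult_le_one mult_nonneg_nonneg abs_ge_zero) auto

text \<open>The positive and the negative part of \<open>f\<close> are densities of two measures
  that agree on boxes, an intersection-stable generator. So the measures agree, hence the densities
  almost everywhere, and equal positive and negative parts both vanish.\<close>

lemma AE_zero_of_box_integrals:
 fixes f :: "real^2 => real"
 assumes f: "integrable lborel f" and 0: "\<And>a b. (LBINT x:box a b. f x) = 0"
 shows "AE x in lborel. f x = 0"
proof -
 have [measurable]: "f \<in> borel_measurable borel" using f by auto
 let ?P = "density lborel (\<lambda>x. ennreal (f x))" and ?N = "density lborel (\<lambda>x. ennreal (- f x))"
 have fin: "(\<integral>\<^sup>+x. ennreal (f x) \<partial>lborel) < \<infinity>" "(\<integral>\<^sup>+x. ennreal (- f x) \<partial>lborel) < \<infinity>"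
  using f by (auto simp: real_integrable_def less_top)
 have fin2: "(\<integral>\<^sup>+x. ennreal (f x) * indicator S x \<partial>lborel) < \<infinity>" "(\<integral>\<^sup>+x. ennreal (- f x) * indicator S x \<partial>lborel) < \<infinity>" for S
  by (rule le_less_trans[OF nn_integral_mono fin(1)], simp add: indicator_def)
   (rule le_less_trans[OF nn_integral_mono fin(2)], simp add: indicator_def)
 have "?P = ?N"
 proof (rule measure_eqI_generator_eq)
  let ?E = "range (\<lambda>(a, b). box a b::(real^2) set)"
  show "Int_stable ?E" by (auto simp: Int_stable_def box_Int_box)
  show "?E \<subseteq> Pow UNIV" "sets ?P = sigma_sets UNIV ?E" "sets ?N = sigma_sets UNIV ?E" by (simp_all add: borel_eq_box)
  let ?A = "\<lambda>n::nat. box (- (real n *\<^sub>R One)) (real n *\<^sub>R One) :: (real^2) set"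
  show "range ?A \<subseteq> ?E" "(\<Union>i. ?A i) = UNIV" unfolding UN_box_eq_UNIV by auto
  show "emeasure ?P (?A i) \<noteq> \<infinity>" for i using fin2(1)[of "?A i"] by (simp add: emeasure_density less_top)
  show "emeasure ?P X = emeasure ?N X" if "X \<in> ?E" for X
  proof -
   obtain a b where X: "X = box a b" using \<open>X \<in> ?E\<close> by auto
   have i: "integrable lborel (\<lambda>x. indicator X x * f x)" using f integrable_mult_indicator[of X lborel f] X by auto
   have "0 = enn2real (\<integral>\<^sup>+x. ennreal (indicator X x * f x) \<partial>lborel) - enn2real (\<integral>\<^sup>+x. ennreal (- (indicator X x * f x)) \<partial>lborel)"
    using 0[of a b] real_lebesgue_integral_def[OF i] by (simp add: set_lebesgue_integral_def X)
   also have "(\<lambda>x. ennreal (indicator X x * f x)) = (\<lambda>x. ennreal (f x) * indicator X x)" by (auto simp: indicator_def)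
   also have "(\<lambda>x. ennreal (- (indicator X x * f x))) = (\<lambda>x. ennreal (- f x) * indicator X x)" by (auto simp: indicator_def)
   finally have "ennreal (enn2real (\<integral>\<^sup>+x. ennreal (f x) * indicator X x \<partial>lborel))
     = ennreal (enn2real (\<integral>\<^sup>+x. ennreal (- f x) * indicator X x \<partial>lborel))" by simp
   then have "(\<integral>\<^sup>+x. ennreal (f x) * indicator X x \<partial>lborel) = (\<integral>\<^sup>+x. ennreal (- f x) * indicator X x \<partial>lborel)"
    using fin2[of X] by (simp only: ennreal_enn2real infinity_ennreal_def)
   then show ?thesis by (simp add: X emeasure_density)
  qed
 qed
 then have "AE x in lborel. ennreal (f x) = ennreal (- f x)"
  using sigma_finite_measure.density_unique[OF sigma_finite_lborel, of "\<lambda>x. ennreal (f x)" "\<lambda>x. ennreal (- f x)"] by simp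
 then show ?thesis
 proof eventually_elim
  case (elim x)
  then show ?case by (cases "f x \<ge> 0") (auto simp: ennreal_neg ennreal_eq_0_iff)
 qed
qed

text \<open>Testing with \<open>box_bump\<close> and passing to the limit shows that the integral
  over a box with closure in \<open>V\<close> is zero. The set \<open>V\<close> is a countable union
  of closed boxes; on each of them \<open>AE_zero_of_box_integrals\<close> applies to
  \<open>f\<close> cut off to the open box, whose boundary is null.\<close>

lemma fundamental_lemma_calculus_of_variations:
 fixes f :: "real^2 => real"
 assumes f: "integrable lborel f" and V: "open V"
  and 0: "\<And>\<phi>. \<phi> \<in> test_functions V ==> (LBINT x. f x * \<phi> x) = 0"
 shows "AE x in lborel. x \<in> V --> f x = 0"
proof -
 have [measurable]: "f \<in> borel_measurable borel" using f by auto
 have box0: "(LBINT x:box a b. f x) = 0" if sub: "cbox a b \<subseteq> V" for a b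
 proof -
  have [measurable]: "box_bump a b n \<in> borel_measurable borel" for n by (intro C_inf_measurable box_bump_C_inf)
  have "(\<lambda>n. LBINT x. f x * box_bump a b n x) \<longlonglongrightarrow> (LBINT x. f x * indicator (box a b) x)"
  proof (rule integral_dominated_convergence[where w = "\<lambda>x. norm (f x)"])
   show "integrable lborel (\<lambda>x. norm (f x))" using f by simp
   show "AE x in lborel. (\<lambda>n. f x * box_bump a b n x) \<longlonglongrightarrow> f x * indicator (box a b) x"
    by (intro AE_I2 tendsto_mult tendsto_const box_bump_limit)
   show "AE x in lborel. norm (f x * box_bump a b n x) \<le> norm (f x)" for n using box_bump_le_1 by (auto simp: abs_mult intro!: mult_right_le_one_le)
  qed measurable
  moreover have "(LBINT x. f x * box_bump a b n x) = 0" for n by (rule 0[OF box_bump_test_functions[OF sub]])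
  ultimately show ?thesis by (simp add: LIMSEQ_const_iff set_lebesgue_integral_def mult.commute)
 qed
 obtain \<D> where \<D>: "countable \<D>" "\<D> \<subseteq> Pow V" "\<And>X. X \<in> \<D> ==> \<exists>a b. X = cbox a b" "\<Union>\<D> = V"
  by (rule open_countable_Union_open_cbox[OF V]) (rule that)
 have "AE x in lborel. \<forall>X\<in>\<D>. x \<in> X --> f x = 0"
 proof (subst AE_ball_countable[OF \<D>(1)], intro ballI)
  fix X assume X: "X \<in> \<D>"
  then obtain a b where ab: "X = cbox a b" using \<D>(3) by blast
  have "AE x in lborel. indicator (box a b) x * f x = 0"
  proof (rule AE_zero_of_box_integrals)
   show "integrable lborel (\<lambda>x. indicator (box a b) x * f x)" using f integrable_mult_indicator[of "box a b" lborel f] by auto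
   fix c d :: "real^2"
   obtain e g where eg: "box a b \<inter> box c d = box e g" "cbox e g \<subseteq> cbox a b \<or> box e g = {}"
   proof -
    let ?e = "(\<Sum>i\<in>Basis. max (a \<bullet> i) (c \<bullet> i) *\<^sub>R i)" and ?g = "(\<Sum>i\<in>Basis. min (b \<bullet> i) (d \<bullet> i) *\<^sub>R i)"
    have "box a b \<inter> box c d = box ?e ?g" by (rule box_Int_box)
    moreover have "cbox ?e ?g \<subseteq> cbox a b" by (auto simp: mem_box)
    ultimately show ?thesis using that by blast
   qed
   have "(LBINT x:box c d. indicator (box a b) x * f x) = (LBINT x:box e g. f x)" unfolding set_lebesgue_integral_def eg(1)[symmetric]
    by (intro Bochner_Integration.integral_cong) (auto simp: indicator_def)
   also have "\<dots> = 0" using eg(2) box0[of e g] \<D>(2) X ab by (auto simp: set_lebesgue_integral_def)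
   finally show "(LBINT x:box c d. indicator (box a b) x * f x) = 0" .
  qed
  moreover have "AE x in lborel. x \<notin> cbox a b - box a b"
   by (rule AE_not_in) (auto simp: null_sets_def emeasure_Diff box_subset_cbox emeasure_lborel_box_eq emeasure_lborel_cbox_eq)
  ultimately show "AE x in lborel. x \<in> X --> f x = 0" by eventually_elim (auto simp: ab indicator_def split: if_splits)
 qed
 then show ?thesis by eventually_elim (use \<D>(4) in blast)
qed

section \<open>Weakly differentiable functions: differences along segments\<close>

lemma
 fixes f :: "'a::euclidean_space => 'b::{banach, second_countable_topology}"
 assumes [measurable]: "f \<in> borel_measurable borel"
 shows integral_translate: "(LBINT x. f (x + z)) = (LBINT x. f x)"
  and integrable_translate: "integrable lborel (\<lambda>x. f (x + z)) \<longleftrightarrow> integrable lborel f"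
proof -
 have "(LINT x|distr lborel borel ((+) z). f x) = (LBINT x. f (z + x))" by (subst integral_distr) auto
 then show "(LBINT x. f (x + z)) = (LBINT x. f x)" by (simp add: lborel_distr_plus add.commute)
 have "integrable (distr lborel borel ((+) z)) f \<longleftrightarrow> integrable lborel (\<lambda>x. f (z + x))" by (subst integrable_distr_eq) auto
 then show "integrable lborel (\<lambda>x. f (x + z)) \<longleftrightarrow> integrable lborel f" by (simp add: lborel_distr_plus add.commute)
qed

lemma nn_integral_translate:
 fixes f :: "'a::euclidean_space => ennreal"
 assumes [measurable]: "f \<in> borel_measurable borel"
 shows "(\<integral>\<^sup>+x. f (x + z) \<partial>lborel) = (\<integral>\<^sup>+x. f x \<partial>lborel)"
proof -
 have "(\<integral>\<^sup>+x. f x \<partial>distr lborel borel ((+) z)) = (\<integral>\<^sup>+x. f (z + x) \<partial>lborel)" by (subst nn_integral_distr) auto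
 then show ?thesis by (simp add: lborel_distr_plus add.commute)
qed

text \<open>Justifies the exchanges of integrals below. Translation does not change the L1 norm of
  \<open>f\<close>, so the inner integral is at most \<open>K\<close> times that norm times the
  absolute value of \<open>\<kappa> v\<close>.\<close>

lemma integrable_shift_pair:
 fixes \<kappa> :: "'v::euclidean_space => real" and f :: "real^2 => real" and L :: "'v => real^2"
 assumes \<kappa>: "integrable lborel \<kappa>" and f: "integrable lborel f"
  and [measurable]: "L \<in> borel_measurable borel" "b \<in> borel_measurable (borel \<Otimes>\<^sub>M borel)"
  and b: "\<And>v x. \<bar>b (v, x)\<bar> \<le> K"
 shows "integrable (lborel \<Otimes>\<^sub>M lborel) (\<lambda>(v, x). \<kappa> v * (f (x + L v) * b (v, x)))"
proof (rule lborel_pair.Fubini_integrable)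
 have [measurable]: "\<kappa> \<in> borel_measurable borel" "f \<in> borel_measurable borel" using \<kappa> f by auto
 show "(\<lambda>(v, x). \<kappa> v * (f (x + L v) * b (v, x))) \<in> borel_measurable (lborel \<Otimes>\<^sub>M lborel)" by measurable
 have dom: "integrable lborel (\<lambda>x. norm (\<kappa> v) * (norm (f (x + L v)) * K))" for v
  using f by (intro integrable_mult_right integrable_mult_left integrable_norm) (simp add: integrable_translate)
 have i: "integrable lborel (\<lambda>x. \<kappa> v * (f (x + L v) * b (v, x)))" for v by (rule Bochner_Integration.integrable_bound[OF dom[of v]])
   (use b in \<open>auto simp: abs_mult intro!: mult_left_mono order_trans[OF b abs_ge_self]\<close>)
 then show "AE v in lborel. integrable lborel (\<lambda>x. case (v, x) of (v, x) => \<kappa> v * (f (x + L v) * b (v, x)))" by simp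
 show "integrable lborel (\<lambda>v. LBINT x. norm (case (v, x) of (v, x) => \<kappa> v * (f (x + L v) * b (v, x))))"
 proof (rule Bochner_Integration.integrable_bound)
  show "integrable lborel (\<lambda>v. norm (\<kappa> v) * ((LBINT x. norm (f x)) * K))" using \<kappa> by (intro integrable_mult_left integrable_norm)
  show "(\<lambda>v. LBINT x. norm (case (v, x) of (v, x) => \<kappa> v * (f (x + L v) * b (v, x)))) \<in> borel_measurable lborel" by measurable
  show "AE v in lborel. norm (LBINT x. norm (case (v, x) of (v, x) => \<kappa> v * (f (x + L v) * b (v, x))))
   \<le> norm (norm (\<kappa> v) * ((LBINT x. norm (f x)) * K))"
  proof (rule AE_I2)
   fix v
   have K: "0 \<le> K" using b[of v 0] by simp
   have "(LBINT x. norm (\<kappa> v * (f (x + L v) * b (v, x)))) \<le> (LBINT x. norm (\<kappa> v) * (norm (f (x + L v)) * K))"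
    using b by (intro integral_mono integrable_norm i dom) (auto simp: abs_mult intro!: mult_left_mono)
   also have "\<dots> = norm (\<kappa> v) * ((LBINT x. norm (f x)) * K)" using integral_translate[of "\<lambda>x. \<bar>f x\<bar>" "L v"] by simp
   finally show "norm (LBINT x. norm (case (v, x) of (v, x) => \<kappa> v * (f (x + L v) * b (v, x))))
    \<le> norm (norm (\<kappa> v) * ((LBINT x. norm (f x)) * K))" using K by (simp add: integral_nonneg_AE)
  qed
 qed
qed

text \<open>Borel representatives on the whole plane of a function in \<open>H\<^sup>1(U)\<close> and its weak gradient.\<close>

definition H1_fun :: "(real^2) set => (real^2 => real) => (real^2 => real^2) => bool" where
 "H1_fun U w g \<longleftrightarrow>
   integrable lborel w \<and> integrable lborel (\<lambda>x. (w x)^2) \<and>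
   integrable lborel g \<and> integrable lborel (\<lambda>x. (norm (g x))^2) \<and>
   (\<forall>\<phi>\<in>test_functions U. \<forall>i. (LBINT x. w x * partial i \<phi> x) = - (LBINT x. g x $ i * \<phi> x))"

lemma H1_fun_mono: "H1_fun U w g ==> V \<subseteq> U ==> H1_fun V w g"
 unfolding H1_fun_def using test_functions_mono by blast

lemma H1_funD:
 assumes "H1_fun U w g"
 shows "integrable lborel w" "integrable lborel (\<lambda>x. (w x)^2)" "integrable lborel g"
  "integrable lborel (\<lambda>x. (norm (g x))^2)" "w \<in> borel_measurable borel" "g \<in> borel_measurable borel"
  "integrable lborel (\<lambda>x. g x \<bullet> z)"
proof -
 show 1: "integrable lborel w" "integrable lborel (\<lambda>x. (w x)^2)" "integrable lborel g"
  "integrable lborel (\<lambda>x. (norm (g x))^2)" using assms by (auto simp: H1_fun_def)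
 show "w \<in> borel_measurable borel" "g \<in> borel_measurable borel" using borel_measurable_integrable[OF 1(1)] borel_measurable_integrable[OF 1(3)] by auto
 show "integrable lborel (\<lambda>x. g x \<bullet> z)" using 1(3) by (rule integrable_inner_left)
qed

lemma H1_fun_weak_gradient:
 assumes H: "H1_fun U w g" and \<phi>: "\<phi> \<in> test_functions U"
 shows "(LBINT x. w x * (grad \<phi> x \<bullet> z)) = - (LBINT x. (g x \<bullet> z) * \<phi> x)"
proof -
 have iw: "integrable lborel (\<lambda>x. w x * partial i \<phi> x)" for i
  by (rule test_functions_integrable_mult[OF test_functions_partial[OF \<phi>] H1_funD(1)[OF H]])
 have ig: "integrable lborel (\<lambda>x. g x $ i * \<phi> x)" for i
  using test_functions_integrable_mult[OF \<phi> H1_funD(7)[OF H, of "axis i 1"]] by (simp add: inner_axis)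
 have e: "(LBINT x. w x * partial i \<phi> x) = - (LBINT x. g x $ i * \<phi> x)" for i using H \<phi> by (simp add: H1_fun_def)
 have "(LBINT x. w x * (grad \<phi> x \<bullet> z)) = (LBINT x. z$1 * (w x * partial 1 \<phi> x) + z$2 * (w x * partial 2 \<phi> x))"
  by (simp add: inner_vec2 grad_def algebra_simps)
 also have "\<dots> = z$1 * - (LBINT x. g x $ 1 * \<phi> x) + z$2 * - (LBINT x. g x $ 2 * \<phi> x)" using iw by (simp add: e)
 also have "\<dots> = - (LBINT x. z$1 * (g x $ 1 * \<phi> x) + z$2 * (g x $ 2 * \<phi> x))" using ig by simp
 also have "(LBINT x. z$1 * (g x $ 1 * \<phi> x) + z$2 * (g x $ 2 * \<phi> x)) = (LBINT x. (g x \<bullet> z) * \<phi> x)" by (simp add: inner_vec2 algebra_simps)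
 finally show ?thesis .
qed

lemma test_functions_translate:
 assumes "\<phi> \<in> test_functions V" "\<And>x. x \<in> V ==> x + z \<in> U"
 shows "(\<lambda>x. \<phi> (x - z)) \<in> test_functions U"
proof -
 have eq: "{x. \<phi> (x - z) \<noteq> 0} = (+) z ` {x. \<phi> x \<noteq> 0}" by (auto simp: image_iff) (metis add.commute diff_add_cancel)
 have "(\<lambda>x. \<phi> (x + - z)) \<in> C_inf" using assms by (intro C_inf_translate test_functions_C_inf)
 moreover have c: "closure {x. \<phi> (x - z) \<noteq> 0} = (+) z ` closure {x. \<phi> x \<noteq> 0}" unfolding eq by (rule closure_translation)
 moreover have "compact ((+) z ` closure {x. \<phi> x \<noteq> 0})" using assms(1) by (intro compact_translation) (simp add: test_functions_def)
 moreover have "(+) z ` closure {x. \<phi> x \<noteq> 0} \<subseteq> U" using assms by (auto simp: test_functions_def add.commute[of z])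
 ultimately show ?thesis unfolding test_functions_def mem_Collect_eq c by simp
qed

lemma C_inf_difference_integral:
 assumes \<phi>: "\<phi> \<in> C_inf"
 shows "\<phi> (x + z) - \<phi> x = (LBINT s. indicator {0..1} s * (grad \<phi> (x + s *\<^sub>R z) \<bullet> z))"
proof -
 have "(LBINT s. indicator {0..1} s *\<^sub>R (grad \<phi> (x + s *\<^sub>R z) \<bullet> z)) = \<phi> (x + 1 *\<^sub>R z) - \<phi> (x + 0 *\<^sub>R z)"
 proof (rule integral_FTC_Icc)
  show "((\<lambda>s. \<phi> (x + s *\<^sub>R z)) has_vector_derivative grad \<phi> (x + s *\<^sub>R z) \<bullet> z) (at s within {0..1})" for s
   using C_inf_line_derivative[OF \<phi>, of x z s] by (simp add: has_real_derivative_iff_has_vector_derivative has_vector_derivative_at_within)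
  show "continuous_on {0..1} (\<lambda>s. grad \<phi> (x + s *\<^sub>R z) \<bullet> z)"
   by (intro continuous_intros continuous_on_compose2[OF C_inf_continuous_grad[OF \<phi>, of UNIV]]) auto
 qed simp
 then show ?thesis by simp
qed

lemma test_functions_grad_bounded:
 assumes "\<phi> \<in> test_functions U"
 shows "\<exists>M. \<forall>x. \<bar>grad \<phi> x \<bullet> z\<bar> \<le> M"
proof -
 obtain M1 where M1: "\<And>x. \<bar>partial 1 \<phi> x\<bar> \<le> M1" using test_functions_bounded[OF test_functions_partial[OF assms]] by metis
 obtain M2 where M2: "\<And>x. \<bar>partial 2 \<phi> x\<bar> \<le> M2" using test_functions_bounded[OF test_functions_partial[OF assms]] by metis
 have "\<bar>grad \<phi> x \<bullet> z\<bar> \<le> M1 * \<bar>z$1\<bar> + M2 * \<bar>z$2\<bar>" for x unfolding inner_vec2 grad_def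
  by (rule order_trans[OF abs_triangle_ineq]) (auto simp: abs_mult intro!: add_mono mult_right_mono M1 M2)
 then show ?thesis by blast
qed

lemma C_inf_grad_measurable: "\<phi> \<in> C_inf ==> grad \<phi> \<in> borel_measurable borel"
 by (intro borel_measurable_continuous_onI C_inf_continuous_grad)

lemma integrable_indicator_Icc: "integrable lborel (indicator {a..b} :: real => real)"
 by (rule integrable_real_indicator) (auto simp: emeasure_lborel_Icc_eq)

text \<open>The fundamental theorem of calculus along parallel segments, almost everywhere. Tested
  with \<phi>, the shifts pass to \<phi>, where the formula is
  \<open>C_inf_difference_integral\<close>; the weak gradient is used for each \<open>s\<close>
  separately, and Fubini joins the pieces.\<close>

lemma H1_fun_difference:
 assumes H: "H1_fun U w g" and V: "open V" and sub: "\<And>x s. x \<in> V ==> s \<in> {0..1} ==> x + s *\<^sub>R z \<in> U"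
 shows "AE x in lborel. x \<in> V --> w (x + z) - w x = (LBINT s. indicator {0..1} s * (g (x + s *\<^sub>R z) \<bullet> z))"
proof -
 note [measurable] = H1_funD(5,6)[OF H]
 let ?I = "indicator {0..1::real} :: real => real"
 have ii: "integrable lborel ?I" by (rule integrable_indicator_Icc)
 have gz: "integrable lborel (\<lambda>x. g x \<bullet> z)" by (rule H1_funD(7)[OF H])
 have Ig: "integrable (lborel \<Otimes>\<^sub>M lborel) (\<lambda>(s, x). ?I s * ((g (x + s *\<^sub>R z) \<bullet> z) * 1))"
  by (rule integrable_shift_pair[OF ii gz, where K = 1 and L = "\<lambda>s. s *\<^sub>R z" and b = "\<lambda>_. 1"]) auto
 let ?R = "\<lambda>x. w (x + z) - w x - (LBINT s. ?I s * (g (x + s *\<^sub>R z) \<bullet> z))"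
 have Iint: "integrable lborel (\<lambda>x. LBINT s. ?I s * (g (x + s *\<^sub>R z) \<bullet> z))" using lborel_pair.integrable_snd[OF Ig] by simp
 have wz: "integrable lborel (\<lambda>x. w (x + z))" using H1_funD(1)[OF H] by (simp add: integrable_translate)
 have "AE x in lborel. x \<in> V --> ?R x = 0"
 proof (rule fundamental_lemma_calculus_of_variations[OF _ V])
  show "integrable lborel ?R" using wz Iint H1_funD(1)[OF H] by (intro Bochner_Integration.integrable_diff)
  fix \<phi> assume \<phi>: "\<phi> \<in> test_functions V"
  note \<phi>C = test_functions_C_inf[OF \<phi>]
  have [measurable]: "\<phi> \<in> borel_measurable borel" "grad \<phi> \<in> borel_measurable borel"
   using C_inf_measurable[OF \<phi>C] C_inf_grad_measurable[OF \<phi>C] by auto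
  obtain M where M: "\<And>x. \<bar>\<phi> x\<bar> \<le> M" using test_functions_bounded[OF \<phi>] by auto
  obtain M' where M': "\<And>x. \<bar>grad \<phi> x \<bullet> - z\<bar> \<le> M'" using test_functions_grad_bounded[OF \<phi>] by metis
  have 1: "integrable (lborel \<Otimes>\<^sub>M lborel) (\<lambda>(s, x). ?I s * ((g (x + s *\<^sub>R z) \<bullet> z) * \<phi> x))"
   using integrable_shift_pair[OF ii gz, where K = M and L = "\<lambda>s. s *\<^sub>R z" and b = "\<lambda>(s, x). \<phi> x"] M by auto
  have 2: "integrable (lborel \<Otimes>\<^sub>M lborel) (\<lambda>(s, x). ?I s * (w x * (grad \<phi> (x + s *\<^sub>R - z) \<bullet> - z)))"
   using integrable_shift_pair[OF ii H1_funD(1)[OF H], where K = M' and L = "\<lambda>s. 0" and b = "\<lambda>(s, x). grad \<phi> (x + s *\<^sub>R - z) \<bullet> - z"] M' by auto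
  have "(LBINT x. (LBINT s. ?I s * (g (x + s *\<^sub>R z) \<bullet> z)) * \<phi> x)
    = (LBINT x. LBINT s. ?I s * ((g (x + s *\<^sub>R z) \<bullet> z) * \<phi> x))" by (subst integral_mult_left_zero[symmetric]) (simp add: mult.assoc)
  also have "\<dots> = (LBINT s. LBINT x. ?I s * ((g (x + s *\<^sub>R z) \<bullet> z) * \<phi> x))" by (rule lborel_pair.Fubini_integral[OF 1])
  also have "\<dots> = (LBINT s. LBINT x. ?I s * (w x * (grad \<phi> (x + s *\<^sub>R - z) \<bullet> - z)))"
  proof (rule Bochner_Integration.integral_cong[OF refl])
   fix s :: real
   show "(LBINT x. ?I s * ((g (x + s *\<^sub>R z) \<bullet> z) * \<phi> x)) = (LBINT x. ?I s * (w x * (grad \<phi> (x + s *\<^sub>R - z) \<bullet> - z)))"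
   proof (cases "s \<in> {0..1}")
    case True
    \<comment> \<open>The shifted test function is supported in \<open>V + s z\<close>, which lies
      in \<open>U\<close> by \<open>sub\<close>, so the weak gradient may be tested with it.\<close>
    let ?\<psi> = "\<lambda>x. \<phi> (x - s *\<^sub>R z)"
    have \<psi>: "?\<psi> \<in> test_functions U" by (rule test_functions_translate[OF \<phi>]) (use sub True in auto)
    have gr: "grad ?\<psi> x = grad \<phi> (x - s *\<^sub>R z)" for x
     using partial_translate(1)[of \<phi> _ "- s *\<^sub>R z"] C_inf_differentiable[OF \<phi>C] by (simp add: grad_def)
    have "(LBINT x. (g (x + s *\<^sub>R z) \<bullet> z) * \<phi> x) = (LBINT x. (\<lambda>y. (g y \<bullet> z) * ?\<psi> y) (x + s *\<^sub>R z))" by simp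
    also have "\<dots> = (LBINT x. (g x \<bullet> z) * ?\<psi> x)" by (rule integral_translate) measurable
    also have "\<dots> = - (LBINT x. w x * (grad \<phi> (x - s *\<^sub>R z) \<bullet> z))" using H1_fun_weak_gradient[OF H \<psi>, of z] by (simp add: gr)
    also have "\<dots> = (LBINT x. w x * (grad \<phi> (x + s *\<^sub>R - z) \<bullet> - z))" by (simp add: integral_minus[symmetric] del: integral_minus)
    finally show ?thesis using True by simp
   qed simp
  qed
  also have "\<dots> = (LBINT x. LBINT s. ?I s * (w x * (grad \<phi> (x + s *\<^sub>R - z) \<bullet> - z)))" by (rule lborel_pair.Fubini_integral[OF 2, symmetric])
  also have "\<dots> = (LBINT x. w x * (\<phi> (x + - z) - \<phi> x))" unfolding C_inf_difference_integral[OF \<phi>C]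
   by (subst integral_mult_right_zero[symmetric]) (simp add: mult_ac)
  also have "\<dots> = (LBINT x. w x * \<phi> (x - z)) - (LBINT x. w x * \<phi> x)"
  proof -
   have "(\<lambda>x. \<phi> (x - z)) \<in> test_functions UNIV" by (rule test_functions_translate[OF \<phi>]) auto
   from test_functions_integrable_mult[OF this H1_funD(1)[OF H]] test_functions_integrable_mult[OF \<phi> H1_funD(1)[OF H]]
   show ?thesis by (simp add: right_diff_distrib)
  qed
  also have "(LBINT x. w x * \<phi> (x - z)) = (LBINT x. w (x + z) * \<phi> x)" using integral_translate[of "\<lambda>x. w x * \<phi> (x - z)" z] by simp
  finally have "(LBINT x. (LBINT s. ?I s * (g (x + s *\<^sub>R z) \<bullet> z)) * \<phi> x)
   = (LBINT x. w (x + z) * \<phi> x) - (LBINT x. w x * \<phi> x)" .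
  then show "(LBINT x. ?R x * \<phi> x) = 0" using test_functions_integrable_mult[OF \<phi> wz] test_functions_integrable_mult[OF \<phi> H1_funD(1)[OF H]]
    test_functions_integrable_mult[OF \<phi> Iint] by (simp add: left_diff_distrib)
 qed
 then show ?thesis by eventually_elim auto
qed

section \<open>The Poincare inequality on convex sets\<close>

lemma nn_integral_dilate:
 fixes F :: "real^2 => ennreal"
 assumes [measurable]: "F \<in> borel_measurable borel" and c: "c \<noteq> 0"
 shows "(\<integral>\<^sup>+x. F x \<partial>lborel) = ennreal (c^2) * (\<integral>\<^sup>+z. F (t + c *\<^sub>R z) \<partial>lborel)"
proof -
 have "(\<integral>\<^sup>+x. F x \<partial>lborel) = (\<integral>\<^sup>+x. F x \<partial>density (distr lborel borel (\<lambda>x. t + c *\<^sub>R x)) (\<lambda>_. ennreal (\<bar>c\<bar> ^ DIM(real^2))))"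
  using lborel_affine[OF c, of t] by simp
 also have "\<dots> = ennreal (c^2) * (\<integral>\<^sup>+z. F (t + c *\<^sub>R z) \<partial>lborel)"
  by (simp add: nn_integral_density nn_integral_distr nn_integral_cmult)
 finally show ?thesis .
qed

lemma square_integral_le:
 fixes f :: "'a::euclidean_space => real"
 assumes [measurable]: "f \<in> borel_measurable borel" "S \<in> sets borel"
 shows "ennreal ((LBINT y. indicator S y * f y)^2)
   \<le> emeasure lborel S * (\<integral>\<^sup>+y. indicator S y * ennreal ((f y)^2) \<partial>lborel)"
proof (cases "integrable lborel (\<lambda>y. indicator S y * f y)")
 case True
 have "ennreal \<bar>LBINT y. indicator S y * f y\<bar> \<le> (\<integral>\<^sup>+y. ennreal (norm (indicator S y * f y)) \<partial>lborel)"
  using integral_norm_bound_ennreal[OF True] by simp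
 also have "\<dots> = (\<integral>\<^sup>+y. (indicator S y * ennreal \<bar>f y\<bar>) * indicator S y \<partial>lborel)"
  by (intro nn_integral_cong) (auto simp: indicator_def)
 finally have "(ennreal \<bar>LBINT y. indicator S y * f y\<bar>)^2 \<le> (\<integral>\<^sup>+y. (indicator S y * ennreal \<bar>f y\<bar>) * indicator S y \<partial>lborel)^2"
  by (rule power_mono) simp
 also have "\<dots> \<le> (\<integral>\<^sup>+y. (indicator S y * ennreal \<bar>f y\<bar>)^2 \<partial>lborel) * (\<integral>\<^sup>+y. (indicator S y)^2 \<partial>lborel)"
  by (rule Cauchy_Schwarz_nn_integral) measurable
 also have "(\<integral>\<^sup>+y. (indicator S y * ennreal \<bar>f y\<bar>)^2 \<partial>lborel) = (\<integral>\<^sup>+y. indicator S y * ennreal ((f y)^2) \<partial>lborel)"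
  by (intro nn_integral_cong) (auto simp: indicator_def ennreal_power)
 also have "(\<integral>\<^sup>+y. (indicator S y)^2 \<partial>lborel) = emeasure lborel S"
  by (subst nn_integral_indicator[symmetric], simp, intro nn_integral_cong) (auto simp: indicator_def)
 finally show ?thesis by (simp add: ennreal_power mult.commute)
\<comment> \<open>If the product is not integrable, its Bochner integral is 0 by convention and the
  bound is trivial.\<close>
qed (simp add: not_integrable_integral_eq)

text \<open>With \<open>y = x + z\<close> and \<open>H1_fun_difference\<close> the double integral
  is bounded by \<open>d^2\<close> times integrals of the squared gradient at
  \<open>x + s z\<close>. For \<open>s \<ge> 1/2\<close> the endpoint \<open>x\<close> is kept and
  \<open>z\<close> is dilated by \<open>s\<close>; for smaller \<open>s\<close> the endpoint
  \<open>y\<close> is kept and \<open>z\<close> is dilated by \<open>s - 1\<close>. Either way the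
  Jacobian is at least 1/4, whence the factor 4. Keeping \<open>x\<close> throughout would leave the
  non-integrable factor \<open>1/s^2\<close>.\<close>

lemma poincare_pairs:
 assumes H: "H1_fun S w g" and S: "open S" "convex S" and d: "\<And>x y. x \<in> S ==> y \<in> S ==> norm (y - x) \<le> d"
 shows "(\<integral>\<^sup>+x. \<integral>\<^sup>+y. indicator S x * (indicator S y * ennreal ((w y - w x)^2)) \<partial>lborel \<partial>lborel)
   \<le> ennreal (4 * d^2) * emeasure lborel S * (\<integral>\<^sup>+y. indicator S y * ennreal ((norm (g y))^2) \<partial>lborel)"
  (is "?L \<le> ?B")
proof -
 note [measurable] = H1_funD(5,6)[OF H]
 have [measurable]: "S \<in> sets borel" using S by simp
 let ?\<chi> = "indicator S :: real^2 => ennreal" and ?I = "indicator {0..1::real} :: real => ennreal"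
 let ?G = "\<lambda>y. ennreal ((norm (g y))^2)"
 let ?h = "\<lambda>z x s. ?I s * (?\<chi> x * (?\<chi> (x + z) * (ennreal (d^2) * ?G (x + s *\<^sub>R z))))"
 have A: "(\<integral>\<^sup>+x. ?\<chi> x * (?\<chi> (x + z) * ennreal ((w (x + z) - w x)^2)) \<partial>lborel) \<le> (\<integral>\<^sup>+x. \<integral>\<^sup>+s. ?h z x s \<partial>lborel \<partial>lborel)" for z
 proof -
  let ?V = "S \<inter> (\<lambda>x. x + z) -` S"
  have V: "open ?V" by (intro open_Int S(1) open_vimage) (auto intro!: continuous_intros)
  have sub: "x + s *\<^sub>R z \<in> S" if "x \<in> ?V" "s \<in> {0..1}" for x s
  proof -
   have "(1 - s) *\<^sub>R x + s *\<^sub>R (x + z) \<in> S" using that S(2) unfolding convex_alt by auto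
   then show ?thesis by (simp add: algebra_simps)
  qed
  have "AE x in lborel. x \<in> ?V --> w (x + z) - w x = (LBINT s. indicator {0..1} s * (g (x + s *\<^sub>R z) \<bullet> z))"
   by (rule H1_fun_difference[OF H V sub])
  then have "AE x in lborel. ?\<chi> x * (?\<chi> (x + z) * ennreal ((w (x + z) - w x)^2)) \<le> (\<integral>\<^sup>+s. ?h z x s \<partial>lborel)"
  proof eventually_elim
   case (elim x)
   show ?case
   proof (cases "x \<in> ?V")
    case True
    have nz: "norm z \<le> d" using d[of x "x + z"] True by simp
    have "ennreal ((w (x + z) - w x)^2) \<le> emeasure lborel {0..1::real} * (\<integral>\<^sup>+s. ?I s * ennreal ((g (x + s *\<^sub>R z) \<bullet> z)^2) \<partial>lborel)"
     using elim True square_integral_le[of "\<lambda>s. g (x + s *\<^sub>R z) \<bullet> z" "{0..1}"] by simp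
    also have "\<dots> = (\<integral>\<^sup>+s. ?I s * ennreal ((g (x + s *\<^sub>R z) \<bullet> z)^2) \<partial>lborel)" by simp
    also have "\<dots> \<le> (\<integral>\<^sup>+s. ?h z x s \<partial>lborel)"
    proof (intro nn_integral_mono)
     fix s
     have "\<bar>g (x + s *\<^sub>R z) \<bullet> z\<bar> \<le> norm (g (x + s *\<^sub>R z)) * d"
      using Cauchy_Schwarz_ineq2[of "g (x + s *\<^sub>R z)" z] mult_left_mono[OF nz norm_ge_zero] by (rule order_trans)
     then have "(g (x + s *\<^sub>R z) \<bullet> z)^2 \<le> (norm (g (x + s *\<^sub>R z)) * d)^2" by (metis abs_ge_zero power2_abs power_mono)
     then have "ennreal ((g (x + s *\<^sub>R z) \<bullet> z)^2) \<le> ennreal (d^2) * ?G (x + s *\<^sub>R z)"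
      by (simp add: ennreal_mult[symmetric] power_mult_distrib mult.commute)
     then show "?I s * ennreal ((g (x + s *\<^sub>R z) \<bullet> z)^2) \<le> ?h z x s" using True by (auto simp: indicator_def)
    qed
    finally show ?thesis using True by simp
   qed (auto simp: indicator_def)
  qed
  then show ?thesis by (rule nn_integral_mono_AE)
 qed
 let ?E = "\<integral>\<^sup>+y. ?\<chi> y * ?G y \<partial>lborel"
 have dil: "(\<integral>\<^sup>+z. ?\<chi> (x + c *\<^sub>R z) * ?G (x + c *\<^sub>R z) \<partial>lborel) \<le> 4 * ?E" if c: "1/2 \<le> \<bar>c\<bar>" for x c
 proof -
  have c2: "1/4 \<le> c^2" using power_mono[OF c, of 2] by (simp add: power2_eq_square)
  have "?E = ennreal (c^2) * (\<integral>\<^sup>+z. ?\<chi> (x + c *\<^sub>R z) * ?G (x + c *\<^sub>R z) \<partial>lborel)"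
   by (rule nn_integral_dilate) (use c in auto)
  then have "ennreal (1/4) * (\<integral>\<^sup>+z. ?\<chi> (x + c *\<^sub>R z) * ?G (x + c *\<^sub>R z) \<partial>lborel) \<le> ?E"
   using c2 by (simp add: mult_right_mono ennreal_leI del: ennreal_divide_numeral)
  then have "4 * (ennreal (1/4) * (\<integral>\<^sup>+z. ?\<chi> (x + c *\<^sub>R z) * ?G (x + c *\<^sub>R z) \<partial>lborel)) \<le> 4 * ?E"
   by (rule mult_left_mono) simp
  moreover have "4 * ennreal (1/4) = 1" using ennreal_mult[of 4 "1/4"] by simp
  ultimately show ?thesis by (simp only: mult.assoc[symmetric] mult_1_left)
 qed
 have C: "(\<integral>\<^sup>+z. \<integral>\<^sup>+x. ?h z x s \<partial>lborel \<partial>lborel) \<le> ?I s * ?B" for s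
 proof (cases "s \<in> {0..1}")
  case s: True
  show ?thesis
  proof (cases "1/2 \<le> s")
   case True
   have "(\<integral>\<^sup>+z. \<integral>\<^sup>+x. ?h z x s \<partial>lborel \<partial>lborel) = (\<integral>\<^sup>+x. \<integral>\<^sup>+z. ?h z x s \<partial>lborel \<partial>lborel)"
    by (rule lborel_pair.Fubini') measurable
   also have "\<dots> \<le> (\<integral>\<^sup>+x. ?\<chi> x * (ennreal (d^2) * (4 * ?E)) \<partial>lborel)"
   proof (rule nn_integral_mono)
    fix x
    have "(\<integral>\<^sup>+z. ?h z x s \<partial>lborel) \<le> (\<integral>\<^sup>+z. ?\<chi> x * ennreal (d^2) * (?\<chi> (x + s *\<^sub>R z) * ?G (x + s *\<^sub>R z)) \<partial>lborel)"
    proof (rule nn_integral_mono)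
     fix z
     have "x + s *\<^sub>R z \<in> S" if "x \<in> S" "x + z \<in> S"
     proof -
      have "(1 - s) *\<^sub>R x + s *\<^sub>R (x + z) \<in> S" using that s S(2) unfolding convex_alt by auto
      then show ?thesis by (simp add: algebra_simps)
     qed
     then show "?h z x s \<le> ?\<chi> x * ennreal (d^2) * (?\<chi> (x + s *\<^sub>R z) * ?G (x + s *\<^sub>R z))" by (auto simp: indicator_def)
    qed
    also have "\<dots> = ?\<chi> x * ennreal (d^2) * (\<integral>\<^sup>+z. ?\<chi> (x + s *\<^sub>R z) * ?G (x + s *\<^sub>R z) \<partial>lborel)"
     by (rule nn_integral_cmult) measurable
    also have "\<dots> \<le> ?\<chi> x * ennreal (d^2) * (4 * ?E)" by (rule mult_left_mono[OF dil]) (use True in auto)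
    finally show "(\<integral>\<^sup>+z. ?h z x s \<partial>lborel) \<le> ?\<chi> x * (ennreal (d^2) * (4 * ?E))" by (simp add: mult.assoc)
   qed
   also have "\<dots> = ?B" by (subst nn_integral_multc) (auto simp: ennreal_mult mult_ac)
   finally show ?thesis using s by simp
  next
   \<comment> \<open>Small \<open>s\<close>: the substitution \<open>x = y - z\<close> makes the far
     endpoint the fixed one.\<close>
   case False
   have "(\<integral>\<^sup>+z. \<integral>\<^sup>+x. ?h z x s \<partial>lborel \<partial>lborel) = (\<integral>\<^sup>+z. \<integral>\<^sup>+y. ?h z (y + - z) s \<partial>lborel \<partial>lborel)"
    by (intro nn_integral_cong nn_integral_translate[symmetric]) measurable
   also have "\<dots> = (\<integral>\<^sup>+y. \<integral>\<^sup>+z. ?h z (y + - z) s \<partial>lborel \<partial>lborel)" by (rule lborel_pair.Fubini') measurable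
   also have "\<dots> \<le> (\<integral>\<^sup>+y. ?\<chi> y * (ennreal (d^2) * (4 * ?E)) \<partial>lborel)"
   proof (rule nn_integral_mono)
    fix y :: "real^2"
    let ?c = "s - 1"
    have eq: "y + - z + s *\<^sub>R z = y + ?c *\<^sub>R z" for z by (simp add: algebra_simps)
    have "(\<integral>\<^sup>+z. ?h z (y + - z) s \<partial>lborel) \<le> (\<integral>\<^sup>+z. ?\<chi> y * ennreal (d^2) * (?\<chi> (y + ?c *\<^sub>R z) * ?G (y + ?c *\<^sub>R z)) \<partial>lborel)"
    proof (rule nn_integral_mono)
     fix z
     have "y + ?c *\<^sub>R z \<in> S" if "y \<in> S" "y - z \<in> S"
     proof -
      have "(1 - s) *\<^sub>R (y - z) + s *\<^sub>R y \<in> S" using that s S(2) unfolding convex_alt by auto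
      then show ?thesis by (simp add: algebra_simps)
     qed
     then show "?h z (y + - z) s \<le> ?\<chi> y * ennreal (d^2) * (?\<chi> (y + ?c *\<^sub>R z) * ?G (y + ?c *\<^sub>R z))"
      unfolding eq by (auto simp: indicator_def)
    qed
    also have "\<dots> = ?\<chi> y * ennreal (d^2) * (\<integral>\<^sup>+z. ?\<chi> (y + ?c *\<^sub>R z) * ?G (y + ?c *\<^sub>R z) \<partial>lborel)"
     by (rule nn_integral_cmult) measurable
    also have "\<dots> \<le> ?\<chi> y * ennreal (d^2) * (4 * ?E)" by (rule mult_left_mono[OF dil]) (use False s in auto)
    finally show "(\<integral>\<^sup>+z. ?h z (y + - z) s \<partial>lborel) \<le> ?\<chi> y * (ennreal (d^2) * (4 * ?E))" by (simp add: mult.assoc)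
   qed
   also have "\<dots> = ?B" by (subst nn_integral_multc) (auto simp: ennreal_mult mult_ac)
   finally show ?thesis using s by simp
  qed
 qed simp
 have "?L = (\<integral>\<^sup>+x. \<integral>\<^sup>+z. ?\<chi> x * (?\<chi> (x + z) * ennreal ((w (x + z) - w x)^2)) \<partial>lborel \<partial>lborel)"
 proof (rule nn_integral_cong)
  fix x
  show "(\<integral>\<^sup>+y. ?\<chi> x * (?\<chi> y * ennreal ((w y - w x)^2)) \<partial>lborel) = (\<integral>\<^sup>+z. ?\<chi> x * (?\<chi> (x + z) * ennreal ((w (x + z) - w x)^2)) \<partial>lborel)"
   using nn_integral_translate[of "\<lambda>y. ?\<chi> x * (?\<chi> y * ennreal ((w y - w x)^2))" x] by (simp add: add.commute)
 qed
 also have "\<dots> = (\<integral>\<^sup>+z. \<integral>\<^sup>+x. ?\<chi> x * (?\<chi> (x + z) * ennreal ((w (x + z) - w x)^2)) \<partial>lborel \<partial>lborel)"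
  by (rule lborel_pair.Fubini') measurable
 also have "\<dots> \<le> (\<integral>\<^sup>+z. \<integral>\<^sup>+x. \<integral>\<^sup>+s. ?h z x s \<partial>lborel \<partial>lborel \<partial>lborel)"
  by (rule nn_integral_mono[OF A])
 also have "\<dots> = (\<integral>\<^sup>+z. \<integral>\<^sup>+s. \<integral>\<^sup>+x. ?h z x s \<partial>lborel \<partial>lborel \<partial>lborel)"
  by (rule nn_integral_cong, rule lborel_pair.Fubini') measurable
 also have "\<dots> = (\<integral>\<^sup>+s. \<integral>\<^sup>+z. \<integral>\<^sup>+x. ?h z x s \<partial>lborel \<partial>lborel \<partial>lborel)"
  by (rule lborel_pair.Fubini') measurable
 also have "\<dots> \<le> (\<integral>\<^sup>+s. ?I s * ?B \<partial>lborel)" by (rule nn_integral_mono[OF C])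
 also have "\<dots> = ?B" by (subst nn_integral_multc) auto
 finally show ?thesis .
qed

text \<open>The deviation of \<open>w x\<close> from the mean is the mean over \<open>y\<close> of
  \<open>w x - w y\<close>. Cauchy-Schwarz in \<open>y\<close> and \<open>poincare_pairs\<close>
  produce the area of \<open>S\<close> on both sides, so it cancels and only the diameter bound
  \<open>d\<close> enters the constant.\<close>

lemma poincare:
 assumes H: "H1_fun S w g" and S: "open S" "convex S" "bounded S" "S \<noteq> {}"
  and d: "\<And>x y. x \<in> S ==> y \<in> S ==> norm (y - x) \<le> d"
 defines "m \<equiv> (LBINT x:S. w x) / measure lborel S"
 shows "(LBINT x:S. (w x - m)^2) \<le> 4 * d^2 * (LBINT x:S. (norm (g x))^2)"
proof -
 note [measurable] = H1_funD(5,6)[OF H]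
 have [measurable]: "S \<in> sets borel" using S by simp
 let ?\<chi> = "indicator S :: real^2 => ennreal"
 let ?A = "measure lborel S"
 have fin: "emeasure lborel S < \<infinity>" by (rule emeasure_bounded_finite[OF S(3)])
 have eA: "emeasure lborel S = ennreal ?A" using fin by (simp add: emeasure_eq_ennreal_measure)
 have "?A \<noteq> 0"
 proof
  assume "?A = 0"
  then have "S \<in> null_sets lborel" using eA by auto
  then have "negligible S" by (simp add: negligible_iff_null_sets null_sets_completionI)
  then show False using open_not_negligible[OF S(1,4)] by simp
 qed
 then have A: "0 < ?A" by (simp add: zero_less_measure_iff)
 have iS: "integrable lborel (indicator S :: real^2 => real)" using fin by (intro integrable_real_indicator) auto
 have iw: "integrable lborel (\<lambda>x. indicator S x * w x)" using integrable_mult_indicator[OF _ H1_funD(1)[OF H], of S] by simp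
 have pt: "?\<chi> x * ennreal ((w x - m)^2) * ennreal ?A \<le> (\<integral>\<^sup>+y. ?\<chi> x * (?\<chi> y * ennreal ((w y - w x)^2)) \<partial>lborel)" for x
 proof -
  have "(LBINT y. indicator S y * (w y - w x)) = (LBINT y. indicator S y * w y) - ?A * w x" using iw iS by (simp add: right_diff_distrib)
  also have "\<dots> = ?A * (m - w x)" using A by (simp add: m_def set_lebesgue_integral_def field_simps)
  finally have "ennreal ((?A * (m - w x))^2) \<le> emeasure lborel S * (\<integral>\<^sup>+y. ?\<chi> y * ennreal ((w y - w x)^2) \<partial>lborel)"
   using square_integral_le[of "\<lambda>y. w y - w x" S] by simp
  also have "(?A * (m - w x))^2 = ?A * (?A * (w x - m)^2)" by (simp add: power2_eq_square algebra_simps)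
  also have "ennreal (?A * (?A * (w x - m)^2)) = ennreal ?A * ennreal (?A * (w x - m)^2)" using A by (intro ennreal_mult) auto
  finally have "ennreal ?A * ennreal (?A * (w x - m)^2) \<le> ennreal ?A * (\<integral>\<^sup>+y. ?\<chi> y * ennreal ((w y - w x)^2) \<partial>lborel)"
   by (simp add: eA)
  then have "ennreal (?A * (w x - m)^2) \<le> (\<integral>\<^sup>+y. ?\<chi> y * ennreal ((w y - w x)^2) \<partial>lborel)"
   using A by (subst (asm) ennreal_mult_le_mult_iff) auto
  then have "?\<chi> x * ennreal (?A * (w x - m)^2) \<le> ?\<chi> x * (\<integral>\<^sup>+y. ?\<chi> y * ennreal ((w y - w x)^2) \<partial>lborel)"
   by (rule mult_left_mono) simp
  also have "\<dots> = (\<integral>\<^sup>+y. ?\<chi> x * (?\<chi> y * ennreal ((w y - w x)^2)) \<partial>lborel)"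
   by (rule nn_integral_cmult[symmetric]) measurable
  finally show ?thesis using A by (simp add: ennreal_mult mult_ac)
 qed
 let ?E = "\<integral>\<^sup>+y. ?\<chi> y * ennreal ((norm (g y))^2) \<partial>lborel"
 have "(\<integral>\<^sup>+x. ?\<chi> x * ennreal ((w x - m)^2) \<partial>lborel) * ennreal ?A = (\<integral>\<^sup>+x. ?\<chi> x * ennreal ((w x - m)^2) * ennreal ?A \<partial>lborel)"
  by (rule nn_integral_multc[symmetric]) measurable
 also have "\<dots> \<le> (\<integral>\<^sup>+x. \<integral>\<^sup>+y. ?\<chi> x * (?\<chi> y * ennreal ((w y - w x)^2)) \<partial>lborel \<partial>lborel)"
  by (rule nn_integral_mono[OF pt])
 also have "\<dots> \<le> ennreal (4 * d^2) * emeasure lborel S * ?E" by (rule poincare_pairs[OF H S(1,2) d])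
 finally have "ennreal ?A * (\<integral>\<^sup>+x. ?\<chi> x * ennreal ((w x - m)^2) \<partial>lborel) \<le> ennreal ?A * (ennreal (4 * d^2) * ?E)"
  by (simp add: eA mult_ac)
 then have le: "(\<integral>\<^sup>+x. ?\<chi> x * ennreal ((w x - m)^2) \<partial>lborel) \<le> ennreal (4 * d^2) * ?E"
  using A by (subst (asm) ennreal_mult_le_mult_iff) auto
 have ind: "?\<chi> x * ennreal a = ennreal (indicator S x * a)" for x a by (simp add: indicator_def)
 have ig: "integrable lborel (\<lambda>x. indicator S x * (norm (g x))^2)" using integrable_mult_indicator[OF _ H1_funD(4)[OF H], of S] by simp
 have iw2: "integrable lborel (\<lambda>x. indicator S x * (w x - m)^2)"
 proof -
  have "integrable lborel (\<lambda>x. indicator S x * (w x)^2 - 2 * m * (indicator S x * w x) + m^2 * indicator S x)"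
   using integrable_mult_indicator[OF _ H1_funD(2)[OF H], of S] iw iS by simp
  then show ?thesis by (simp add: power2_diff algebra_simps)
 qed
 have "ennreal (LBINT x:S. (w x - m)^2) = (\<integral>\<^sup>+x. ?\<chi> x * ennreal ((w x - m)^2) \<partial>lborel)"
  unfolding ind set_lebesgue_integral_def using nn_integral_eq_integral[OF iw2] by simp
 also note le
 also have "?E = ennreal (LBINT x:S. (norm (g x))^2)" unfolding ind set_lebesgue_integral_def using nn_integral_eq_integral[OF ig] by simp
 finally show ?thesis by (simp add: ennreal_mult''[symmetric] set_lebesgue_integral_def)
qed

section \<open>Mollification\<close>

text \<open>The kernel is evaluated at \<open>u - x\<close>, so that the value at \<open>x\<close>
  is the average of \<open>f (x + v)\<close> with weight \<open>\<kappa> v\<close>; averages over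
  shifts are what the comparison of edge moments uses.\<close>

definition conv :: "(real^2 => real) => (real^2 => 'b::{banach, second_countable_topology}) => real^2 => 'b" where
 "conv \<kappa> f x = (LBINT u. \<kappa> (u - x) *\<^sub>R f u)"

lemma
 assumes \<kappa>: "\<kappa> \<in> test_functions UNIV" and f: "integrable lborel f"
 shows conv_integrable: "integrable lborel (\<lambda>u. \<kappa> (u - x) *\<^sub>R f u)"
  and conv_continuous: "continuous_on S (conv \<kappa> f)"
proof -
 note \<kappa>C = test_functions_C_inf[OF \<kappa>]
 have [measurable]: "\<kappa> \<in> borel_measurable borel" by (rule C_inf_measurable[OF \<kappa>C])
 have [measurable]: "f \<in> borel_measurable borel" using f by auto
 obtain M where M: "\<And>x. \<bar>\<kappa> x\<bar> \<le> M" using test_functions_bounded[OF \<kappa>] by auto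
 have dom: "integrable lborel (\<lambda>u. M * norm (f u))" using f by simp
 have bnd: "norm (\<kappa> (u - x) *\<^sub>R f u) \<le> M * norm (f u)" for u x using M by (simp add: mult_right_mono)
 show "integrable lborel (\<lambda>u. \<kappa> (u - x) *\<^sub>R f u)"
  by (rule Bochner_Integration.integrable_bound[OF dom]) (simp, intro AE_I2, metis bnd order_trans abs_ge_self real_norm_def)
 have "isCont (conv \<kappa> f) x" for x unfolding continuous_at_sequentially
 proof (intro allI impI)
  fix X :: "nat => real^2" assume X: "X \<longlonglongrightarrow> x"
  have "(\<lambda>n. LBINT u. \<kappa> (u - X n) *\<^sub>R f u) \<longlonglongrightarrow> (LBINT u. \<kappa> (u - x) *\<^sub>R f u)"
  proof (rule integral_dominated_convergence[where w = "\<lambda>u. M * norm (f u)"])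
   show "AE u in lborel. (\<lambda>n. \<kappa> (u - X n) *\<^sub>R f u) \<longlonglongrightarrow> \<kappa> (u - x) *\<^sub>R f u"
   proof (rule AE_I2)
    fix u
    have "isCont \<kappa> (u - x)" using C_inf_continuous[OF \<kappa>C, of UNIV] by (simp add: continuous_on_eq_continuous_at)
    then have "(\<lambda>n. \<kappa> (u - X n)) \<longlonglongrightarrow> \<kappa> (u - x)" by (rule isCont_tendsto_compose) (intro tendsto_intros X)
    then show "(\<lambda>n. \<kappa> (u - X n) *\<^sub>R f u) \<longlonglongrightarrow> \<kappa> (u - x) *\<^sub>R f u" by (intro tendsto_intros)
   qed
  qed (use dom bnd in auto)
  then show "(conv \<kappa> f \<circ> X) \<longlonglongrightarrow> conv \<kappa> f x" by (simp add: o_def conv_def)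
 qed
 then show "continuous_on S (conv \<kappa> f)" by (simp add: continuous_at_imp_continuous_on)
qed

lemma conv_inner:
 fixes g :: "real^2 => real^2"
 assumes "\<kappa> \<in> test_functions UNIV" "integrable lborel g"
 shows "conv \<kappa> g x \<bullet> z = conv \<kappa> (\<lambda>u. g u \<bullet> z) x"
 unfolding conv_def using integral_inner_left[OF conv_integrable[OF assms, of x], of z] by simp

lemma conv_shift:
 fixes f :: "real^2 => real"
 assumes [measurable]: "\<kappa> \<in> borel_measurable borel" "f \<in> borel_measurable borel"
 shows "conv \<kappa> f (x + z) = (LBINT u. \<kappa> (u - x) * f (u + z))"
  and "conv \<kappa> f x = (LBINT v. \<kappa> v * f (x + v))"
proof -
 have "(LBINT u. (\<lambda>y. \<kappa> (y - (x + z)) * f y) (u + z)) = (LBINT u. \<kappa> (u - (x + z)) * f u)" by (rule integral_translate) measurable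
 then show "conv \<kappa> f (x + z) = (LBINT u. \<kappa> (u - x) * f (u + z))" by (simp add: conv_def algebra_simps)
 have "(LBINT u. (\<lambda>y. \<kappa> (y - x) * f y) (u + x)) = (LBINT u. \<kappa> (u - x) * f u)" by (rule integral_translate) measurable
 then show "conv \<kappa> f x = (LBINT v. \<kappa> v * f (x + v))" by (simp add: conv_def add.commute)
qed

text \<open>Averaging over \<open>u\<close> absorbs the null set excluded in
  \<open>H1_fun_difference\<close>, so the formula becomes valid at every point whose segment,
  thickened by the support of \<kappa>, stays in \<open>U\<close>.\<close>

lemma conv_difference:
 assumes H: "H1_fun U w g" and \<kappa>: "\<kappa> \<in> test_functions B" and B: "open B"
  and sub: "\<And>s v. s \<in> {0..1} ==> v \<in> B ==> x + s *\<^sub>R z + v \<in> U"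
 shows "conv \<kappa> w (x + z) - conv \<kappa> w x = (LBINT s. indicator {0..1} s * (conv \<kappa> g (x + s *\<^sub>R z) \<bullet> z))"
proof -
 have \<kappa>1: "\<kappa> \<in> test_functions UNIV" using test_functions_mono[OF subset_UNIV \<kappa>] .
 note \<kappa>C = test_functions_C_inf[OF \<kappa>]
 note [measurable] = H1_funD(5,6)[OF H] C_inf_measurable[OF \<kappa>C]
 let ?I = "indicator {0..1::real} :: real => real"
 obtain M where M: "\<And>x. \<bar>\<kappa> x\<bar> \<le> M" using test_functions_bounded[OF \<kappa>] by auto
 let ?V = "(\<lambda>u. u - x) -` B"
 have V: "open ?V" by (intro open_vimage B) (auto intro!: continuous_intros)
 have ae: "AE u in lborel. u \<in> ?V --> w (u + z) - w u = (LBINT s. ?I s * (g (u + s *\<^sub>R z) \<bullet> z))"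
 proof (rule H1_fun_difference[OF H V])
  fix u s assume "u \<in> ?V" "s \<in> {0..1::real}"
  then show "u + s *\<^sub>R z \<in> U" using sub[of s "u - x"] by (simp add: algebra_simps)
 qed
 have fz: "integrable lborel (\<lambda>u. \<kappa> (u - x) * w (u + z))"
  using conv_integrable[OF \<kappa>1, of "\<lambda>u. w (u + z)" x] H1_funD(1)[OF H] by (simp add: integrable_translate)
 have "conv \<kappa> w (x + z) - conv \<kappa> w x = (LBINT u. \<kappa> (u - x) * w (u + z)) - (LBINT u. \<kappa> (u - x) * w u)"
  unfolding conv_shift(1)[OF C_inf_measurable[OF \<kappa>C] H1_funD(5)[OF H]] by (simp add: conv_def)
 also have "\<dots> = (LBINT u. \<kappa> (u - x) * (w (u + z) - w u))"
  using fz conv_integrable[OF \<kappa>1 H1_funD(1)[OF H], of x] by (simp add: right_diff_distrib)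
 also have "\<dots> = (LBINT u. LBINT s. ?I s * ((g (u + s *\<^sub>R z) \<bullet> z) * \<kappa> (u - x)))"
 proof (rule integral_cong_AE)
  show "AE u in lborel. \<kappa> (u - x) * (w (u + z) - w u) = (LBINT s. ?I s * ((g (u + s *\<^sub>R z) \<bullet> z) * \<kappa> (u - x)))" using ae
  proof eventually_elim
   case (elim u)
   have "(LBINT s. ?I s * ((g (u + s *\<^sub>R z) \<bullet> z) * \<kappa> (u - x))) = (LBINT s. ?I s * (g (u + s *\<^sub>R z) \<bullet> z)) * \<kappa> (u - x)"
    by (subst integral_mult_left_zero[symmetric]) (simp add: mult.assoc)
   then show ?case using elim test_functions_zero_outside[OF \<kappa>, of "u - x"] by (cases "u \<in> ?V") auto
  qed
 qed measurable
 also have "\<dots> = (LBINT s. LBINT u. ?I s * ((g (u + s *\<^sub>R z) \<bullet> z) * \<kappa> (u - x)))"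
 proof (rule lborel_pair.Fubini_integral)
  show "integrable (lborel \<Otimes>\<^sub>M lborel) (\<lambda>(s, u). ?I s * ((g (u + s *\<^sub>R z) \<bullet> z) * \<kappa> (u - x)))"
   using integrable_shift_pair[OF integrable_indicator_Icc H1_funD(7)[OF H, of z], where K = M and L = "\<lambda>s. s *\<^sub>R z" and b = "\<lambda>(s, u). \<kappa> (u - x)"] M by auto
 qed
 also have "\<dots> = (LBINT s. ?I s * (conv \<kappa> g (x + s *\<^sub>R z) \<bullet> z))"
 proof (rule Bochner_Integration.integral_cong[OF refl])
  fix s :: real
  show "(LBINT u. ?I s * ((g (u + s *\<^sub>R z) \<bullet> z) * \<kappa> (u - x))) = ?I s * (conv \<kappa> g (x + s *\<^sub>R z) \<bullet> z)"
   unfolding conv_inner[OF \<kappa>1 H1_funD(3)[OF H]]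
   using conv_shift(1)[of \<kappa> "\<lambda>u. g u \<bullet> z" x "s *\<^sub>R z"] by (simp add: mult.commute)
 qed
 finally show ?thesis .
qed

text \<open>The remainder \<open>W y - W x - G x \<bullet> (y - x)\<close> is the mean over the
  segment of increments of \<open>G\<close>, small by continuity. This replaces differentiation
  under the integral for mollified functions.\<close>

lemma C1_on_of_difference:
 assumes T: "convex T" and G: "continuous_on UNIV G"
  and diff: "\<And>x y. x \<in> T ==> y \<in> T ==> W y - W x = (LBINT s. indicator {0..1} s * (G (x + s *\<^sub>R (y - x)) \<bullet> (y - x)))"
 shows "C1_on T W G"
 unfolding C1_on_def
proof (intro conjI ballI)
 show "continuous_on T G" using G continuous_on_subset by blast
 fix x assume x: "x \<in> T"
 show "(W has_derivative (\<lambda>h. G x \<bullet> h)) (at x within T)" unfolding has_derivative_within_alt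
 proof (intro conjI allI impI)
  show "bounded_linear (\<lambda>h. G x \<bullet> h)" by (rule bounded_linear_inner_right)
  fix e :: real assume e: "0 < e"
  obtain d where d: "d > 0" "\<And>y. dist y x < d ==> dist (G y) (G x) < e" using G e unfolding continuous_on_iff by (metis UNIV_I)
  have "norm (W y - W x - G x \<bullet> (y - x)) \<le> e * norm (y - x)" if y: "y \<in> T" "norm (y - x) < d" for y
  proof -
   have ci: "set_integrable lborel {0..1} (\<lambda>s. G (x + s *\<^sub>R (y - x)) \<bullet> (y - x))" unfolding set_integrable_def
    by (rule borel_integrable_compact) (auto intro!: continuous_intros continuous_on_compose2[OF G])
   have c1: "set_integrable lborel {0..1} (\<lambda>s::real. c)" for c :: real unfolding set_integrable_def by (rule borel_integrable_compact) auto
   have l1: "(LINT s:{0..1::real}|lborel. c) = c" for c :: real by (simp add: set_lebesgue_integral_def)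
   have "W y - W x - G x \<bullet> (y - x) = (LINT s:{0..1}|lborel. G (x + s *\<^sub>R (y - x)) \<bullet> (y - x)) - (LINT s:{0..1::real}|lborel. G x \<bullet> (y - x))"
    using diff[OF x y(1)] unfolding l1 by (simp add: set_lebesgue_integral_def)
   also have "\<dots> = (LINT s:{0..1}|lborel. G (x + s *\<^sub>R (y - x)) \<bullet> (y - x) - G x \<bullet> (y - x))"
    by (rule set_integral_diff(2)[OF ci c1, symmetric])
   finally have eq: "W y - W x - G x \<bullet> (y - x) = (LINT s:{0..1}|lborel. G (x + s *\<^sub>R (y - x)) \<bullet> (y - x) - G x \<bullet> (y - x))" .
   have "norm (W y - W x - G x \<bullet> (y - x)) \<le> (LINT s:{0..1}|lborel. \<bar>G (x + s *\<^sub>R (y - x)) \<bullet> (y - x) - G x \<bullet> (y - x)\<bar>)"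
    using integral_norm_bound[of lborel "\<lambda>s. indicator {0..1} s *\<^sub>R (G (x + s *\<^sub>R (y - x)) \<bullet> (y - x) - G x \<bullet> (y - x))"]
    unfolding eq set_lebesgue_integral_def by (simp add: abs_mult)
   also have "\<dots> \<le> (LINT s:{0..1::real}|lborel. e * norm (y - x))"
   proof (rule set_integral_mono)
    show "set_integrable lborel {0..1} (\<lambda>s. \<bar>G (x + s *\<^sub>R (y - x)) \<bullet> (y - x) - G x \<bullet> (y - x)\<bar>)"
     by (intro set_integrable_abs set_integral_diff(1) ci c1)
    fix s :: real assume s: "s \<in> {0..1}"
    have "dist (x + s *\<^sub>R (y - x)) x \<le> norm (y - x)" using s by (simp add: dist_norm mult_left_le_one_le)
    then have "dist (G (x + s *\<^sub>R (y - x))) (G x) < e" using d(2) y(2) by force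
    then have "norm (G (x + s *\<^sub>R (y - x)) - G x) \<le> e" by (simp add: dist_norm)
    then have "norm (G (x + s *\<^sub>R (y - x)) - G x) * norm (y - x) \<le> e * norm (y - x)" by (rule mult_right_mono) simp
    then show "\<bar>G (x + s *\<^sub>R (y - x)) \<bullet> (y - x) - G x \<bullet> (y - x)\<bar> \<le> e * norm (y - x)"
     using Cauchy_Schwarz_ineq2[of "G (x + s *\<^sub>R (y - x)) - G x" "y - x"] by (simp add: inner_diff_left)
   qed (rule c1)
   finally show ?thesis by (simp add: l1)
  qed
  then show "\<exists>d>0. \<forall>y\<in>T. norm (y - x) < d --> norm (W y - W x - G x \<bullet> (y - x)) \<le> e * norm (y - x)" using d(1) by blast
 qed
qed

section \<open>Equality of edge moments from both sides of an edge\<close>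

text \<open>A moment over \<open>T\<close> as a function of a shift of \<open>f\<close>. Moments of
  mollified functions are averages of it, and the moment itself is its value at 0.\<close>

definition shift_mom :: "(real^2) set => (real^2 => real) => (real^2 => real) => real^2 => real" where
 "shift_mom T \<beta> f v = (LBINT x:T. \<beta> x * f (x + v))"

lemma
 assumes T: "compact T" and \<beta>: "continuous_on UNIV \<beta>" and f: "integrable lborel f" and \<kappa>: "\<kappa> \<in> test_functions UNIV"
 shows shift_mom_conv: "(LBINT x:T. \<beta> x * conv \<kappa> f x) = (LBINT v. \<kappa> v * shift_mom T \<beta> f v)"
  and shift_mom_integrable: "integrable lborel (\<lambda>v. \<kappa> v * shift_mom T \<beta> f v)"
proof -
 note \<kappa>C = test_functions_C_inf[OF \<kappa>]
 have [measurable]: "f \<in> borel_measurable borel" "\<beta> \<in> borel_measurable borel" "\<kappa> \<in> borel_measurable borel" "T \<in> sets borel"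
  using f C_inf_measurable[OF \<kappa>C] borel_measurable_continuous_onI[OF \<beta>] T by (auto simp: borel_compact)
 have "compact (\<beta> ` T)" using T \<beta> by (intro compact_continuous_image) (auto intro: continuous_on_subset)
 then obtain K where K: "\<And>y. y \<in> \<beta> ` T ==> norm y \<le> K" using compact_imp_bounded bounded_iff by metis
 have b: "\<bar>indicator T x * \<beta> x\<bar> \<le> max K 0" for x using K[of "\<beta> x"] by (auto simp: indicator_def le_max_iff_disj)
 have \<kappa>i: "integrable lborel \<kappa>"
 proof -
  let ?S = "closure {x. \<kappa> x \<noteq> 0}"
  have "integrable lborel (\<lambda>x. indicator ?S x *\<^sub>R \<kappa> x)"
   using \<kappa> by (intro borel_integrable_compact C_inf_continuous[OF \<kappa>C]) (simp add: test_functions_def)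
  moreover have "(\<lambda>x. indicator ?S x *\<^sub>R \<kappa> x) = \<kappa>"
   using closure_subset[of "{x. \<kappa> x \<noteq> 0}"] by (auto simp: indicator_def fun_eq_iff)
  ultimately show ?thesis by simp
 qed
 have i: "integrable (lborel \<Otimes>\<^sub>M lborel) (\<lambda>(v, x). \<kappa> v * (f (x + v) * (indicator T x * \<beta> x)))"
  using integrable_shift_pair[OF \<kappa>i f, where L = "\<lambda>v. v" and b = "\<lambda>(v, x). indicator T x * \<beta> x" and K = "max K 0"] b by auto
 have e: "(LBINT x. \<kappa> v * (f (x + v) * (indicator T x * \<beta> x))) = \<kappa> v * shift_mom T \<beta> f v" for v
  unfolding shift_mom_def set_lebesgue_integral_def by (subst integral_mult_right_zero[symmetric]) (simp add: mult_ac)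
 show "integrable lborel (\<lambda>v. \<kappa> v * shift_mom T \<beta> f v)" using lborel_pair.integrable_fst'[OF i] by (simp only: prod.case e)
 have "(LBINT x:T. \<beta> x * conv \<kappa> f x) = (LBINT x. LBINT v. \<kappa> v * (f (x + v) * (indicator T x * \<beta> x)))" unfolding set_lebesgue_integral_def
 proof (rule Bochner_Integration.integral_cong[OF refl])
  fix x
  have "(LBINT v. \<kappa> v * (f (x + v) * (indicator T x * \<beta> x))) = (LBINT v. \<kappa> v * f (x + v)) * (indicator T x * \<beta> x)"
   by (subst integral_mult_left_zero[symmetric]) (simp add: mult.assoc)
  then show "indicator T x *\<^sub>R (\<beta> x * conv \<kappa> f x) = (LBINT v. \<kappa> v * (f (x + v) * (indicator T x * \<beta> x)))"
   by (simp add: conv_shift(2)[of \<kappa> f x])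
 qed
 also have "\<dots> = (LBINT v. LBINT x. \<kappa> v * (f (x + v) * (indicator T x * \<beta> x)))" by (rule lborel_pair.Fubini_integral[OF i])
 finally show "(LBINT x:T. \<beta> x * conv \<kappa> f x) = (LBINT v. \<kappa> v * shift_mom T \<beta> f v)" unfolding e .
qed

lemma AE_not_frontier_convex:
 assumes "convex (S :: (real^2) set)"
 shows "AE x in lborel. x \<notin> frontier S"
proof -
 have "frontier S \<in> null_sets lebesgue" using negligible_convex_frontier[OF assms] by (simp add: negligible_iff_null_sets)
 then have "frontier S \<in> null_sets lborel" by (simp add: null_sets_completion_iff)
 then show ?thesis by (rule AE_not_in)
qed

text \<open>A translation moves the shift from \<open>f\<close> to the weight, which is cut off to
  \<open>T\<close>. The shifted weights converge off the frontier of \<open>T\<close>, a null set by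
  convexity, so dominated convergence works for \<open>f\<close> that is merely integrable.\<close>

lemma shift_mom_continuous:
 assumes T: "compact T" "convex T" and \<beta>: "continuous_on UNIV \<beta>" and f: "integrable lborel f"
 shows "isCont (shift_mom T \<beta> f) 0"
 unfolding continuous_at_sequentially
proof (intro allI impI)
 fix X :: "nat => real^2" assume X: "X \<longlonglongrightarrow> 0"
 have [measurable]: "f \<in> borel_measurable borel" "\<beta> \<in> borel_measurable borel" "T \<in> sets borel"
  using f borel_measurable_continuous_onI[OF \<beta>] T by (auto simp: borel_compact)
 have "compact (\<beta> ` T)" using T \<beta> by (intro compact_continuous_image) (auto intro: continuous_on_subset)
 then obtain K where K: "\<And>y. y \<in> \<beta> ` T ==> norm y \<le> K" using compact_imp_bounded bounded_iff by metis
 have b: "\<bar>indicator T x * \<beta> x\<bar> \<le> max K 0" for x using K[of "\<beta> x"] by (auto simp: indicator_def le_max_iff_disj)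
 have e: "shift_mom T \<beta> f v = (LBINT y. indicator T (y - v) * \<beta> (y - v) * f y)" for v
 proof -
  have "(LBINT x. (\<lambda>y. indicator T (y - v) * \<beta> (y - v) * f y) (x + v)) = (LBINT y. indicator T (y - v) * \<beta> (y - v) * f y)"
   by (rule integral_translate) measurable
  then show ?thesis by (simp add: shift_mom_def set_lebesgue_integral_def mult.assoc)
 qed
 have "(\<lambda>n. LBINT y. indicator T (y - X n) * \<beta> (y - X n) * f y) \<longlonglongrightarrow> (LBINT y. indicator T (y - 0) * \<beta> (y - 0) * f y)"
 proof (rule integral_dominated_convergence[where w = "\<lambda>y. max K 0 * norm (f y)"])
  show "integrable lborel (\<lambda>y. max K 0 * norm (f y))" using f by simp
  show "AE y in lborel. norm (indicator T (y - X n) * \<beta> (y - X n) * f y) \<le> max K 0 * norm (f y)" for n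
   unfolding norm_mult[of "indicator T _ * \<beta> _"] using mult_right_mono[OF b abs_ge_zero] by (intro AE_I2) simp
  show "AE y in lborel. (\<lambda>n. indicator T (y - X n) * \<beta> (y - X n) * f y) \<longlonglongrightarrow> indicator T (y - 0) * \<beta> (y - 0) * f y"
   using AE_not_frontier_convex[OF T(2)]
  proof eventually_elim
   case (elim y)
   have yX: "(\<lambda>n. y - X n) \<longlonglongrightarrow> y - 0" by (intro tendsto_intros X)
   have "isCont \<beta> (y - 0)" using \<beta> by (simp add: continuous_on_eq_continuous_at)
   then have 1: "(\<lambda>n. \<beta> (y - X n)) \<longlonglongrightarrow> \<beta> (y - 0)" by (rule isCont_tendsto_compose[OF _ yX])
   have 2: "(\<lambda>n. indicator T (y - X n) :: real) \<longlonglongrightarrow> indicator T (y - 0)"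
   proof (cases "y \<in> interior T")
    case True
    then have "\<forall>\<^sub>F n in sequentially. y - X n \<in> interior T"
     using yX topological_tendstoD[of "\<lambda>n. y - X n" y sequentially "interior T"] by auto
    then have "\<forall>\<^sub>F n in sequentially. (indicator T (y - X n) :: real) = indicator T (y - 0)"
     by eventually_elim (use True interior_subset in \<open>auto simp: indicator_def\<close>)
    then show ?thesis by (rule tendsto_eventually)
   next
    case False
    then have yT: "y \<in> - T" using elim T(1) by (auto simp: frontier_def compact_imp_closed)
    moreover have "open (- T)" using T(1) by (simp add: compact_imp_closed open_Compl)
    ultimately have "\<forall>\<^sub>F n in sequentially. y - X n \<in> - T" using yX topological_tendstoD[of "\<lambda>n. y - X n" y sequentially "- T"] by auto
    then have "\<forall>\<^sub>F n in sequentially. (indicator T (y - X n) :: real) = indicator T (y - 0)"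
     by eventually_elim (use yT in \<open>auto simp: indicator_def\<close>)
    then show ?thesis by (rule tendsto_eventually)
   qed
   show ?case by (intro tendsto_mult 1 2 tendsto_const)
  qed
 qed measurable
 then show "(shift_mom T \<beta> f \<circ> X) \<longlonglongrightarrow> shift_mom T \<beta> f 0" by (simp add: o_def e)
qed

lemma edge_mom_eq_shift_mom:
 assumes nz: "dbl_area A B C \<noteq> 0"
  and w: "set_integrable lborel (convex hull {A, B, C}) (\<lambda>x. w (x + v))"
  and g: "set_integrable lborel (convex hull {A, B, C}) (\<lambda>x. g (x + v))"
 shows "edge_mom A B C (\<lambda>x. w (x + v)) (\<lambda>x. g (x + v)) =
  (shift_mom (convex hull {A, B, C}) (bary A B C) (\<lambda>x. g x \<bullet> (A - C)) v
   + shift_mom (convex hull {A, B, C}) (\<lambda>_. 1) w v) / \<bar>dbl_area A B C\<bar>"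
proof -
 have "set_integrable lborel (convex hull {A, B, C}) (\<lambda>x. bary A B C x * (g (x + v) \<bullet> (A - C)))"
  using bary_bounds[OF nz] by (intro set_integrable_mult_bounded[where K = 1] set_integrable_inner g) auto
 from set_integral_add(2)[OF this w] show ?thesis by (simp add: edge_mom_def shift_mom_def)
qed

lemma integrable_imp_set_integrable:
 fixes f :: "real^2 => 'b::{banach, second_countable_topology}"
 shows "integrable lborel f ==> T \<in> sets borel ==> set_integrable lborel T f"
 unfolding set_integrable_def by (rule integrable_mult_indicator) auto

lemma convex_triangle: "convex (convex hull {A, B, C :: real^2})"
 by (rule convex_convex_hull)

lemma triangle_borel [measurable, simp]: "convex hull {A, B, C :: real^2} \<in> sets borel"
 using compact_triangle by (rule borel_compact)

text \<open>For mollified functions both moments are the same integral over \<open>AB\<close> by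
  \<open>edge_mom_C1\<close>. Hence \<open>F C\<close> and \<open>F C'\<close>, the moments as
  functions of a shift, have equal averages against every kernel supported near 0, and both are
  continuous at 0. The compact inclusion in the open set \<open>U\<close> gives the radius
  \<open>e\<close> available for kernels.\<close>

lemma edge_mom_interface_compact:
 assumes H: "H1_fun U w g" and U: "open U"
  and nz: "dbl_area A B C \<noteq> 0" "dbl_area A B C' \<noteq> 0"
  and sub: "convex hull {A, B, C} \<union> convex hull {A, B, C'} \<subseteq> U"
 shows "edge_mom A B C w g = edge_mom A B C' w g"
proof -
 note int = H1_funD(1,3)[OF H]
 note [measurable] = H1_funD(5,6)[OF H]
 define F where "F c v = (shift_mom (convex hull {A, B, c}) (bary A B c) (\<lambda>x. g x \<bullet> (A - c)) v
   + shift_mom (convex hull {A, B, c}) (\<lambda>_. 1) w v) / \<bar>dbl_area A B c\<bar>" for c v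
 have F0: "edge_mom A B c w g = F c 0" if "dbl_area A B c \<noteq> 0" for c
  using edge_mom_eq_shift_mom[OF that, of w 0 g] int by (simp add: F_def integrable_imp_set_integrable)
 have cF: "isCont (F c) 0" if "dbl_area A B c \<noteq> 0" for c unfolding F_def
  by (intro continuous_intros shift_mom_continuous compact_triangle convex_triangle continuous_on_bary continuous_on_id
    int(1) H1_funD(7)[OF H]) (use that in auto)
 obtain e where e: "e > 0" "(\<Union>x\<in>convex hull {A, B, C} \<union> convex hull {A, B, C'}. ball x e) \<subseteq> U"
  by (rule compact_subset_open_imp_ball_epsilon_subset[OF compact_Un[OF compact_triangle compact_triangle] U sub]) (rule that)
 have inU: "x + v \<in> U" if "x \<in> convex hull {A, B, C} \<union> convex hull {A, B, C'}" "norm v < e" for x v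
 proof -
  have "x + v \<in> ball x e" using that(2) by (simp add: dist_norm)
  then show ?thesis using e(2) that(1) by blast
 qed
 have key: "(LBINT v. \<kappa> v * F C v) = (LBINT v. \<kappa> v * F C' v)" "integrable lborel (\<lambda>v. \<kappa> v * F c v)"
  if \<kappa>: "\<kappa> \<in> test_functions (ball 0 e)" for \<kappa> c
 proof -
  have \<kappa>1: "\<kappa> \<in> test_functions UNIV" using test_functions_mono[OF subset_UNIV \<kappa>] .
  have cg: "continuous_on UNIV (conv \<kappa> g)" by (rule conv_continuous[OF \<kappa>1 int(2)])
  have cw: "continuous_on UNIV (conv \<kappa> w)" by (rule conv_continuous[OF \<kappa>1 int(1)])
  have Fint: "integrable lborel (\<lambda>v. \<kappa> v * F c v)"
   and Feq: "dbl_area A B c \<noteq> 0 ==> (LBINT v. \<kappa> v * F c v) = edge_mom A B c (conv \<kappa> w) (conv \<kappa> g)" for c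
  proof -
   let ?T = "convex hull {A, B, c}"
   have c1: "continuous_on UNIV (\<lambda>_::real^2. 1::real)" by simp
   have cb: "continuous_on UNIV (bary A B c)" by (intro continuous_on_bary continuous_on_id)
   note i1 = shift_mom_integrable[OF compact_triangle c1 int(1) \<kappa>1, of A B c]
   note i2 = shift_mom_integrable[OF compact_triangle cb H1_funD(7)[OF H] \<kappa>1, of A B c "A - c"]
   have eq: "\<kappa> v * F c v = (\<kappa> v * shift_mom ?T (bary A B c) (\<lambda>x. g x \<bullet> (A - c)) v + \<kappa> v * shift_mom ?T (\<lambda>_. 1) w v) / \<bar>dbl_area A B c\<bar>" for v
    by (simp add: F_def algebra_simps)
   show "integrable lborel (\<lambda>v. \<kappa> v * F c v)" unfolding eq using i1 i2 by (intro integrable_divide Bochner_Integration.integrable_add)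
   assume nz: "dbl_area A B c \<noteq> 0"
   have "(LBINT v. \<kappa> v * F c v) = ((LBINT x:?T. bary A B c x * (conv \<kappa> g x \<bullet> (A - c))) + (LBINT x:?T. conv \<kappa> w x)) / \<bar>dbl_area A B c\<bar>"
    unfolding eq using i1 i2 shift_mom_conv[OF compact_triangle c1 int(1) \<kappa>1, of A B c]
     shift_mom_conv[OF compact_triangle cb H1_funD(7)[OF H] \<kappa>1, of A B c "A - c"] by (simp add: conv_inner[OF \<kappa>1 int(2)])
   also have "(LBINT x:?T. bary A B c x * (conv \<kappa> g x \<bullet> (A - c))) + (LBINT x:?T. conv \<kappa> w x)
     = (LBINT x:?T. bary A B c x * (conv \<kappa> g x \<bullet> (A - c)) + conv \<kappa> w x)"
    by (intro set_integral_add(2)[symmetric] set_integrable_continuous_compact compact_triangle continuous_intros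
      continuous_on_subset[OF cg] continuous_on_subset[OF cw]) auto
   finally show "(LBINT v. \<kappa> v * F c v) = edge_mom A B c (conv \<kappa> w) (conv \<kappa> g)" by (simp add: edge_mom_def)
  qed
  \<comment> \<open>Kernels supported in the ball of radius \<open>e\<close> see only points of
    \<open>U\<close>, so the difference formula holds on the whole triangle.\<close>
  have C1: "C1_on (convex hull {A, B, c}) (conv \<kappa> w) (conv \<kappa> g)"
   if c: "convex hull {A, B, c} \<subseteq> convex hull {A, B, C} \<union> convex hull {A, B, C'}" for c
  proof (rule C1_on_of_difference[OF convex_triangle cg])
   fix x y assume xy: "x \<in> convex hull {A, B, c}" "y \<in> convex hull {A, B, c}"
   have "conv \<kappa> w (x + (y - x)) - conv \<kappa> w x = (LBINT s. indicator {0..1} s * (conv \<kappa> g (x + s *\<^sub>R (y - x)) \<bullet> (y - x)))"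
   proof (rule conv_difference[OF H \<kappa> open_ball])
    fix s :: real and v :: "real^2" assume s: "s \<in> {0..1}" and v: "v \<in> ball 0 e"
    have "(1 - s) *\<^sub>R x + s *\<^sub>R y \<in> convex hull {A, B, c}" using convex_triangle[of A B c] xy s unfolding convex_alt by auto
    then have "x + s *\<^sub>R (y - x) \<in> convex hull {A, B, c}" by (simp add: algebra_simps)
    then show "x + s *\<^sub>R (y - x) + v \<in> U" using c v by (intro inU) auto
   qed
   then show "conv \<kappa> w y - conv \<kappa> w x = (LBINT s. indicator {0..1} s * (conv \<kappa> g (x + s *\<^sub>R (y - x)) \<bullet> (y - x)))" by simp
  qed
  show "integrable lborel (\<lambda>v. \<kappa> v * F c v)" by (rule Fint)
  show "(LBINT v. \<kappa> v * F C v) = (LBINT v. \<kappa> v * F C' v)"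
   unfolding Feq[OF nz(1)] Feq[OF nz(2)] edge_mom_C1[OF nz(1) C1[OF Un_upper1]] edge_mom_C1[OF nz(2) C1[OF Un_upper2]] ..
 qed
 define D where "D v = F C v - F C' v" for v
 have "D 0 = 0"
 proof (rule ccontr)
  assume D0: "D 0 \<noteq> 0"
  \<comment> \<open>Multiplying by \<open>D 0\<close> makes the difference positive near 0 without a
    case distinction on its sign; a small bump then detects it.\<close>
  have "isCont (\<lambda>v. D 0 * D v) 0" unfolding D_def by (intro continuous_intros cF nz)
  moreover have "0 < D 0 * D 0" using D0 by (metis not_real_square_gt_zero)
  ultimately obtain d where d: "d > 0" "\<And>v. norm v < d ==> 0 < D 0 * D v"
  proof -
   assume a: "isCont (\<lambda>v. D 0 * D v) 0" "0 < D 0 * D 0"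
   then have "\<forall>\<^sub>F v in nhds 0. 0 < D 0 * D v" by (metis order_tendstoD(1) isCont_def tendsto_nhds_iff)
   then show thesis using that unfolding eventually_nhds_metric by (auto simp: dist_norm)
  qed
  \<comment> \<open>The square of half side \<open>r\<close> consists of vectors of norm at most
    \<open>2 r\<close>, below both \<open>d\<close> and \<open>e\<close>.\<close>
  define r where "r = min d e / 4"
  have r: "r > 0" "4 * r \<le> d" "4 * r \<le> e" using d(1) e(1) by (auto simp: r_def)
  define a where "a = (\<chi> i. - r :: real^2)"
  define b where "b = (\<chi> i. r :: real^2)"
  define \<kappa> where "\<kappa> = box_bump a b 0"
  have nv: "norm v < 4 * r" if "v \<in> cbox a b" for v
  proof -
   have "norm v \<le> \<bar>v$1\<bar> + \<bar>v$2\<bar>" using norm_le_l1_cart[of v] by (simp add: sum_2)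
   moreover have "\<bar>v$1\<bar> \<le> r" "\<bar>v$2\<bar> \<le> r" using that by (auto simp: mem_box_cart a_def b_def abs_le_iff minus_le_iff)
   ultimately show ?thesis using r(1) by linarith
  qed
  have \<kappa>: "\<kappa> \<in> test_functions (ball 0 e)" unfolding \<kappa>_def by (rule box_bump_test_functions) (use nv r in fastforce)
  have i: "integrable lborel (\<lambda>v. \<kappa> v * (D 0 * D v))"
  proof -
   have "integrable lborel (\<lambda>v. D 0 * (\<kappa> v * F C v - \<kappa> v * F C' v))"
    using key(2)[OF \<kappa>] by (intro integrable_mult_right Bochner_Integration.integrable_diff)
   then show ?thesis by (simp add: D_def algebra_simps)
  qed
  have z: "(LBINT v. \<kappa> v * (D 0 * D v)) = 0"
  proof -
   have "(LBINT v. \<kappa> v * (D 0 * D v)) = (LBINT v. D 0 * (\<kappa> v * F C v - \<kappa> v * F C' v))" by (simp add: D_def algebra_simps)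
   also have "\<dots> = 0" using key[OF \<kappa>] by simp
   finally show ?thesis .
  qed
  have \<kappa>0: "0 \<le> \<kappa> v" for v unfolding \<kappa>_def box_bump_def using bump_bounds by (intro mult_nonneg_nonneg) auto
  have pos: "0 \<le> \<kappa> v * (D 0 * D v)" for v
  proof (cases "v \<in> box a b")
   case True
   then have "norm v < d" using nv[of v] box_subset_cbox r by fastforce
   then show ?thesis using d(2) \<kappa>0 by (simp add: less_imp_le)
  qed (use box_bump_nonzero[of a b 0 v] in \<open>simp add: \<kappa>_def\<close>)
  have "AE v in lborel. \<kappa> v * (D 0 * D v) = 0" using integral_nonneg_eq_0_iff_AE[OF i] z pos by simp
  then have "AE v in lborel. v \<notin> box a b"
  proof eventually_elim
   case (elim v)
   show ?case
   proof
    assume v: "v \<in> box a b"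
    then have "norm v < d" using nv[of v] box_subset_cbox r by fastforce
    then show False using elim d(2)[of v] box_bump_nonzero[of a b 0 v] v by (auto simp: \<kappa>_def)
   qed
  qed
  then have "box a b \<in> null_sets lborel" by (intro AE_iff_null_sets[THEN iffD2]) auto
  then have "negligible (box a b)" by (simp add: negligible_iff_null_sets null_sets_completionI)
  moreover have "0 \<in> box a b" using r(1) by (simp add: mem_box_2 a_def b_def)
  ultimately show False using open_not_negligible[OF open_box] by blast
 qed
 then show ?thesis using F0[OF nz(1)] F0[OF nz(2)] by (simp add: D_def)
qed

lemma dbl_area_dilate:
 "dbl_area (m + t *\<^sub>R (P - m)) (m + t *\<^sub>R (Q - m)) (m + t *\<^sub>R (R - m)) = t^2 * dbl_area P Q R"
 by (simp add: dbl_area_def crs_def algebra_simps power2_eq_square)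

lemma bary_dilate:
 assumes "t \<noteq> 0"
 shows "bary (m + t *\<^sub>R (A - m)) (m + t *\<^sub>R (B - m)) (m + t *\<^sub>R (C - m)) (m + t *\<^sub>R (x - m)) = bary A B C x"
 using assms by (simp add: bary_def dbl_area_dilate)

text \<open>The dilation about \<open>m\<close> is pulled back into the indicator and the hat
  function, leaving \<open>w\<close> and \<open>g\<close> in place, and dominated convergence
  applies. A point outside the triangle is outside every shrunken copy, as the triangle is convex
  and contains \<open>m\<close>.\<close>

lemma edge_mom_dilate_limit:
 assumes nz: "dbl_area A B C \<noteq> 0" and w: "integrable lborel w" and g: "integrable lborel g"
  and m: "m \<in> convex hull {A, B, C}"
  and t: "\<And>n. 0 < t n" "\<And>n. t n \<le> 1" "t \<longlonglongrightarrow> 1"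
 shows "(\<lambda>n. edge_mom (m + t n *\<^sub>R (A - m)) (m + t n *\<^sub>R (B - m)) (m + t n *\<^sub>R (C - m)) w g) \<longlonglongrightarrow> edge_mom A B C w g"
proof -
 let ?T = "convex hull {A, B, C}"
 let ?y = "\<lambda>n x. m + (1 / t n) *\<^sub>R (x - m)"
 have [measurable]: "w \<in> borel_measurable borel" "g \<in> borel_measurable borel" using w g by auto
 let ?f = "\<lambda>n x. indicator ?T (?y n x) * (bary A B C (?y n x) * (t n * (g x \<bullet> (A - C))) + w x)"
 let ?g = "\<lambda>x. indicator ?T x * (bary A B C x * (g x \<bullet> (A - C)) + w x)"
 have t0: "t n \<noteq> 0" for n using t(1)[of n] by simp
 have perm: "dbl_area (m + t n *\<^sub>R (A - m)) (m + t n *\<^sub>R (B - m)) (m + t n *\<^sub>R (C - m)) \<noteq> 0" for n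
  using nz t0 by (simp add: dbl_area_dilate)
 have yx: "x = m + t n *\<^sub>R (?y n x - m)" for n x using t0 by simp
 have eq: "edge_mom (m + t n *\<^sub>R (A - m)) (m + t n *\<^sub>R (B - m)) (m + t n *\<^sub>R (C - m)) w g
   = (LBINT x. ?f n x) / ((t n)^2 * \<bar>dbl_area A B C\<bar>)" for n
 proof -
  let ?A = "m + t n *\<^sub>R (A - m)" and ?B = "m + t n *\<^sub>R (B - m)" and ?C = "m + t n *\<^sub>R (C - m)"
  have b: "bary ?A ?B ?C x = bary A B C (?y n x)" "bary ?B ?C ?A x = bary B C A (?y n x)" "bary ?C ?A ?B x = bary C A B (?y n x)" for x
   using bary_dilate[OF t0, of m n A B C "?y n x"] bary_dilate[OF t0, of m n B C A "?y n x"] bary_dilate[OF t0, of m n C A B "?y n x"]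
   unfolding yx[symmetric] by auto
  have d: "?A - ?C = t n *\<^sub>R (A - C)" by (simp add: algebra_simps)
  have "indicator (convex hull {?A, ?B, ?C}) x = (indicator ?T (?y n x) :: real)" for x
   unfolding indicator_def mem_triangle_iff[OF perm] mem_triangle_iff[OF nz] b ..
  then show ?thesis unfolding edge_mom_def set_lebesgue_integral_def b d dbl_area_dilate by (simp add: abs_mult)
 qed
 have "(\<lambda>n. LBINT x. ?f n x) \<longlonglongrightarrow> (LBINT x. ?g x)"
 proof (rule integral_dominated_convergence[where w = "\<lambda>x. \<bar>g x \<bullet> (A - C)\<bar> + \<bar>w x\<bar>"])
  show "integrable lborel (\<lambda>x. \<bar>g x \<bullet> (A - C)\<bar> + \<bar>w x\<bar>)"
   using w integrable_inner_left[OF g, of "A - C"] by (intro Bochner_Integration.integrable_add integrable_abs)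
  show "AE x in lborel. norm (?f n x) \<le> \<bar>g x \<bullet> (A - C)\<bar> + \<bar>w x\<bar>" for n
  proof (rule AE_I2)
   fix x
   show "norm (?f n x) \<le> \<bar>g x \<bullet> (A - C)\<bar> + \<bar>w x\<bar>"
   proof (cases "?y n x \<in> ?T")
    case True
    have "\<bar>bary A B C (?y n x) * (t n * (g x \<bullet> (A - C)))\<bar> \<le> 1 * (1 * \<bar>g x \<bullet> (A - C)\<bar>)"
     unfolding abs_mult using bary_bounds[OF nz True] t(1,2)[of n] by (intro mult_mono) (auto intro: mult_left_le_one_le mult_nonneg_nonneg)
    then show ?thesis using True abs_triangle_ineq[of "bary A B C (?y n x) * (t n * (g x \<bullet> (A - C)))" "w x"] by simp
   qed simp
  qed
  show "AE x in lborel. (\<lambda>n. ?f n x) \<longlonglongrightarrow> ?g x" using AE_not_frontier_convex[OF convex_triangle[of A B C]]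
  proof eventually_elim
   case (elim x)
   have "(\<lambda>n. ?y n x) \<longlonglongrightarrow> m + (1 / 1) *\<^sub>R (x - m)" by (intro tendsto_intros t(3)) simp
   then have yl: "(\<lambda>n. ?y n x) \<longlonglongrightarrow> x" by simp
   have "isCont (bary A B C) x" using continuous_on_bary[OF continuous_on_id, of UNIV A B C] by (simp add: continuous_on_eq_continuous_at)
   then have bl: "(\<lambda>n. bary A B C (?y n x)) \<longlonglongrightarrow> bary A B C x" by (rule isCont_tendsto_compose[OF _ yl])
   have il: "(\<lambda>n. indicator ?T (?y n x) :: real) \<longlonglongrightarrow> indicator ?T x"
   proof (cases "x \<in> interior ?T")
    case True
    then have "\<forall>\<^sub>F n in sequentially. ?y n x \<in> interior ?T" using topological_tendstoD[OF yl] by auto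
    then have "\<forall>\<^sub>F n in sequentially. (indicator ?T (?y n x) :: real) = indicator ?T x"
     by eventually_elim (use True interior_subset in \<open>auto simp: indicator_def\<close>)
    then show ?thesis by (rule tendsto_eventually)
   next
    case False
    then have xT: "x \<notin> ?T" using elim compact_triangle[of A B C] by (auto simp: frontier_def compact_imp_closed)
    have "?y n x \<notin> ?T" for n
    proof
     assume "?y n x \<in> ?T"
     then have "(1 - t n) *\<^sub>R m + t n *\<^sub>R ?y n x \<in> ?T" using convex_triangle[of A B C] m t(1)[of n] t(2)[of n] unfolding convex_alt by auto
     moreover have "(1 - t n) *\<^sub>R m + t n *\<^sub>R ?y n x = x" using t0 by (simp add: algebra_simps)
     ultimately show False using xT by simp
    qed
    then show ?thesis using xT by (simp add: indicator_def)
   qed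
   have "(\<lambda>n. ?f n x) \<longlonglongrightarrow> indicator ?T x * (bary A B C x * (1 * (g x \<bullet> (A - C))) + w x)"
    by (intro tendsto_intros il bl t(3))
   then show ?case by simp
  qed
 qed measurable
 then have "(\<lambda>n. (LBINT x. ?f n x) / ((t n)^2 * \<bar>dbl_area A B C\<bar>)) \<longlonglongrightarrow> (LBINT x. ?g x) / (1^2 * \<bar>dbl_area A B C\<bar>)"
  by (intro tendsto_intros t(3)) (use nz in auto)
 then show ?thesis unfolding eq by (simp add: edge_mom_def set_lebesgue_integral_def)
qed

text \<open>Shrinking towards the midpoint of \<open>AB\<close> makes the coordinates of
  \<open>A\<close> and \<open>B\<close> positive. If that of \<open>C\<close> is positive too, the
  point is interior to the first triangle. Otherwise it lies on the open edge; there every nearby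
  point has a nonnegative coordinate for \<open>C\<close> or for \<open>C'\<close>, because these
  lie on opposite sides of \<open>AB\<close>.\<close>

lemma mem_interior_opposite_triangles:
 assumes opp: "dbl_area A B C * dbl_area A B C' < 0"
  and x: "x \<in> convex hull {A, B, C}" and t: "0 < t" "t < 1"
 defines "m \<equiv> (1/2) *\<^sub>R (A + B)"
 shows "m + t *\<^sub>R (x - m) \<in> interior (convex hull {A, B, C} \<union> convex hull {A, B, C'})"
proof -
 let ?p = "m + t *\<^sub>R (x - m)"
 have nz: "dbl_area A B C \<noteq> 0" and nz': "dbl_area A B C' \<noteq> 0" using opp by auto
 let ?b = "\<lambda>P Q R. bary P Q R :: real^2 => real"
 have xb: "0 \<le> ?b A B C x" "0 \<le> ?b B C A x" "0 \<le> ?b C A B x" using x mem_triangle_iff[OF nz] by auto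
 have aff: "?b P Q R ?p = (1 - t) * (?b P Q R A + ?b P Q R B) / 2 + t * ?b P Q R x" for P Q R
 proof -
  have "2 * dbl_area ?p Q R = (1 - t) * (dbl_area A Q R + dbl_area B Q R) + 2 * t * dbl_area x Q R" by (simp add: m_def dbl_area_def crs_def algebra_simps)
  then have "dbl_area ?p Q R = (1 - t) * (dbl_area A Q R + dbl_area B Q R) / 2 + t * dbl_area x Q R" by simp
  then show ?thesis by (simp add: bary_def add_divide_distrib distrib_left)
 qed
 have vert: "?b A B C A = 1" "?b A B C B = 0" "?b B C A A = 0" "?b B C A B = 1" "?b C A B A = 0" "?b C A B B = 0"
  using nz dbl_area_perm(1,2)[where A = A and B = B and C = C] by (auto simp: bary_def) (auto simp: dbl_area_def crs_def)
 have p: "?b A B C ?p > 0" "?b B C A ?p > 0" "?b C A B ?p \<ge> 0" unfolding aff vert using xb t by (auto intro!: add_pos_nonneg mult_nonneg_nonneg)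
 have op: "open {y. 0 < ?b P Q R y}" for P Q R by (intro open_Collect_less continuous_on_const continuous_on_bary continuous_on_id)
 show ?thesis
 proof (cases "?b C A B ?p > 0")
  case True
  let ?O = "{y. 0 < ?b A B C y} \<inter> {y. 0 < ?b B C A y} \<inter> {y. 0 < ?b C A B y}"
  have "?O \<subseteq> convex hull {A, B, C} \<union> convex hull {A, B, C'}" using mem_triangle_iff[OF nz] by fastforce
  then have "?O \<subseteq> interior (convex hull {A, B, C} \<union> convex hull {A, B, C'})" by (intro interior_maximal open_Int op)
  then show ?thesis using True p by blast
 next
  case False
  then have p0: "?b C A B ?p = 0" using p(3) by simp
  have "dbl_area C A B \<noteq> 0" unfolding dbl_area_perm(2)[where A = A and B = B and C = C] by (rule nz)
  then have "dbl_area ?p A B = 0" using p0 by (simp add: bary_def)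
  then have d0: "dbl_area A B ?p = 0" using dbl_area_perm(2)[where A = A and B = B and C = ?p] by (simp only:)
  have p0': "?b C' A B ?p = 0" using d0 dbl_area_perm(2)[where A = A and B = B and C = ?p] by (simp add: bary_def)
  have eq: "?b A B C' ?p = ?b A B C ?p" "?b B C' A ?p = ?b B C A ?p"
  proof -
   define a where "a = ?b A B C ?p"
   define c where "c = ?b B C A ?p"
   have s1: "a = 1 - c" using bary_sum[OF nz, of ?p] p0 by (simp add: a_def c_def)
   have "?p = a *\<^sub>R A + c *\<^sub>R B" using bary_combination[OF nz, of ?p] p0 by (simp add: a_def c_def)
   also have "\<dots> = A + c *\<^sub>R (B - A) + 0 *\<^sub>R (C' - A)" unfolding s1 by (simp add: algebra_simps)
   finally have pe: "?p = A + c *\<^sub>R (B - A) + 0 *\<^sub>R (C' - A)" .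
   have "?b A B C' ?p = a" "?b B C' A ?p = c" unfolding pe using bary_param[OF nz', of c 0] s1 by auto
   then show "?b A B C' ?p = ?b A B C ?p" "?b B C' A ?p = ?b B C A ?p" by (simp_all add: a_def c_def)
  qed
  let ?O = "{y. 0 < ?b A B C y} \<inter> {y. 0 < ?b B C A y} \<inter> ({y. 0 < ?b A B C' y} \<inter> {y. 0 < ?b B C' A y})"
  have "?O \<subseteq> convex hull {A, B, C} \<union> convex hull {A, B, C'}"
  proof
   fix y assume y: "y \<in> ?O"
   have yC: "?b C A B y = dbl_area A B y / dbl_area A B C" "?b C' A B y = dbl_area A B y / dbl_area A B C'"
    using dbl_area_perm(2)[where A = A and B = B and C = y] dbl_area_perm(2)[where A = A and B = B and C = C] dbl_area_perm(2)[where A = A and B = B and C = C'] by (auto simp: bary_def)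
   have "0 \<le> ?b C A B y \<or> 0 \<le> ?b C' A B y" unfolding yC using opp by (auto simp: zero_le_divide_iff mult_less_0_iff)
   then show "y \<in> convex hull {A, B, C} \<union> convex hull {A, B, C'}" using y mem_triangle_iff[OF nz] mem_triangle_iff[OF nz'] by auto
  qed
  then have "?O \<subseteq> interior (convex hull {A, B, C} \<union> convex hull {A, B, C'})" by (intro interior_maximal open_Int op)
  moreover have "?p \<in> ?O" using p eq by auto
  ultimately show ?thesis by blast
 qed
qed

text \<open>The two triangles reach the boundary of their union, which leaves no room for
  mollification. \<open>edge_mom_interface_compact\<close> is applied to copies shrunk towards the
  midpoint of \<open>AB\<close>, and the shrinking is undone in the limit.\<close>

lemma edge_mom_interface:
 assumes opp: "dbl_area A B C * dbl_area A B C' < 0"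
  and H: "H1_fun (interior (convex hull {A, B, C} \<union> convex hull {A, B, C'})) w g"
 shows "edge_mom A B C w g = edge_mom A B C' w g"
proof -
 have nz: "dbl_area A B C \<noteq> 0" "dbl_area A B C' \<noteq> 0" using opp by auto
 define m where "m = (1/2) *\<^sub>R (A + B)"
 \<comment> \<open>The index is raised by two so that already the first factor is positive.\<close>
 define t where "t n = 1 - inverse (real (Suc (Suc n)))" for n
 have t: "0 < t n" "t n < 1" for n by (auto simp: t_def field_simps)
 have "(\<lambda>n. 1 - inverse (real (Suc n))) \<longlonglongrightarrow> 1 - 0" by (intro tendsto_diff tendsto_const LIMSEQ_inverse_real_of_nat)
 then have t1: "t \<longlonglongrightarrow> 1" unfolding t_def using LIMSEQ_Suc by fastforce
 have mT: "m \<in> convex hull {A, B, c}" for c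
 proof -
  have "m = (1/2) *\<^sub>R A + (1/2) *\<^sub>R B + 0 *\<^sub>R c" by (simp add: m_def algebra_simps)
  then show ?thesis unfolding convex_hull_3 by (intro CollectI exI[of _ "1/2"] exI[of _ "1/2"] exI[of _ 0]) auto
 qed
 let ?s = "\<lambda>n P. m + t n *\<^sub>R (P - m)"
 have hull: "convex hull {?s n A, ?s n B, ?s n c} \<subseteq> (\<lambda>x. ?s n x) ` (convex hull {A, B, c})" for n c
 proof -
  have e: "?s n P = (1 - t n) *\<^sub>R m + t n *\<^sub>R P" for P by (simp add: algebra_simps)
  show ?thesis unfolding e using convex_hull_affinity[of "(1 - t n) *\<^sub>R m" "t n" "{A, B, c}"] by simp
 qed
 have sub: "convex hull {?s n A, ?s n B, ?s n C} \<union> convex hull {?s n A, ?s n B, ?s n C'}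
   \<subseteq> interior (convex hull {A, B, C} \<union> convex hull {A, B, C'})" for n
  using hull[of n C] hull[of n C'] mem_interior_opposite_triangles[OF opp _ t(1,2)[of n]]
   mem_interior_opposite_triangles[of A B C' C, OF _ _ t(1,2)[of n]] opp unfolding m_def[symmetric] by (auto simp: mult.commute Un_commute)
 have eq: "edge_mom (?s n A) (?s n B) (?s n C) w g = edge_mom (?s n A) (?s n B) (?s n C') w g" for n
  by (rule edge_mom_interface_compact[OF H open_interior _ _ sub])
   (use nz t(1)[of n] in \<open>auto simp: dbl_area_dilate\<close>)
 have lim: "(\<lambda>n. edge_mom (?s n A) (?s n B) (?s n c) w g) \<longlonglongrightarrow> edge_mom A B c w g" if "dbl_area A B c \<noteq> 0" for c
  by (rule edge_mom_dilate_limit[OF that H1_funD(1,3)[OF H] mT t(1) less_imp_le[OF t(2)] t1])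
 show ?thesis using LIMSEQ_unique[OF lim[OF nz(1), unfolded eq] lim[OF nz(2)]] .
qed

section \<open>Borel representatives\<close>

lemma borel_measurable_lebesgue_AE:
 fixes f g :: "real^2 => 'b::euclidean_space"
 assumes f: "f \<in> borel_measurable borel" and ae: "AE x in lborel. g x = f x"
 shows "g \<in> borel_measurable lebesgue"
proof (rule measurableI)
 fix A :: "'b set" assume A: "A \<in> sets borel"
 show "g -` A \<inter> space lebesgue \<in> sets lebesgue"
 proof (rule complete_measure.in_sets_AE[OF completion.complete_measure_axioms])
  show "AE x in lebesgue. (x \<in> f -` A) = (x \<in> g -` A \<inter> space lebesgue)" using AE_completion[OF ae] by eventually_elim simp
  show "f -` A \<in> sets lebesgue" using measurable_sets_borel[OF f A] by (intro sets_completionI_sets) simp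
 qed simp
qed simp

text \<open>Passage from integrals over \<open>lebesgue_on S\<close>, in which norms and weak
  derivatives are stated, to \<open>lborel\<close>, on which translations, dilations and Fubini are
  used.\<close>

lemma
 fixes f h :: "real^2 => 'b::euclidean_space"
 assumes S: "S \<in> sets borel" and h: "h \<in> borel_measurable borel" and ae: "AE x in lborel. x \<in> S --> f x = h x"
 shows integral_lebesgue_on_eq: "integral\<^sup>L (lebesgue_on S) f = (LBINT x:S. h x)"
  and integrable_lebesgue_on_eq: "integrable (lebesgue_on S) f \<longleftrightarrow> set_integrable lborel S h"
  and measurable_lebesgue_on_AE: "f \<in> borel_measurable (lebesgue_on S)"
proof -
 have Sl: "S \<inter> space lebesgue \<in> sets lebesgue" using S by (simp add: sets_completionI_sets)
 have [measurable]: "S \<in> sets borel" "h \<in> borel_measurable borel" by fact+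
 have hb: "(\<lambda>x. indicator S x *\<^sub>R h x) \<in> borel_measurable lborel" by measurable
 have ae': "AE x in lborel. indicator S x *\<^sub>R f x = indicator S x *\<^sub>R h x" using ae by eventually_elim (auto simp: indicator_def)
 have fm: "(\<lambda>x. indicator S x *\<^sub>R f x) \<in> borel_measurable lebesgue" by (rule borel_measurable_lebesgue_AE[OF _ ae']) (use hb in simp)
 have hm: "(\<lambda>x. indicator S x *\<^sub>R h x) \<in> borel_measurable lebesgue"
  by (rule borel_measurable_lebesgue_AE[of "\<lambda>x. indicator S x *\<^sub>R h x"]) (use hb in auto)
 show "f \<in> borel_measurable (lebesgue_on S)" using fm borel_measurable_restrict_space_iff[OF Sl, of f] by simp
 have "integral\<^sup>L (lebesgue_on S) f = integral\<^sup>L lebesgue (\<lambda>x. indicator S x *\<^sub>R f x)" by (rule integral_restrict_space[OF Sl])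
 also have "\<dots> = integral\<^sup>L lebesgue (\<lambda>x. indicator S x *\<^sub>R h x)" by (rule integral_cong_AE[OF fm hm AE_completion[OF ae']])
 also have "\<dots> = integral\<^sup>L lborel (\<lambda>x. indicator S x *\<^sub>R h x)" by (rule integral_completion[OF hb])
 finally show "integral\<^sup>L (lebesgue_on S) f = (LBINT x:S. h x)" by (simp add: set_lebesgue_integral_def)
 have "integrable (lebesgue_on S) f \<longleftrightarrow> integrable lebesgue (\<lambda>x. indicator S x *\<^sub>R f x)" by (rule integrable_restrict_space[OF Sl])
 also have "\<dots> \<longleftrightarrow> integrable lebesgue (\<lambda>x. indicator S x *\<^sub>R h x)"
  by (rule integrable_cong_AE[OF fm hm AE_completion[OF ae']])
 also have "\<dots> \<longleftrightarrow> integrable lborel (\<lambda>x. indicator S x *\<^sub>R h x)" by (rule integrable_completion[OF hb])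
 finally show "integrable (lebesgue_on S) f \<longleftrightarrow> set_integrable lborel S h" by (simp add: set_integrable_def)
qed

text \<open>Zero outside \<open>S\<close>, so that integrals over \<open>S\<close> are integrals
  over the plane, and Borel, so that shifted and joint versions stay measurable.\<close>

definition borel_rep :: "(real^2) set => (real^2 => real) => real^2 => real" where
 "borel_rep S f = (SOME f'. f' \<in> borel_measurable borel \<and> (\<forall>x. x \<notin> S --> f' x = 0) \<and>
   (AE x in lborel. x \<in> S --> f x = f' x))"

lemma borel_rep:
 assumes S: "S \<in> sets borel" and f: "f \<in> borel_measurable (lebesgue_on S)"
 shows "borel_rep S f \<in> borel_measurable borel" "x \<notin> S ==> borel_rep S f x = 0"
  "AE x in lborel. x \<in> S --> f x = borel_rep S f x"
proof -
 have Sl: "S \<inter> space lebesgue \<in> sets lebesgue" using S by (simp add: sets_completionI_sets)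
 have "(\<lambda>x. indicator S x *\<^sub>R f x) \<in> borel_measurable lebesgue" using f borel_measurable_restrict_space_iff[OF Sl, of f] by simp
 from completion_ex_borel_measurable_real[OF this]
 obtain g where g: "g \<in> borel_measurable borel" "AE x in lborel. indicator S x *\<^sub>R f x = g x" by auto
 have "\<exists>f'. f' \<in> borel_measurable borel \<and> (\<forall>x. x \<notin> S --> f' x = 0) \<and> (AE x in lborel. x \<in> S --> f x = f' x)"
 proof (intro exI[of _ "\<lambda>x. indicator S x * g x"] conjI)
  show "(\<lambda>x. indicator S x * g x) \<in> borel_measurable borel" using g(1) S by measurable
  show "AE x in lborel. x \<in> S --> f x = indicator S x * g x" using g(2) by eventually_elim (auto simp: indicator_def)
 qed auto
 from someI_ex[OF this, folded borel_rep_def]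
 show "borel_rep S f \<in> borel_measurable borel" "x \<notin> S ==> borel_rep S f x = 0"
  "AE x in lborel. x \<in> S --> f x = borel_rep S f x" by auto
qed

lemma set_integral_zero_outside:
 fixes f :: "real^2 => real"
 assumes "\<And>x. x \<notin> S ==> f x = 0"
 shows "(LBINT x:S. f x) = (LBINT x. f x)" "set_integrable lborel S f \<longleftrightarrow> integrable lborel f"
proof -
 have "(\<lambda>x. indicator S x *\<^sub>R f x) = f" using assms by (auto simp: indicator_def fun_eq_iff)
 then show "(LBINT x:S. f x) = (LBINT x. f x)" "set_integrable lborel S f \<longleftrightarrow> integrable lborel f"
  by (simp_all add: set_lebesgue_integral_def set_integrable_def)
qed

lemma integrable_of_square:
 fixes f :: "real^2 => real"
 assumes [measurable]: "f \<in> borel_measurable borel" and S: "bounded S" "S \<in> sets borel"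
  and f2: "integrable lborel (\<lambda>x. (f x)^2)" and 0: "\<And>x. x \<notin> S ==> f x = 0"
 shows "integrable lborel f"
proof (rule Bochner_Integration.integrable_bound)
 have "integrable lborel (indicator S :: real^2 => real)" by (rule integrable_real_indicator) (use S emeasure_bounded_finite in auto)
 then show "integrable lborel (\<lambda>x. (f x)^2 + indicator S x)" using f2 by simp
 have "\<bar>f x\<bar> \<le> (f x)^2 + 1" for x using sum_squares_bound[of "\<bar>f x\<bar>" "1/2"] by (simp add: power2_eq_square)
 then show "AE x in lborel. norm (f x) \<le> norm ((f x)^2 + indicator S x)" using 0 by (intro AE_I2) (auto simp: indicator_def)
qed simp

lemma L2_borel_rep:
 assumes S: "S \<in> sets borel" and f: "f \<in> L2 (lebesgue_on S)"
 shows "integrable lborel (\<lambda>x. (borel_rep S f x)^2)"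
  and "bounded S ==> integrable lborel (borel_rep S f)"
  and "(L2_norm (lebesgue_on S) f)^2 = (LBINT x. (borel_rep S f x)^2)"
proof -
 have fm: "f \<in> borel_measurable (lebesgue_on S)" using f by (simp add: L2_def)
 note r = borel_rep[OF S fm]
 have [measurable]: "borel_rep S f \<in> borel_measurable borel" by (rule r(1))
 have m: "(\<lambda>x. (borel_rep S f x)^2) \<in> borel_measurable borel" by measurable
 have ae: "AE x in lborel. x \<in> S --> (f x)^2 = (borel_rep S f x)^2" using r(3) by eventually_elim auto
 show i: "integrable lborel (\<lambda>x. (borel_rep S f x)^2)"
  using f integrable_lebesgue_on_eq[OF S m ae] set_integral_zero_outside(2)[of S "\<lambda>x. (borel_rep S f x)^2"] r(2) by (simp add: L2_def)
 show "integrable lborel (borel_rep S f)" if "bounded S" by (rule integrable_of_square[OF r(1) that S i r(2)])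
 have "L2_inner (lebesgue_on S) f f = (LBINT x. (borel_rep S f x)^2)"
  using integral_lebesgue_on_eq[OF S m ae] set_integral_zero_outside(1)[of S "\<lambda>x. (borel_rep S f x)^2"] r(2) by (simp add: L2_inner_def power2_eq_square)
 then show "(L2_norm (lebesgue_on S) f)^2 = (LBINT x. (borel_rep S f x)^2)" by (simp add: L2_norm_def)
qed

lemma L2_inner_borel_rep:
 assumes S: "S \<in> sets borel" and f: "f \<in> borel_measurable (lebesgue_on S)" and h: "h \<in> borel_measurable borel"
  and T: "T \<in> sets borel" "AE x in lborel. x \<in> T --> x \<in> S"
 shows "L2_inner (lebesgue_on T) f h = (LBINT x:T. borel_rep S f x * h x)"
 unfolding L2_inner_def
proof (rule integral_lebesgue_on_eq[OF T(1)])
 show "(\<lambda>x. borel_rep S f x * h x) \<in> borel_measurable borel" using borel_rep(1)[OF S f] h by measurable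
 show "AE x in lborel. x \<in> T --> f x \<bullet> h x = borel_rep S f x * h x" using T(2) borel_rep(3)[OF S f] by eventually_elim auto
qed

lemma L2_inner_borel_rep_self:
 assumes S: "S \<in> sets borel" and f: "f \<in> borel_measurable (lebesgue_on S)" and h: "h \<in> borel_measurable borel"
 shows "L2_inner (lebesgue_on S) f h = (LBINT x. borel_rep S f x * h x)"
 using L2_inner_borel_rep[OF S f h S] set_integral_zero_outside(1)[of S "\<lambda>x. borel_rep S f x * h x"] borel_rep(2)[OF S f] by simp

section \<open>Weak derivatives and Sobolev norms\<close>

lemma partials_test_functions:
 assumes "\<phi> \<in> test_functions U"
 shows "partials \<alpha> \<phi> \<in> test_functions U"
proof -
 have "(partial i ^^ n) \<psi> \<in> test_functions U" if "\<psi> \<in> test_functions U" for i n \<psi>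
  using that by (induction n) (auto intro: test_functions_partial)
 then show ?thesis using assms by (simp add: partials_def)
qed

lemma funpow_partial_C_inf: "\<phi> \<in> C_inf ==> (partial i ^^ n) \<phi> \<in> C_inf"
 by (induction n) (auto intro: C_inf_partial)

lemma funpow_partial_commute:
 assumes "\<phi> \<in> C_inf"
 shows "(partial i ^^ n) (partial j \<phi>) = partial j ((partial i ^^ n) \<phi>)"
 using assms by (induction n) (auto simp: partial_commute funpow_partial_C_inf)

lemma partials_partial:
 assumes "\<phi> \<in> C_inf"
 shows "partials \<alpha> (partial 1 \<phi>) = partials (Suc (fst \<alpha>), snd \<alpha>) \<phi>"
  "partials \<alpha> (partial 2 \<phi>) = partials (fst \<alpha>, Suc (snd \<alpha>)) \<phi>" unfolding partials_def fst_conv snd_conv funpow_Suc_right o_apply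
 by (simp_all only: funpow_partial_commute[OF assms])

lemma has_weak_deriv_borel:
 assumes S: "open S" and u: "u \<in> borel_measurable (lebesgue_on S)" and g: "has_weak_deriv S \<alpha> u g" and \<phi>: "\<phi> \<in> test_functions S"
 shows "(LBINT x. borel_rep S u x * partials \<alpha> \<phi> x) = (-1) ^ (fst \<alpha> + snd \<alpha>) * (LBINT x. borel_rep S g x * \<phi> x)"
proof -
 have Sb: "S \<in> sets borel" using S by simp
 have gm: "g \<in> borel_measurable (lebesgue_on S)" using g by (simp add: has_weak_deriv_def L2_def)
 have m: "partials \<alpha> \<phi> \<in> borel_measurable borel" "\<phi> \<in> borel_measurable borel"
  by (rule C_inf_measurable[OF test_functions_C_inf[OF partials_test_functions[OF \<phi>]]])
   (rule C_inf_measurable[OF test_functions_C_inf[OF \<phi>]])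
 show ?thesis using g \<phi> unfolding has_weak_deriv_def
   L2_inner_borel_rep_self[OF Sb u m(1), symmetric] L2_inner_borel_rep_self[OF Sb gm m(2), symmetric] by blast
qed

text \<open>The difference of two weak derivatives integrates to zero against every test function.
  Uniqueness is what gives the choice in \<open>weak_deriv\<close> and the norms built on it a
  meaning.\<close>

lemma has_weak_deriv_unique:
 assumes S: "open S" "bounded S" and u: "u \<in> borel_measurable (lebesgue_on S)"
  and g: "has_weak_deriv S \<alpha> u g" and h: "has_weak_deriv S \<alpha> u h"
 shows "AE x in lborel. borel_rep S g x = borel_rep S h x"
proof -
 have Sb: "S \<in> sets borel" using S by simp
 have L: "g \<in> L2 (lebesgue_on S)" "h \<in> L2 (lebesgue_on S)" using g h by (auto simp: has_weak_deriv_def)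
 note i = L2_borel_rep(2)[OF Sb L(1) S(2)] L2_borel_rep(2)[OF Sb L(2) S(2)]
 have "AE x in lborel. x \<in> S --> borel_rep S g x - borel_rep S h x = 0"
 proof (rule fundamental_lemma_calculus_of_variations[OF _ S(1)])
  show "integrable lborel (\<lambda>x. borel_rep S g x - borel_rep S h x)" using i by simp
  fix \<phi> assume \<phi>: "\<phi> \<in> test_functions S"
  have "(LBINT x. borel_rep S g x * \<phi> x) = (LBINT x. borel_rep S h x * \<phi> x)"
   using has_weak_deriv_borel[OF S(1) u g \<phi>] has_weak_deriv_borel[OF S(1) u h \<phi>] by simp
  then show "(LBINT x. (borel_rep S g x - borel_rep S h x) * \<phi> x) = 0"
   using test_functions_integrable_mult[OF \<phi> i(1)] test_functions_integrable_mult[OF \<phi> i(2)] by (simp add: left_diff_distrib)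
 qed
 then show ?thesis
 proof eventually_elim
  case (elim x)
  then show ?case using borel_rep(2)[OF Sb, of _ x] L by (cases "x \<in> S") (auto simp: L2_def)
 qed
qed

definition wderiv :: "(real^2) set => nat \<times> nat => (real^2 => real) => real^2 => real" where
 "wderiv S \<alpha> u = borel_rep S (weak_deriv S \<alpha> u)"

lemma Hk_measurable: "u \<in> Hk k S ==> u \<in> borel_measurable (lebesgue_on S)"
 by (simp add: Hk_def L2_def)

lemma Hk_has_weak_deriv:
 assumes "u \<in> Hk k S" "fst \<alpha> + snd \<alpha> \<le> k"
 shows "has_weak_deriv S \<alpha> u (weak_deriv S \<alpha> u)"
proof -
 have "\<exists>g. has_weak_deriv S \<alpha> u g" using assms by (cases \<alpha>) (auto simp: Hk_def multi_indices_def)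
 then show ?thesis unfolding weak_deriv_def by (rule someI_ex)
qed

lemma finite_multi_indices: "finite (multi_indices k)"
 by (rule finite_subset[of _ "{..k} \<times> {..k}"]) (auto simp: multi_indices_def)

lemma wderiv_props:
 assumes S: "open S" "bounded S" and u: "u \<in> Hk k S" and \<alpha>: "fst \<alpha> + snd \<alpha> \<le> k"
 shows "wderiv S \<alpha> u \<in> borel_measurable borel" "x \<notin> S ==> wderiv S \<alpha> u x = 0"
  "integrable lborel (wderiv S \<alpha> u)" "integrable lborel (\<lambda>x. (wderiv S \<alpha> u x)^2)"
  "AE x in lborel. x \<in> S --> weak_deriv S \<alpha> u x = wderiv S \<alpha> u x"
proof -
 have Sb: "S \<in> sets borel" using S by simp
 have L: "weak_deriv S \<alpha> u \<in> L2 (lebesgue_on S)" using Hk_has_weak_deriv[OF u \<alpha>] by (simp add: has_weak_deriv_def)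
 then have m: "weak_deriv S \<alpha> u \<in> borel_measurable (lebesgue_on S)" by (simp add: L2_def)
 show "wderiv S \<alpha> u \<in> borel_measurable borel" "x \<notin> S ==> wderiv S \<alpha> u x = 0"
  "AE x in lborel. x \<in> S --> weak_deriv S \<alpha> u x = wderiv S \<alpha> u x" using borel_rep[OF Sb m] by (auto simp: wderiv_def)
 show "integrable lborel (wderiv S \<alpha> u)" "integrable lborel (\<lambda>x. (wderiv S \<alpha> u x)^2)"
  using L2_borel_rep[OF Sb L] S(2) by (auto simp: wderiv_def)
qed

lemma wderiv_test:
 assumes S: "open S" and u: "u \<in> Hk k S" and \<alpha>: "fst \<alpha> + snd \<alpha> \<le> k" and \<phi>: "\<phi> \<in> test_functions S"
 shows "(LBINT x. borel_rep S u x * partials \<alpha> \<phi> x) = (-1) ^ (fst \<alpha> + snd \<alpha>) * (LBINT x. wderiv S \<alpha> u x * \<phi> x)"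
 unfolding wderiv_def by (rule has_weak_deriv_borel[OF S Hk_measurable[OF u] Hk_has_weak_deriv[OF u \<alpha>] \<phi>])

lemma Hk_norm_eq:
 assumes S: "open S" "bounded S" and u: "u \<in> Hk k S"
 shows "(Hk_norm k S u)^2 = (\<Sum>\<alpha>\<in>multi_indices k. LBINT x. (wderiv S \<alpha> u x)^2)"
proof -
 have Sb: "S \<in> sets borel" using S by simp
 have "(Hk_norm k S u)^2 = (\<Sum>\<alpha>\<in>multi_indices k. (L2_norm (lebesgue_on S) (weak_deriv S \<alpha> u))^2)" by (simp add: Hk_norm_def sum_nonneg)
 also have "\<dots> = (\<Sum>\<alpha>\<in>multi_indices k. LBINT x. (wderiv S \<alpha> u x)^2)"
 proof (rule sum.cong[OF refl])
  fix \<alpha> assume "\<alpha> \<in> multi_indices k"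
  then have "fst \<alpha> + snd \<alpha> \<le> k" by (simp add: multi_indices_def)
  then have "weak_deriv S \<alpha> u \<in> L2 (lebesgue_on S)" using Hk_has_weak_deriv[OF u] by (simp add: has_weak_deriv_def)
  then show "(L2_norm (lebesgue_on S) (weak_deriv S \<alpha> u))^2 = (LBINT x. (wderiv S \<alpha> u x)^2)" unfolding wderiv_def by (rule L2_borel_rep(3)[OF Sb])
 qed
 finally show ?thesis .
qed

definition wgrad :: "(real^2) set => nat \<times> nat => (real^2 => real) => real^2 => real^2" where
 "wgrad S \<alpha> u x = vector [wderiv S (Suc (fst \<alpha>), snd \<alpha>) u x, wderiv S (fst \<alpha>, Suc (snd \<alpha>)) u x]"

lemma norm_vec2_sq: "(norm (v::real^2))^2 = (v$1)^2 + (v$2)^2"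
 unfolding power2_norm_eq_inner inner_vec2 by (simp add: power2_eq_square)

lemma integrable_vector2:
 assumes f: "integrable lborel f" and g: "integrable lborel g"
 shows "integrable lborel (\<lambda>x::real^2. vector [f x, g x] :: real^2)"
proof -
 have "(\<lambda>x. vector [f x, g x] :: real^2) = (\<lambda>x. f x *\<^sub>R axis 1 1 + g x *\<^sub>R axis 2 1)" by (auto simp: fun_eq_iff vec2_eq_iff axis_def)
 then show ?thesis using f g by simp
qed

text \<open>Testing the derivative of order \<alpha> with \<open>partial i \<phi>\<close> brings in
  the derivative of \<phi> of the next order, by \<open>partials_partial\<close>. The signs of
  orders \<open>n\<close> and \<open>Suc n\<close> differ by one factor -1, which is the minus sign
  of \<open>H1_fun\<close>.\<close>

lemma H1_fun_wderiv:
 assumes S: "open S" "bounded S" and u: "u \<in> Hk k S" and \<alpha>: "fst \<alpha> + snd \<alpha> < k"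
 shows "H1_fun S (wderiv S \<alpha> u) (wgrad S \<alpha> u)"
 unfolding H1_fun_def
proof (intro conjI ballI allI)
 have a: "fst \<alpha> + snd \<alpha> \<le> k" "fst (Suc (fst \<alpha>), snd \<alpha>) + snd (Suc (fst \<alpha>), snd \<alpha>) \<le> k"
  "fst (fst \<alpha>, Suc (snd \<alpha>)) + snd (fst \<alpha>, Suc (snd \<alpha>)) \<le> k" using \<alpha> by auto
 note p = wderiv_props[OF S u a(1)] and p1 = wderiv_props[OF S u a(2)] and p2 = wderiv_props[OF S u a(3)]
 show "integrable lborel (wderiv S \<alpha> u)" "integrable lborel (\<lambda>x. (wderiv S \<alpha> u x)^2)" using p by auto
 show "integrable lborel (wgrad S \<alpha> u)" unfolding wgrad_def by (rule integrable_vector2[OF p1(3) p2(3)])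
 show "integrable lborel (\<lambda>x. (norm (wgrad S \<alpha> u x))^2)" using p1(4) p2(4) by (simp add: norm_vec2_sq wgrad_def)
 fix \<phi> i assume \<phi>: "\<phi> \<in> test_functions S"
 note \<phi>C = test_functions_C_inf[OF \<phi>]
 have neg: "a = - b" if "(-1) ^ n * a = (-1) ^ Suc n * b" for a b :: real and n
 proof -
  have "(-1) ^ n * (a + b) = 0" using that by (simp add: distrib_left)
  then show ?thesis by simp
 qed
 have 1: "(LBINT x. wderiv S \<alpha> u x * partial 1 \<phi> x) = - (LBINT x. wderiv S (Suc (fst \<alpha>), snd \<alpha>) u x * \<phi> x)"
  by (rule neg[of "fst \<alpha> + snd \<alpha>"])
   (use wderiv_test[OF S(1) u a(1) test_functions_partial[OF \<phi>], of 1] wderiv_test[OF S(1) u a(2) \<phi>] partials_partial(1)[OF \<phi>C, of \<alpha>] in simp)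
 have 2: "(LBINT x. wderiv S \<alpha> u x * partial 2 \<phi> x) = - (LBINT x. wderiv S (fst \<alpha>, Suc (snd \<alpha>)) u x * \<phi> x)"
  by (rule neg[of "fst \<alpha> + snd \<alpha>"])
   (use wderiv_test[OF S(1) u a(1) test_functions_partial[OF \<phi>], of 2] wderiv_test[OF S(1) u a(3) \<phi>] partials_partial(2)[OF \<phi>C, of \<alpha>] in simp)
 show "(LBINT x. wderiv S \<alpha> u x * partial i \<phi> x) = - (LBINT x. wgrad S \<alpha> u x $ i * \<phi> x)" using exhaust_2[of i] 1 2 by (auto simp: wgrad_def)
qed

text \<open>By translation invariance \<open>F (x + z) - F x\<close> has integral zero; written as
  an integral of the gradient along the segment, it has the integral of
  \<open>grad F x \<bullet> z\<close>.\<close>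

lemma integral_grad_test_function:
 assumes F: "F \<in> test_functions UNIV"
 shows "(LBINT x. grad F x \<bullet> z) = 0"
proof -
 note FC = test_functions_C_inf[OF F]
 have i0: "integrable lborel \<psi>" if "\<psi> \<in> test_functions UNIV" for \<psi> :: "real^2 => real"
 proof -
  let ?S = "closure {x. \<psi> x \<noteq> 0}"
  have "integrable lborel (\<lambda>x. indicator ?S x *\<^sub>R \<psi> x)"
   using that by (intro borel_integrable_compact C_inf_continuous[OF test_functions_C_inf[OF that]]) (simp add: test_functions_def)
  moreover have "(\<lambda>x. indicator ?S x *\<^sub>R \<psi> x) = \<psi>"
   using closure_subset[of "{x. \<psi> x \<noteq> 0}"] by (auto simp: indicator_def fun_eq_iff)
  ultimately show ?thesis by simp
 qed
 have ig: "integrable lborel (\<lambda>x. grad F x \<bullet> z)" using i0[OF test_functions_partial[OF F]] by (simp add: inner_vec2 grad_def)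
 have [measurable]: "grad F \<in> borel_measurable borel" "F \<in> borel_measurable borel" using C_inf_grad_measurable[OF FC] C_inf_measurable[OF FC] by auto
 let ?I = "indicator {0..1::real} :: real => real"
 have i: "integrable (lborel \<Otimes>\<^sub>M lborel) (\<lambda>(s, x). ?I s * ((grad F (x + s *\<^sub>R z) \<bullet> z) * 1))"
  by (rule integrable_shift_pair[OF integrable_indicator_Icc ig, where K = 1 and L = "\<lambda>s. s *\<^sub>R z" and b = "\<lambda>_. 1"]) auto
 have "0 = (LBINT x. F (x + z) - F x)" using i0[OF F] integrable_translate[of F z] integral_translate[of F z] by simp
 also have "\<dots> = (LBINT x. LBINT s. ?I s * ((grad F (x + s *\<^sub>R z) \<bullet> z) * 1))" unfolding C_inf_difference_integral[OF FC] by simp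
 also have "\<dots> = (LBINT s. LBINT x. ?I s * ((grad F (x + s *\<^sub>R z) \<bullet> z) * 1))" by (rule lborel_pair.Fubini_integral[OF i])
 also have "\<dots> = (LBINT s. ?I s * (LBINT x. grad F x \<bullet> z))" using integral_translate[of "\<lambda>x. grad F x \<bullet> z"] by simp
 also have "\<dots> = (LBINT x. grad F x \<bullet> z)" by simp
 finally show ?thesis by simp
qed

lemma integral_by_parts_smooth:
 assumes w: "w \<in> C_inf" and \<phi>: "\<phi> \<in> test_functions S"
 shows "(LBINT x. w x * partial i \<phi> x) = - (LBINT x. partial i w x * \<phi> x)"
proof -
 note \<phi>C = test_functions_C_inf[OF \<phi>]
 have sub: "(\<lambda>x. f x * \<psi> x) \<in> test_functions UNIV" if "f \<in> C_inf" "\<psi> \<in> test_functions S" for f \<psi>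
  by (rule test_functions_subset[OF test_functions_mono[OF subset_UNIV that(2)]])
   (use that C_inf_mult test_functions_C_inf closure_subset[of "{x. \<psi> x \<noteq> 0}"] in auto)
 have i0: "integrable lborel \<psi>" if "\<psi> \<in> test_functions UNIV" for \<psi> :: "real^2 => real"
 proof -
  let ?S = "closure {x. \<psi> x \<noteq> 0}"
  have "integrable lborel (\<lambda>x. indicator ?S x *\<^sub>R \<psi> x)"
   using that by (intro borel_integrable_compact C_inf_continuous[OF test_functions_C_inf[OF that]]) (simp add: test_functions_def)
  moreover have "(\<lambda>x. indicator ?S x *\<^sub>R \<psi> x) = \<psi>"
   using closure_subset[of "{x. \<psi> x \<noteq> 0}"] by (auto simp: indicator_def fun_eq_iff)
  ultimately show ?thesis by simp
 qed
 note i1 = i0[OF sub[OF w test_functions_partial[OF \<phi>]]] i0[OF sub[OF C_inf_partial[OF w] \<phi>]]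
 have "partial i (\<lambda>x. w x * \<phi> x) = (\<lambda>x. w x * partial i \<phi> x + partial i w x * \<phi> x)"
  by (rule partial_mult) (use C_inf_differentiable w \<phi>C in auto)
 then have "(LBINT x. w x * partial i \<phi> x + partial i w x * \<phi> x) = 0"
  using integral_grad_test_function[OF sub[OF w \<phi>], of "axis i 1"] by (simp add: inner_axis grad_def)
 then show ?thesis using i1[of i] by simp
qed

lemma multi_indices_1: "multi_indices 1 = {(0, 0), (1, 0), (0, 1)}"
 by (auto simp: multi_indices_def)

lemma C_inf_square_integrable:
 assumes w: "w \<in> C_inf" and S: "bounded S" "S \<in> sets borel"
 shows "set_integrable lborel S (\<lambda>x. (w x)^2)"
proof -
 have "set_integrable lborel (closure S) (\<lambda>x. (w x)^2)"
  by (rule set_integrable_continuous_compact) (use S in simp, intro continuous_on_power C_inf_continuous w)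
 then show ?thesis by (rule set_integrable_subset) (use S closure_subset in auto)
qed

text \<open>The derivative of order \<open>(0, 0)\<close> is a choice as well, so it agrees with
  \<open>u\<close> only almost everywhere.\<close>

lemma Hk_wderiv_zero:
 assumes \<Omega>: "open \<Omega>" "bounded \<Omega>" and u: "u \<in> Hk k \<Omega>"
 shows "AE x in lborel. x \<in> \<Omega> --> u x = wderiv \<Omega> (0, 0) u x"
proof -
 have \<Omega>b: "\<Omega> \<in> sets borel" using \<Omega> by simp
 have uL: "u \<in> L2 (lebesgue_on \<Omega>)" using u by (simp add: Hk_def)
 have "has_weak_deriv \<Omega> (0, 0) u u" using uL by (simp add: has_weak_deriv_def partials_def)
 from has_weak_deriv_unique[OF \<Omega> Hk_measurable[OF u] this Hk_has_weak_deriv[OF u]] borel_rep(3)[OF \<Omega>b Hk_measurable[OF u]]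
 show ?thesis by (simp add: wderiv_def) (erule AE_mp, erule AE_mp, auto)
qed

text \<open>\<open>Hk_norm\<close> of a combination involves fresh choices of weak derivatives on
  \<open>S\<close>; uniqueness expresses them by the classical derivatives of \<phi> and the weak
  ones of \<open>u\<close> on \<Omega>. The coefficients cover the two differences of \<phi> and
  \<open>u\<close> in either order and the restriction of \<open>u\<close> itself.\<close>

lemma Hk_1_norm_combination:
 fixes a b :: real
 assumes \<Omega>: "open \<Omega>" "bounded \<Omega>" and S: "open S" "S \<subseteq> \<Omega>" and u: "u \<in> Hk 1 \<Omega>" and \<phi>: "\<phi> \<in> C_inf"
 defines "v \<equiv> \<lambda>x. a * \<phi> x + b * u x"
 shows "v \<in> Hk 1 S"
  and "(Hk_norm 1 S v)^2 = (LBINT x:S. (a * \<phi> x + b * wderiv \<Omega> (0, 0) u x)^2)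
    + (LBINT x:S. (norm (a *\<^sub>R grad \<phi> x + b *\<^sub>R wgrad \<Omega> (0, 0) u x))^2)"
proof -
 have bS: "bounded S" using \<Omega> S bounded_subset by blast
 have Sb: "S \<in> sets borel" and \<Omega>b: "\<Omega> \<in> sets borel" using S \<Omega> by auto
 define d where "d \<alpha> = partials \<alpha> \<phi>" for \<alpha>
 define h where "h \<alpha> x = a * d \<alpha> x + b * wderiv \<Omega> \<alpha> u x" for \<alpha> x
 have dC: "d \<alpha> \<in> C_inf" for \<alpha> using \<phi> by (simp add: d_def partials_def funpow_partial_C_inf)
 have d0: "d (0, 0) = \<phi>" "d (1, 0) = partial 1 \<phi>" "d (0, 1) = partial 2 \<phi>" by (simp_all add: d_def partials_def)
 have le: "fst \<alpha> + snd \<alpha> \<le> 1" if "\<alpha> \<in> multi_indices 1" for \<alpha> using that by (simp add: multi_indices_def)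
 note um = Hk_measurable[OF u]
 note u0 = Hk_wderiv_zero[OF \<Omega> u]
 have hm [measurable]: "h \<alpha> \<in> borel_measurable borel" if "\<alpha> \<in> multi_indices 1" for \<alpha>
  unfolding h_def using C_inf_measurable[OF dC] wderiv_props(1)[OF \<Omega> u le[OF that]] by measurable
 have h2: "set_integrable lborel S (\<lambda>x. (h \<alpha> x)^2)" if \<alpha>: "\<alpha> \<in> multi_indices 1" for \<alpha> unfolding set_integrable_def
 proof (rule Bochner_Integration.integrable_bound)
  have "set_integrable lborel S (\<lambda>x. 2 * a^2 * (d \<alpha> x)^2 + 2 * b^2 * (wderiv \<Omega> \<alpha> u x)^2)"
   by (intro set_integral_add(1) set_integrable_mult_right C_inf_square_integrable dC bS Sb
     integrable_imp_set_integrable wderiv_props(4)[OF \<Omega> u le[OF \<alpha>]])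
  then show "integrable lborel (\<lambda>x. indicator S x *\<^sub>R (2 * a^2 * (d \<alpha> x)^2 + 2 * b^2 * (wderiv \<Omega> \<alpha> u x)^2))"
   by (simp add: set_integrable_def)
  show "(\<lambda>x. indicator S x *\<^sub>R (h \<alpha> x)^2) \<in> borel_measurable lborel" using hm[OF \<alpha>] Sb by measurable
  have "(h \<alpha> x)^2 \<le> 2 * a^2 * (d \<alpha> x)^2 + 2 * b^2 * (wderiv \<Omega> \<alpha> u x)^2" for x
   using sum_squares_bound[of "a * d \<alpha> x" "b * wderiv \<Omega> \<alpha> u x"] by (simp add: h_def power2_sum power_mult_distrib)
  then show "AE x in lborel. norm (indicator S x *\<^sub>R (h \<alpha> x)^2) \<le> norm (indicator S x *\<^sub>R (2 * a^2 * (d \<alpha> x)^2 + 2 * b^2 * (wderiv \<Omega> \<alpha> u x)^2))"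
   by (intro AE_I2) (auto simp: indicator_def)
 qed
 have hL: "h \<alpha> \<in> L2 (lebesgue_on S)" if \<alpha>: "\<alpha> \<in> multi_indices 1" for \<alpha> unfolding L2_def
 proof (intro CollectI conjI)
  show "h \<alpha> \<in> borel_measurable (lebesgue_on S)" by (rule measurable_lebesgue_on_AE[OF Sb hm[OF \<alpha>]]) simp
  have "(\<lambda>x. (h \<alpha> x)^2) \<in> borel_measurable borel" using hm[OF \<alpha>] by measurable
  from integrable_lebesgue_on_eq[OF Sb this, of "\<lambda>x. (h \<alpha> x)^2"] h2[OF \<alpha>]
  show "integrable (lebesgue_on S) (\<lambda>x. (h \<alpha> x)^2)" by simp
 qed
 have mi: "(0, 0) \<in> multi_indices 1" by (simp add: multi_indices_def)
 have vae: "AE x in lborel. x \<in> S --> v x = h (0, 0) x" using u0 by eventually_elim (use S(2) in \<open>auto simp: v_def h_def d0\<close>)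
 have vL: "v \<in> L2 (lebesgue_on S)" unfolding L2_def
 proof (intro CollectI conjI)
  show "v \<in> borel_measurable (lebesgue_on S)" by (rule measurable_lebesgue_on_AE[OF Sb hm[OF mi] vae])
  have "(\<lambda>x. (h (0, 0) x)^2) \<in> borel_measurable borel" using hm[OF mi] by measurable
  moreover have "AE x in lborel. x \<in> S --> (v x)^2 = (h (0, 0) x)^2" using vae by eventually_elim auto
  ultimately show "integrable (lebesgue_on S) (\<lambda>x. (v x)^2)" using integrable_lebesgue_on_eq[OF Sb, of "\<lambda>x. (h (0, 0) x)^2"] h2[OF mi] by simp
 qed
 have vm: "v \<in> borel_measurable (lebesgue_on S)" using vL by (simp add: L2_def)
 have wd: "has_weak_deriv S \<alpha> v (h \<alpha>)" if \<alpha>: "\<alpha> \<in> multi_indices 1" for \<alpha> unfolding has_weak_deriv_def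
 proof (intro conjI hL[OF \<alpha>] ballI)
  fix \<psi> assume \<psi>: "\<psi> \<in> test_functions S"
  have \<psi>\<Omega>: "\<psi> \<in> test_functions \<Omega>" by (rule test_functions_mono[OF S(2) \<psi>])
  note \<psi>p = partials_test_functions[OF \<psi>, of \<alpha>] and \<psi>\<Omega>p = partials_test_functions[OF \<psi>\<Omega>, of \<alpha>]
  have [measurable]: "\<psi> \<in> borel_measurable borel" "partials \<alpha> \<psi> \<in> borel_measurable borel"
   by (rule C_inf_measurable[OF test_functions_C_inf[OF \<psi>]])
    (rule C_inf_measurable[OF test_functions_C_inf[OF \<psi>p]])
  have conv: "L2_inner (lebesgue_on S) f \<eta> = (LBINT x. g x * \<eta> x)"
   if g: "g \<in> borel_measurable borel" and ae: "AE x in lborel. x \<in> S --> f x = g x" and \<eta>: "\<eta> \<in> test_functions S" for f g \<eta>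
  proof -
   have "\<eta> \<in> borel_measurable borel" using \<eta> by (intro C_inf_measurable test_functions_C_inf)
   then have m: "(\<lambda>x. g x * \<eta> x) \<in> borel_measurable borel" using g by measurable
   have "AE x in lborel. x \<in> S --> f x \<bullet> \<eta> x = g x * \<eta> x" using ae by eventually_elim auto
   from integral_lebesgue_on_eq[OF Sb m this] set_integral_zero_outside(1)[of S "\<lambda>x. g x * \<eta> x"] test_functions_zero_outside[OF \<eta>]
   show ?thesis by (simp add: L2_inner_def)
  qed
  have int: "integrable lborel (\<lambda>x. f x * \<eta> x)" if f: "f \<in> C_inf" and \<eta>: "\<eta> \<in> test_functions S" for f \<eta>
  proof -
   have "integrable lborel (\<lambda>x. indicator (closure S) x *\<^sub>R f x)"
    by (rule borel_integrable_compact) (use bS f in \<open>auto intro: C_inf_continuous\<close>)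
   from test_functions_integrable_mult[OF \<eta> this] show ?thesis
   proof (rule Bochner_Integration.integrable_cong[OF refl, THEN iffD1, rotated])
    fix x show "indicator (closure S) x *\<^sub>R f x * \<eta> x = f x * \<eta> x"
     using test_functions_zero_outside[OF \<eta>, of x] closure_subset[of S] by (auto simp: indicator_def)
   qed
  qed
  have U: "(LBINT x. wderiv \<Omega> (0, 0) u x * partials \<alpha> \<psi> x) = (-1) ^ (fst \<alpha> + snd \<alpha>) * (LBINT x. wderiv \<Omega> \<alpha> u x * \<psi> x)"
  proof -
   have "(LBINT x. wderiv \<Omega> (0, 0) u x * partials \<alpha> \<psi> x) = (LBINT x. borel_rep \<Omega> u x * partials \<alpha> \<psi> x)"
    using wderiv_test[OF \<Omega>(1) u _ \<psi>\<Omega>p, of "(0, 0)"] by (simp add: partials_def)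
   then show ?thesis using wderiv_test[OF \<Omega>(1) u le[OF \<alpha>] \<psi>\<Omega>] by simp
  qed
  have P: "(LBINT x. \<phi> x * partials \<alpha> \<psi> x) = (-1) ^ (fst \<alpha> + snd \<alpha>) * (LBINT x. d \<alpha> x * \<psi> x)"
   using \<alpha> integral_by_parts_smooth[OF \<phi> \<psi>] unfolding multi_indices_1 by (auto simp: d_def partials_def)
  have "L2_inner (lebesgue_on S) v (partials \<alpha> \<psi>) = (LBINT x. h (0, 0) x * partials \<alpha> \<psi> x)" by (rule conv[OF hm[OF mi] vae \<psi>p])
  also have "\<dots> = (LBINT x. a * (\<phi> x * partials \<alpha> \<psi> x) + b * (wderiv \<Omega> (0, 0) u x * partials \<alpha> \<psi> x))"
   by (simp add: h_def d0 algebra_simps)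
  also have "\<dots> = a * (LBINT x. \<phi> x * partials \<alpha> \<psi> x) + b * (LBINT x. wderiv \<Omega> (0, 0) u x * partials \<alpha> \<psi> x)"
   using int[OF \<phi> \<psi>p] test_functions_integrable_mult[OF \<psi>p wderiv_props(3)[OF \<Omega> u le[OF mi]]] by simp
  also have "\<dots> = (-1) ^ (fst \<alpha> + snd \<alpha>) * (a * (LBINT x. d \<alpha> x * \<psi> x) + b * (LBINT x. wderiv \<Omega> \<alpha> u x * \<psi> x))"
   unfolding U P by (simp add: algebra_simps)
  also have "a * (LBINT x. d \<alpha> x * \<psi> x) + b * (LBINT x. wderiv \<Omega> \<alpha> u x * \<psi> x)
    = (LBINT x. a * (d \<alpha> x * \<psi> x) + b * (wderiv \<Omega> \<alpha> u x * \<psi> x))"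
   using int[OF dC \<psi>] test_functions_integrable_mult[OF \<psi> wderiv_props(3)[OF \<Omega> u le[OF \<alpha>]]] by simp
  also have "\<dots> = (LBINT x. h \<alpha> x * \<psi> x)" by (simp add: h_def algebra_simps)
  also have "\<dots> = L2_inner (lebesgue_on S) (h \<alpha>) \<psi>" by (rule conv[OF hm[OF \<alpha>] _ \<psi>, symmetric]) simp
  finally show "L2_inner (lebesgue_on S) v (partials \<alpha> \<psi>) = (-1) ^ (fst \<alpha> + snd \<alpha>) * L2_inner (lebesgue_on S) (h \<alpha>) \<psi>" .
 qed
 show vH: "v \<in> Hk 1 S" unfolding Hk_def using vL wd by blast
 have n: "(LBINT x. (wderiv S \<alpha> v x)^2) = (LBINT x:S. (h \<alpha> x)^2)" if \<alpha>: "\<alpha> \<in> multi_indices 1" for \<alpha>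
 proof -
  have hmS: "h \<alpha> \<in> borel_measurable (lebesgue_on S)" using hL[OF \<alpha>] by (simp add: L2_def)
  note p = wderiv_props[OF S(1) bS vH le[OF \<alpha>]]
  have [measurable]: "wderiv S \<alpha> v \<in> borel_measurable borel" "borel_rep S (h \<alpha>) \<in> borel_measurable borel"
   using p(1) borel_rep(1)[OF Sb hmS] by auto
  have "AE x in lborel. wderiv S \<alpha> v x = borel_rep S (h \<alpha>) x"
   unfolding wderiv_def by (rule has_weak_deriv_unique[OF S(1) bS vm Hk_has_weak_deriv[OF vH le[OF \<alpha>]] wd[OF \<alpha>]])
  moreover have "AE x in lborel. x \<in> S --> h \<alpha> x = borel_rep S (h \<alpha>) x" by (rule borel_rep(3)[OF Sb hmS])
  ultimately have "AE x in lborel. (wderiv S \<alpha> v x)^2 = indicator S x *\<^sub>R (h \<alpha> x)^2"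
   by eventually_elim (use p(2) in \<open>auto simp: indicator_def\<close>)
  then show ?thesis unfolding set_lebesgue_integral_def using hm[OF \<alpha>] Sb by (intro integral_cong_AE) auto
 qed
 have mi1: "(1, 0) \<in> multi_indices 1" "(0, 1) \<in> multi_indices 1" by (auto simp: multi_indices_def)
 have "(Hk_norm 1 S v)^2 = (\<Sum>\<alpha>\<in>multi_indices 1. LBINT x:S. (h \<alpha> x)^2)" unfolding Hk_norm_eq[OF S(1) bS vH] by (rule sum.cong[OF refl n])
 also have "\<dots> = (LBINT x:S. (h (0, 0) x)^2) + ((LBINT x:S. (h (1, 0) x)^2) + (LBINT x:S. (h (0, 1) x)^2))" unfolding multi_indices_1 by simp
 also have "(LBINT x:S. (h (1, 0) x)^2) + (LBINT x:S. (h (0, 1) x)^2) = (LBINT x:S. (h (1, 0) x)^2 + (h (0, 1) x)^2)"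
  by (rule set_integral_add(2)[OF h2[OF mi1(1)] h2[OF mi1(2)], symmetric])
 also have "(\<lambda>x. (h (1, 0) x)^2 + (h (0, 1) x)^2) = (\<lambda>x. (norm (a *\<^sub>R grad \<phi> x + b *\<^sub>R wgrad \<Omega> (0, 0) u x))^2)"
  using d0(2,3) by (auto simp: fun_eq_iff norm_vec2_sq h_def grad_def wgrad_def)
 finally show "(Hk_norm 1 S v)^2 = (LBINT x:S. (a * \<phi> x + b * wderiv \<Omega> (0, 0) u x)^2)
    + (LBINT x:S. (norm (a *\<^sub>R grad \<phi> x + b *\<^sub>R wgrad \<Omega> (0, 0) u x))^2)" by (simp add: h_def d0)
qed

section \<open>L2 spaces and completeness\<close>

lemma L2_mult_integrable:
 assumes "f \<in> L2 M" "g \<in> L2 M"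
 shows "integrable M (\<lambda>x. f x * g x)"
proof (rule Bochner_Integration.integrable_bound)
 have [measurable]: "f \<in> borel_measurable M" "g \<in> borel_measurable M" using assms by (auto simp: L2_def)
 show "integrable M (\<lambda>x. (f x)^2 + (g x)^2)" using assms by (auto simp: L2_def)
 show "(\<lambda>x. f x * g x) \<in> borel_measurable M" by measurable
 have "\<bar>f x * g x\<bar> \<le> (f x)^2 + (g x)^2" for x
 proof -
  have "2 * (\<bar>f x\<bar> * \<bar>g x\<bar>) \<le> (f x)^2 + (g x)^2" using sum_squares_bound[of "\<bar>f x\<bar>" "\<bar>g x\<bar>"] by (simp add: mult.assoc)
  moreover have "0 \<le> \<bar>f x\<bar> * \<bar>g x\<bar>" by simp
  ultimately show ?thesis unfolding abs_mult by linarith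
 qed
 then show "AE x in M. norm (f x * g x) \<le> norm ((f x)^2 + (g x)^2)" by (intro AE_I2) simp
qed

lemma L2_combination:
 assumes "f \<in> L2 M" "g \<in> L2 M"
 shows "(\<lambda>x. a * f x + b * g x) \<in> L2 M"
  "L2_inner M (\<lambda>x. a * f x + b * g x) (\<lambda>x. a * f x + b * g x)
   = a^2 * L2_inner M f f + 2 * a * b * L2_inner M f g + b^2 * L2_inner M g g"
proof -
 have [measurable]: "f \<in> borel_measurable M" "g \<in> borel_measurable M" using assms by (auto simp: L2_def)
 note i = L2_mult_integrable[OF assms(1) assms(1)] L2_mult_integrable[OF assms] L2_mult_integrable[OF assms(2) assms(2)]
 have e: "(a * f x + b * g x)^2 = a^2 * (f x * f x) + 2 * a * b * (f x * g x) + b^2 * (g x * g x)" for x by (simp add: power2_eq_square algebra_simps)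
 show "(\<lambda>x. a * f x + b * g x) \<in> L2 M" unfolding L2_def using i by (auto simp: e)
 show "L2_inner M (\<lambda>x. a * f x + b * g x) (\<lambda>x. a * f x + b * g x)
   = a^2 * L2_inner M f f + 2 * a * b * L2_inner M f g + b^2 * L2_inner M g g"
  using i by (simp add: L2_inner_def e[unfolded power2_eq_square[of "a * f _ + b * g _"]])
qed

lemma L2_diff: "f \<in> L2 M ==> g \<in> L2 M ==> (\<lambda>x. f x - g x) \<in> L2 M"
 using L2_combination(1)[of f M g 1 "-1"] by simp

lemma L2_inner_self_nonneg: "0 \<le> L2_inner M f f" for f :: "'a => 'b::real_inner"
 by (simp add: L2_inner_def)

lemma L2_norm_nonneg: "0 \<le> L2_norm M f"
 by (simp add: L2_norm_def L2_inner_self_nonneg)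

lemma L2_norm_sq: "(L2_norm M f)^2 = L2_inner M f f"
 by (simp add: L2_norm_def L2_inner_self_nonneg)

lemma Cauchy_Schwarz_of_quadratic:
 fixes A B C :: real
 assumes "\<And>t. 0 \<le> A + 2 * t * B + t^2 * C" "0 \<le> A" "0 \<le> C"
 shows "\<bar>B\<bar> \<le> sqrt A * sqrt C"
proof -
 have "B^2 \<le> A * C"
 proof (cases "C = 0")
  case True
  have "B = 0"
  proof (rule ccontr)
   assume B: "B \<noteq> 0"
   \<comment> \<open>This parameter gives the expression the value -1.\<close>
   have "0 \<le> A + 2 * (- (A + 1) / (2 * B)) * B" using assms(1)[of "- (A + 1) / (2 * B)"] True by simp
   then show False using B by (simp add: field_simps)
  qed
  then show ?thesis using True by simp
 next
  case False
  then have C: "0 < C" using assms(3) by simp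
  have "0 \<le> A + 2 * (- B / C) * B + (- B / C)^2 * C" by (rule assms(1))
  also have "\<dots> = (A * C - B^2) / C" using C by (simp add: field_simps power2_eq_square)
  finally show ?thesis using C by (simp add: zero_le_divide_iff)
 qed
 then have "sqrt (B^2) \<le> sqrt (A * C)" by (rule real_sqrt_le_mono)
 then show ?thesis by (simp add: real_sqrt_mult)
qed

lemma L2_Cauchy_Schwarz:
 assumes "f \<in> L2 M" "g \<in> L2 M"
 shows "\<bar>L2_inner M f g\<bar> \<le> L2_norm M f * L2_norm M g"
 unfolding L2_norm_def
proof (rule Cauchy_Schwarz_of_quadratic)
 fix t
 show "0 \<le> L2_inner M f f + 2 * t * L2_inner M f g + t^2 * L2_inner M g g"
  using L2_inner_self_nonneg[of M "\<lambda>x. 1 * f x + t * g x"] unfolding L2_combination(2)[OF assms] by simp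
qed (rule L2_inner_self_nonneg)+

lemma L2_norm_triangle:
 assumes "f \<in> L2 M" "g \<in> L2 M"
 shows "L2_norm M (\<lambda>x. f x + g x) \<le> L2_norm M f + L2_norm M g"
proof (rule power2_le_imp_le)
 have "(L2_norm M (\<lambda>x. f x + g x))^2 = (L2_norm M f)^2 + 2 * L2_inner M f g + (L2_norm M g)^2"
  using L2_combination(2)[OF assms, of 1 1] by (simp add: L2_norm_sq)
 also have "\<dots> \<le> (L2_norm M f + L2_norm M g)^2" using L2_Cauchy_Schwarz[OF assms] by (simp add: power2_sum)
 finally show "(L2_norm M (\<lambda>x. f x + g x))^2 \<le> (L2_norm M f + L2_norm M g)^2" .
qed (simp add: L2_norm_nonneg)

lemma L2_norm_triangle_diff:
 assumes "f \<in> L2 M" "g \<in> L2 M" "h \<in> L2 M"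
 shows "L2_norm M (\<lambda>x. f x - h x) \<le> L2_norm M (\<lambda>x. f x - g x) + L2_norm M (\<lambda>x. g x - h x)"
 using L2_norm_triangle[OF L2_diff[OF assms(1,2)] L2_diff[OF assms(2,3)]] by simp

lemma L2_nn_integral:
 assumes "f \<in> L2 M"
 shows "(\<integral>\<^sup>+x. ennreal ((f x)^2) \<partial>M) = ennreal ((L2_norm M f)^2)"
proof -
 have "integrable M (\<lambda>x. (f x)^2)" using assms by (simp add: L2_def)
 from nn_integral_eq_integral[OF this] show ?thesis unfolding L2_norm_sq L2_inner_def by (simp add: power2_eq_square)
qed

lemma L2_of_nn_integral_le:
 assumes [measurable]: "f \<in> borel_measurable M" and le: "(\<integral>\<^sup>+x. ennreal ((f x)^2) \<partial>M) \<le> ennreal (c^2)" and c: "0 \<le> c"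
 shows "f \<in> L2 M" "L2_norm M f \<le> c"
proof -
 have "integrable M (\<lambda>x. (f x)^2)" by (rule integrableI_bounded) (use le in \<open>auto intro: le_less_trans\<close>)
 then show f: "f \<in> L2 M" by (simp add: L2_def)
 have "ennreal ((L2_norm M f)^2) \<le> ennreal (c^2)" using le L2_nn_integral[OF f] by simp
 then have "(L2_norm M f)^2 \<le> c^2" by (subst (asm) ennreal_le_iff) auto
 then show "L2_norm M f \<le> c" using c by (rule power2_le_imp_le)
qed

text \<open>A subsequence with increments of norm at most \<open>2\<^sup>-\<^sup>k\<close> converges almost everywhere, since
 \<open>2 \<bar>d\<bar> \<le> 2\<^sup>k d^2 + 2\<^sup>-\<^sup>k\<close>; Fatou's lemma identifies the limit.\<close>

lemma L2_complete:
 fixes f :: "nat => 'a => real"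
 assumes f: "\<And>n. f n \<in> L2 M"
  and cau: "\<And>e. 0 < e ==> \<exists>N. \<forall>m\<ge>N. \<forall>n\<ge>N. L2_norm M (\<lambda>x. f m x - f n x) < e"
 shows "\<exists>g\<in>L2 M. (\<lambda>n. L2_norm M (\<lambda>x. f n x - g x)) \<longlonglongrightarrow> 0"
proof -
 have [measurable]: "f n \<in> borel_measurable M" for n using f[of n] by (simp add: L2_def)
 obtain N where N: "\<And>k m n. N k \<le> m ==> N k \<le> n ==> L2_norm M (\<lambda>x. f m x - f n x) < (1/2) ^ k"
  using cau[of "(1/2) ^ _"] by (metis zero_less_power half_gt_zero_iff zero_less_one)
 \<comment> \<open>Summing makes the indices nondecreasing, so that \<open>r k\<close> is beyond
   \<open>N k'\<close> for every \<open>k' \<le> k\<close>.\<close>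
 define r where "r k = (\<Sum>j\<le>k. N j)" for k
 have rN: "N k \<le> r k" for k unfolding r_def by (rule member_le_sum) auto
 have rS: "r k \<le> r (Suc k)" for k by (simp add: r_def)
 have rk: "k' \<le> k ==> N k' \<le> r k" for k k' using lift_Suc_mono_le[of r, OF rS] rN order_trans by blast
 define d where "d k x = f (r (Suc k)) x - f (r k) x" for k x
 have dL: "d k \<in> L2 M" for k unfolding d_def[abs_def] by (intro L2_diff f)
 have [measurable]: "d k \<in> borel_measurable M" for k using dL[of k] by (simp add: L2_def)
 have dn: "L2_norm M (d k) \<le> (1/2) ^ k" for k unfolding d_def[abs_def] by (rule less_imp_le[OF N[OF rk rk]]) auto
 have "(\<integral>\<^sup>+x. (\<Sum>k. ennreal (2 ^ k * (d k x)^2)) \<partial>M) = (\<Sum>k. \<integral>\<^sup>+x. ennreal (2 ^ k * (d k x)^2) \<partial>M)"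
  by (rule nn_integral_suminf) measurable
 also have "\<dots> = (\<Sum>k. ennreal (2 ^ k * (L2_norm M (d k))^2))" using L2_nn_integral[OF dL] by (simp add: ennreal_mult nn_integral_cmult)
 also have "\<dots> \<le> (\<Sum>k. ennreal ((1/2) ^ k))"
 proof (intro suminf_le summableI ennreal_leI)
  fix k
  have "(L2_norm M (d k))^2 \<le> ((1/2) ^ k)^2" using dn[of k] by (intro power_mono L2_norm_nonneg)
  then have "2 ^ k * (L2_norm M (d k))^2 \<le> 2 ^ k * ((1/2) ^ k)^2" by (intro mult_left_mono) auto
  also have "(2::real) ^ k * ((1/2) ^ k)^2 = (2 ^ k * (1/2) ^ k) * (1/2) ^ k" unfolding power2_eq_square by (simp only: mult.assoc)
  also have "(2::real) ^ k * (1/2) ^ k = 1" by (simp only: power_mult_distrib[symmetric]) simp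
  also have "1 * (1/2::real) ^ k = (1/2) ^ k" by simp
  finally show "2 ^ k * (L2_norm M (d k))^2 \<le> (1/2) ^ k" .
 qed
 also have "\<dots> < \<infinity>" by (subst suminf_ennreal2) (auto intro: summable_geometric)
 finally have "AE x in M. (\<Sum>k. ennreal (2 ^ k * (d k x)^2)) \<noteq> \<infinity>" by (intro nn_integral_noteq_infinite) (auto simp: less_top[symmetric])
 then have conv: "AE x in M. convergent (\<lambda>k. f (r k) x)"
 proof eventually_elim
  case (elim x)
  have "summable (\<lambda>k. 2 ^ k * (d k x)^2)" using elim by (intro summable_suminf_not_top) auto
  then have "summable (\<lambda>k. (2 ^ k * (d k x)^2 + (1/2) ^ k))" by (intro summable_add summable_geometric) auto
  then have "summable (\<lambda>k. d k x)"
  proof (rule summable_comparison_test'[where N = 0])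
   fix k
   have "(2 * \<bar>d k x\<bar>) \<le> 2 ^ k * (d k x)^2 + (1/2) ^ k"
   proof -
    have "0 \<le> (2 ^ k * \<bar>d k x\<bar> - 1)^2 / 2 ^ k" by simp
    also have "\<dots> = 2 ^ k * (d k x)^2 - 2 * \<bar>d k x\<bar> + (1/2) ^ k" by (simp add: power2_diff power_mult_distrib field_simps power2_eq_square)
    finally show ?thesis by simp
   qed
   then show "norm (d k x) \<le> 2 ^ k * (d k x)^2 + (1/2) ^ k" by simp
  qed
  then have "convergent (\<lambda>n. \<Sum>k<n. d k x)" by (simp add: summable_iff_convergent)
  moreover have "(\<Sum>k<n. d k x) = f (r n) x - f (r 0) x" for n unfolding d_def by (rule sum_lessThan_telescope)
  ultimately have "convergent (\<lambda>n. f (r n) x - f (r 0) x)" by simp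
  from convergent_add[OF this convergent_const[of "f (r 0) x"]] show ?case by simp
 qed
 define g where "g x = lim (\<lambda>k. f (r k) x)" for x
 have [measurable]: "g \<in> borel_measurable M" unfolding g_def[abs_def] by measurable
 have lim: "AE x in M. (\<lambda>k. f (r k) x) \<longlonglongrightarrow> g x" using conv by eventually_elim (simp add: g_def convergent_LIMSEQ_iff)
 have bound: "(\<lambda>x. f n x - g x) \<in> L2 M \<and> L2_norm M (\<lambda>x. f n x - g x) \<le> (1/2) ^ k" if n: "N k \<le> n" for n k
 proof -
  have "(\<integral>\<^sup>+x. ennreal ((f n x - g x)^2) \<partial>M) = (\<integral>\<^sup>+x. liminf (\<lambda>j. ennreal ((f n x - f (r j) x)^2)) \<partial>M)"
  proof (rule nn_integral_cong_AE)
   show "AE x in M. ennreal ((f n x - g x)^2) = liminf (\<lambda>j. ennreal ((f n x - f (r j) x)^2))" using lim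
   proof eventually_elim
    case (elim x)
    have "(\<lambda>j. ennreal ((f n x - f (r j) x)^2)) \<longlonglongrightarrow> ennreal ((f n x - g x)^2)" by (intro tendsto_ennrealI tendsto_intros elim)
    then show ?case by (rule lim_imp_Liminf[OF trivial_limit_sequentially, symmetric])
   qed
  qed
  also have "\<dots> \<le> liminf (\<lambda>j. \<integral>\<^sup>+x. ennreal ((f n x - f (r j) x)^2) \<partial>M)" by (rule nn_integral_liminf) measurable
  also have "\<dots> = liminf (\<lambda>j. ennreal ((L2_norm M (\<lambda>x. f n x - f (r j) x))^2))" by (simp add: L2_nn_integral[OF L2_diff[OF f f]])
  also have "\<dots> \<le> ennreal (((1/2) ^ k)^2)"
  proof (rule Liminf_le)
   show "\<forall>\<^sub>F j in sequentially. ennreal ((L2_norm M (\<lambda>x. f n x - f (r j) x))^2) \<le> ennreal (((1/2) ^ k)^2)"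
    using eventually_ge_at_top[of k] by eventually_elim (intro ennreal_leI power_mono L2_norm_nonneg less_imp_le[OF N[OF n rk]])
  qed simp
  finally show ?thesis using L2_of_nn_integral_le[of "\<lambda>x. f n x - g x" M "(1/2) ^ k"] by simp
 qed
 have "(\<lambda>x. f (N 0) x - (f (N 0) x - g x)) \<in> L2 M" by (rule L2_diff[OF f conjunct1[OF bound[OF order_refl]]])
 then have gL: "g \<in> L2 M" by simp
 have "(\<lambda>n. L2_norm M (\<lambda>x. f n x - g x)) \<longlonglongrightarrow> 0"
 proof (rule LIMSEQ_I)
  fix e :: real assume "0 < e"
  then obtain k where k: "(1/2::real) ^ k < e" using real_arch_pow_inv[of e "1/2"] by auto
  show "\<exists>n0. \<forall>n\<ge>n0. norm (L2_norm M (\<lambda>x. f n x - g x) - 0) < e"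
  proof (intro exI[of _ "N k"] allI impI)
   fix n assume "N k \<le> n"
   then have "L2_norm M (\<lambda>x. f n x - g x) < e" using bound[of k n] k by simp
   then show "norm (L2_norm M (\<lambda>x. f n x - g x) - 0) < e" by (simp add: L2_norm_nonneg)
  qed
 qed
 then show ?thesis using gL by blast
qed

section \<open>Integrals over edges\<close>

text \<open>The endpoints \<open>c\<close>, \<open>d\<close> chosen inside
  \<open>edge_measure\<close> may be \<open>a\<close>, \<open>b\<close> in either order. The
  computation is done with \<open>c\<close>, \<open>d\<close>, and the reflection \<open>t\<close>
  to \<open>1 - t\<close> covers the swapped case.\<close>

lemma edge_measure_segment:
 fixes a b :: "real^2" and f :: "real^2 => real"
 assumes ab: "a \<noteq> b" and f: "f \<in> borel_measurable (restrict_space borel (closed_segment a b))"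
 shows "integral\<^sup>L (edge_measure (closed_segment a b)) f = dist a b * (LINT s:{0..1}|lborel. f (a + s *\<^sub>R (b - a)))"
  and "integrable (edge_measure (closed_segment a b)) f \<longleftrightarrow> set_integrable lborel {0..1} (\<lambda>s. f (a + s *\<^sub>R (b - a)))"
  and "sets (edge_measure (closed_segment a b)) = sets (restrict_space borel (closed_segment a b))"
proof -
 let ?e = "closed_segment a b"
 have ebor: "?e \<in> sets borel" using compact_segment(1) by (intro borel_compact)
 define P where "P = (SOME (a', b'). ?e = closed_segment a' b')"
 have "case P of (a', b') => ?e = closed_segment a' b'" unfolding P_def by (rule someI[of "\<lambda>(a', b'). ?e = closed_segment a' b'" "(a, b)"]) simp
 then obtain c d where P: "P = (c, d)" and cd: "?e = closed_segment c d" by (cases P) auto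
 have cases: "(c = a \<and> d = b) \<or> (c = b \<and> d = a)" using cd closed_segment_eq[of a b c d] by (auto simp: doubleton_eq_iff)
 have L: "dist c d = dist a b" "0 < dist a b" using cases ab by (auto simp: dist_commute)
 let ?g = "\<lambda>s. linepath c d (s / dist c d)"
 define F where "F x = indicator ?e x * f x" for x
 have Fm [measurable]: "F \<in> borel_measurable borel" using f borel_measurable_restrict_space_iff[of ?e borel f] ebor by (simp add: F_def[abs_def])
 have gm: "?g \<in> borel_measurable borel" unfolding linepath_def by (intro borel_measurable_continuous_onI continuous_intros) (use L in auto)
 have ge: "?g s \<in> ?e" if "s \<in> {0..dist c d}" for s unfolding cd using that L by (intro linepath_in_path) (auto simp: divide_le_eq)
 have gM: "?g \<in> measurable (lebesgue_on {0..dist c d}) (restrict_space borel ?e)"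
 proof (rule measurable_restrict_space2)
  show "?g \<in> space (lebesgue_on {0..dist c d}) \<rightarrow> ?e" using ge by (auto simp: space_restrict_space)
  have "?g \<in> borel_measurable lebesgue" by (rule measurable_completion) (use gm in simp)
  then show "?g \<in> borel_measurable (lebesgue_on {0..dist c d})" by (rule measurable_restrict_space1)
 qed
 have em: "edge_measure ?e = distr (lebesgue_on {0..dist c d}) (restrict_space borel ?e) ?g" unfolding edge_measure_def P_def[symmetric] P by simp
 show "sets (edge_measure ?e) = sets (restrict_space borel ?e)" unfolding em by simp
 have S: "{0..dist c d} \<inter> space lebesgue \<in> sets lebesgue" by simp
 have eqF: "indicator {0..dist c d} s *\<^sub>R f (?g s) = indicator {0..dist c d} s * F (?g s)" for s using ge[of s] by (auto simp: F_def indicator_def)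
 have m: "(\<lambda>s. indicator {0..dist c d} s * F (?g s)) \<in> borel_measurable lborel" using gm by measurable
 have gx: "?g (0 + dist c d * t) = c + t *\<^sub>R (d - c)" for t using L by (simp add: linepath_def algebra_simps)
 have sub: "indicator {0..dist c d} (0 + dist c d * t) * F (?g (0 + dist c d * t)) = indicator {0..1} t *\<^sub>R f (c + t *\<^sub>R (d - c))" for t
 proof -
  have "(0 + dist c d * t \<in> {0..dist c d}) = (t \<in> {0..1})" using L by (auto simp: zero_le_mult_iff)
  moreover have "F (?g (0 + dist c d * t)) = f (c + t *\<^sub>R (d - c))" if "t \<in> {0..1}"
   using ge[of "0 + dist c d * t"] that L calculation unfolding gx by (auto simp: F_def)
  ultimately show ?thesis by (auto simp: indicator_def)
 qed
 have "integral\<^sup>L (edge_measure ?e) f = integral\<^sup>L (lebesgue_on {0..dist c d}) (\<lambda>s. f (?g s))" unfolding em by (rule integral_distr[OF gM f])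
 also have "\<dots> = (LINT s|lebesgue. indicator {0..dist c d} s * F (?g s))" by (simp only: integral_restrict_space[OF S] eqF)
 also have "\<dots> = (LBINT s. indicator {0..dist c d} s * F (?g s))" by (rule integral_completion[OF m])
 also have "\<dots> = \<bar>dist c d\<bar> *\<^sub>R (LBINT t. indicator {0..dist c d} (0 + dist c d * t) * F (?g (0 + dist c d * t)))"
  by (rule lborel_integral_real_affine) (use L in simp)
 finally have 1: "integral\<^sup>L (edge_measure ?e) f = dist a b * (LINT t:{0..1}|lborel. f (c + t *\<^sub>R (d - c)))"
  unfolding sub set_lebesgue_integral_def using L by simp
 have "integrable (edge_measure ?e) f \<longleftrightarrow> integrable (lebesgue_on {0..dist c d}) (\<lambda>s. f (?g s))"
  unfolding em by (rule integrable_distr_eq[OF gM f])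
 also have "\<dots> \<longleftrightarrow> integrable lebesgue (\<lambda>s. indicator {0..dist c d} s * F (?g s))"
  by (simp only: integrable_restrict_space[OF S] eqF)
 also have "\<dots> \<longleftrightarrow> integrable lborel (\<lambda>s. indicator {0..dist c d} s * F (?g s))" by (rule integrable_completion[OF m])
 also have "\<dots> \<longleftrightarrow> integrable lborel (\<lambda>t. indicator {0..dist c d} (0 + dist c d * t) * F (?g (0 + dist c d * t)))"
  using lborel_integrable_real_affine_iff[of "dist c d" "\<lambda>s. indicator {0..dist c d} s * F (?g s)" 0] L by simp
 finally have 2: "integrable (edge_measure ?e) f \<longleftrightarrow> set_integrable lborel {0..1} (\<lambda>t. f (c + t *\<^sub>R (d - c)))"
  unfolding sub set_integrable_def .
 have flip: "indicator {0..1} (1 + (-1) * t) *\<^sub>R f (b + (1 + (-1) * t) *\<^sub>R (a - b)) = indicator {0..1} t *\<^sub>R f (a + t *\<^sub>R (b - a))" for t :: real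
 proof -
  have "b + (1 + (-1) * t) *\<^sub>R (a - b) = a + t *\<^sub>R (b - a)" by (simp add: algebra_simps)
  then show ?thesis by (auto simp: indicator_def)
 qed
 have f1: "(LINT t:{0..1}|lborel. f (b + t *\<^sub>R (a - b))) = (LINT t:{0..1}|lborel. f (a + t *\<^sub>R (b - a)))" unfolding set_lebesgue_integral_def
  using lborel_integral_real_affine[of "-1" "\<lambda>t. indicator {0..1} t *\<^sub>R f (b + t *\<^sub>R (a - b))" 1] unfolding flip by simp
 have f2: "set_integrable lborel {0..1} (\<lambda>t. f (b + t *\<^sub>R (a - b))) \<longleftrightarrow> set_integrable lborel {0..1} (\<lambda>t. f (a + t *\<^sub>R (b - a)))"
  unfolding set_integrable_def
  using lborel_integrable_real_affine_iff[of "-1" "\<lambda>t. indicator {0..1} t *\<^sub>R f (b + t *\<^sub>R (a - b))" 1] unfolding flip by simp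
 show "integral\<^sup>L (edge_measure ?e) f = dist a b * (LINT s:{0..1}|lborel. f (a + s *\<^sub>R (b - a)))" using 1 f1 cases by auto
 show "integrable (edge_measure ?e) f \<longleftrightarrow> set_integrable lborel {0..1} (\<lambda>s. f (a + s *\<^sub>R (b - a)))" using 2 f2 cases by auto
qed

section \<open>Triangles with labelled vertices\<close>

text \<open>An ordered labelling of the vertices. Rotations and swaps give further labellings of the
  same triangle, so that a statement about the edge \<open>AB\<close> covers all edges.\<close>

definition is_tri :: "(real^2) set => real^2 => real^2 => real^2 => bool" where
 "is_tri T A B C \<longleftrightarrow> T = convex hull {A, B, C} \<and> \<not> affine_dependent {A, B, C} \<and> dbl_area A B C \<noteq> 0"

lemma dbl_area_distinct: "dbl_area A B C \<noteq> 0 ==> A \<noteq> B \<and> B \<noteq> C \<and> A \<noteq> C"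
 by (auto simp: dbl_area_def crs_def)

lemma dbl_area_zero_imp_affine_dependent:
 assumes 0: "dbl_area A B C = 0" and ne: "A \<noteq> B" "B \<noteq> C" "A \<noteq> C"
 shows "affine_dependent {A, B, C}"
proof -
 have "\<exists>t. C - A = t *\<^sub>R (B - A)"
 proof (cases "(B - A)$1 = 0")
  case True
  then have b2: "(B - A)$2 \<noteq> 0" using ne(1) by (auto simp: vec2_eq_iff)
  have "(C - A)$1 = 0" using 0 True b2 by (simp add: dbl_area_def crs_def)
  then show ?thesis using True b2 by (intro exI[of _ "(C - A)$2 / (B - A)$2"]) (simp add: vec2_eq_iff)
 next
  case False
  then have "(C - A)$2 = (C - A)$1 / (B - A)$1 * (B - A)$2" using 0 by (simp add: dbl_area_def crs_def field_simps)
  then show ?thesis using False by (intro exI[of _ "(C - A)$1 / (B - A)$1"]) (simp add: vec2_eq_iff)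
 qed
 then obtain t where t: "C - A = t *\<^sub>R (B - A)" ..
 have "C = (1 - t) *\<^sub>R A + t *\<^sub>R B" using t by (simp add: algebra_simps)
 then have "C \<in> affine hull {A, B}" unfolding affine_hull_2 by force
 moreover have "{A, B, C} - {C} = {A, B}" using ne by auto
 ultimately show ?thesis unfolding affine_dependent_def by (intro bexI[of _ C]) auto
qed

lemma simplex_is_tri:
 assumes "2 simplex T"
 obtains A B C where "is_tri T A B C"
proof -
 obtain V where V: "\<not> affine_dependent V" "int (card V) = 2 + 1" "T = convex hull V" using assms by (auto simp: simplex_def)
 then have "card V = 3" by simp
 then obtain A B C where V3: "V = {A, B, C}" "A \<noteq> B" "B \<noteq> C" "A \<noteq> C" by (auto simp: card_3_iff)
 then have "dbl_area A B C \<noteq> 0" using dbl_area_zero_imp_affine_dependent V(1) by blast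
 then show ?thesis using that V V3 by (auto simp: is_tri_def)
qed

lemma is_tri_rotate:
 assumes "is_tri T A B C"
 shows "is_tri T B C A"
proof -
 have "{B, C, A} = {A, B, C}" by auto
 then show ?thesis using assms dbl_area_rotate[where A = A and B = B and C = C] by (simp add: is_tri_def)
qed

lemma is_tri_swap:
 assumes "is_tri T A B C"
 shows "is_tri T B A C"
proof -
 have "{B, A, C} = {A, B, C}" by auto
 then show ?thesis using assms dbl_area_swap[where A = A and B = B and C = C] by (simp add: is_tri_def)
qed

text \<open>The faces of a simplex are the hulls of subsets of its vertices, and affine dimension
  one selects the subsets with two elements.\<close>

lemma is_tri_edge_iff:
 assumes T: "is_tri T A B C"
 shows "e edge_of T \<longleftrightarrow> e \<in> {closed_segment A B, closed_segment B C, closed_segment C A}"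
proof -
 have ind: "\<not> affine_dependent {A, B, C}" and Teq: "T = convex hull {A, B, C}" and ne: "A \<noteq> B" "B \<noteq> C" "A \<noteq> C"
  using T dbl_area_distinct[of A B C] by (auto simp: is_tri_def)
 have dim: "aff_dim (convex hull c) = int (card c) - 1" if "c \<subseteq> {A, B, C}" for c
  using aff_dim_affine_independent[OF affine_independent_subset[OF ind that]] by (simp add: aff_dim_convex_hull)
 have two: "c \<in> {{A, B}, {B, C}, {C, A}}" if c: "c \<subseteq> {A, B, C}" "card c = 2" for c
 proof -
  obtain x y where xy: "c = {x, y}" "x \<noteq> y" using c(2) by (auto simp: card_2_iff)
  then show ?thesis using c(1) by auto
 qed
 show ?thesis
 proof
  assume "e edge_of T"
  then have f: "e face_of (convex hull {A, B, C})" "aff_dim e = 1" by (simp_all add: edge_of_def Teq)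
  obtain c where c: "c \<subseteq> {A, B, C}" "e = convex hull c" using iffD1[OF face_of_convex_hull_affine_independent[OF ind] f(1)] by (elim exE conjE)
  then have "card c = 2" using dim[OF c(1)] f(2) by simp
  then have "c \<in> {{A, B}, {B, C}, {C, A}}" by (rule two[OF c(1)])
  then show "e \<in> {closed_segment A B, closed_segment B C, closed_segment C A}" unfolding c(2) segment_convex_hull by auto
 next
  have seg: "closed_segment x y edge_of T" if "x \<in> {A, B, C}" "y \<in> {A, B, C}" "x \<noteq> y" for x y
  proof -
   have sub: "{x, y} \<subseteq> {A, B, C}" using that by simp
   have "convex hull {x, y} face_of (convex hull {A, B, C})"
    by (rule iffD2[OF face_of_convex_hull_affine_independent[OF ind]], rule exI[of _ "{x, y}"]) (use sub in simp)
   moreover have "aff_dim (convex hull {x, y}) = 1" using dim[OF sub] that(3) by simp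
   ultimately show ?thesis by (simp add: edge_of_def Teq segment_convex_hull)
  qed
  assume "e \<in> {closed_segment A B, closed_segment B C, closed_segment C A}"
  then show "e edge_of T" using seg ne by auto
 qed
qed

lemma is_tri_sum_edges:
 assumes T: "is_tri T A B C"
 shows "(\<Sum>e | e edge_of T. f e) = f (closed_segment A B) + f (closed_segment B C) + f (closed_segment C A)"
  and "finite {e. e edge_of T}"
proof -
 have ne: "A \<noteq> B" "B \<noteq> C" "A \<noteq> C" using T dbl_area_distinct[of A B C] by (auto simp: is_tri_def)
 have "{e. e edge_of T} = {closed_segment A B, closed_segment B C, closed_segment C A}" using is_tri_edge_iff[OF T] by auto
 then show "(\<Sum>e | e edge_of T. f e) = f (closed_segment A B) + f (closed_segment B C) + f (closed_segment C A)"
  "finite {e. e edge_of T}" using ne by (auto simp: doubleton_eq_iff add.assoc)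
qed

lemma edge_is_tri:
 assumes "2 simplex T" "e edge_of T"
 obtains A B C where "is_tri T A B C" "e = closed_segment A B"
proof -
 obtain A B C where T: "is_tri T A B C" using simplex_is_tri[OF assms(1)] .
 then consider "e = closed_segment A B" | "e = closed_segment B C" | "e = closed_segment C A" using is_tri_edge_iff[OF T] assms(2) by auto
 then show ?thesis by cases (use that T is_tri_rotate in blast)+
qed

text \<open>The vertices are the extreme points of \<open>T\<close>, so an edge determines its
  labelling up to a swap. This makes quantities defined through a labelling independent of its
  choice.\<close>

lemma is_tri_unique:
 assumes T: "is_tri T A B C" and T': "is_tri T A' B' C'" and e: "closed_segment A B = closed_segment A' B'"
 shows "((A' = A \<and> B' = B) \<or> (A' = B \<and> B' = A)) \<and> C' = C"
proof -
 have "{x. x extreme_point_of T} = {A, B, C}" "{x. x extreme_point_of T} = {A', B', C'}" using T T' extreme_point_of_convex_hull_affine_independent[of "{A, B, C}"]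
   extreme_point_of_convex_hull_affine_independent[of "{A', B', C'}"] by (auto simp: is_tri_def)
 then have V: "{A, B, C} = {A', B', C'}" by simp
 have AB: "(A' = A \<and> B' = B) \<or> (A' = B \<and> B' = A)" using e by (auto simp: doubleton_eq_iff)
 have "A \<noteq> B \<and> B \<noteq> C \<and> A \<noteq> C" "A' \<noteq> B' \<and> B' \<noteq> C' \<and> A' \<noteq> C'"
  using T T' dbl_area_distinct by (auto simp: is_tri_def)
 then show ?thesis using V AB by auto
qed

lemma edge_normal_norm: "dbl_area A B C \<noteq> 0 ==> norm (edge_normal A B C) = dist A B"
proof -
 assume "dbl_area A B C \<noteq> 0"
 then have "\<bar>sgn (dbl_area A B C)\<bar> = 1" by (simp add: abs_sgn_eq)
 then have "(norm (edge_normal A B C))^2 = (dist A B)^2" unfolding edge_normal_def dist_norm norm_scaleR by (simp add: norm_vec2_sq power2_commute)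
 then show ?thesis by (simp add: power2_eq_iff_nonneg)
qed

lemma edge_normal_orth: "edge_normal A B C \<bullet> (B - A) = 0"
 by (simp add: edge_normal_def inner_vec2 algebra_simps)

lemma edge_normal_apex: "edge_normal A B C \<bullet> (C - A) = - \<bar>dbl_area A B C\<bar>"
proof -
 have "(vector [B$2 - A$2, A$1 - B$1] :: real^2) \<bullet> (C - A) = - dbl_area A B C" by (simp add: inner_vec2 dbl_area_def crs_def algebra_simps)
 then show ?thesis by (simp add: edge_normal_def abs_sgn mult.commute)
qed

text \<open>A normal as described is orthogonal to \<open>AB\<close>, since \<open>B - A\<close> and
  its negative both give nonpositive products. So it is a multiple of \<open>edge_normal\<close>,
  with the sign fixed by \<open>C\<close> and the size by the unit norm.\<close>

lemma outward_normal_tri: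
 assumes T: "is_tri T A B C"
 shows "dist A B *\<^sub>R outward_normal T (closed_segment A B) = edge_normal A B C"
proof -
 have nz: "dbl_area A B C \<noteq> 0" and Teq: "T = convex hull {A, B, C}" using T by (auto simp: is_tri_def)
 let ?N = "edge_normal A B C" and ?e = "closed_segment A B"
 have ne: "A \<noteq> B" using dbl_area_distinct[OF nz] by simp
 then have L: "0 < dist A B" by simp
 have nN: "norm ?N = dist A B" by (rule edge_normal_norm[OF nz])
 let ?n = "(1 / dist A B) *\<^sub>R ?N"
 have sgn: "?N \<bullet> (y - x) \<le> 0" if x: "x \<in> ?e" and y: "y \<in> T" for x y
 proof -
  obtain s where s: "0 \<le> s" "s \<le> 1" "x = (1 - s) *\<^sub>R A + s *\<^sub>R B" using x by (auto simp: closed_segment_def)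
  have "x = A + s *\<^sub>R (B - A) + 0 *\<^sub>R (C - A)" using s by (simp add: algebra_simps)
  then have "bary C A B x = 0" using bary_param(3)[OF nz, of s 0] by simp
  moreover have "0 \<le> bary C A B y" using y mem_triangle_iff[OF nz] Teq by auto
  ultimately have "?N \<bullet> (y - x) / \<bar>dbl_area A B C\<bar> \<le> 0" using bary_edge_normal[OF nz, of y x] by simp
  then show ?thesis using nz by (simp add: divide_le_0_iff)
 qed
 have "outward_normal T ?e = ?n" unfolding outward_normal_def
 proof (rule the_equality)
  show "norm ?n = 1 \<and> (\<forall>x\<in>?e. \<forall>y\<in>T. ?n \<bullet> (y - x) \<le> 0)" using nN L sgn by (auto simp: divide_le_0_iff)
  fix n assume n: "norm n = 1 \<and> (\<forall>x\<in>?e. \<forall>y\<in>T. n \<bullet> (y - x) \<le> 0)"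
  have inT: "A \<in> T" "B \<in> T" "C \<in> T" unfolding Teq by (auto intro: hull_inc)
  have "n \<bullet> (B - A) \<le> 0" "n \<bullet> (A - B) \<le> 0" "n \<bullet> (C - A) \<le> 0" using n inT by auto
  then have 0: "n \<bullet> (B - A) = 0" and nC: "n \<bullet> (C - A) \<le> 0" by (auto simp: inner_diff_right)
  define l where "l = (n \<bullet> ?N) / (dist A B)^2"
  have nl: "n = l *\<^sub>R ?N"
  proof -
   let ?d = "B - A"
   have s2: "sgn (dbl_area A B C) * sgn (dbl_area A B C) = 1" using nz by (simp add: sgn_if)
   have d2: "(dist A B)^2 = (?d$1)^2 + (?d$2)^2" by (simp only: dist_norm norm_minus_commute[of A B] norm_vec2_sq)
   have N: "?N$1 = sgn (dbl_area A B C) * ?d$2" "?N$2 = - sgn (dbl_area A B C) * ?d$1" by (simp_all add: edge_normal_def algebra_simps)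
   have o: "n$1 * ?d$1 = - (n$2 * ?d$2)" using 0 by (simp add: inner_vec2)
   have iN: "n \<bullet> ?N = sgn (dbl_area A B C) * (n$1 * ?d$2 - n$2 * ?d$1)" by (simp only: inner_vec2 N) (simp add: algebra_simps)
   have "(n \<bullet> ?N) * ?N$1 = (n$1 * ?d$2 - n$2 * ?d$1) * ?d$2 * (sgn (dbl_area A B C) * sgn (dbl_area A B C))" unfolding iN N by (simp only: mult_ac)
   also have "\<dots> = n$1 * (?d$2)^2 - (n$2 * ?d$2) * ?d$1" unfolding s2 by (simp only: power2_eq_square) (simp only: algebra_simps mult_1_right)
   also have "\<dots> = n$1 * (dist A B)^2" unfolding d2 using o by (simp only: power2_eq_square) (simp only: algebra_simps, algebra)
   finally have c1: "(n \<bullet> ?N) * ?N$1 = n$1 * (dist A B)^2" .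
   have "(n \<bullet> ?N) * ?N$2 = - (n$1 * ?d$2 - n$2 * ?d$1) * ?d$1 * (sgn (dbl_area A B C) * sgn (dbl_area A B C))"
    unfolding iN N by (simp only: mult_ac mult_minus_left mult_minus_right)
   also have "\<dots> = n$2 * (?d$1)^2 - (n$1 * ?d$1) * ?d$2" unfolding s2 by (simp only: power2_eq_square) (simp only: algebra_simps mult_1_right, algebra)
   also have "\<dots> = n$2 * (dist A B)^2" unfolding d2 o by (simp only: power2_eq_square) (simp only: ring_distribs, simp)
   finally have c2: "(n \<bullet> ?N) * ?N$2 = n$2 * (dist A B)^2" .
   show ?thesis unfolding vec2_eq_iff using c1 c2 L by (simp add: l_def)
  qed
  have "0 \<le> l"
  proof -
   have "n \<bullet> (C - A) = l * - \<bar>dbl_area A B C\<bar>" by (subst nl) (simp add: edge_normal_apex)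
   then have "0 \<le> l * \<bar>dbl_area A B C\<bar>" using nC by simp
   then show ?thesis using nz by (simp add: zero_le_mult_iff)
  qed
  moreover have "\<bar>l\<bar> * dist A B = 1" using n nN by (metis nl norm_scaleR)
  ultimately have "l = 1 / dist A B" using L by (simp add: field_simps)
  then show "n = ?n" using nl by simp
 qed
 then show ?thesis using L by simp
qed

section \<open>Traces on the edges of a mesh\<close>

text \<open>The last inclusion rests on the condition that \<Omega> is the interior of its closure;
  it lets the weak derivatives of \<open>u\<close> on \<Omega> be used on every triangle.\<close>

lemma conforming_mesh_triangle:
 assumes \<Omega>: "polygonal_domain \<Omega>" and mesh: "conforming_mesh \<Omega> \<T>" and T: "T \<in> \<T>"
 shows "2 simplex T" "T \<subseteq> closure \<Omega>" "interior T \<subseteq> \<Omega>"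
proof -
 show "2 simplex T" "T \<subseteq> closure \<Omega>" using mesh T by (auto simp: conforming_mesh_def)
 then have "interior T \<subseteq> interior (closure \<Omega>)" by (intro interior_mono)
 then show "interior T \<subseteq> \<Omega>" using \<Omega> by (simp add: polygonal_domain_def)
qed

lemma continuous_edge_measurable:
 fixes f :: "real^2 => real"
 assumes ab: "a \<noteq> b" and f: "continuous_on (closed_segment a b) f"
 shows "f \<in> borel_measurable (restrict_space borel (closed_segment a b))" "f \<in> L2 (edge_measure (closed_segment a b))"
  "f \<in> borel_measurable (edge_measure (closed_segment a b))"
proof -
 show m: "f \<in> borel_measurable (restrict_space borel (closed_segment a b))" by (rule borel_measurable_continuous_on_restrict[OF f])
 then have m2: "(\<lambda>x. (f x)^2) \<in> borel_measurable (restrict_space borel (closed_segment a b))" by measurable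
 show em: "f \<in> borel_measurable (edge_measure (closed_segment a b))" using m edge_measure_segment(3)[OF ab m] measurable_cong_sets by blast
 have im: "(\<lambda>s. a + s *\<^sub>R (b - a)) ` {0..1} \<subseteq> closed_segment a b"
 proof safe
  fix s :: real assume "s \<in> {0..1}"
  moreover have "a + s *\<^sub>R (b - a) = (1 - s) *\<^sub>R a + s *\<^sub>R b" by (simp add: algebra_simps)
  ultimately show "a + s *\<^sub>R (b - a) \<in> closed_segment a b" unfolding closed_segment_def by auto
 qed
 have "set_integrable lborel {0..1} (\<lambda>s. (f (a + s *\<^sub>R (b - a)))^2)" unfolding set_integrable_def
  by (intro borel_integrable_compact continuous_intros continuous_on_compose2[OF f _ im]) auto
 then show "f \<in> L2 (edge_measure (closed_segment a b))" using em edge_measure_segment(2)[OF ab m2] by (simp add: L2_def)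
qed

lemma set_integral_interior_triangle:
 fixes f :: "real^2 => real"
 assumes [measurable]: "f \<in> borel_measurable borel"
 shows "(LBINT x:interior (convex hull {A, B, C}). f x) = (LBINT x:convex hull {A, B, C}. f x)"
proof -
 let ?T = "convex hull {A, B, C}"
 have "AE x in lborel. indicator (interior ?T) x *\<^sub>R f x = indicator ?T x *\<^sub>R f x" using AE_not_frontier_convex[OF convex_triangle[of A B C]]
  by eventually_elim (use compact_triangle[of A B C] interior_subset in \<open>auto simp: frontier_def compact_imp_closed indicator_def\<close>)
 then show ?thesis unfolding set_lebesgue_integral_def by (intro integral_cong_AE) auto
qed

lemma
 assumes \<Omega>: "open \<Omega>" "bounded \<Omega>" and S: "open S" "S \<subseteq> \<Omega>" and u: "u \<in> Hk 1 \<Omega>" and \<eta>: "\<eta> \<in> C_inf"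
 shows Hk_1_norm_diff: "(Hk_norm 1 S (\<lambda>x. \<eta> x - u x))^2
   = (LBINT x:S. (\<eta> x - wderiv \<Omega> (0, 0) u x)^2 + (norm (grad \<eta> x - wgrad \<Omega> (0, 0) u x))^2)"
  and Hk_1_diff_integrable: "set_integrable lborel S (\<lambda>x. (\<eta> x - wderiv \<Omega> (0, 0) u x)^2)"
   "set_integrable lborel S (\<lambda>x. (norm (grad \<eta> x - wgrad \<Omega> (0, 0) u x))^2)"
proof -
 let ?U = "wderiv \<Omega> (0, 0) u" and ?G = "wgrad \<Omega> (0, 0) u"
 have H: "H1_fun \<Omega> ?U ?G" by (rule H1_fun_wderiv[OF \<Omega> u]) simp
 have bS: "bounded S" using \<Omega>(2) S(2) bounded_subset by blast
 have [measurable]: "S \<in> sets borel" using S(1) by simp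
 note [measurable] = H1_funD(5,6)[OF H]
 note [measurable] = C_inf_measurable[OF \<eta>] C_inf_grad_measurable[OF \<eta>]
 have cS: "compact (closure S)" using bS by simp
 have sub2: "set_integrable lborel S f" if "continuous_on (closure S) f" for f :: "real^2 => real"
  by (rule set_integrable_subset[OF set_integrable_continuous_compact[OF cS that]]) (use closure_subset in auto)
 have b1: "(a - b)^2 \<le> 2 * a^2 + 2 * b^2" for a b :: real using zero_le_power2[of "a + b"] by (simp add: power2_sum power2_diff)
 have b2: "(norm (a - b))^2 \<le> 2 * (norm a)^2 + 2 * (norm b)^2" for a b :: "real^2" using b1[of "a$1" "b$1"] b1[of "a$2" "b$2"] by (simp add: norm_vec2_sq)
 show i1: "set_integrable lborel S (\<lambda>x. (\<eta> x - ?U x)^2)"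
 proof (rule set_integrable_bound)
  show "set_integrable lborel S (\<lambda>x. 2 * (\<eta> x)^2 + 2 * (?U x)^2)"
   by (intro set_integral_add(1) set_integrable_mult_right sub2 continuous_on_power C_inf_continuous[OF \<eta>]
    integrable_imp_set_integrable H1_funD(2)[OF H]) auto
  show "set_borel_measurable lborel S (\<lambda>x. (\<eta> x - ?U x)^2)" unfolding set_borel_measurable_def by measurable
  show "AE x in lborel. x \<in> S --> norm ((\<eta> x - ?U x)^2) \<le> norm (2 * (\<eta> x)^2 + 2 * (?U x)^2)" using b1 by (intro AE_I2) auto
 qed
 show i2: "set_integrable lborel S (\<lambda>x. (norm (grad \<eta> x - ?G x))^2)"
 proof (rule set_integrable_bound)
  show "set_integrable lborel S (\<lambda>x. 2 * (norm (grad \<eta> x))^2 + 2 * (norm (?G x))^2)"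
   by (intro set_integral_add(1) set_integrable_mult_right sub2 continuous_on_power continuous_on_norm C_inf_continuous_grad[OF \<eta>]
    integrable_imp_set_integrable H1_funD(4)[OF H]) auto
  show "set_borel_measurable lborel S (\<lambda>x. (norm (grad \<eta> x - ?G x))^2)" unfolding set_borel_measurable_def by measurable
  show "AE x in lborel. x \<in> S --> norm ((norm (grad \<eta> x - ?G x))^2) \<le> norm (2 * (norm (grad \<eta> x))^2 + 2 * (norm (?G x))^2)"
   using b2 by (intro AE_I2) auto
 qed
 show "(Hk_norm 1 S (\<lambda>x. \<eta> x - u x))^2 = (LBINT x:S. (\<eta> x - ?U x)^2 + (norm (grad \<eta> x - ?G x))^2)"
  using Hk_1_norm_combination(2)[OF \<Omega> S u \<eta>, of 1 "-1"] unfolding set_integral_add(2)[OF i1 i2] by simp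
qed

text \<open>\<open>trace_inequality_C1\<close> for the difference of two smooth functions, with
  \<open>u\<close> inserted between them. Hence sequences converging to \<open>u\<close> in H1 have
  edge values that form a Cauchy sequence in L2.\<close>

lemma trace_difference_bound:
 assumes \<Omega>: "open \<Omega>" "bounded \<Omega>" and u: "u \<in> Hk 1 \<Omega>" and T: "is_tri T A B C" and sub: "interior T \<subseteq> \<Omega>"
 shows "\<exists>K\<ge>0. \<forall>\<phi>\<in>C_inf. \<forall>\<psi>\<in>C_inf. (L2_norm (edge_measure (closed_segment A B)) (\<lambda>x. \<phi> x - \<psi> x))^2
   \<le> K * ((Hk_norm 1 (interior T) (\<lambda>x. \<phi> x - u x))^2 + (Hk_norm 1 (interior T) (\<lambda>x. \<psi> x - u x))^2)"
proof -
 have nz: "dbl_area A B C \<noteq> 0" and Teq: "T = convex hull {A, B, C}" using T by (auto simp: is_tri_def)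
 have ne: "A \<noteq> B" using dbl_area_distinct[OF nz] by simp
 let ?S = "interior T"
 define k where "k = (2 + norm (A - C) + norm (B - C)) / \<bar>dbl_area A B C\<bar>"
 have k: "0 \<le> k" by (simp add: k_def)
 show ?thesis
 proof (intro exI[of _ "dist A B * k * 2"] conjI ballI)
  show "0 \<le> dist A B * k * 2" using k by simp
  fix \<phi> \<psi> assume C: "\<phi> \<in> C_inf" "\<psi> \<in> C_inf"
  let ?d = "\<lambda>x. \<phi> x - \<psi> x"
  note dC = C_inf_diff[OF C]
  have gd: "grad ?d x = grad \<phi> x - grad \<psi> x" for x using has_derivative_diff[OF C_inf_has_derivative[OF C(1)] C_inf_has_derivative[OF C(2)], of x]
   by (intro has_derivative_inner_imp_grad) (simp add: inner_diff_left)
  let ?U = "wderiv \<Omega> (0, 0) u" and ?G = "wgrad \<Omega> (0, 0) u"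
  have H: "H1_fun \<Omega> ?U ?G" by (rule H1_fun_wderiv[OF \<Omega> u]) simp
  note [measurable] = H1_funD(5,6)[OF H] C_inf_measurable[OF C(1)] C_inf_measurable[OF C(2)]
   C_inf_grad_measurable[OF C(1)] C_inf_grad_measurable[OF C(2)]
  have bS: "bounded ?S" using \<Omega>(2) sub bounded_subset by blast
  define P where "P \<eta> x = (\<eta> x - ?U x)^2 + (norm (grad \<eta> x - ?G x))^2" for \<eta> x
  have N: "(Hk_norm 1 ?S (\<lambda>x. \<eta> x - u x))^2 = (LBINT x:?S. P \<eta> x)" "set_integrable lborel ?S (P \<eta>)"
   if \<eta>: "\<eta> \<in> C_inf" for \<eta>
   using Hk_1_norm_diff[OF \<Omega> open_interior sub u \<eta>] set_integral_add(1)[OF Hk_1_diff_integrable[OF \<Omega> open_interior sub u \<eta>]]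
   by (simp_all add: P_def[abs_def])
  have "(L2_norm (edge_measure (closed_segment A B)) ?d)^2 = dist A B * (LINT s:{0..1}|lborel. (?d (A + s *\<^sub>R (B - A)))^2)"
  proof -
   have "continuous_on (closed_segment A B) (\<lambda>x. (?d x)^2)" by (intro continuous_on_power C_inf_continuous dC)
   from edge_measure_segment(1)[OF ne continuous_edge_measurable(1)[OF ne this]]
   show ?thesis unfolding L2_norm_sq L2_inner_def unfolding inner_real_def power2_eq_square .
  qed
  also have "\<dots> \<le> dist A B * (k * (LBINT x:T. (?d x)^2 + (norm (grad ?d x))^2))"
   unfolding k_def Teq by (intro mult_left_mono trace_inequality_C1[OF nz C_inf_C1_on[OF dC]]) auto
  also have "(LBINT x:T. (?d x)^2 + (norm (grad ?d x))^2) = (LBINT x:?S. (?d x)^2 + (norm (grad ?d x))^2)"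
  proof -
   have "(\<lambda>x. (?d x)^2 + (norm (grad ?d x))^2) \<in> borel_measurable borel" using C_inf_measurable[OF dC] C_inf_grad_measurable[OF dC] by measurable
   then show ?thesis unfolding Teq by (rule set_integral_interior_triangle[symmetric])
  qed
  also have "\<dots> \<le> (LBINT x:?S. 2 * P \<phi> x + 2 * P \<psi> x)"
  proof (rule set_integral_mono)
   show "set_integrable lborel ?S (\<lambda>x. 2 * P \<phi> x + 2 * P \<psi> x)" using N(2) C by (intro set_integral_add(1) set_integrable_mult_right)
   show "set_integrable lborel ?S (\<lambda>x. (?d x)^2 + (norm (grad ?d x))^2)"
   proof (rule set_integrable_subset[OF set_integrable_continuous_compact])
    show "compact T" unfolding Teq by (rule compact_triangle)
    show "continuous_on T (\<lambda>x. (?d x)^2 + (norm (grad ?d x))^2)" by (intro continuous_intros C_inf_continuous[OF dC] C_inf_continuous_grad[OF dC])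
   qed (use interior_subset in auto)
   fix x
   have b1: "(a - b)^2 \<le> 2 * (a - c)^2 + 2 * (b - c)^2" for a b c :: real
    using zero_le_power2[of "a + b - 2 * c"] by (simp add: power2_eq_square algebra_simps)
   have b2: "(norm (a - b))^2 \<le> 2 * (norm (a - c))^2 + 2 * (norm (b - c))^2" for a b c :: "real^2"
    using b1[of "a$1" "b$1" "c$1"] b1[of "a$2" "b$2" "c$2"] by (simp add: norm_vec2_sq)
   show "(?d x)^2 + (norm (grad ?d x))^2 \<le> 2 * P \<phi> x + 2 * P \<psi> x"
    using b1[of "\<phi> x" "\<psi> x" "?U x"] b2[of "grad \<phi> x" "grad \<psi> x" "?G x"] by (simp add: P_def gd)
  qed
  also have "\<dots> = 2 * ((Hk_norm 1 ?S (\<lambda>x. \<phi> x - u x))^2 + (Hk_norm 1 ?S (\<lambda>x. \<psi> x - u x))^2)"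
   using N C by (simp add: set_integral_add set_integrable_mult_right)
  finally show "(L2_norm (edge_measure (closed_segment A B)) ?d)^2
   \<le> dist A B * k * 2 * ((Hk_norm 1 ?S (\<lambda>x. \<phi> x - u x))^2 + (Hk_norm 1 ?S (\<lambda>x. \<psi> x - u x))^2)"
   using k by (simp add: mult_left_mono mult.assoc)
 qed
qed

text \<open>A trace does not depend on the approximating sequence: \<phi> is compared on the edge
  with the sequence that witnesses \<open>has_trace\<close>.\<close>

lemma trace_limit:
 assumes \<Omega>: "open \<Omega>" "bounded \<Omega>" and u: "u \<in> Hk 1 \<Omega>" and T: "is_tri T A B C" and sub: "interior T \<subseteq> \<Omega>"
  and g: "has_trace (interior T) (closed_segment A B) u g" and \<phi>: "\<And>n. \<phi> n \<in> C_inf"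
  and lim: "(\<lambda>n. Hk_norm 1 (interior T) (\<lambda>x. \<phi> n x - u x)) \<longlonglongrightarrow> 0"
 shows "(\<lambda>n. L2_norm (edge_measure (closed_segment A B)) (\<lambda>x. \<phi> n x - g x)) \<longlonglongrightarrow> 0"
proof -
 let ?M = "edge_measure (closed_segment A B)" and ?S = "interior T"
 have ne: "A \<noteq> B" using T dbl_area_distinct[of A B C] by (simp add: is_tri_def)
 obtain w where w: "\<And>n. w n \<in> C_inf" "(\<lambda>n. Hk_norm 1 ?S (\<lambda>x. w n x - u x)) \<longlonglongrightarrow> 0"
  "(\<lambda>n. L2_norm ?M (\<lambda>x. w n x - g x)) \<longlonglongrightarrow> 0" and gL: "g \<in> L2 ?M" using g unfolding has_trace_def by blast
 obtain K where K: "0 \<le> K" "\<And>\<phi> \<psi>. \<phi> \<in> C_inf ==> \<psi> \<in> C_inf ==> (L2_norm ?M (\<lambda>x. \<phi> x - \<psi> x))^2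
   \<le> K * ((Hk_norm 1 ?S (\<lambda>x. \<phi> x - u x))^2 + (Hk_norm 1 ?S (\<lambda>x. \<psi> x - u x))^2)"
  using trace_difference_bound[OF \<Omega> u T sub] by blast
 have L: "f \<in> L2 ?M" if "f \<in> C_inf" for f by (rule continuous_edge_measurable(2)[OF ne C_inf_continuous[OF that]])
 have b: "L2_norm ?M (\<lambda>x. \<phi> n x - w n x) \<le> sqrt (K * ((Hk_norm 1 ?S (\<lambda>x. \<phi> n x - u x))^2 + (Hk_norm 1 ?S (\<lambda>x. w n x - u x))^2))" for n
  by (rule real_le_rsqrt) (rule K(2)[OF \<phi> w(1)])
 have "(\<lambda>n. sqrt (K * ((Hk_norm 1 ?S (\<lambda>x. \<phi> n x - u x))^2 + (Hk_norm 1 ?S (\<lambda>x. w n x - u x))^2)) + L2_norm ?M (\<lambda>x. w n x - g x)) \<longlonglongrightarrow> sqrt (K * (0^2 + 0^2)) + 0"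
  by (intro tendsto_intros lim w)
 then have l0: "(\<lambda>n. sqrt (K * ((Hk_norm 1 ?S (\<lambda>x. \<phi> n x - u x))^2 + (Hk_norm 1 ?S (\<lambda>x. w n x - u x))^2)) + L2_norm ?M (\<lambda>x. w n x - g x)) \<longlonglongrightarrow> 0"
  by simp
 show ?thesis
 proof (rule tendsto_sandwich[OF _ _ tendsto_const l0])
  show "\<forall>\<^sub>F n in sequentially. 0 \<le> L2_norm ?M (\<lambda>x. \<phi> n x - g x)" by (simp add: L2_norm_nonneg)
  show "\<forall>\<^sub>F n in sequentially. L2_norm ?M (\<lambda>x. \<phi> n x - g x)
   \<le> sqrt (K * ((Hk_norm 1 ?S (\<lambda>x. \<phi> n x - u x))^2 + (Hk_norm 1 ?S (\<lambda>x. w n x - u x))^2)) + L2_norm ?M (\<lambda>x. w n x - g x)"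
   using L2_norm_triangle_diff[OF L[OF \<phi>] L[OF w(1)] gL] b by (intro always_eventually allI) (meson add_right_mono order_trans)
 qed
qed

lemma Hk_1_norm_diff_mono:
 assumes \<Omega>: "open \<Omega>" "bounded \<Omega>" and S: "open S" "S \<subseteq> \<Omega>" and u: "u \<in> Hk 1 \<Omega>" and \<eta>: "\<eta> \<in> C_inf"
 shows "Hk_norm 1 S (\<lambda>x. \<eta> x - u x) \<le> Hk_norm 1 \<Omega> (\<lambda>x. \<eta> x - u x)"
proof (rule power2_le_imp_le)
 show "0 \<le> Hk_norm 1 \<Omega> (\<lambda>x. \<eta> x - u x)" by (simp add: Hk_norm_def sum_nonneg)
 let ?P = "\<lambda>x. (\<eta> x - wderiv \<Omega> (0, 0) u x)^2 + (norm (grad \<eta> x - wgrad \<Omega> (0, 0) u x))^2"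
 have i: "set_integrable lborel \<Omega> ?P" "set_integrable lborel S ?P"
  using set_integral_add(1)[OF Hk_1_diff_integrable[OF \<Omega> \<Omega>(1) order_refl u \<eta>]]
   set_integral_add(1)[OF Hk_1_diff_integrable[OF \<Omega> S u \<eta>]] by auto
 have "(LBINT x:S. ?P x) \<le> (LBINT x:\<Omega>. ?P x)" unfolding set_lebesgue_integral_def
  by (rule integral_mono) (use i S(2) in \<open>auto simp: set_integrable_def indicator_def\<close>)
 then show "(Hk_norm 1 S (\<lambda>x. \<eta> x - u x))^2 \<le> (Hk_norm 1 \<Omega> (\<lambda>x. \<eta> x - u x))^2"
  unfolding Hk_1_norm_diff[OF \<Omega> S u \<eta>] Hk_1_norm_diff[OF \<Omega> \<Omega>(1) order_refl u \<eta>] .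
qed

lemma H1_0_approximation:
 assumes \<Omega>: "open \<Omega>" "bounded \<Omega>" and u: "u \<in> H1_0 \<Omega>"
 shows "\<exists>\<phi>. (\<forall>n. \<phi> n \<in> test_functions \<Omega>) \<and> (\<lambda>n. Hk_norm 1 \<Omega> (\<lambda>x. \<phi> n x - u x)) \<longlonglongrightarrow> 0"
proof -
 have u1: "u \<in> Hk 1 \<Omega>" using u by (simp add: H1_0_def)
 have "\<exists>\<phi>\<in>test_functions \<Omega>. Hk_norm 1 \<Omega> (\<lambda>x. u x - \<phi> x) < inverse (real (Suc n))" for n using u by (simp add: H1_0_def)
 then obtain \<phi> where \<phi>: "\<And>n. \<phi> n \<in> test_functions \<Omega>" "\<And>n. Hk_norm 1 \<Omega> (\<lambda>x. u x - \<phi> n x) < inverse (real (Suc n))"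
  by metis
 \<comment> \<open>The definition of \<open>H1_0\<close> and that of \<open>has_trace\<close>
   subtract in opposite orders, and \<open>weak_deriv\<close> makes unrelated choices for a function
   and its negative; hence the detour over explicit norms.\<close>
 have eq: "Hk_norm 1 \<Omega> (\<lambda>x. \<phi> n x - u x) = Hk_norm 1 \<Omega> (\<lambda>x. u x - \<phi> n x)" for n
 proof -
  have e: "a *\<^sub>R x + b *\<^sub>R y = - ((-a) *\<^sub>R x + (-b) *\<^sub>R y)" for a b and x y :: "real^2" by simp
  have s: "(1 * \<phi> n x + (-1) * y)^2 = ((-1) * \<phi> n x + 1 * y)^2" for x y by (simp add: power2_commute)
  have v: "(norm (1 *\<^sub>R x + (-1) *\<^sub>R y))^2 = (norm ((-1) *\<^sub>R x + 1 *\<^sub>R y))^2" for x y :: "real^2" by (simp add: norm_minus_commute)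
  have "(Hk_norm 1 \<Omega> (\<lambda>x. \<phi> n x - u x))^2 = (Hk_norm 1 \<Omega> (\<lambda>x. u x - \<phi> n x))^2"
   using Hk_1_norm_combination(2)[OF \<Omega> \<Omega>(1) order_refl u1 test_functions_C_inf[OF \<phi>(1)[of n]], of 1 "-1", unfolded s v]
    Hk_1_norm_combination(2)[OF \<Omega> \<Omega>(1) order_refl u1 test_functions_C_inf[OF \<phi>(1)[of n]], of "-1" 1] by simp
  then show ?thesis by (simp add: Hk_norm_def sum_nonneg power2_eq_iff_nonneg)
 qed
 have "(\<lambda>n. Hk_norm 1 \<Omega> (\<lambda>x. \<phi> n x - u x)) \<longlonglongrightarrow> 0"
 proof (rule tendsto_sandwich[OF _ _ tendsto_const LIMSEQ_inverse_real_of_nat])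
  show "\<forall>\<^sub>F n in sequentially. 0 \<le> Hk_norm 1 \<Omega> (\<lambda>x. \<phi> n x - u x)" by (simp add: Hk_norm_def sum_nonneg)
  show "\<forall>\<^sub>F n in sequentially. Hk_norm 1 \<Omega> (\<lambda>x. \<phi> n x - u x) \<le> inverse (real (Suc n))"
   by (intro always_eventually allI) (unfold eq, rule less_imp_le[OF \<phi>(2)])
 qed
 then show ?thesis using \<phi>(1) by blast
qed

text \<open>One sequence approximates \<open>u\<close> on all triangles. Its edge values converge in
  L2, and the limit is a trace from each triangle that contains the edge. So the common trace
  selected by \<open>mesh_trace\<close> exists, and by \<open>trace_limit\<close> the same sequence
  converges to it.\<close>

lemma mesh_trace_limit:
 assumes \<Omega>: "polygonal_domain \<Omega>" and mesh: "conforming_mesh \<Omega> \<T>" and u: "u \<in> Hk 1 \<Omega>"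
  and \<phi>: "\<And>n. \<phi> n \<in> C_inf" and lim: "(\<lambda>n. Hk_norm 1 \<Omega> (\<lambda>x. \<phi> n x - u x)) \<longlonglongrightarrow> 0"
  and e: "e \<in> edges \<T>"
 shows "mesh_trace \<T> e u \<in> L2 (edge_measure e)"
  "(\<lambda>n. L2_norm (edge_measure e) (\<lambda>x. \<phi> n x - mesh_trace \<T> e u x)) \<longlonglongrightarrow> 0"
proof -
 have o: "open \<Omega>" "bounded \<Omega>" using \<Omega> by (auto simp: polygonal_domain_def)
 note tri = conforming_mesh_triangle[OF \<Omega> mesh]
 have limT: "(\<lambda>n. Hk_norm 1 (interior T) (\<lambda>x. \<phi> n x - u x)) \<longlonglongrightarrow> 0" if T: "T \<in> \<T>" for T
 proof (rule tendsto_sandwich[OF _ _ tendsto_const lim])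
  show "\<forall>\<^sub>F n in sequentially. 0 \<le> Hk_norm 1 (interior T) (\<lambda>x. \<phi> n x - u x)" by (simp add: Hk_norm_def sum_nonneg)
  show "\<forall>\<^sub>F n in sequentially. Hk_norm 1 (interior T) (\<lambda>x. \<phi> n x - u x) \<le> Hk_norm 1 \<Omega> (\<lambda>x. \<phi> n x - u x)"
   by (intro always_eventually allI Hk_1_norm_diff_mono[OF o open_interior tri(3)[OF T] u \<phi>])
 qed
 obtain T where T: "T \<in> \<T>" "e edge_of T" using e by (auto simp: edges_def)
 obtain A B C where ABC: "is_tri T A B C" "e = closed_segment A B" using edge_is_tri[OF tri(1)[OF T(1)] T(2)] .
 have ne: "A \<noteq> B" using ABC(1) dbl_area_distinct[of A B C] by (simp add: is_tri_def)
 let ?M = "edge_measure e"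
 have L: "f \<in> L2 ?M" if "f \<in> C_inf" for f unfolding ABC(2) by (rule continuous_edge_measurable(2)[OF ne C_inf_continuous[OF that]])
 let ?N = "\<lambda>n. Hk_norm 1 (interior T) (\<lambda>x. \<phi> n x - u x)"
 obtain K where K: "0 \<le> K" "\<And>\<phi> \<psi>. \<phi> \<in> C_inf ==> \<psi> \<in> C_inf ==> (L2_norm ?M (\<lambda>x. \<phi> x - \<psi> x))^2
   \<le> K * ((Hk_norm 1 (interior T) (\<lambda>x. \<phi> x - u x))^2 + (Hk_norm 1 (interior T) (\<lambda>x. \<psi> x - u x))^2)"
  using trace_difference_bound[OF o u ABC(1) tri(3)[OF T(1)]] unfolding ABC(2) by blast
 have "\<exists>g\<in>L2 ?M. (\<lambda>n. L2_norm ?M (\<lambda>x. \<phi> n x - g x)) \<longlonglongrightarrow> 0"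
 proof (rule L2_complete)
  show "\<phi> n \<in> L2 ?M" for n by (rule L[OF \<phi>])
  fix \<epsilon> :: real assume \<epsilon>: "0 < \<epsilon>"
  \<comment> \<open>With both squared norms below \<delta> the bound becomes
    \<open>\<epsilon>^2 / 2\<close>; \<open>K + 1\<close> avoids division by zero.\<close>
  define \<delta> where "\<delta> = \<epsilon>^2 / (4 * (K + 1))"
  have \<delta>: "0 < \<delta>" using \<epsilon> K(1) by (simp add: \<delta>_def)
  have "(\<lambda>n. (?N n)^2) \<longlonglongrightarrow> 0^2" by (intro tendsto_intros limT T(1))
  then have "\<forall>\<^sub>F n in sequentially. (?N n)^2 < \<delta>" using \<delta> by (intro order_tendstoD(2)) auto
  then obtain n0 where n0: "\<And>n. n0 \<le> n ==> (?N n)^2 < \<delta>" by (auto simp: eventually_sequentially)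
  show "\<exists>N. \<forall>m\<ge>N. \<forall>n\<ge>N. L2_norm ?M (\<lambda>x. \<phi> m x - \<phi> n x) < \<epsilon>"
  proof (intro exI[of _ n0] allI impI)
   fix m n assume mn: "n0 \<le> m" "n0 \<le> n"
   have "(L2_norm ?M (\<lambda>x. \<phi> m x - \<phi> n x))^2 \<le> K * ((?N m)^2 + (?N n)^2)" by (rule K(2)[OF \<phi> \<phi>])
   also have "\<dots> \<le> (K + 1) * (\<delta> + \<delta>)" using n0[OF mn(1)] n0[OF mn(2)] K(1) by (intro mult_mono add_mono) auto
   also have "\<dots> = \<epsilon>^2 / 2"
   proof -
    have "k * (\<epsilon>^2 / (4 * k) + \<epsilon>^2 / (4 * k)) = \<epsilon>^2 / 2" if "0 < k" for k using that by (simp add: field_simps)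
    from this[of "K + 1"] K(1) show ?thesis by (simp add: \<delta>_def)
   qed
   also have "\<dots> < \<epsilon>^2" using \<epsilon> by simp
   finally show "L2_norm ?M (\<lambda>x. \<phi> m x - \<phi> n x) < \<epsilon>" by (rule power2_less_imp_less) (use \<epsilon> in simp)
  qed
 qed
 then obtain g where g: "g \<in> L2 ?M" "(\<lambda>n. L2_norm ?M (\<lambda>x. \<phi> n x - g x)) \<longlonglongrightarrow> 0" by (rule bexE) (rule that)
 have "has_trace (interior T') e u g" if T': "T' \<in> \<T>" for T' unfolding has_trace_def
 proof (intro conjI exI[of _ \<phi>] allI \<phi> limT[OF T'] g)
  show "u \<in> Hk 1 (interior T')" using Hk_1_norm_combination(1)[OF o open_interior tri(3)[OF T'] u \<phi>[of 0], of 0 1] by simp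
 qed
 then have "\<forall>T\<in>\<T>. e edge_of T --> has_trace (interior T) e u (mesh_trace \<T> e u)"
  unfolding mesh_trace_def by (intro someI[of "\<lambda>g. \<forall>T\<in>\<T>. e edge_of T --> has_trace (interior T) e u g" g]) blast
 then have tr: "has_trace (interior T) e u (mesh_trace \<T> e u)" using T by blast
 then show "mesh_trace \<T> e u \<in> L2 ?M" by (simp add: has_trace_def)
 show "(\<lambda>n. L2_norm ?M (\<lambda>x. \<phi> n x - mesh_trace \<T> e u x)) \<longlonglongrightarrow> 0"
  using trace_limit[OF o u ABC(1) tri(3)[OF T(1)] tr[unfolded ABC(2)] \<phi> limT[OF T(1)]] unfolding ABC(2) .
qed

text \<open>The approximating test functions vanish on the frontier, so the sequence of distances to
  the trace is constant while it tends to zero.\<close>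

lemma mesh_trace_boundary:
 assumes \<Omega>: "polygonal_domain \<Omega>" and mesh: "conforming_mesh \<Omega> \<T>" and u: "u \<in> H1_0 \<Omega>"
  and e: "e \<in> edges \<T>" "e \<subseteq> frontier \<Omega>"
 shows "L2_norm (edge_measure e) (mesh_trace \<T> e u) = 0"
proof -
 have o: "open \<Omega>" "bounded \<Omega>" using \<Omega> by (auto simp: polygonal_domain_def)
 have u1: "u \<in> Hk 1 \<Omega>" using u by (simp add: H1_0_def)
 obtain \<phi> where \<phi>: "\<And>n. \<phi> n \<in> test_functions \<Omega>" "(\<lambda>n. Hk_norm 1 \<Omega> (\<lambda>x. \<phi> n x - u x)) \<longlonglongrightarrow> 0"
  using H1_0_approximation[OF o u] by blast
 obtain T where T: "T \<in> \<T>" "e edge_of T" using e by (auto simp: edges_def)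
 obtain A B C where ABC: "is_tri T A B C" "e = closed_segment A B" using edge_is_tri[OF conforming_mesh_triangle(1)[OF \<Omega> mesh T(1)] T(2)] .
 have ne: "A \<noteq> B" using ABC(1) dbl_area_distinct[of A B C] by (simp add: is_tri_def)
 note lim = mesh_trace_limit[OF \<Omega> mesh u1 test_functions_C_inf[OF \<phi>(1)] \<phi>(2) e(1)]
 have sp: "space (edge_measure e) = e"
 proof -
  have "sets (edge_measure e) = sets (restrict_space borel e)" unfolding ABC(2) by (rule edge_measure_segment(3)[OF ne, of "\<lambda>_. 0"]) simp
  then have "space (edge_measure e) = space (restrict_space borel e)" by (rule sets_eq_imp_space_eq)
  then show ?thesis by (simp add: space_restrict_space)
 qed
 have z: "\<phi> n x = 0" if "x \<in> e" for n x using that e(2) o(1) test_functions_zero_outside[OF \<phi>(1)] by (auto simp: frontier_def interior_open)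
 have "L2_norm (edge_measure e) (\<lambda>x. \<phi> n x - mesh_trace \<T> e u x) = L2_norm (edge_measure e) (mesh_trace \<T> e u)" for n
  unfolding L2_norm_def L2_inner_def by (intro arg_cong[where f = sqrt] Bochner_Integration.integral_cong refl) (simp add: sp z)
 then show ?thesis using lim(2) by (simp add: LIMSEQ_const_iff)
qed

lemma edge_mom_C1_swap:
 assumes nz: "dbl_area A B C \<noteq> 0" and w: "C1_on (convex hull {A, B, C}) w G"
 shows "edge_mom B A C w G = (LINT s:{0..1}|lborel. s * w (A + s *\<^sub>R (B - A)))"
proof -
 have nz2: "dbl_area B A C \<noteq> 0" using nz dbl_area_swap[where A = A and B = B and C = C] by simp
 have T2: "convex hull {B, A, C} = convex hull {A, B, C}" by (simp add: insert_commute)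
 have "(LBINT s. indicator {0..1} s * (s * w (A + s *\<^sub>R (B - A))))
   = \<bar>-1\<bar> *\<^sub>R (LBINT s. indicator {0..1} (1 + (-1) * s) * ((1 + (-1) * s) * w (A + (1 + (-1) * s) *\<^sub>R (B - A))))"
  by (rule lborel_integral_real_affine) simp
 also have "\<dots> = (LBINT s. indicator {0..1} s * ((1 - s) * w (B + s *\<^sub>R (A - B))))"
  by (auto simp: indicator_def algebra_simps intro!: Bochner_Integration.integral_cong)
 finally show ?thesis unfolding edge_mom_C1[OF nz2 w[folded T2]] by (simp add: set_lebesgue_integral_def)
qed

lemma edge_mom_C1_weighted:
 assumes nz: "dbl_area A B C \<noteq> 0" and w: "C1_on (convex hull {A, B, C}) w G"
 shows "\<alpha> * edge_mom A B C w G + \<beta> * edge_mom B A C w G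
  = (LINT s:{0..1}|lborel. ((1 - s) * \<alpha> + s * \<beta>) * w (A + s *\<^sub>R (B - A)))"
proof -
 have seg: "A + s *\<^sub>R (B - A) \<in> convex hull {A, B, C}" if "s \<in> {0..1}" for s
 proof -
  have "A + s *\<^sub>R (B - A) = (1 - s) *\<^sub>R A + s *\<^sub>R B + 0 *\<^sub>R C" by (simp add: algebra_simps)
  then show ?thesis using that unfolding convex_hull_3 by (intro CollectI exI[of _ "1 - s"] exI[of _ s] exI[of _ 0]) auto
 qed
 have c: "continuous_on {0..1} (\<lambda>s. w (A + s *\<^sub>R (B - A)))"
  by (rule continuous_on_compose2[OF C1_on_continuous[OF w]]) (use seg in \<open>auto intro!: continuous_intros\<close>)
 have ci: "set_integrable lborel {0..1} f" if "continuous_on {0..1} f" for f :: "real => real"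
  using borel_integrable_compact[of "{0..1::real}" f] that by (simp add: set_integrable_def)
 have i: "set_integrable lborel {0..1} (\<lambda>s. \<alpha> * ((1 - s) * w (A + s *\<^sub>R (B - A))))"
  "set_integrable lborel {0..1} (\<lambda>s. \<beta> * (s * w (A + s *\<^sub>R (B - A))))" by (intro ci continuous_intros c)+
 have "\<alpha> * edge_mom A B C w G + \<beta> * edge_mom B A C w G
   = (LINT s:{0..1}|lborel. \<alpha> * ((1 - s) * w (A + s *\<^sub>R (B - A)))) + (LINT s:{0..1}|lborel. \<beta> * (s * w (A + s *\<^sub>R (B - A))))"
  unfolding edge_mom_C1[OF assms] edge_mom_C1_swap[OF assms] by (simp only: set_integral_mult_right)
 also have "\<dots> = (LINT s:{0..1}|lborel. \<alpha> * ((1 - s) * w (A + s *\<^sub>R (B - A))) + \<beta> * (s * w (A + s *\<^sub>R (B - A))))"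
  by (rule set_integral_add(2)[OF i, symmetric])
 also have "\<dots> = (LINT s:{0..1}|lborel. ((1 - s) * \<alpha> + s * \<beta>) * w (A + s *\<^sub>R (B - A)))" by (simp add: algebra_simps)
 finally show ?thesis .
qed

section \<open>The two triangles at an interior edge\<close>

lemma is_tri_nz: "is_tri T A B C ==> dbl_area A B C \<noteq> 0"
 and is_tri_hull: "is_tri T A B C ==> T = convex hull {A, B, C}"
 by (auto simp: is_tri_def)

lemma dbl_area_line: "dbl_area A B (x - t *\<^sub>R (C - A)) = dbl_area A B x - t * dbl_area A B C"
 by (simp add: dbl_area_def crs_def algebra_simps)

lemma dbl_area_segment:
 assumes "x \<in> closed_segment A B"
 shows "dbl_area A B x = 0"
proof -
 obtain u where x: "x = (1 - u) *\<^sub>R A + u *\<^sub>R B" using assms by (auto simp: closed_segment_def)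
 show ?thesis unfolding x by (simp add: dbl_area_def crs_def algebra_simps)
qed

lemma is_tri_side:
 assumes T: "is_tri T A B C" and y: "y \<in> T"
 shows "0 \<le> dbl_area A B y * dbl_area A B C"
proof -
 have "0 \<le> bary C A B y" using y mem_triangle_iff[OF is_tri_nz[OF T]] is_tri_hull[OF T] by auto
 moreover have "bary C A B y = dbl_area A B y / dbl_area A B C"
  using dbl_area_perm(2)[where A = A and B = B and C = y] dbl_area_perm(2)[where A = A and B = B and C = C] by (simp add: bary_def)
 ultimately show ?thesis by (auto simp: zero_le_divide_iff zero_le_mult_iff)
qed

text \<open>Moving slightly from the midpoint of \<open>AB\<close> towards \<open>C\<close> gives a
  point in the interior of \<open>T\<close> that also lies in \<open>S\<close>. A face of
  \<open>T\<close> with an interior point of \<open>T\<close> is \<open>T\<close> itself, so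
  \<open>T\<close> is a face of \<open>S\<close>, and equal dimensions make them equal.\<close>

lemma same_side_triangles_eq:
 assumes mesh: "triangulation \<T>" and T: "T \<in> \<T>" "is_tri T A B C" and S: "S \<in> \<T>" "is_tri S A B D"
  and dim: "2 simplex T" "2 simplex S" and side: "0 < dbl_area A B C * dbl_area A B D"
 shows "T = S"
proof -
 have nzC: "dbl_area A B C \<noteq> 0" and nzD: "dbl_area A B D \<noteq> 0" using T S is_tri_nz by auto
 define m where "m = (1/2) *\<^sub>R (A + B)"
 define y where "y t = m + t *\<^sub>R (C - m)" for t
 have b: "bary P Q R (y t) = (1 - t) * (bary P Q R A + bary P Q R B) / 2 + t * bary P Q R C" for P Q R t
 proof -
  have "2 * dbl_area (y t) Q R = (1 - t) * (dbl_area A Q R + dbl_area B Q R) + 2 * t * dbl_area C Q R"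
   by (simp add: y_def m_def dbl_area_def crs_def algebra_simps)
  then have "dbl_area (y t) Q R = (1 - t) * (dbl_area A Q R + dbl_area B Q R) / 2 + t * dbl_area C Q R" by simp
  then show ?thesis by (simp add: bary_def add_divide_distrib distrib_left)
 qed
 have vert: "bary A B E A = 1" "bary A B E B = 0" "bary B E A A = 0" "bary B E A B = 1" "bary E A B A = 0" "bary E A B B = 0"
  if "dbl_area A B E \<noteq> 0" for E using that bary_param[OF that, of 0 0] bary_param[OF that, of 1 0] by auto
 have vE: "bary E A B E = 1" "bary A B E E = 0" "bary B E A E = 0" if "dbl_area A B E \<noteq> 0" for E using that bary_param[OF that, of 0 1] by auto
 have DC: "0 < bary D A B C"
 proof -
  have "bary D A B C = dbl_area A B C / dbl_area A B D"
   using dbl_area_perm(2)[where A = A and B = B and C = C] dbl_area_perm(2)[where A = A and B = B and C = D] by (simp add: bary_def)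
  then show ?thesis using side by (auto simp: zero_less_divide_iff zero_less_mult_iff)
 qed
 have lim: "((\<lambda>t. bary P Q R (y t)) \<longlongrightarrow> (1 - 0) * (bary P Q R A + bary P Q R B) / 2 + 0 * bary P Q R C) (at_right 0)" for P Q R
  unfolding b by (intro tendsto_intros) auto
 have ev: "\<forall>\<^sub>F t in at_right (0::real). 0 < bary P Q R (y t)" if "0 < bary P Q R A + bary P Q R B" for P Q R
  using order_tendstoD(1)[OF lim[of P Q R], of 0] that by simp
 have "\<forall>\<^sub>F t in at_right (0::real). 0 < t \<and> 0 < bary A B D (y t) \<and> 0 < bary B D A (y t) \<and> t < 1"
  using ev[of A B D] ev[of B D A] vert[OF nzD] eventually_at_right_less[of "0::real"] eventually_at_right_real[of 0 "1::real"]
  by (auto elim: eventually_elim2 simp: eventually_conj_iff)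
 then obtain t where t: "0 < t" "0 < bary A B D (y t)" "0 < bary B D A (y t)" "t < 1"
  using eventually_happens[of _ "at_right (0::real)"] by (auto simp: trivial_limit_at_right_real)
 have "bary D A B (y t) = t * bary D A B C" unfolding b using vert[OF nzD] by simp
 then have "0 < bary D A B (y t)" using t DC by simp
 then have yS: "y t \<in> S" using t mem_triangle_iff[OF nzD] is_tri_hull[OF S(2)] by simp
 have yT: "y t \<in> interior T"
 proof -
  let ?O = "{y. 0 < bary A B C y} \<inter> {y. 0 < bary B C A y} \<inter> {y. 0 < bary C A B y}"
  have "open ?O" by (intro open_Int open_Collect_less continuous_on_const continuous_on_bary continuous_on_id)
  moreover have "?O \<subseteq> T" using mem_triangle_iff[OF nzC] is_tri_hull[OF T(2)] by fastforce
  ultimately have "?O \<subseteq> interior T" by (rule interior_maximal[rotated])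
  moreover have "y t \<in> ?O" using t vert[OF nzC] vE[OF nzC] by (simp add: b)
  ultimately show ?thesis by blast
 qed
 have f: "(T \<inter> S) face_of T" "(S \<inter> T) face_of S" using mesh T S by (auto simp: triangulation_def)
 have "T \<inter> S = T"
 proof (rule ccontr)
  assume "T \<inter> S \<noteq> T"
  from face_of_disjoint_interior[OF f(1) this] yS yT interior_subset show False by blast
 qed
 then have fT: "T face_of S" using f(2) by (simp add: Int_commute)
 show ?thesis
 proof (rule ccontr)
  assume "T \<noteq> S"
  from face_of_aff_dim_lt[OF convex_simplex[OF dim(2)] fT this] aff_dim_simplex[OF dim(1)] aff_dim_simplex[OF dim(2)]
  show False by simp
 qed
qed

text \<open>Stepping across the edge at a point inside \<Omega> leads into a second triangle.
  Conformity forces it to share the whole edge, and \<open>same_side_triangles_eq\<close> excludes a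
  third triangle, which would lie on the same side as one of the two.\<close>

lemma interior_edge_two_triangles:
 assumes \<Omega>: "polygonal_domain \<Omega>" and mesh: "conforming_mesh \<Omega> \<T>" and e: "e \<in> edges \<T>" "\<not> e \<subseteq> frontier \<Omega>"
 obtains T T' A B C C' where "is_tri T A B C" "is_tri T' A B C'" "e = closed_segment A B"
  "dbl_area A B C * dbl_area A B C' < 0" "{S \<in> \<T>. e edge_of S} = {T, T'}" "T \<noteq> T'"
proof -
 have o: "open \<Omega>" using \<Omega> by (simp add: polygonal_domain_def)
 have tr: "triangulation \<T>" "finite \<T>" and cov: "\<Union>\<T> = closure \<Omega>" using mesh by (auto simp: conforming_mesh_def triangulation_def)
 note tri = conforming_mesh_triangle[OF \<Omega> mesh]
 obtain T where T: "T \<in> \<T>" "e edge_of T" using e by (auto simp: edges_def)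
 obtain A B C where ABC: "is_tri T A B C" "e = closed_segment A B" using edge_is_tri[OF tri(1)[OF T(1)] T(2)] .
 have nz: "dbl_area A B C \<noteq> 0" and hull: "T = convex hull {A, B, C}" by (rule is_tri_nz[OF ABC(1)], rule is_tri_hull[OF ABC(1)])
 have ne: "A \<noteq> B" using dbl_area_distinct[OF nz] by simp
 have "e \<subseteq> T" using T(2) by (simp add: edge_of_imp_subset)
 then have "e \<inter> \<Omega> \<noteq> {}" using e(2) tri(2)[OF T(1)] o by (auto simp: frontier_def interior_open)
 then have "open_segment A B \<inter> \<Omega> \<noteq> {}"
  using open_Int_closure_eq_empty[OF o, of "open_segment A B"] ne unfolding ABC(2) by (auto simp: Int_commute)
 then obtain x where x: "x \<in> open_segment A B" "x \<in> \<Omega>" by blast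
 have xe: "x \<in> closed_segment A B" using x(1) by (simp add: open_segment_def)
 \<comment> \<open>A neighbourhood of \<open>x\<close> that meets only triangles containing
   \<open>x\<close>.\<close>
 define U where "U = \<Omega> - \<Union>{S \<in> \<T>. x \<notin> S}"
 have "closed (\<Union>{S \<in> \<T>. x \<notin> S})" using tr(2) tri(1) closed_simplex by (intro closed_Union) auto
 then have "open U" unfolding U_def using o by (intro open_Diff)
 moreover have "x \<in> U" using x(2) by (auto simp: U_def)
 ultimately obtain r where r: "r > 0" "ball x r \<subseteq> U" using open_contains_ball by blast
 \<comment> \<open>Small enough for \<open>y\<close> to stay in the ball of radius \<open>r\<close>;
   moving along \<open>A - C\<close> leaves \<open>T\<close> through the edge.\<close>
 define t where "t = r / (2 * (norm (C - A) + 1))"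
 have nn: "0 < norm (C - A) + 1" using norm_ge_zero[of "C - A"] by linarith
 have t: "0 < t" using r nn by (simp add: t_def)
 define y where "y = x - t *\<^sub>R (C - A)"
 have "t * norm (C - A) < r"
 proof -
  have "t * norm (C - A) \<le> t * (norm (C - A) + 1)" using t by (intro mult_left_mono) auto
  also have "\<dots> = r / 2"
  proof -
   have "r / (2 * k) * k = r / 2" if "0 < k" for k using that by simp
   from this[OF nn] show ?thesis by (simp only: t_def)
  qed
  finally show ?thesis using r by simp
 qed
 then have "y \<in> ball x r" using t by (simp add: y_def dist_norm)
 then have yU: "y \<in> U" using r by blast
 then have "y \<in> closure \<Omega>" using closure_subset by (auto simp: U_def)
 then obtain T' where T': "T' \<in> \<T>" "y \<in> T'" using cov by blast
 then have xT': "x \<in> T'" using yU by (auto simp: U_def)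
 have xT: "x \<in> T" using xe \<open>e \<subseteq> T\<close> ABC(2) by blast
 have dy: "dbl_area A B y = - t * dbl_area A B C" unfolding y_def dbl_area_line dbl_area_segment[OF xe] by simp
 have f: "(T \<inter> T') face_of T" "(T' \<inter> T) face_of T'" using tr(1) T(1) T'(1) by (auto simp: triangulation_def)
 have inT: "A \<in> T" "B \<in> T" "C \<in> T" unfolding hull by (auto intro: hull_inc)
 \<comment> \<open>A face that contains a point of an open segment contains its endpoints.\<close>
 have AB: "A \<in> T \<inter> T'" "B \<in> T \<inter> T'" using face_ofD[OF f(1) x(1)] inT xT xT' by blast+
 have ind: "\<not> affine_dependent {A, B, C}" using ABC(1) by (simp add: is_tri_def)
 obtain c where c: "c \<subseteq> {A, B, C}" "T \<inter> T' = convex hull c"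
  using iffD1[OF face_of_convex_hull_affine_independent[OF ind] f(1)[unfolded hull]] unfolding hull by (elim exE conjE)
 \<comment> \<open>Otherwise \<open>T\<close> would be a face of \<open>T'\<close> of full
   dimension, hence equal to it, while \<open>y\<close> is on the wrong side of \<open>AB\<close>
   for \<open>T\<close>.\<close>
 have "C \<notin> c"
 proof
  assume "C \<in> c"
  then have "C \<in> T \<inter> T'" unfolding c(2) by (rule hull_inc)
  then have "{A, B, C} \<subseteq> T'" using AB by auto
  then have "T \<subseteq> T'" unfolding hull by (intro hull_minimal convex_simplex[OF tri(1)[OF T'(1)]])
  then have fT: "T face_of T'" using f(2) by (simp add: Int_absorb1)
  have "T = T'"
  proof (rule ccontr)
   assume "T \<noteq> T'"
   from face_of_aff_dim_lt[OF convex_simplex[OF tri(1)[OF T'(1)]] fT this]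
    aff_dim_simplex[OF tri(1)[OF T(1)]] aff_dim_simplex[OF tri(1)[OF T'(1)]]
   show False by simp
  qed
  then have "0 \<le> dbl_area A B y * dbl_area A B C" using is_tri_side[OF ABC(1)] T'(2) by simp
  moreover have "0 < t * (dbl_area A B C * dbl_area A B C)" using t nz by (auto simp: zero_less_mult_iff)
  ultimately show False unfolding dy by simp
 qed
 then have cAB: "c \<subseteq> {A, B}" using c(1) by auto
 have TT': "T \<inter> T' = e"
 proof
  show "T \<inter> T' \<subseteq> e" unfolding c(2) ABC(2) segment_convex_hull by (rule hull_mono[OF cAB])
  have "convex (T \<inter> T')" unfolding c(2) by (rule convex_convex_hull)
  then show "e \<subseteq> T \<inter> T'" unfolding ABC(2) segment_convex_hull using AB by (intro hull_minimal) auto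
 qed
 have "e edge_of T'" using f(2) T(2) TT' by (simp add: edge_of_def Int_commute)
 then obtain A' B' C' where T'': "is_tri T' A' B' C'" "e = closed_segment A' B'" using edge_is_tri[OF tri(1)[OF T'(1)]] by blast
 have "(A' = A \<and> B' = B) \<or> (A' = B \<and> B' = A)" using T''(2) ABC(2) by (auto simp: doubleton_eq_iff)
 then have ABC': "is_tri T' A B C'" using T''(1) is_tri_swap[of T' B A C'] by auto
 have nz': "dbl_area A B C' \<noteq> 0" by (rule is_tri_nz[OF ABC'])
 have "0 \<le> (- t * dbl_area A B C) * dbl_area A B C'" using is_tri_side[OF ABC' T'(2)] unfolding dy .
 then have "t * (dbl_area A B C * dbl_area A B C') \<le> 0" by (simp add: mult.assoc)
 then have opp: "dbl_area A B C * dbl_area A B C' < 0" using t nz nz' by (simp add: mult_le_0_iff less_le)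
 have "T \<noteq> T'"
 proof
  assume "T = T'"
  then have "0 \<le> dbl_area A B C' * dbl_area A B C" using is_tri_side[OF ABC(1), of C'] is_tri_hull[OF ABC'] by (auto intro: hull_inc)
  then show False using opp by (simp add: mult.commute)
 qed
 moreover have "{S \<in> \<T>. e edge_of S} = {T, T'}"
 proof -
  have "S = T \<or> S = T'" if S: "S \<in> \<T>" "e edge_of S" for S
  proof -
   obtain A' B' D where S': "is_tri S A' B' D" "e = closed_segment A' B'" using edge_is_tri[OF tri(1)[OF S(1)] S(2)] .
   have "(A' = A \<and> B' = B) \<or> (A' = B \<and> B' = A)" using S'(2) ABC(2) by (auto simp: doubleton_eq_iff)
   then have SD: "is_tri S A B D" using S'(1) is_tri_swap[of S B A D] by auto
   have nzD: "dbl_area A B D \<noteq> 0" by (rule is_tri_nz[OF SD])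
   have "0 < dbl_area A B C * dbl_area A B D \<or> 0 < dbl_area A B C' * dbl_area A B D" using opp nz nz' nzD by (auto simp: zero_less_mult_iff mult_less_0_iff)
   then show ?thesis using same_side_triangles_eq[OF tr(1) T(1) ABC(1) S(1) SD tri(1)[OF T(1)] tri(1)[OF S(1)]]
     same_side_triangles_eq[OF tr(1) T'(1) ABC' S(1) SD tri(1)[OF T'(1)] tri(1)[OF S(1)]] by auto
  qed
  then show ?thesis using T T'(1) \<open>e edge_of T'\<close> by auto
 qed
 ultimately show ?thesis using that[OF ABC(1) ABC' ABC(2) opp] by simp
qed

section \<open>Fluxes through edges\<close>

text \<open>The integral of \<open>p (w \<bullet> n)\<close> over the edge \<open>AB\<close> for \<open>p\<close> affine on the edge.\<close>

definition tri_flux :: "real^2 => real^2 => real^2 => (real^2 => real) => (2 => real^2 => real) => (2 => real^2 => real^2) => real" where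
 "tri_flux A B C p w G = (\<Sum>j\<in>UNIV. edge_normal A B C $ j *
   (p A * edge_mom A B C (w j) (G j) + p B * edge_mom B A C (w j) (G j)))"

text \<open>Edges of a mesh come as sets, so a labelling has to be chosen. The two labellings that
  fit give the same value by \<open>tri_flux_swap\<close>.\<close>

definition flux :: "(real^2) set => (real^2) set => (real^2 => real) => (2 => real^2 => real) => (2 => real^2 => real^2) => real" where
 "flux T e p w G = (SOME r. \<exists>A B C. is_tri T A B C \<and> e = closed_segment A B \<and> r = tri_flux A B C p w G)"

lemma tri_flux_swap: "tri_flux B A C p w G = tri_flux A B C p w G"
 by (simp add: tri_flux_def edge_normal_swap[of B A C] add.commute)

lemma flux_eq:
 assumes "is_tri T A B C"
 shows "flux T (closed_segment A B) p w G = tri_flux A B C p w G"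
 unfolding flux_def
proof (rule some_equality)
 fix r assume "\<exists>A' B' C'. is_tri T A' B' C' \<and> closed_segment A B = closed_segment A' B' \<and> r = tri_flux A' B' C' p w G"
 then obtain A' B' C' where *: "is_tri T A' B' C'" "closed_segment A B = closed_segment A' B'" "r = tri_flux A' B' C' p w G" by blast
 from is_tri_unique[OF assms *(1,2)] *(3) tri_flux_swap[of B A C p w G] show "r = tri_flux A B C p w G" by auto
qed (use assms in blast)

lemma edge_normal_opposite: "dbl_area A B C * dbl_area A B C' < 0 ==> edge_normal A B C' = - edge_normal A B C"
 by (auto simp: edge_normal_def mult_less_0_iff sgn_if)

lemma finite_edges:
 assumes "polygonal_domain \<Omega>" "conforming_mesh \<Omega> \<T>"
 shows "finite \<T>" "finite (edges \<T>)"
proof -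
 show f: "finite \<T>" using assms(2) by (simp add: conforming_mesh_def triangulation_def)
 have "edges \<T> = (\<Union>T\<in>\<T>. {e. e edge_of T})" by (auto simp: edges_def)
 moreover have "finite {e. e edge_of T}" if T: "T \<in> \<T>" for T
 proof -
  obtain A B C where "is_tri T A B C" using simplex_is_tri[OF conforming_mesh_triangle(1)[OF assms T]] .
  then show ?thesis by (rule is_tri_sum_edges(2))
 qed
 ultimately show "finite (edges \<T>)" using f by simp
qed

text \<open>The sum is regrouped by edges. On the boundary both endpoint values of the weight
  vanish. On an interior edge the two triangles have opposite normals and, by
  \<open>edge_mom_interface\<close>, equal moments of each component.\<close>

lemma flux_sum_zero:
 assumes \<Omega>: "polygonal_domain \<Omega>" and mesh: "conforming_mesh \<Omega> \<T>"
  and H: "\<And>j. H1_fun \<Omega> (w j) (G j)"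
  and p: "\<And>e x. e \<in> edges \<T> ==> e \<subseteq> frontier \<Omega> ==> x \<in> e ==> p e x = 0"
 shows "(\<Sum>T\<in>\<T>. \<Sum>e | e edge_of T. flux T e (p e) w G) = 0"
proof -
 note fin = finite_edges[OF \<Omega> mesh]
 note tri = conforming_mesh_triangle[OF \<Omega> mesh]
 have "(\<Sum>T\<in>\<T>. \<Sum>e | e edge_of T. flux T e (p e) w G) = (\<Sum>T\<in>\<T>. \<Sum>e | e \<in> edges \<T> \<and> e edge_of T. flux T e (p e) w G)"
  by (intro sum.cong refl) (auto simp: edges_def)
 also have "\<dots> = (\<Sum>e\<in>edges \<T>. \<Sum>T | T \<in> \<T> \<and> e edge_of T. flux T e (p e) w G)" by (rule sum.swap_restrict[OF fin])
 also have "\<dots> = 0"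
 proof (rule sum.neutral, rule ballI)
  fix e assume e: "e \<in> edges \<T>"
  show "(\<Sum>T | T \<in> \<T> \<and> e edge_of T. flux T e (p e) w G) = 0"
  proof (cases "e \<subseteq> frontier \<Omega>")
   case True
   show ?thesis
   proof (rule sum.neutral, rule ballI)
    fix T assume "T \<in> {T \<in> \<T>. e edge_of T}"
    then obtain A B C where *: "is_tri T A B C" "e = closed_segment A B" using edge_is_tri[OF tri(1)] by blast
    have "p e A = 0" "p e B = 0" using p[OF e True, of A] p[OF e True, of B] unfolding *(2) by auto
    then show "flux T e (p e) w G = 0" unfolding *(2) flux_eq[OF *(1)] by (simp add: tri_flux_def)
   qed
  next
   case False
   from interior_edge_two_triangles[OF \<Omega> mesh e False] obtain T T' A B C C' where
    *: "is_tri T A B C" "is_tri T' A B C'" "e = closed_segment A B" "dbl_area A B C * dbl_area A B C' < 0"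
     "{S \<in> \<T>. e edge_of S} = {T, T'}" "T \<noteq> T'" .
   have "T \<in> \<T>" "T' \<in> \<T>" using *(5) by auto
   then have "T \<union> T' \<subseteq> closure \<Omega>" using tri(2) by blast
   \<comment> \<open>The open common edge must belong to \<Omega> for the weak derivatives to be
     tested across it; this again uses that \<Omega> is the interior of its closure.\<close>
   then have "interior (T \<union> T') \<subseteq> interior (closure \<Omega>)" by (rule interior_mono)
   then have sub: "interior (T \<union> T') \<subseteq> \<Omega>" using \<Omega> by (simp add: polygonal_domain_def)
   have HH: "H1_fun (interior (convex hull {A, B, C} \<union> convex hull {A, B, C'})) (w j) (G j)" for j
    using H1_fun_mono[OF H sub] is_tri_hull[OF *(1)] is_tri_hull[OF *(2)] by simp
   have HH2: "H1_fun (interior (convex hull {B, A, C} \<union> convex hull {B, A, C'})) (w j) (G j)" for j using HH by (simp add: insert_commute)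
   have opp2: "dbl_area B A C * dbl_area B A C' < 0"
    using *(4) dbl_area_swap[where A = A and B = B and C = C] dbl_area_swap[where A = A and B = B and C = C'] by simp
   have "edge_mom A B C' (w j) (G j) = edge_mom A B C (w j) (G j)" "edge_mom B A C' (w j) (G j) = edge_mom B A C (w j) (G j)" for j
    using edge_mom_interface[OF *(4) HH] edge_mom_interface[OF opp2 HH2] by auto
   then have "tri_flux A B C' (p e) w G = - tri_flux A B C (p e) w G" unfolding tri_flux_def edge_normal_opposite[OF *(4)] by (simp add: sum_negf[symmetric])
   then have "flux T e (p e) w G + flux T' e (p e) w G = 0" unfolding *(3) flux_eq[OF *(1)] flux_eq[OF *(2)] by simp
   then show ?thesis unfolding *(5) using *(6) by simp
  qed
 qed
 finally show ?thesis .
qed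

text \<open>For the weight one the flux collects the sums of both moments on each edge, and
  component \<open>j\<close> of \<open>edge_mom_divergence\<close> for the pair \<open>w j\<close>,
  \<open>G j\<close> gives one term of the divergence.\<close>

lemma flux_divergence:
 assumes T: "is_tri T A B C" and w: "\<And>j. set_integrable lborel T (w j)" and G: "\<And>j. set_integrable lborel T (G j)"
 shows "(\<Sum>e | e edge_of T. flux T e (\<lambda>_. 1) w G) = (LBINT x:T. G 1 x $ 1) + (LBINT x:T. G 2 x $ 2)"
proof -
 have nz: "dbl_area A B C \<noteq> 0" and hull: "T = convex hull {A, B, C}" by (rule is_tri_nz[OF T], rule is_tri_hull[OF T])
 have f: "flux T (closed_segment P Q) (\<lambda>_. 1) w G = (\<Sum>j\<in>UNIV. edge_normal P Q R $ j * (edge_mom P Q R (w j) (G j) + edge_mom Q P R (w j) (G j)))"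
  if "is_tri T P Q R" for P Q R unfolding flux_eq[OF that] tri_flux_def by simp
 have comp: "(LBINT x:T. G j x) $ j = (LBINT x:T. G j x $ j)" for j using integral_bounded_linear[OF bounded_linear_vec_nth[of j] G[unfolded set_integrable_def]]
  unfolding set_lebesgue_integral_def by simp
 have "(LBINT x:T. G j x $ j) =
   edge_normal A B C $ j * (edge_mom A B C (w j) (G j) + edge_mom B A C (w j) (G j))
  + edge_normal B C A $ j * (edge_mom B C A (w j) (G j) + edge_mom C B A (w j) (G j))
  + edge_normal C A B $ j * (edge_mom C A B (w j) (G j) + edge_mom A C B (w j) (G j))" for j
  unfolding comp[symmetric] using edge_mom_divergence[OF nz w[unfolded hull] G[unfolded hull], of j j, symmetric] by (simp add: hull mult.commute)
 then show ?thesis unfolding is_tri_sum_edges(1)[OF T] f[OF T] f[OF is_tri_rotate[OF T]] f[OF is_tri_rotate[OF is_tri_rotate[OF T]]] by (simp add: sum_2)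
qed

lemma flux_diff_const:
 assumes T: "is_tri T A B C"
 shows "(\<Sum>e | e edge_of T. flux T e (\<lambda>x. p e x - c) w G)
   = (\<Sum>e | e edge_of T. flux T e (p e) w G) - c * (\<Sum>e | e edge_of T. flux T e (\<lambda>_. 1) w G)"
proof -
 have tf: "tri_flux P Q R (\<lambda>x. q x - c) w G = tri_flux P Q R q w G - c * tri_flux P Q R (\<lambda>_. 1) w G" for P Q R q
  by (simp add: tri_flux_def sum_2 algebra_simps)
 then show ?thesis unfolding is_tri_sum_edges(1)[OF T] flux_eq[OF T] flux_eq[OF is_tri_rotate[OF T]] flux_eq[OF is_tri_rotate[OF is_tri_rotate[OF T]]] tf
  by (simp add: algebra_simps)
qed

section \<open>Riesz representation, affine fields and edge polynomials\<close>

text \<open>Definiteness makes the linear map from \<open>c\<close> to the values of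
  \<open>B c\<close> on the basis injective, hence surjective in finite dimension. This yields
  existence and uniqueness of weak gradients and of edge projections.\<close>

lemma riesz_euclidean:
 fixes B :: "'v::euclidean_space => 'v => real"
 assumes B: "bilinear B" and pos: "\<forall>x. B x x = 0 --> x = 0" and l: "linear l"
 shows "\<exists>c. \<forall>d. B c d = l d" and "(\<forall>d. B c d = B c' d) ==> c = c'"
proof -
 have B1: "linear (\<lambda>x. B x y)" and B2: "linear (B x)" for x y using B by (auto simp: bilinear_def)
 have ex: "f d = (\<Sum>b\<in>Basis. (d \<bullet> b) * f b)" if "linear f" for f :: "'v => real" and d
 proof -
  have "f d = f (\<Sum>b\<in>Basis. (d \<bullet> b) *\<^sub>R b)" by (simp add: euclidean_representation)
  then show ?thesis by (simp add: linear_sum[OF that] linear_cmul[OF that])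
 qed
 show un: "c = c'" if "\<forall>d. B c d = B c' d" for c c'
 proof -
  have "B (c - c') (c - c') = 0" using that by (simp add: linear_diff[OF B1])
  then show ?thesis using pos[rule_format, of "c - c'"] by simp
 qed
 define L where "L c = (\<Sum>b\<in>Basis. B c b *\<^sub>R b)" for c
 have "linear L" unfolding L_def by (rule linearI) (simp_all add: linear_add[OF B1] linear_cmul[OF B1] scaleR_add_left sum.distrib scaleR_sum_right)
 moreover have "inj L" unfolding linear_inj_iff_eq_0[OF calculation]
 proof (intro allI impI)
  fix c assume "L c = 0"
  then have "B c b = 0" if "b \<in> Basis" for b
   using that by (simp add: L_def euclidean_eq_iff[of "\<Sum>b\<in>Basis. B c b *\<^sub>R b"] inner_sum_left inner_Basis if_distrib cong: if_cong)
  then have "B c c = 0" using ex[OF B2[of c], of c] by simp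
  then show "c = 0" by (rule pos[rule_format])
 qed
 ultimately have "surj L" by (rule linear_injective_imp_surjective[OF _ _ refl])
 then obtain c where c: "L c = (\<Sum>b\<in>Basis. l b *\<^sub>R b)" by (metis surjD)
 have cb: "B c b = l b" if "b \<in> Basis" for b
 proof -
  have "L c \<bullet> b = (\<Sum>b\<in>Basis. l b *\<^sub>R b) \<bullet> b" by (simp add: c)
  then show ?thesis using that by (simp add: L_def inner_sum_left inner_Basis if_distrib cong: if_cong)
 qed
 have "B c d = l d" for d unfolding ex[OF B2[of c], of d] ex[OF l, of d] using cb by simp
 then show "\<exists>c. \<forall>d. B c d = l d" by blast
qed

text \<open>Value at the origin and the two columns of the linear part of an affine field. Products
  of Euclidean spaces are Euclidean, so \<open>riesz_euclidean\<close> applies to the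
  parameters.\<close>

type_synonym aff_param = "(real^2) \<times> (real^2) \<times> (real^2)"

definition aff :: "aff_param => real^2 => real^2" where
 "aff p x = fst p + x$1 *\<^sub>R fst (snd p) + x$2 *\<^sub>R snd (snd p)"

definition aff_grad :: "aff_param => 2 => real^2" where
 "aff_grad p j = vector [fst (snd p) $ j, snd (snd p) $ j]"

abbreviation aff_comp :: "aff_param => 2 => real^2 => real" where
 "aff_comp p \<equiv> \<lambda>j x. aff p x $ j"

abbreviation aff_const_grad :: "aff_param => 2 => real^2 => real^2" where
 "aff_const_grad p \<equiv> \<lambda>j _. aff_grad p j"

lemma linear_aff: "linear (\<lambda>p. aff p x)"
 by (rule linearI) (auto simp: aff_def algebra_simps)

lemma aff_component: "aff p x $ j = fst p $ j + aff_grad p j \<bullet> x"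
 by (simp add: aff_def aff_grad_def inner_vec2)

lemma continuous_on_aff [continuous_intros]: "continuous_on S (aff p)"
 unfolding aff_def by (intro continuous_intros)

lemma aff_measurable [measurable]: "aff p \<in> borel_measurable borel"
 by (intro borel_measurable_continuous_onI continuous_on_aff)

lemma C1_on_aff: "C1_on T (aff_comp p j) (aff_const_grad p j)"
 unfolding C1_on_def aff_component by (auto intro!: derivative_eq_intros)

lemma aff_zero_on_open:
 assumes S: "open S" "S \<noteq> {}" and z: "\<And>x. x \<in> S ==> aff p x = 0"
 shows "p = 0"
proof -
 obtain x where x: "x \<in> S" using S by blast
 obtain r where r: "r > 0" "ball x r \<subseteq> S" using S x open_contains_ball by blast
 have e: "aff p (x + (r/2) *\<^sub>R axis i 1) = aff p x + (r/2) *\<^sub>R (if i = 1 then fst (snd p) else snd (snd p))" for i :: 2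
  using exhaust_2[of i] by (auto simp: aff_def axis_def algebra_simps)
 have "x + (r/2) *\<^sub>R axis i 1 \<in> S" for i :: 2 using r by (intro subsetD[OF r(2)]) (simp add: dist_norm norm_axis_1)
 then have "(r/2) *\<^sub>R (if i = 1 then fst (snd p) else snd (snd p)) = 0" for i :: 2 using e[of i] z[of "x + (r/2) *\<^sub>R axis i 1"] z[OF x] by simp
 from this[of 1] this[of 2] have "fst (snd p) = 0" "snd (snd p) = 0" using r by auto
 moreover from this have "fst p = 0" using z[OF x] by (simp add: aff_def)
 ultimately show ?thesis by (simp add: prod_eq_iff)
qed

lemma vec_polys_1: "vec_polys 1 T = {\<lambda>x. if x \<in> T then aff p x else 0 |p. True}"
proof (intro equalityI subsetI)
 fix q assume "q \<in> vec_polys 1 T"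
 then have "\<forall>i. \<exists>c. (\<lambda>x. q x $ i) = (\<lambda>x. if x \<in> T then \<Sum>\<alpha>\<in>multi_indices 1. c \<alpha> * (x$1) ^ fst \<alpha> * (x$2) ^ snd \<alpha> else 0)"
  unfolding vec_polys_def polys_def mem_Collect_eq .
 from choice[OF this] obtain c where c: "\<forall>i. (\<lambda>x. q x $ i) = (\<lambda>x. if x \<in> T then \<Sum>\<alpha>\<in>multi_indices 1. c i \<alpha> * (x$1) ^ fst \<alpha> * (x$2) ^ snd \<alpha> else 0)" ..
 define p where "p = ((vec_lambda (\<lambda>i. c i (0, 0)) :: real^2), (vec_lambda (\<lambda>i. c i (1, 0)) :: real^2), (vec_lambda (\<lambda>i. c i (0, 1)) :: real^2))"
 have "q x = (if x \<in> T then aff p x else 0)" for x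
 proof -
  have "q x $ i = (if x \<in> T then aff p x else 0) $ i" for i
   using fun_cong[OF c[rule_format, of i], of x] unfolding multi_indices_1 by (simp add: p_def aff_def algebra_simps)
  then show ?thesis by (simp add: vec_eq_iff)
 qed
 then show "q \<in> {\<lambda>x. if x \<in> T then aff p x else 0 |p. True}" by blast
next
 fix q assume "q \<in> {\<lambda>x. if x \<in> T then aff p x else 0 |p. True}"
 then obtain p where q: "q = (\<lambda>x. if x \<in> T then aff p x else 0)" by blast
 show "q \<in> vec_polys 1 T" unfolding vec_polys_def mem_Collect_eq
 proof
  fix i
  let ?c = "\<lambda>\<alpha>. if \<alpha> = (0, 0) then fst p $ i else if \<alpha> = (1, 0) then fst (snd p) $ i else snd (snd p) $ i"
  have "(\<lambda>x. q x $ i) = (\<lambda>x. if x \<in> T then \<Sum>\<alpha>\<in>multi_indices 1. ?c \<alpha> * (x$1) ^ fst \<alpha> * (x$2) ^ snd \<alpha> else 0)"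
   unfolding multi_indices_1 q by (auto simp: fun_eq_iff aff_def algebra_simps)
  then show "(\<lambda>x. q x $ i) \<in> polys 1 T" unfolding polys_def mem_Collect_eq by (rule exI[of _ ?c])
 qed
qed

lemma polys_0: "polys 0 T = {\<lambda>x. if x \<in> T then k else 0 |k. True}"
proof -
 have m: "multi_indices 0 = {(0, 0)}" by (auto simp: multi_indices_def)
 have "(\<exists>c. p = (\<lambda>x. if x \<in> T then c else 0)) \<longleftrightarrow> (\<exists>c::nat \<times> nat => real. p = (\<lambda>x. if x \<in> T then c (0, 0) else 0))" for p :: "real^2 => real"
  by (rule iffI; elim exE) (rule exI[of _ "\<lambda>_. _"], simp, rule exI)
 then show ?thesis unfolding polys_def m by (simp cong: if_cong)
qed

text \<open>Affine functions on \<open>AB\<close> parametrised by their endpoint values, so that a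
  Euclidean space stands for the polynomials on the edge.\<close>

definition edge_poly :: "real^2 => real^2 => real^2 => real \<times> real => real^2 => real" where
 "edge_poly A B C \<alpha> x = fst \<alpha> * bary A B C x + snd \<alpha> * bary B A C x"

lemma edge_poly_segment:
 assumes "dbl_area A B C \<noteq> 0"
 shows "edge_poly A B C \<alpha> (A + s *\<^sub>R (B - A)) = (1 - s) * fst \<alpha> + s * snd \<alpha>"
proof -
 have "bary A B C (A + s *\<^sub>R (B - A)) = 1 - s" "bary B C A (A + s *\<^sub>R (B - A)) = s" using bary_param[OF assms, of s 0] by auto
 then show ?thesis by (simp add: edge_poly_def bary_swap[of B A C] mult.commute)
qed

lemma closed_segment_param: "closed_segment A B = (\<lambda>s. A + s *\<^sub>R (B - A)) ` {0..1}"
proof -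
 have "(1 - s) *\<^sub>R A + s *\<^sub>R B = A + s *\<^sub>R (B - A)" for s by (simp add: algebra_simps)
 then show ?thesis by (auto simp: closed_segment_def image_iff)
qed

lemma polys_1_edge:
 assumes nz: "dbl_area A B C \<noteq> 0"
 shows "polys 1 (closed_segment A B) = {\<lambda>x. if x \<in> closed_segment A B then edge_poly A B C \<alpha> x else 0 |\<alpha>. True}"
proof (intro equalityI subsetI)
 fix q assume "q \<in> polys 1 (closed_segment A B)"
 then obtain c where q: "q = (\<lambda>x. if x \<in> closed_segment A B then \<Sum>\<alpha>\<in>multi_indices 1. c \<alpha> * (x$1) ^ fst \<alpha> * (x$2) ^ snd \<alpha> else 0)"
  unfolding polys_def by blast
 then have q: "q = (\<lambda>x. if x \<in> closed_segment A B then c (0, 0) + c (1, 0) * x$1 + c (0, 1) * x$2 else 0)"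
  unfolding multi_indices_1 by (simp add: add.assoc cong: if_cong)
 let ?f = "\<lambda>x::real^2. c (0, 0) + c (1, 0) * x$1 + c (0, 1) * x$2"
 have "q x = (if x \<in> closed_segment A B then edge_poly A B C (?f A, ?f B) x else 0)" for x
 proof (cases "x \<in> closed_segment A B")
  case True
  then obtain s where "x = A + s *\<^sub>R (B - A)" unfolding closed_segment_param by blast
  then show ?thesis using True by (simp add: q edge_poly_segment[OF nz]) (simp add: algebra_simps)
 qed (simp add: q)
 then show "q \<in> {\<lambda>x. if x \<in> closed_segment A B then edge_poly A B C \<alpha> x else 0 |\<alpha>. True}" by blast
next
 fix q assume "q \<in> {\<lambda>x. if x \<in> closed_segment A B then edge_poly A B C \<alpha> x else 0 |\<alpha>. True}"
 then obtain \<alpha> where q: "q = (\<lambda>x. if x \<in> closed_segment A B then edge_poly A B C \<alpha> x else 0)" by blast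
 have b: "\<exists>k g. \<forall>x. bary P Q R x = k + g \<bullet> x" for P Q R
  by (rule exI[of _ "bary P Q R 0"], rule exI[of _ "(1 / dbl_area P Q R) *\<^sub>R (vector [Q$2 - R$2, R$1 - Q$1] :: real^2)"], rule allI, rule trans[OF bary_affine[of P Q R _ 0]]) simp
 obtain k1 and g1 :: "real^2" where b1: "\<forall>x. bary A B C x = k1 + g1 \<bullet> x" using b by blast
 obtain k2 and g2 :: "real^2" where b2: "\<forall>x. bary B A C x = k2 + g2 \<bullet> x" using b by blast
 let ?c = "\<lambda>\<beta>. if \<beta> = (0, 0) then fst \<alpha> * k1 + snd \<alpha> * k2 else if \<beta> = (1, 0) then fst \<alpha> * g1$1 + snd \<alpha> * g2$1 else fst \<alpha> * g1$2 + snd \<alpha> * g2$2"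
 have "q = (\<lambda>x. if x \<in> closed_segment A B then \<Sum>\<beta>\<in>multi_indices 1. ?c \<beta> * (x$1) ^ fst \<beta> * (x$2) ^ snd \<beta> else 0)"
  unfolding multi_indices_1 q edge_poly_def by (auto simp: fun_eq_iff b1 b2 inner_vec2 algebra_simps)
 then show "q \<in> polys 1 (closed_segment A B)" unfolding polys_def mem_Collect_eq by (rule exI[of _ ?c])
qed

lemma continuous_on_edge_poly: "continuous_on S (edge_poly A B C \<alpha>)"
 unfolding edge_poly_def by (intro continuous_intros)

definition edge_affine :: "real^2 => real^2 => (real^2 => real) => bool" where
 "edge_affine A B p \<longleftrightarrow> (\<forall>s\<in>{0..1}. p (A + s *\<^sub>R (B - A)) = (1 - s) * p A + s * p B)"

lemma polys_1_edge_affine: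
 assumes "q \<in> polys 1 (closed_segment A B)"
 shows "edge_affine A B q" "continuous_on (closed_segment A B) q"
proof -
 obtain c where q: "q = (\<lambda>x. if x \<in> closed_segment A B then \<Sum>\<alpha>\<in>multi_indices 1. c \<alpha> * (x$1) ^ fst \<alpha> * (x$2) ^ snd \<alpha> else 0)"
  using assms unfolding polys_def by blast
 then have q: "q = (\<lambda>x. if x \<in> closed_segment A B then c (0, 0) + c (1, 0) * x$1 + c (0, 1) * x$2 else 0)"
  unfolding multi_indices_1 by (simp add: add.assoc cong: if_cong)
 have "A + s *\<^sub>R (B - A) \<in> closed_segment A B" if "s \<in> {0..1}" for s using that unfolding closed_segment_param by blast
 then show "edge_affine A B q" unfolding edge_affine_def q by (auto simp: algebra_simps)
 have "continuous_on (closed_segment A B) (\<lambda>x. c (0, 0) + c (1, 0) * x$1 + c (0, 1) * x$2)" by (intro continuous_intros)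
 then show "continuous_on (closed_segment A B) q" by (rule continuous_on_eq) (simp add: q)
qed

lemma L2_inner_edge:
 assumes ab: "A \<noteq> B" and f: "continuous_on (closed_segment A B) f" and g: "continuous_on (closed_segment A B) g"
 shows "L2_inner (edge_measure (closed_segment A B)) f g = dist A B * (LINT s:{0..1}|lborel. f (A + s *\<^sub>R (B - A)) * g (A + s *\<^sub>R (B - A)))"
proof -
 have "continuous_on (closed_segment A B) (\<lambda>x. f x * g x)" by (intro continuous_intros f g)
 from edge_measure_segment(1)[OF ab continuous_edge_measurable(1)[OF ab this]] show ?thesis by (simp add: L2_inner_def)
qed

text \<open>For C1 fields the flux is the true boundary integral: an affine weight is the
  combination of \<open>1 - s\<close> and \<open>s\<close> of its endpoint values, and the length of
  the edge times the unit normal is \<open>edge_normal\<close>.\<close>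

lemma L2_inner_edge_flux:
 assumes T: "is_tri T A B C" and w: "\<And>j. C1_on T (w j) (G j)" and p: "edge_affine A B p" and pc: "continuous_on (closed_segment A B) p"
 shows "L2_inner (edge_measure (closed_segment A B)) p (\<lambda>x. (\<chi> j. w j x) \<bullet> outward_normal T (closed_segment A B))
   = flux T (closed_segment A B) p w G"
proof -
 have nz: "dbl_area A B C \<noteq> 0" and hull: "T = convex hull {A, B, C}" by (rule is_tri_nz[OF T], rule is_tri_hull[OF T])
 have ne: "A \<noteq> B" using dbl_area_distinct[OF nz] by simp
 let ?e = "closed_segment A B" and ?n = "outward_normal T (closed_segment A B)"
 have eT: "?e \<subseteq> T" unfolding hull segment_convex_hull by (rule hull_mono) auto
 have wc: "continuous_on ?e (w j)" for j using C1_on_continuous[OF w] eT continuous_on_subset by blast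
 have im: "A + s *\<^sub>R (B - A) \<in> ?e" if "s \<in> {0..1}" for s using that unfolding closed_segment_param by blast
 have gc: "continuous_on ?e (\<lambda>x. (\<chi> j. w j x) \<bullet> ?n)" by (intro continuous_intros wc)
 have N: "edge_normal A B C $ j = dist A B * ?n $ j" for j unfolding outward_normal_tri[OF T, symmetric] by simp
 have ci: "set_integrable lborel {0..1} (\<lambda>s. p (A + s *\<^sub>R (B - A)) * w j (A + s *\<^sub>R (B - A)) * k)" for j k unfolding set_integrable_def
  by (intro borel_integrable_compact continuous_intros continuous_on_compose2[OF pc] continuous_on_compose2[OF wc]) (use im in auto)
 have I: "(LINT s:{0..1}|lborel. p (A + s *\<^sub>R (B - A)) * w j (A + s *\<^sub>R (B - A))) = p A * edge_mom A B C (w j) (G j) + p B * edge_mom B A C (w j) (G j)" for j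
  unfolding edge_mom_C1_weighted[OF nz w[unfolded hull]] by (rule set_lebesgue_integral_cong) (use p in \<open>auto simp: edge_affine_def\<close>)
 have "L2_inner (edge_measure ?e) p (\<lambda>x. (\<chi> j. w j x) \<bullet> ?n)
   = dist A B * (LINT s:{0..1}|lborel. p (A + s *\<^sub>R (B - A)) * w 1 (A + s *\<^sub>R (B - A)) * ?n$1 + p (A + s *\<^sub>R (B - A)) * w 2 (A + s *\<^sub>R (B - A)) * ?n$2)"
  unfolding L2_inner_edge[OF ne pc gc] by (simp add: inner_vec2 algebra_simps)
 also have "\<dots> = dist A B * ((LINT s:{0..1}|lborel. p (A + s *\<^sub>R (B - A)) * w 1 (A + s *\<^sub>R (B - A))) * ?n$1 + (LINT s:{0..1}|lborel. p (A + s *\<^sub>R (B - A)) * w 2 (A + s *\<^sub>R (B - A))) * ?n$2)"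
  by (simp only: set_integral_add(2)[OF ci ci] set_integral_mult_left)
 finally show ?thesis unfolding I flux_eq[OF T] tri_flux_def N by (simp only: sum_2 algebra_simps)
qed

lemma L2_inner_triangle:
 fixes f :: "real^2 => 'b::euclidean_space"
 assumes T: "T \<in> sets borel" and f: "f \<in> borel_measurable borel" "\<And>x. x \<in> T ==> f' x = f x"
  and g: "g \<in> borel_measurable borel" "\<And>x. x \<in> T ==> g' x = g x"
 shows "L2_inner (lebesgue_on T) f' g' = (LBINT x:T. f x \<bullet> g x)"
 unfolding L2_inner_def by (rule integral_lebesgue_on_eq[OF T]) (use f g in auto)

definition mass :: "(real^2) set => aff_param => aff_param => real" where
 "mass T p q = (LBINT x:T. aff p x \<bullet> aff q x)"

text \<open>For definiteness, a continuous field that vanishes almost everywhere in the interior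
  vanishes there, and an affine field that vanishes on a nonempty open set is zero.\<close>

lemma
 assumes T: "is_tri T A B C"
 shows bilinear_mass: "bilinear (mass T)"
  and mass_pos: "mass T p p = 0 ==> p = 0"
proof -
 have hull: "T = convex hull {A, B, C}" by (rule is_tri_hull[OF T])
 have nz: "dbl_area A B C \<noteq> 0" by (rule is_tri_nz[OF T])
 have i: "set_integrable lborel T (\<lambda>x. aff p x \<bullet> aff q x)" for p q
  unfolding hull by (intro set_integrable_continuous_compact compact_triangle continuous_intros)
 have c: "mass T p q = mass T q p" for p q by (simp add: mass_def inner_commute)
 have l: "linear (mass T p)" for p
 proof (rule linearI)
  fix q r show "mass T p (q + r) = mass T p q + mass T p r"
   by (simp add: mass_def linear_add[OF linear_aff] inner_add_right set_integral_add(2)[OF i i])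
  fix k show "mass T p (k *\<^sub>R q) = k *\<^sub>R mass T p q"
   by (simp add: mass_def linear_cmul[OF linear_aff])
 qed
 then show "bilinear (mass T)" unfolding bilinear_def using c by simp
 assume z: "mass T p p = 0"
 have "AE x in lborel. indicator T x *\<^sub>R (aff p x \<bullet> aff p x) = 0"
  using integral_nonneg_eq_0_iff_AE[OF i[of p p, unfolded set_integrable_def]] z by (auto simp: mass_def set_lebesgue_integral_def)
 then have ae: "AE x in lborel. x \<in> interior T --> aff p x = 0"
  by eventually_elim (use interior_subset[of T] in \<open>auto simp: indicator_def split: if_splits\<close>)
 let ?O = "interior T \<inter> {x. aff p x \<noteq> 0}"
 have "open {x. aff p x \<noteq> 0}" by (intro open_Collect_neq continuous_on_aff continuous_on_const)
 then have oO: "open ?O" by blast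
 have "AE x in lborel. x \<notin> ?O" using ae by eventually_elim auto
 then have "?O \<in> null_sets lborel" by (intro AE_iff_null_sets[THEN iffD2]) (use oO in auto)
 then have "negligible ?O" by (simp add: negligible_iff_null_sets null_sets_completionI)
 then have "?O = {}" using open_not_negligible[OF oO] by blast
 moreover have "interior T \<noteq> {}"
 proof -
  let ?I = "{y. 0 < bary A B C y} \<inter> {y. 0 < bary B C A y} \<inter> {y. 0 < bary C A B y}"
  have "open ?I" by (intro open_Int open_Collect_less continuous_on_const continuous_on_bary continuous_on_id)
  moreover have "?I \<subseteq> T" using mem_triangle_iff[OF nz] hull by fastforce
  ultimately have "?I \<subseteq> interior T" by (rule interior_maximal[rotated])
  moreover have "A + (1/3) *\<^sub>R (B - A) + (1/3) *\<^sub>R (C - A) \<in> ?I" using bary_param[OF nz, of "1/3" "1/3"] by simp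
  ultimately show ?thesis by blast
 qed
 ultimately show "p = 0" by (intro aff_zero_on_open[OF open_interior]) auto
qed

lemma linear_flux:
 assumes T: "is_tri T A B C"
 shows "linear (\<lambda>q. \<Sum>e | e edge_of T. flux T e (p e) (aff_comp q) (aff_const_grad q))"
proof -
 have hull: "T = convex hull {A, B, C}" by (rule is_tri_hull[OF T])
 have em: "linear (\<lambda>q. edge_mom P Q R (aff_comp q j) (aff_const_grad q j))" if "dbl_area P Q R \<noteq> 0" for P Q R j
 proof -
  have i: "set_integrable lborel (convex hull {P, Q, R}) (\<lambda>x. bary P Q R x * (aff_grad q j \<bullet> (P - R)) + aff q x $ j)" for q
   by (intro set_integrable_continuous_compact compact_triangle continuous_intros)
  have g: "aff_grad (q + r) j = aff_grad q j + aff_grad r j" "aff_grad (k *\<^sub>R q) j = k *\<^sub>R aff_grad q j" for q r k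
   by (simp_all add: aff_grad_def vec2_eq_iff)
  show ?thesis
  proof (rule linearI)
   fix q r
   have "bary P Q R x * (aff_grad (q + r) j \<bullet> (P - R)) + aff (q + r) x $ j
     = (bary P Q R x * (aff_grad q j \<bullet> (P - R)) + aff q x $ j) + (bary P Q R x * (aff_grad r j \<bullet> (P - R)) + aff r x $ j)" for x
    unfolding linear_add[OF linear_aff] g by (simp add: inner_add_left distrib_left)
   then show "edge_mom P Q R (aff_comp (q + r) j) (aff_const_grad (q + r) j) = edge_mom P Q R (aff_comp q j) (aff_const_grad q j) + edge_mom P Q R (aff_comp r j) (aff_const_grad r j)"
    unfolding edge_mom_def add_divide_distrib[symmetric] set_integral_add(2)[OF i i, symmetric] by presburger
   fix k
   have "bary P Q R x * (aff_grad (k *\<^sub>R q) j \<bullet> (P - R)) + aff (k *\<^sub>R q) x $ j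
     = k * (bary P Q R x * (aff_grad q j \<bullet> (P - R)) + aff q x $ j)" for x unfolding linear_cmul[OF linear_aff] g by (simp add: distrib_left)
   then show "edge_mom P Q R (aff_comp (k *\<^sub>R q) j) (aff_const_grad (k *\<^sub>R q) j) = k *\<^sub>R edge_mom P Q R (aff_comp q j) (aff_const_grad q j)"
    unfolding edge_mom_def real_scaleR_def by simp
  qed
 qed
 have tf: "linear (\<lambda>q. tri_flux P Q R f (aff_comp q) (aff_const_grad q))" if "is_tri T P Q R" for P Q R f
 proof -
  have nz: "dbl_area P Q R \<noteq> 0" "dbl_area Q P R \<noteq> 0" using is_tri_nz[OF that] is_tri_nz[OF is_tri_swap[OF that]] by auto
  have "linear (\<lambda>q. edge_normal P Q R $ j *\<^sub>R (f P *\<^sub>R edge_mom P Q R (aff_comp q j) (aff_const_grad q j) + f Q *\<^sub>R edge_mom Q P R (aff_comp q j) (aff_const_grad q j)))" for j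
   by (intro linear_compose_scale_right linear_compose_add em nz)
  then show ?thesis unfolding tri_flux_def real_scaleR_def by (intro linear_compose_sum ballI)
 qed
 show ?thesis unfolding is_tri_sum_edges(1)[OF T] flux_eq[OF T] flux_eq[OF is_tri_rotate[OF T]] flux_eq[OF is_tri_rotate[OF is_tri_rotate[OF T]]]
  by (rule linear_compose_add[OF linear_compose_add[OF tf[OF T] tf[OF is_tri_rotate[OF T]]] tf[OF is_tri_rotate[OF is_tri_rotate[OF T]]]])
qed

lemma divergence_aff:
 assumes x: "x \<in> interior T"
 shows "divergence T (\<lambda>x. if x \<in> T then aff p x else 0) x = aff_grad p 1 $ 1 + aff_grad p 2 $ 2"
proof -
 let ?q = "\<lambda>x. if x \<in> T then aff p x else 0" and ?D = "\<lambda>h::real^2. h$1 *\<^sub>R fst (snd p) + h$2 *\<^sub>R snd (snd p)"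
 have "(aff p has_derivative ?D) (at x)" unfolding aff_def[abs_def] by (auto intro!: derivative_eq_intros bounded_linear_imp_has_derivative bounded_linear_vec_nth)
 then have "(?q has_derivative ?D) (at x)" by (rule has_derivative_transform_within_open[OF _ open_interior x]) (use interior_subset in auto)
 then have "frechet_derivative ?q (at x) = ?D" by (rule frechet_derivative_at[symmetric])
 moreover have "at x within T = at x" using x by (rule at_within_interior)
 ultimately show ?thesis by (simp add: divergence_def sum_2 axis_def aff_grad_def)
qed

lemma flux_one_affine:
 assumes T: "is_tri T A B C"
 shows "(\<Sum>e | e edge_of T. flux T e (\<lambda>_. 1) (aff_comp q) (aff_const_grad q)) = (aff_grad q 1 $ 1 + aff_grad q 2 $ 2) * measure lborel T"
proof -
 have hull: "T = convex hull {A, B, C}" by (rule is_tri_hull[OF T])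
 have i: "set_integrable lborel T (aff_comp q j)" for j unfolding hull by (intro set_integrable_continuous_compact compact_triangle continuous_intros)
 have m: "emeasure lborel T < \<infinity>" unfolding hull by (rule emeasure_bounded_finite[OF compact_imp_bounded[OF compact_triangle]])
 have c: "set_integrable lborel T (\<lambda>_. v)" for v :: "real^2"
  unfolding set_integrable_def hull using borel_integrable_compact[OF compact_triangle, of A B C "\<lambda>_. v"] by simp
 have l: "(LBINT x:T. k) = k * measure lborel T" for k :: real using m by (simp add: set_lebesgue_integral_def hull)
 show ?thesis unfolding flux_divergence[OF T i c] l by (simp add: algebra_simps)
qed

section \<open>Square-integrable functions on a triangle\<close>

definition sq_integrable :: "(real^2) set => (real^2 => 'b::euclidean_space) => bool" where
 "sq_integrable S f \<longleftrightarrow> f \<in> borel_measurable borel \<and> set_integrable lborel S (\<lambda>x. (norm (f x))^2)"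

definition sq_norm :: "(real^2) set => (real^2 => 'b::euclidean_space) => real" where
 "sq_norm S f = sqrt (LBINT x:S. (norm (f x))^2)"

lemma sq_norm_nonneg: "0 \<le> sq_norm S f"
 by (simp add: sq_norm_def set_lebesgue_integral_def)

lemma sq_norm_sq: "(sq_norm S f)^2 = (LBINT x:S. (norm (f x))^2)"
 by (simp add: sq_norm_def set_lebesgue_integral_def)

lemma set_integrable_dominated:
 fixes g :: "real^2 => 'b::euclidean_space"
 assumes f: "set_integrable lborel S f" and [measurable]: "S \<in> sets borel" "g \<in> borel_measurable borel"
  and le: "\<And>x. norm (g x) \<le> (f x :: real)"
 shows "set_integrable lborel S g"
 unfolding set_integrable_def
proof (rule Bochner_Integration.integrable_bound[OF f[unfolded set_integrable_def]])
 show "AE x in lborel. norm (indicator S x *\<^sub>R g x) \<le> norm (indicator S x *\<^sub>R f x)"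
  using le by (intro AE_I2) (auto simp: indicator_def intro: order_trans abs_ge_self)
qed measurable

lemma sq_integrable_add:
 assumes "sq_integrable S f" "sq_integrable S g" and S: "S \<in> sets borel"
 shows "sq_integrable S (\<lambda>x. f x + g x)"
 unfolding sq_integrable_def
proof (intro conjI)
 have [measurable]: "f \<in> borel_measurable borel" "g \<in> borel_measurable borel" using assms by (auto simp: sq_integrable_def)
 show "(\<lambda>x. f x + g x) \<in> borel_measurable borel" by measurable
 show "set_integrable lborel S (\<lambda>x. (norm (f x + g x))^2)"
 proof (rule set_integrable_dominated[OF _ S])
  show "set_integrable lborel S (\<lambda>x. 2 * (norm (f x))^2 + 2 * (norm (g x))^2)"
   using assms by (intro set_integral_add(1) set_integrable_mult_right) (auto simp: sq_integrable_def)
  show "norm ((norm (f x + g x))^2) \<le> 2 * (norm (f x))^2 + 2 * (norm (g x))^2" for x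
  proof -
   have "(norm (f x + g x))^2 \<le> (norm (f x) + norm (g x))^2" by (intro power_mono norm_triangle_ineq) simp
   then show ?thesis using sum_squares_bound[of "norm (f x)" "norm (g x)"] by (simp add: power2_sum)
  qed
 qed measurable
qed

lemma sq_integrable_scaleR: "sq_integrable S f ==> sq_integrable S (\<lambda>x. c *\<^sub>R f x)"
 by (auto simp: sq_integrable_def power_mult_distrib intro!: borel_measurable_scaleR)

lemma sq_integrable_diff:
 assumes "sq_integrable S f" "sq_integrable S g" "S \<in> sets borel"
 shows "sq_integrable S (\<lambda>x. f x - g x)"
 using sq_integrable_add[OF assms(1) sq_integrable_scaleR[OF assms(2), of "-1"] assms(3)] by simp

lemma sq_integrable_inner:
 assumes "sq_integrable S f" "sq_integrable S g" and S: "S \<in> sets borel"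
 shows "set_integrable lborel S (\<lambda>x. f x \<bullet> g x)"
proof (rule set_integrable_dominated[OF _ S])
 have [measurable]: "f \<in> borel_measurable borel" "g \<in> borel_measurable borel" using assms by (auto simp: sq_integrable_def)
 show "(\<lambda>x. f x \<bullet> g x) \<in> borel_measurable borel" by measurable
 show "set_integrable lborel S (\<lambda>x. (norm (f x))^2 + (norm (g x))^2)" using assms by (intro set_integral_add(1)) (auto simp: sq_integrable_def)
 show "norm (f x \<bullet> g x) \<le> (norm (f x))^2 + (norm (g x))^2" for x
  using Cauchy_Schwarz_ineq2[of "f x" "g x"] sum_squares_bound[of "norm (f x)" "norm (g x)"]
   zero_le_power2[of "norm (f x)"] zero_le_power2[of "norm (g x)"] by simp
qed

lemma sq_integrable_Cauchy_Schwarz: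
 assumes f: "sq_integrable S f" and g: "sq_integrable S g" and S: "S \<in> sets borel"
 shows "\<bar>LBINT x:S. f x \<bullet> g x\<bar> \<le> sq_norm S f * sq_norm S g"
 unfolding sq_norm_def
proof (rule Cauchy_Schwarz_of_quadratic)
 fix t :: real
 let ?F = "LBINT x:S. (norm (f x))^2" and ?G = "LBINT x:S. (norm (g x))^2" and ?I = "LBINT x:S. f x \<bullet> g x"
 have i: "set_integrable lborel S (\<lambda>x. (norm (f x))^2)" "set_integrable lborel S (\<lambda>x. (norm (g x))^2)"
  "set_integrable lborel S (\<lambda>x. f x \<bullet> g x)" using f g sq_integrable_inner[OF f g S] by (auto simp: sq_integrable_def)
 have "0 \<le> (LBINT x:S. (norm (f x + t *\<^sub>R g x))^2)" by (simp add: set_lebesgue_integral_def)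
 also have "\<dots> = (LBINT x:S. (norm (f x))^2 + 2 * t * (f x \<bullet> g x) + t^2 * (norm (g x))^2)" unfolding power2_norm_eq_inner
  by (rule arg_cong[of _ _ "set_lebesgue_integral lborel S"], rule ext)
   (simp add: inner_add_left inner_add_right inner_commute[of "g _" "f _"] power2_eq_square distrib_left)
 also have "\<dots> = ?F + 2 * t * ?I + t^2 * ?G" using i by (simp add: set_integral_add(2) set_integral_add(1))
 finally show "0 \<le> ?F + 2 * t * ?I + t^2 * ?G" .
qed (simp_all add: set_lebesgue_integral_def)

lemma sq_integrable_continuous:
 fixes f :: "real^2 => 'b::euclidean_space"
 assumes "compact S" "continuous_on UNIV f"
 shows "sq_integrable S f"
 unfolding sq_integrable_def using assms by (intro conjI borel_measurable_continuous_onI set_integrable_continuous_compact continuous_intros)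
  (auto intro: continuous_on_subset)

lemma sq_integrable_set_integrable:
 assumes f: "sq_integrable T f" and T: "compact T"
 shows "set_integrable lborel T f"
proof (rule set_integrable_dominated)
 show Tb: "T \<in> sets borel" using T by (rule borel_compact)
 show "f \<in> borel_measurable borel" using f by (simp add: sq_integrable_def)
 show "set_integrable lborel T (\<lambda>x. 1 + (norm (f x))^2)"
  using f set_integrable_continuous_compact[OF T, of "\<lambda>_. 1"] by (intro set_integral_add(1)) (auto simp: sq_integrable_def)
 show "norm (f x) \<le> 1 + (norm (f x))^2" for x using sum_squares_bound[of 1 "norm (f x)"] norm_ge_zero[of "f x"] unfolding mult_1_right one_power2 by linarith
qed

lemma sq_integrable_of_integrable:
 assumes "f \<in> borel_measurable borel" "integrable lborel (\<lambda>x. (norm (f x))^2)" "S \<in> sets borel"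
 shows "sq_integrable S f"
 using assms by (simp add: sq_integrable_def integrable_imp_set_integrable)

lemma triangle_const:
 fixes k :: real
 shows "set_integrable lborel (convex hull {A, B, C}) (\<lambda>_::real^2. k)"
  "(LBINT x:convex hull {A, B, C}. k) = k * measure lborel (convex hull {A, B, C})"
 using set_integrable_continuous_compact[OF compact_triangle, of A B C "\<lambda>_. k"] emeasure_bounded_finite[OF compact_imp_bounded[OF compact_triangle], of A B C]
 by (auto simp: set_lebesgue_integral_def)

lemma measure_triangle:
 assumes nz: "dbl_area A B C \<noteq> 0"
 shows "measure lborel (convex hull {A, B, C}) = \<bar>dbl_area A B C\<bar> / 2"
proof -
 have in1: "(LBINT r. indicator {0..1} s * indicator {0..1 - s} r) = indicator {0..1} s *\<^sub>R (1 - s)" for s :: real by (auto simp: indicator_def[of "{0..1}"])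
 have "measure lborel (convex hull {A, B, C}) = (LBINT x:convex hull {A, B, C}. 1)" by (simp add: triangle_const(2))
 also have "\<dots> = \<bar>dbl_area A B C\<bar> * (LBINT s::real. LBINT r::real. indicator {0..1} s * indicator {0..1 - s} r)"
  using set_integral_triangle[OF nz triangle_const(1)[where k = 1]] unfolding mult_1_right .
 also have "(LBINT s::real. LBINT r::real. indicator {0..1} s * indicator {0..1 - s} r :: real) = (1 - 1^2/2) - (0 - 0^2/2)" unfolding in1
  by (rule integral_FTC_atLeastAtMost) (auto intro!: derivative_eq_intros continuous_intros simp: has_real_derivative_iff_has_vector_derivative[symmetric])
 finally show ?thesis by simp
qed

lemma is_tri_edgeE:
 assumes T: "is_tri T A B C" and e: "e edge_of T"
 obtains P Q R where "is_tri T P Q R" "e = closed_segment P Q"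
 using e is_tri_edge_iff[OF T] that[of A B C] that[of B C A] that[of C A B] T is_tri_rotate[OF T] is_tri_rotate[OF is_tri_rotate[OF T]] by auto

lemma space_edge_measure:
 assumes "A \<noteq> B"
 shows "space (edge_measure (closed_segment A B)) = closed_segment (A :: real^2) B"
 using sets_eq_imp_space_eq[OF edge_measure_segment(3)[OF assms, of "\<lambda>_. 0"]] by (simp add: space_restrict_space)

lemma L2_inner_edge_cong:
 assumes "A \<noteq> B" "\<And>x. x \<in> closed_segment A B ==> f x = f' x" "\<And>x. x \<in> closed_segment A B ==> g x = g' x"
 shows "L2_inner (edge_measure (closed_segment A (B :: real^2))) f g = L2_inner (edge_measure (closed_segment A B)) f' g'"
 unfolding L2_inner_def by (rule Bochner_Integration.integral_cong) (use assms space_edge_measure in auto)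

lemma AE_triangle_interior:
 assumes "is_tri T A B C"
 shows "AE x in lborel. x \<in> T --> x \<in> interior T"
 using AE_not_frontier_convex[OF convex_triangle[of A B C]] unfolding is_tri_hull[OF assms, symmetric]
 by eventually_elim (use closure_subset[of T] in \<open>auto simp: frontier_def\<close>)

section \<open>Weak gradients and projections on a single element\<close>

abbreviation zero_ext :: "(real^2) set => (real^2 => 'b::zero) => real^2 => 'b" where
 "zero_ext T f \<equiv> \<lambda>x. if x \<in> T then f x else 0"

text \<open>Since \<open>fst v T\<close> is the constant \<open>c\<close>, the divergence theorem
  turns the element term into \<open>- c\<close> times the flux of \<open>q\<close>. The defining
  functional is then the flux weighted with the jump, and \<open>riesz_euclidean\<close> represents
  it by an affine field.\<close>

lemma weak_grad_triangle:
 assumes T: "is_tri T A B C" and c: "fst v T = zero_ext T (\<lambda>_. c)"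
  and vb: "\<And>e. e edge_of T ==> snd v e \<in> polys 1 e"
 obtains p where "weak_grad v T = zero_ext T (aff p)"
  "\<And>q. mass T p q = (\<Sum>e | e edge_of T. flux T e (\<lambda>x. snd v e x - c) (aff_comp q) (aff_const_grad q))"
proof -
 let ?l = "\<lambda>q. \<Sum>e | e edge_of T. flux T e (\<lambda>x. snd v e x - c) (aff_comp q) (aff_const_grad q)"
 have hull: "T = convex hull {A, B, C}" by (rule is_tri_hull[OF T])
 then have Tb: "T \<in> sets borel" by simp
 have inner: "L2_inner (lebesgue_on T) (zero_ext T (aff p)) (zero_ext T (aff q)) = mass T p q" for p q unfolding mass_def by (rule L2_inner_triangle[OF Tb]) auto
 have rhs: "- L2_inner (lebesgue_on T) (fst v T) (divergence T (zero_ext T (aff q)))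
   + (\<Sum>e | e edge_of T. L2_inner (edge_measure e) (snd v e) (\<lambda>x. zero_ext T (aff q) x \<bullet> outward_normal T e)) = ?l q" for q
 proof -
  let ?D = "aff_grad q 1 $ 1 + aff_grad q 2 $ 2"
  have "AE x in lborel. x \<in> T --> fst v T x \<bullet> divergence T (zero_ext T (aff q)) x = c * ?D"
   using AE_triangle_interior[OF T] by eventually_elim (auto simp: divergence_aff c)
  then have "L2_inner (lebesgue_on T) (fst v T) (divergence T (zero_ext T (aff q))) = (LBINT x:T. c * ?D)"
   unfolding L2_inner_def by (intro integral_lebesgue_on_eq[OF Tb]) simp_all
  also have "\<dots> = c * ?D * measure lborel T" unfolding hull by (rule triangle_const(2))
  finally have 1: "L2_inner (lebesgue_on T) (fst v T) (divergence T (zero_ext T (aff q))) = c * (?D * measure lborel T)" by simp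
  have 2: "L2_inner (edge_measure e) (snd v e) (\<lambda>x. zero_ext T (aff q) x \<bullet> outward_normal T e)
    = flux T e (snd v e) (aff_comp q) (aff_const_grad q)" if e: "e edge_of T" for e
  proof -
   obtain P Q R where P: "is_tri T P Q R" "e = closed_segment P Q" using is_tri_edgeE[OF T e] .
   have ne: "P \<noteq> Q" using dbl_area_distinct[OF is_tri_nz[OF P(1)]] by simp
   have sub: "closed_segment P Q \<subseteq> T" unfolding is_tri_hull[OF P(1)] segment_convex_hull by (rule hull_mono) auto
   have "L2_inner (edge_measure e) (snd v e) (\<lambda>x. zero_ext T (aff q) x \<bullet> outward_normal T e)
     = L2_inner (edge_measure e) (snd v e) (\<lambda>x. (\<chi> j. aff q x $ j) \<bullet> outward_normal T e)"
    unfolding P(2) by (rule L2_inner_edge_cong[OF ne]) (use sub in auto)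
   also have "\<dots> = flux T e (snd v e) (aff_comp q) (aff_const_grad q)"
    unfolding P(2) using polys_1_edge_affine[OF vb[OF e, unfolded P(2)]] unfolding P(2)[symmetric] by (intro L2_inner_edge_flux[OF P(1), folded P(2)] C1_on_aff)
   finally show ?thesis .
  qed
  show ?thesis unfolding 1 flux_diff_const[OF T] flux_one_affine[OF T] by (simp add: 2)
 qed
 have mpos: "\<forall>x. mass T x x = 0 --> x = 0" using mass_pos[OF T] by blast
 obtain p where p: "\<forall>q. mass T p q = ?l q" using riesz_euclidean(1)[OF bilinear_mass[OF T] mpos linear_flux[OF T]] ..
 have "weak_grad v T = zero_ext T (aff p)" unfolding weak_grad_def
 proof (rule the_equality)
  show "zero_ext T (aff p) \<in> vec_polys 1 T \<and> (\<forall>q\<in>vec_polys 1 T. L2_inner (lebesgue_on T) (zero_ext T (aff p)) q =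
    - L2_inner (lebesgue_on T) (fst v T) (divergence T q) + (\<Sum>e | e edge_of T. L2_inner (edge_measure e) (snd v e) (\<lambda>x. q x \<bullet> outward_normal T e)))"
  proof (intro conjI ballI)
   show "zero_ext T (aff p) \<in> vec_polys 1 T" unfolding vec_polys_1 by blast
   fix q assume "q \<in> vec_polys 1 T"
   then obtain r where r: "q = zero_ext T (aff r)" unfolding vec_polys_1 by blast
   show "L2_inner (lebesgue_on T) (zero_ext T (aff p)) q = - L2_inner (lebesgue_on T) (fst v T) (divergence T q)
    + (\<Sum>e | e edge_of T. L2_inner (edge_measure e) (snd v e) (\<lambda>x. q x \<bullet> outward_normal T e))" unfolding r inner rhs p[rule_format] ..
  qed
 next
  fix g assume g: "g \<in> vec_polys 1 T \<and> (\<forall>q\<in>vec_polys 1 T. L2_inner (lebesgue_on T) g q =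
    - L2_inner (lebesgue_on T) (fst v T) (divergence T q) + (\<Sum>e | e edge_of T. L2_inner (edge_measure e) (snd v e) (\<lambda>x. q x \<bullet> outward_normal T e)))"
  then obtain p' where p': "g = zero_ext T (aff p')" unfolding vec_polys_1 by blast
  have "mass T p' q = ?l q" for q
  proof -
   have "zero_ext T (aff q) \<in> vec_polys 1 T" unfolding vec_polys_1 by blast
   from bspec[OF conjunct2[OF g] this] show ?thesis unfolding rhs unfolding p' inner .
  qed
  then have "p' = p" using p by (intro riesz_euclidean(2)[OF bilinear_mass[OF T] mpos linear_flux[OF T]]) auto
  then show "g = zero_ext T (aff p)" by (simp only: p')
 qed
 then show thesis using p by (intro that) blast+
qed

lemma L2_proj_const:
 assumes T: "is_tri T A B C" and U: "U \<in> borel_measurable borel" "set_integrable lborel T U"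
  and ae: "AE x in lborel. x \<in> T --> u x = U x"
 shows "L2_proj (lebesgue_on T) (polys 0 T) u = zero_ext T (\<lambda>_. (LBINT x:T. U x) / measure lborel T)"
proof -
 have hull: "T = convex hull {A, B, C}" by (rule is_tri_hull[OF T])
 then have Tb: "T \<in> sets borel" by simp
 have pos: "measure lborel T > 0" using is_tri_nz[OF T] measure_triangle[OF is_tri_nz[OF T]] by (simp add: hull)
 have inner: "L2_inner (lebesgue_on T) (\<lambda>x. u x - zero_ext T (\<lambda>_. k) x) (zero_ext T (\<lambda>_. k')) = ((LBINT x:T. U x) - k * measure lborel T) * k'" for k k'
 proof -
  have "L2_inner (lebesgue_on T) (\<lambda>x. u x - zero_ext T (\<lambda>_. k) x) (zero_ext T (\<lambda>_. k')) = (LBINT x:T. (U x - k) * k')"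
   unfolding L2_inner_def
  proof (rule integral_lebesgue_on_eq[OF Tb])
   show "(\<lambda>x. (U x - k) * k') \<in> borel_measurable borel" using U by measurable
   show "AE x in lborel. x \<in> T --> (u x - zero_ext T (\<lambda>_. k) x) \<bullet> zero_ext T (\<lambda>_. k') x = (U x - k) * k'"
    using ae by eventually_elim auto
  qed
  also have "\<dots> = (LBINT x:T. U x - k) * k'" by simp
  also have "(LBINT x:T. U x - k) = (LBINT x:T. U x) - k * measure lborel T"
   using set_integral_diff(2)[OF U(2) triangle_const(1)[of A B C k, folded hull]] triangle_const(2)[of A B C k, folded hull] by simp
  finally show ?thesis .
 qed
 show ?thesis unfolding L2_proj_def polys_0
 proof (rule the_equality)
  show "zero_ext T (\<lambda>_. (LBINT x:T. U x) / measure lborel T) \<in> {zero_ext T (\<lambda>_. k) |k. True} \<and>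
   (\<forall>q\<in>{zero_ext T (\<lambda>_. k) |k. True}. L2_inner (lebesgue_on T) (\<lambda>x. u x - zero_ext T (\<lambda>_. (LBINT x:T. U x) / measure lborel T) x) q = 0)"
   using inner[of "(LBINT x:T. U x) / measure lborel T"] pos by auto
  fix p assume p: "p \<in> {zero_ext T (\<lambda>_. k) |k. True} \<and> (\<forall>q\<in>{zero_ext T (\<lambda>_. k) |k. True}. L2_inner (lebesgue_on T) (\<lambda>x. u x - p x) q = 0)"
  then obtain k where k: "p = zero_ext T (\<lambda>_. k)" by blast
  have "((LBINT x:T. U x) - k * measure lborel T) * 1 = 0"
  proof -
   have "zero_ext T (\<lambda>_. 1 :: real) \<in> {zero_ext T (\<lambda>_. k) |k. True}" by blast
   from bspec[OF conjunct2[OF p] this] show ?thesis unfolding k inner .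
  qed
  then have "k = (LBINT x:T. U x) / measure lborel T" using pos by (simp add: field_simps)
  then show "p = zero_ext T (\<lambda>_. (LBINT x:T. U x) / measure lborel T)" by (simp add: k cong: if_cong)
 qed
qed

text \<open>\<open>riesz_euclidean\<close> in the two endpoint values. The third claim serves
  boundary edges, where the trace is orthogonal to all polynomials but known to vanish only in
  norm.\<close>

lemma edge_projection:
 fixes A B C :: "real^2"
 defines "e \<equiv> closed_segment A B"
 defines "M \<equiv> edge_measure e"
 assumes nz: "dbl_area A B C \<noteq> 0" and g: "g \<in> L2 M"
 shows "L2_proj M (polys 1 e) g \<in> polys 1 e"
  and "q \<in> polys 1 e ==> L2_inner M (L2_proj M (polys 1 e) g) q = L2_inner M g q"
  and "(\<And>q. q \<in> polys 1 e ==> L2_inner M g q = 0) ==> L2_proj M (polys 1 e) g = (\<lambda>_. 0)"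
proof -
 have ne: "A \<noteq> B" using dbl_area_distinct[OF nz] by simp
 let ?E = "edge_poly A B C"
 let ?B = "\<lambda>\<alpha> \<beta>. L2_inner M (?E \<alpha>) (?E \<beta>)" and ?l = "\<lambda>\<beta>. L2_inner M g (?E \<beta>)"
 have EL: "?E \<alpha> \<in> L2 M" for \<alpha> unfolding M_def e_def by (rule continuous_edge_measurable(2)[OF ne continuous_on_edge_poly])
 have ext: "L2_inner M f (zero_ext e (?E \<beta>)) = L2_inner M f (?E \<beta>)" "L2_inner M (zero_ext e (?E \<beta>)) f = L2_inner M (?E \<beta>) f" for f \<beta>
  unfolding M_def e_def by (auto intro!: L2_inner_edge_cong[OF ne])
 have lin: "linear (\<lambda>\<beta>. L2_inner M f (?E \<beta>))" if f: "f \<in> L2 M" for f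
 proof (rule linearI)
  note i = L2_mult_integrable[OF f EL]
  fix \<beta> \<gamma> show "L2_inner M f (?E (\<beta> + \<gamma>)) = L2_inner M f (?E \<beta>) + L2_inner M f (?E \<gamma>)"
   using Bochner_Integration.integral_add[OF i[of \<beta>] i[of \<gamma>]] by (simp add: L2_inner_def edge_poly_def algebra_simps)
  fix k show "L2_inner M f (?E (k *\<^sub>R \<beta>)) = k *\<^sub>R L2_inner M f (?E \<beta>)"
  proof -
   have "f x * ?E (k *\<^sub>R \<beta>) x = k * (f x * ?E \<beta> x)" for x by (simp add: edge_poly_def algebra_simps)
   then have "L2_inner M f (?E (k *\<^sub>R \<beta>)) = (LINT x|M. k * (f x * ?E \<beta> x))" by (simp only: L2_inner_def inner_real_def)
   then show ?thesis by (simp add: L2_inner_def)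
  qed
 qed
 have comm: "?B \<alpha> \<beta> = ?B \<beta> \<alpha>" for \<alpha> \<beta> by (simp add: L2_inner_def mult.commute)
 have bil: "bilinear ?B" unfolding bilinear_def using lin[OF EL] comm by simp
 have pos: "\<forall>\<alpha>. ?B \<alpha> \<alpha> = 0 --> \<alpha> = 0"
 proof (intro allI impI)
  fix \<alpha> assume z: "?B \<alpha> \<alpha> = 0"
  let ?a = "fst \<alpha>" and ?b = "snd \<alpha>"
  have "?B \<alpha> \<alpha> = dist A B * (LINT s:{0..1}|lborel. ((1 - s) * ?a + s * ?b) * ((1 - s) * ?a + s * ?b))"
   unfolding M_def e_def L2_inner_edge[OF ne continuous_on_edge_poly continuous_on_edge_poly] edge_poly_segment[OF nz] ..
  also have "(LINT s:{0..1}|lborel. ((1 - s) * ?a + s * ?b) * ((1 - s) * ?a + s * ?b))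
    = (?a^2 * 1 + ?a * (?b - ?a) * 1^2 + (?b - ?a)^2 * 1^3 / 3) - (?a^2 * 0 + ?a * (?b - ?a) * 0^2 + (?b - ?a)^2 * 0^3 / 3)" unfolding set_lebesgue_integral_def
   by (rule integral_FTC_atLeastAtMost)
    (auto intro!: derivative_eq_intros continuous_intros simp: has_real_derivative_iff_has_vector_derivative[symmetric] power2_eq_square field_simps)
  finally have "?a^2 + ?a * (?b - ?a) + (?b - ?a)^2 / 3 = 0" using z ne by simp
  \<comment> \<open>The integral is a third of \<open>a^2 + a b + b^2\<close> in the endpoint
    values, and the square is completed.\<close>
  then have "(?a + ?b / 2)^2 + 3 / 4 * ?b^2 = 0" by (simp add: power2_eq_square field_simps)
  then have "?b = 0" "?a + ?b / 2 = 0" using sum_power2_eq_zero_iff[of "?a + ?b / 2" "sqrt (3/4) * ?b"] by (auto simp: power_mult_distrib)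
  then show "\<alpha> = 0" by (simp add: prod_eq_iff)
 qed
 obtain \<alpha> where \<alpha>: "\<forall>\<beta>. ?B \<alpha> \<beta> = ?l \<beta>" using riesz_euclidean(1)[OF bil pos lin[OF g]] ..
 have diff: "L2_inner M (\<lambda>x. g x - zero_ext e (?E \<gamma>) x) (zero_ext e (?E \<beta>)) = ?l \<beta> - ?B \<gamma> \<beta>" for \<gamma> \<beta>
 proof -
  have "L2_inner M (\<lambda>x. g x - zero_ext e (?E \<gamma>) x) (zero_ext e (?E \<beta>)) = L2_inner M (\<lambda>x. g x - ?E \<gamma> x) (?E \<beta>)"
   unfolding M_def e_def by (rule L2_inner_edge_cong[OF ne]) auto
  also have "\<dots> = ?l \<beta> - ?B \<gamma> \<beta>"
   using Bochner_Integration.integral_diff[OF L2_mult_integrable[OF g EL[of \<beta>]] L2_mult_integrable[OF EL[of \<gamma>] EL[of \<beta>]]]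
   by (simp add: L2_inner_def left_diff_distrib)
  finally show ?thesis .
 qed
 have P: "polys 1 e = {zero_ext e (?E \<alpha>) |\<alpha>. True}" unfolding e_def by (rule polys_1_edge[OF nz])
 have eq: "L2_proj M (polys 1 e) g = zero_ext e (?E \<alpha>)" unfolding L2_proj_def P
 proof (rule the_equality)
  show "zero_ext e (?E \<alpha>) \<in> {zero_ext e (?E \<alpha>) |\<alpha>. True} \<and> (\<forall>q\<in>{zero_ext e (?E \<alpha>) |\<alpha>. True}. L2_inner M (\<lambda>x. g x - zero_ext e (?E \<alpha>) x) q = 0)"
  proof (intro conjI ballI)
   fix q assume "q \<in> {zero_ext e (?E \<alpha>) |\<alpha>. True}"
   then obtain \<beta> where \<beta>: "q = zero_ext e (?E \<beta>)" by blast
   show "L2_inner M (\<lambda>x. g x - zero_ext e (?E \<alpha>) x) q = 0" unfolding \<beta> diff \<alpha>[rule_format, of \<beta>] by simp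
  qed blast
  fix p assume p: "p \<in> {zero_ext e (?E \<alpha>) |\<alpha>. True} \<and> (\<forall>q\<in>{zero_ext e (?E \<alpha>) |\<alpha>. True}. L2_inner M (\<lambda>x. g x - p x) q = 0)"
  then obtain \<gamma> where \<gamma>: "p = zero_ext e (?E \<gamma>)" by blast
  have "?B \<gamma> \<beta> = ?B \<alpha> \<beta>" for \<beta>
  proof -
   have "L2_inner M (\<lambda>x. g x - p x) (zero_ext e (?E \<beta>)) = 0" using p by blast
   then show ?thesis unfolding \<gamma> diff \<alpha>[rule_format, of \<beta>] by simp
  qed
  then have "\<gamma> = \<alpha>" by (intro riesz_euclidean(2)[OF bil pos lin[OF g]]) auto
  then show "p = zero_ext e (?E \<alpha>)" by (simp only: \<gamma>)
 qed
 show "L2_proj M (polys 1 e) g \<in> polys 1 e" unfolding eq unfolding P by blast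
 show "L2_inner M (L2_proj M (polys 1 e) g) q = L2_inner M g q" if "q \<in> polys 1 e" for q
 proof -
  from that obtain \<beta> where "q = zero_ext e (?E \<beta>)" unfolding P by blast
  then show ?thesis unfolding eq using \<alpha> by (simp only: ext)
 qed
 assume z: "\<And>q. q \<in> polys 1 e ==> L2_inner M g q = 0"
 have "zero_ext e (?E \<alpha>) \<in> polys 1 e" unfolding P by blast
 from z[OF this] have "?l \<alpha> = 0" unfolding ext .
 then have "\<alpha> = 0" using \<alpha>[rule_format, of \<alpha>] by (intro pos[rule_format]) simp
 then show "L2_proj M (polys 1 e) g = (\<lambda>_. 0)" unfolding eq by (simp add: edge_poly_def fun_eq_iff)
qed

section \<open>Green's formula and the projection of the exact solution\<close>

lemma C1_on_mult:
 assumes "C1_on T f F" "C1_on T g G"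
 shows "C1_on T (\<lambda>x. f x * g x) (\<lambda>x. f x *\<^sub>R G x + g x *\<^sub>R F x)"
 unfolding C1_on_def
proof (intro conjI ballI)
 show "continuous_on T (\<lambda>x. f x *\<^sub>R G x + g x *\<^sub>R F x)"
  using assms C1_on_continuous[OF assms(1)] C1_on_continuous[OF assms(2)] by (intro continuous_intros) (auto simp: C1_on_def)
 fix x assume "x \<in> T"
 then have "(f has_derivative (\<lambda>h. F x \<bullet> h)) (at x within T)" "(g has_derivative (\<lambda>h. G x \<bullet> h)) (at x within T)"
  using assms by (auto simp: C1_on_def)
 from has_derivative_mult[OF this] show "((\<lambda>x. f x * g x) has_derivative (\<lambda>h. (f x *\<^sub>R G x + g x *\<^sub>R F x) \<bullet> h)) (at x within T)"
  by (simp add: inner_add_left mult.commute)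
qed

lemma sq_inner_tendsto:
 assumes f: "\<And>n. sq_integrable S (f n)" "sq_integrable S g" "sq_integrable S h" and S: "S \<in> sets borel"
  and lim: "(\<lambda>n. sq_norm S (\<lambda>x. f n x - g x)) \<longlonglongrightarrow> 0"
 shows "(\<lambda>n. LBINT x:S. f n x \<bullet> h x) \<longlonglongrightarrow> (LBINT x:S. g x \<bullet> h x)"
proof (rule LIM_zero_cancel, rule Lim_null_comparison)
 show "(\<lambda>n. sq_norm S (\<lambda>x. f n x - g x) * sq_norm S h) \<longlonglongrightarrow> 0" using tendsto_mult_right[OF lim] by simp
 show "\<forall>\<^sub>F n in sequentially. norm ((LBINT x:S. f n x \<bullet> h x) - (LBINT x:S. g x \<bullet> h x)) \<le> sq_norm S (\<lambda>x. f n x - g x) * sq_norm S h"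
 proof (rule always_eventually, rule allI)
  fix n
  have "(LBINT x:S. f n x \<bullet> h x) - (LBINT x:S. g x \<bullet> h x) = (LBINT x:S. (f n x - g x) \<bullet> h x)" unfolding inner_diff_left
   by (rule set_integral_diff(2)[symmetric]) (intro sq_integrable_inner f S)+
  then show "norm ((LBINT x:S. f n x \<bullet> h x) - (LBINT x:S. g x \<bullet> h x)) \<le> sq_norm S (\<lambda>x. f n x - g x) * sq_norm S h"
   using sq_integrable_Cauchy_Schwarz[OF sq_integrable_diff[OF f(1,2) S] f(3) S] by simp
 qed
qed

lemma L2_inner_tendsto:
 assumes f: "\<And>n. f n \<in> L2 M" "g \<in> L2 M" "h \<in> L2 M" and lim: "(\<lambda>n. L2_norm M (\<lambda>x. f n x - g x)) \<longlonglongrightarrow> 0"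
 shows "(\<lambda>n. L2_inner M (f n) h) \<longlonglongrightarrow> L2_inner M g h"
proof (rule LIM_zero_cancel, rule Lim_null_comparison)
 show "(\<lambda>n. L2_norm M (\<lambda>x. f n x - g x) * L2_norm M h) \<longlonglongrightarrow> 0" using tendsto_mult_right[OF lim] by simp
 show "\<forall>\<^sub>F n in sequentially. norm (L2_inner M (f n) h - L2_inner M g h) \<le> L2_norm M (\<lambda>x. f n x - g x) * L2_norm M h"
 proof (rule always_eventually, rule allI)
  fix n
  have "L2_inner M (f n) h - L2_inner M g h = L2_inner M (\<lambda>x. f n x - g x) h"
   using Bochner_Integration.integral_diff[OF L2_mult_integrable[OF f(1,3), of n] L2_mult_integrable[OF f(2,3)]] by (simp add: L2_inner_def left_diff_distrib)
  then show "norm (L2_inner M (f n) h - L2_inner M g h) \<le> L2_norm M (\<lambda>x. f n x - g x) * L2_norm M h"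
   using L2_Cauchy_Schwarz[OF L2_diff[OF f(1,2)] f(3)] by simp
 qed
qed

lemma sq_integrable_H1_fun:
 assumes "H1_fun U w g" "S \<in> sets borel"
 shows "sq_integrable S w" "sq_integrable S g"
 using H1_funD[OF assms(1)] assms(2) by (auto intro!: sq_integrable_of_integrable)

lemma sq_norm_le_Hk_norm:
 assumes \<Omega>: "open \<Omega>" "bounded \<Omega>" and T: "is_tri T A B C" "interior T \<subseteq> \<Omega>" and u: "u \<in> Hk 1 \<Omega>" and \<eta>: "\<eta> \<in> C_inf"
 shows "sq_norm T (\<lambda>x. \<eta> x - wderiv \<Omega> (0, 0) u x) \<le> Hk_norm 1 \<Omega> (\<lambda>x. \<eta> x - u x)"
  and "sq_norm T (\<lambda>x. grad \<eta> x - wgrad \<Omega> (0, 0) u x) \<le> Hk_norm 1 \<Omega> (\<lambda>x. \<eta> x - u x)"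
proof -
 let ?a = "\<lambda>x. (\<eta> x - wderiv \<Omega> (0, 0) u x)^2" and ?b = "\<lambda>x. (norm (grad \<eta> x - wgrad \<Omega> (0, 0) u x))^2"
 have hull: "T = convex hull {A, B, C}" by (rule is_tri_hull[OF T(1)])
 note H = H1_fun_wderiv[OF \<Omega> u, of "(0, 0)", simplified]
 note [measurable] = H1_funD(5,6)[OF H] C_inf_measurable[OF \<eta>] C_inf_grad_measurable[OF \<eta>]
 have bm: "?a \<in> borel_measurable borel" "?b \<in> borel_measurable borel" by measurable
 have "(sq_norm T (\<lambda>x. \<eta> x - wderiv \<Omega> (0, 0) u x))^2 + (sq_norm T (\<lambda>x. grad \<eta> x - wgrad \<Omega> (0, 0) u x))^2
   = (LBINT x:interior T. ?a x) + (LBINT x:interior T. ?b x)"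
  unfolding sq_norm_sq hull set_integral_interior_triangle[OF bm(1)] set_integral_interior_triangle[OF bm(2)] by simp
 also have "\<dots> = (Hk_norm 1 (interior T) (\<lambda>x. \<eta> x - u x))^2" unfolding Hk_1_norm_diff[OF \<Omega> open_interior T(2) u \<eta>]
  by (rule set_integral_add(2)[symmetric]) (rule Hk_1_diff_integrable[OF \<Omega> open_interior T(2) u \<eta>])+
 also have "\<dots> \<le> (Hk_norm 1 \<Omega> (\<lambda>x. \<eta> x - u x))^2"
  by (intro power_mono Hk_1_norm_diff_mono[OF \<Omega> open_interior T(2) u \<eta>]) (simp add: Hk_norm_def sum_nonneg)
 finally have le: "(sq_norm T (\<lambda>x. \<eta> x - wderiv \<Omega> (0, 0) u x))^2 + (sq_norm T (\<lambda>x. grad \<eta> x - wgrad \<Omega> (0, 0) u x))^2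
   \<le> (Hk_norm 1 \<Omega> (\<lambda>x. \<eta> x - u x))^2" .
 have nn: "0 \<le> Hk_norm 1 \<Omega> (\<lambda>x. \<eta> x - u x)" by (simp add: Hk_norm_def sum_nonneg)
 show "sq_norm T (\<lambda>x. \<eta> x - wderiv \<Omega> (0, 0) u x) \<le> Hk_norm 1 \<Omega> (\<lambda>x. \<eta> x - u x)"
  by (rule power2_le_imp_le[OF order_trans[OF _ le] nn]) simp
 show "sq_norm T (\<lambda>x. grad \<eta> x - wgrad \<Omega> (0, 0) u x) \<le> Hk_norm 1 \<Omega> (\<lambda>x. \<eta> x - u x)"
  by (rule power2_le_imp_le[OF order_trans[OF _ le] nn]) simp
qed

text \<open>For each approximating test function this is \<open>flux_divergence\<close> of the
  product field. The volume terms converge by H1 convergence on the triangle, the edge terms by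
  \<open>mesh_trace_limit\<close>.\<close>

lemma trace_green:
 assumes \<Omega>: "polygonal_domain \<Omega>" and mesh: "conforming_mesh \<Omega> \<T>" and u: "u \<in> H1_0 \<Omega>"
  and T: "T \<in> \<T>" "is_tri T A B C"
 shows "(\<Sum>e | e edge_of T. L2_inner (edge_measure e) (mesh_trace \<T> e u) (\<lambda>x. (\<chi> j. aff q x $ j) \<bullet> outward_normal T e))
  = (LBINT x:T. wderiv \<Omega> (0, 0) u x) * (aff_grad q 1 $ 1 + aff_grad q 2 $ 2) + (LBINT x:T. wgrad \<Omega> (0, 0) u x \<bullet> aff q x)"
proof -
 have o: "open \<Omega>" "bounded \<Omega>" using \<Omega> by (auto simp: polygonal_domain_def)
 have u1: "u \<in> Hk 1 \<Omega>" using u by (simp add: H1_0_def)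
 have hull: "T = convex hull {A, B, C}" by (rule is_tri_hull[OF T(2)])
 have Tb: "T \<in> sets borel" and Tc: "compact T" unfolding hull by (simp_all add: compact_triangle)
 note sub = conforming_mesh_triangle(3)[OF \<Omega> mesh T(1)]
 let ?D = "aff_grad q 1 $ 1 + aff_grad q 2 $ 2"
 let ?U = "wderiv \<Omega> (0, 0) u" and ?V = "wgrad \<Omega> (0, 0) u"
 obtain \<phi> where \<phi>t: "\<And>n. \<phi> n \<in> test_functions \<Omega>" and lim: "(\<lambda>n. Hk_norm 1 \<Omega> (\<lambda>x. \<phi> n x - u x)) \<longlonglongrightarrow> 0"
  using H1_0_approximation[OF o u] by blast
 have \<phi>: "\<phi> n \<in> C_inf" for n by (rule test_functions_C_inf[OF \<phi>t])
 note UV = sq_integrable_H1_fun[OF H1_fun_wderiv[OF o u1, of "(0, 0)", simplified] Tb]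
 have s\<phi>: "sq_integrable T (\<phi> n)" "sq_integrable T (grad (\<phi> n))" for n
  using C_inf_continuous[OF \<phi>, of UNIV n] C_inf_continuous_grad[OF \<phi>, of UNIV n] by (auto intro: sq_integrable_continuous[OF Tc])
 have sq: "sq_integrable T (aff q)" "sq_integrable T (\<lambda>_. ?D)" by (intro sq_integrable_continuous[OF Tc] continuous_intros)+
 have green: "(\<Sum>e | e edge_of T. L2_inner (edge_measure e) (\<phi> n) (\<lambda>x. (\<chi> j. aff q x $ j) \<bullet> outward_normal T e))
   = (LBINT x:T. \<phi> n x \<bullet> ?D) + (LBINT x:T. grad (\<phi> n) x \<bullet> aff q x)" for n
 proof -
  let ?w = "\<lambda>j x. \<phi> n x * aff q x $ j" and ?G = "\<lambda>j x. \<phi> n x *\<^sub>R aff_grad q j + aff q x $ j *\<^sub>R grad (\<phi> n) x"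
  have C1: "C1_on S (?w j) (?G j)" for j S by (rule C1_on_mult[OF C_inf_C1_on[OF \<phi>] C1_on_aff])
  have iw: "set_integrable lborel T (?w j)" for j by (intro set_integrable_continuous_compact[OF Tc] C1_on_continuous[OF C1])
  have iG: "set_integrable lborel T (?G j)" for j
   by (rule sq_integrable_set_integrable[OF sq_integrable_continuous[OF Tc] Tc]) (use C1[of UNIV j] in \<open>simp add: C1_on_def\<close>)
  have edge: "L2_inner (edge_measure e) (\<phi> n) (\<lambda>x. (\<chi> j. aff q x $ j) \<bullet> outward_normal T e) = flux T e (\<lambda>_. 1) ?w ?G"
   if e: "e edge_of T" for e
  proof -
   obtain P Q R where P: "is_tri T P Q R" "e = closed_segment P Q" using is_tri_edgeE[OF T(2) e] .
   have "L2_inner (edge_measure e) (\<phi> n) (\<lambda>x. (\<chi> j. aff q x $ j) \<bullet> outward_normal T e)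
     = L2_inner (edge_measure e) (\<lambda>_. 1) (\<lambda>x. (\<chi> j. ?w j x) \<bullet> outward_normal T e)"
    unfolding L2_inner_def by (simp add: inner_vec2 distrib_left mult.assoc)
   also have "\<dots> = flux T e (\<lambda>_. 1) ?w ?G" unfolding P(2) by (rule L2_inner_edge_flux[OF P(1) C1]) (auto simp: edge_affine_def)
   finally show ?thesis .
  qed
  have comp: "set_integrable lborel T (\<lambda>x. ?G j x $ j)" for j using set_integrable_inner[OF iG[of j], of "axis j 1"] by (simp add: inner_axis)
  have "(\<Sum>e | e edge_of T. L2_inner (edge_measure e) (\<phi> n) (\<lambda>x. (\<chi> j. aff q x $ j) \<bullet> outward_normal T e))
    = (\<Sum>e | e edge_of T. flux T e (\<lambda>_. 1) ?w ?G)" by (rule sum.cong[OF refl], rule edge) simp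
  also have "\<dots> = (LBINT x:T. ?G 1 x $ 1) + (LBINT x:T. ?G 2 x $ 2)" by (rule flux_divergence[OF T(2) iw iG])
  also have "\<dots> = (LBINT x:T. ?G 1 x $ 1 + ?G 2 x $ 2)" by (rule set_integral_add(2)[symmetric, OF comp comp])
  also have "\<dots> = (LBINT x:T. \<phi> n x \<bullet> ?D + grad (\<phi> n) x \<bullet> aff q x)"
   by (rule arg_cong[of _ _ "set_lebesgue_integral lborel T"]) (simp add: fun_eq_iff inner_vec2 algebra_simps)
  also have "\<dots> = (LBINT x:T. \<phi> n x \<bullet> ?D) + (LBINT x:T. grad (\<phi> n) x \<bullet> aff q x)"
   by (rule set_integral_add(2)) (intro sq_integrable_inner s\<phi> sq Tb)+
  finally show ?thesis .
 qed
 have l1: "(\<lambda>n. sq_norm T (\<lambda>x. \<phi> n x - ?U x)) \<longlonglongrightarrow> 0" "(\<lambda>n. sq_norm T (\<lambda>x. grad (\<phi> n) x - ?V x)) \<longlonglongrightarrow> 0"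
  by (rule tendsto_sandwich[OF _ _ tendsto_const lim];
    intro always_eventually allI sq_norm_nonneg sq_norm_le_Hk_norm[OF o T(2) sub u1 \<phi>])+
 have rhs: "(\<lambda>n. (LBINT x:T. \<phi> n x \<bullet> ?D) + (LBINT x:T. grad (\<phi> n) x \<bullet> aff q x))
   \<longlonglongrightarrow> (LBINT x:T. ?U x \<bullet> ?D) + (LBINT x:T. ?V x \<bullet> aff q x)" by (intro tendsto_add sq_inner_tendsto s\<phi> UV sq Tb l1)
 have lhs: "(\<lambda>n. \<Sum>e | e edge_of T. L2_inner (edge_measure e) (\<phi> n) (\<lambda>x. (\<chi> j. aff q x $ j) \<bullet> outward_normal T e))
   \<longlonglongrightarrow> (\<Sum>e | e edge_of T. L2_inner (edge_measure e) (mesh_trace \<T> e u) (\<lambda>x. (\<chi> j. aff q x $ j) \<bullet> outward_normal T e))"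
 proof (rule tendsto_sum)
  fix e assume "e \<in> {e. e edge_of T}"
  then have e: "e edge_of T" by simp
  then have eE: "e \<in> edges \<T>" using T(1) by (auto simp: edges_def)
  obtain P Q R where P: "is_tri T P Q R" "e = closed_segment P Q" using is_tri_edgeE[OF T(2) e] .
  have ne: "P \<noteq> Q" using dbl_area_distinct[OF is_tri_nz[OF P(1)]] by simp
  show "(\<lambda>n. L2_inner (edge_measure e) (\<phi> n) (\<lambda>x. (\<chi> j. aff q x $ j) \<bullet> outward_normal T e))
   \<longlonglongrightarrow> L2_inner (edge_measure e) (mesh_trace \<T> e u) (\<lambda>x. (\<chi> j. aff q x $ j) \<bullet> outward_normal T e)"
  proof (rule L2_inner_tendsto[OF _ mesh_trace_limit(1)[OF \<Omega> mesh u1 \<phi> lim eE] _ mesh_trace_limit(2)[OF \<Omega> mesh u1 \<phi> lim eE]])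
   show "\<phi> n \<in> L2 (edge_measure e)" for n unfolding P(2) by (rule continuous_edge_measurable(2)[OF ne C_inf_continuous[OF \<phi>]])
   show "(\<lambda>x. (\<chi> j. aff q x $ j) \<bullet> outward_normal T e) \<in> L2 (edge_measure e)"
    unfolding P(2) by (rule continuous_edge_measurable(2)[OF ne]) (intro continuous_intros)
  qed
 qed
 from LIMSEQ_unique[OF lhs[unfolded green] rhs] show ?thesis by simp
qed

text \<open>The normal component of an affine field is an admissible test polynomial on an edge, so
  an edge projection disappears when tested with it.\<close>

lemma affine_polys_1: "zero_ext e (\<lambda>x. (\<chi> j. aff q x $ j) \<bullet> n) \<in> polys 1 e"
 unfolding polys_def mem_Collect_eq multi_indices_1
 by (rule exI[of _ "\<lambda>\<beta>. if \<beta> = (0, 0) then fst q \<bullet> n else if \<beta> = (1, 0) then fst (snd q) \<bullet> n else snd (snd q) \<bullet> n"])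
  (auto simp: fun_eq_iff aff_def inner_vec2 algebra_simps)

lemma Qh_triangle:
 assumes \<Omega>: "polygonal_domain \<Omega>" and mesh: "conforming_mesh \<Omega> \<T>" and u: "u \<in> Hk 1 \<Omega>" and T: "T \<in> \<T>" "is_tri T A B C"
 shows "fst (Qh \<T> u) T = zero_ext T (\<lambda>_. (LBINT x:T. wderiv \<Omega> (0, 0) u x) / measure lborel T)"
proof -
 have o: "open \<Omega>" "bounded \<Omega>" using \<Omega> by (auto simp: polygonal_domain_def)
 have hull: "T = convex hull {A, B, C}" by (rule is_tri_hull[OF T(2)])
 have Tb: "T \<in> sets borel" unfolding hull by simp
 have "AE x in lborel. x \<in> T --> u x = wderiv \<Omega> (0, 0) u x" using AE_triangle_interior[OF T(2)] Hk_wderiv_zero[OF o u]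
  by eventually_elim (use conforming_mesh_triangle(3)[OF \<Omega> mesh T(1)] in blast)
 moreover have "set_integrable lborel T (wderiv \<Omega> (0, 0) u)" by (intro integrable_imp_set_integrable[OF _ Tb] wderiv_props(3)[OF o u]) simp
 ultimately show ?thesis using L2_proj_const[OF T(2) wderiv_props(1)[OF o u]] T(1) by (simp add: Qh_def)
qed

lemma Qh_edge:
 assumes \<Omega>: "polygonal_domain \<Omega>" and mesh: "conforming_mesh \<Omega> \<T>" and u: "u \<in> H1_0 \<Omega>" and e: "e \<in> edges \<T>"
 shows "snd (Qh \<T> u) e \<in> polys 1 e"
  and "q \<in> polys 1 e ==> L2_inner (edge_measure e) (snd (Qh \<T> u) e) q = L2_inner (edge_measure e) (mesh_trace \<T> e u) q"
  and "e \<subseteq> frontier \<Omega> ==> snd (Qh \<T> u) e = (\<lambda>_. 0)"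
proof -
 have o: "open \<Omega>" "bounded \<Omega>" using \<Omega> by (auto simp: polygonal_domain_def)
 have u1: "u \<in> Hk 1 \<Omega>" using u by (simp add: H1_0_def)
 obtain \<phi> where \<phi>t: "\<And>n. \<phi> n \<in> test_functions \<Omega>" and lim: "(\<lambda>n. Hk_norm 1 \<Omega> (\<lambda>x. \<phi> n x - u x)) \<longlonglongrightarrow> 0"
  using H1_0_approximation[OF o u] by blast
 note tr = mesh_trace_limit(1)[OF \<Omega> mesh u1 test_functions_C_inf[OF \<phi>t] lim e]
 obtain T where T: "T \<in> \<T>" "e edge_of T" using e by (auto simp: edges_def)
 obtain A B C where P: "is_tri T A B C" "e = closed_segment A B" using edge_is_tri[OF conforming_mesh_triangle(1)[OF \<Omega> mesh T(1)] T(2)] .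
 have ne: "A \<noteq> B" using dbl_area_distinct[OF is_tri_nz[OF P(1)]] by simp
 have eq: "snd (Qh \<T> u) e = L2_proj (edge_measure e) (polys 1 e) (mesh_trace \<T> e u)" using e by (simp add: Qh_def)
 note proj = edge_projection[OF is_tri_nz[OF P(1)] tr[unfolded P(2)], folded P(2)]
 show "snd (Qh \<T> u) e \<in> polys 1 e" unfolding eq by (rule proj(1))
 show "L2_inner (edge_measure e) (snd (Qh \<T> u) e) q = L2_inner (edge_measure e) (mesh_trace \<T> e u) q" if "q \<in> polys 1 e"
  unfolding eq by (rule proj(2)[OF that])
 assume fr: "e \<subseteq> frontier \<Omega>"
 have "L2_inner (edge_measure e) (mesh_trace \<T> e u) q = 0" if q: "q \<in> polys 1 e" for q
 proof -
  have "q \<in> L2 (edge_measure e)" unfolding P(2) by (rule continuous_edge_measurable(2)[OF ne polys_1_edge_affine(2)[OF q[unfolded P(2)]]])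
  from L2_Cauchy_Schwarz[OF tr this] show ?thesis by (simp add: mesh_trace_boundary[OF \<Omega> mesh u e fr])
 qed
 then show "snd (Qh \<T> u) e = (\<lambda>_. 0)" unfolding eq by (rule proj(3))
qed

lemma Qh_Vh0:
 assumes \<Omega>: "polygonal_domain \<Omega>" and mesh: "conforming_mesh \<Omega> \<T>" and u: "u \<in> H1_0 \<Omega>"
 shows "Qh \<T> u \<in> Vh0 \<Omega> \<T>"
proof -
 have u1: "u \<in> Hk 1 \<Omega>" using u by (simp add: H1_0_def)
 have 1: "fst (Qh \<T> u) T \<in> polys 0 T" if T: "T \<in> \<T>" for T
 proof -
  obtain A B C where P: "is_tri T A B C" using simplex_is_tri[OF conforming_mesh_triangle(1)[OF \<Omega> mesh T]] .
  show ?thesis unfolding Qh_triangle[OF \<Omega> mesh u1 T P] polys_0 by blast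
 qed
 have 2: "fst (Qh \<T> u) T = (\<lambda>_. 0)" if "T \<notin> \<T>" for T using that by (simp add: Qh_def)
 have 3: "snd (Qh \<T> u) e = (\<lambda>_. 0)" if "e \<notin> edges \<T>" for e using that by (simp add: Qh_def)
 have "Qh \<T> u \<in> Vh \<T>" unfolding Vh_def using 1 2 3 Qh_edge(1)[OF \<Omega> mesh u] by (simp add: mem_Times_iff)
 then show ?thesis unfolding Vh0_def using Qh_edge(3)[OF \<Omega> mesh u] by simp
qed

text \<open>With \<open>weak_grad_triangle\<close> this is the commuting property: the weak gradient
  of the projection is the L2 projection of grad u onto affine fields. The edge projection drops out
  by \<open>affine_polys_1\<close>; replacing \<open>u\<close> by its mean is harmless because the
  divergence of an affine field is constant; \<open>trace_green\<close> gives the rest.\<close>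

lemma Qh_flux:
 assumes \<Omega>: "polygonal_domain \<Omega>" and mesh: "conforming_mesh \<Omega> \<T>" and u: "u \<in> H1_0 \<Omega>"
  and T: "T \<in> \<T>" "is_tri T A B C" and c: "fst (Qh \<T> u) T = zero_ext T (\<lambda>_. c)"
 shows "(\<Sum>e | e edge_of T. flux T e (\<lambda>x. snd (Qh \<T> u) e x - c) (aff_comp q) (aff_const_grad q)) = (LBINT x:T. wgrad \<Omega> (0, 0) u x \<bullet> aff q x)"
proof -
 have u1: "u \<in> Hk 1 \<Omega>" using u by (simp add: H1_0_def)
 have hull: "T = convex hull {A, B, C}" by (rule is_tri_hull[OF T(2)])
 have AT: "A \<in> T" unfolding hull by (rule hull_inc) simp
 have pos: "measure lborel T > 0" using is_tri_nz[OF T(2)] measure_triangle[OF is_tri_nz[OF T(2)]] by (simp add: hull)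
 have "c = (LBINT x:T. wderiv \<Omega> (0, 0) u x) / measure lborel T" using fun_cong[OF c, of A] AT unfolding Qh_triangle[OF \<Omega> mesh u1 T] by simp
 then have c': "c * measure lborel T = (LBINT x:T. wderiv \<Omega> (0, 0) u x)" using pos by simp
 have edge: "flux T e (snd (Qh \<T> u) e) (aff_comp q) (aff_const_grad q)
   = L2_inner (edge_measure e) (mesh_trace \<T> e u) (\<lambda>x. (\<chi> j. aff q x $ j) \<bullet> outward_normal T e)" if e: "e edge_of T" for e
 proof -
  have eE: "e \<in> edges \<T>" using T(1) e by (auto simp: edges_def)
  obtain P Q R where P: "is_tri T P Q R" "e = closed_segment P Q" using is_tri_edgeE[OF T(2) e] .
  have ne: "P \<noteq> Q" using dbl_area_distinct[OF is_tri_nz[OF P(1)]] by simp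
  note aff1 = polys_1_edge_affine[of _ P Q, folded P(2), OF Qh_edge(1)[OF \<Omega> mesh u eE]]
  have ext: "L2_inner (edge_measure e) f (\<lambda>x. (\<chi> j. aff q x $ j) \<bullet> outward_normal T e)
    = L2_inner (edge_measure e) f (zero_ext e (\<lambda>x. (\<chi> j. aff q x $ j) \<bullet> outward_normal T e))" for f
   unfolding P(2) by (rule L2_inner_edge_cong[OF ne]) auto
  have "flux T e (snd (Qh \<T> u) e) (aff_comp q) (aff_const_grad q)
    = L2_inner (edge_measure e) (snd (Qh \<T> u) e) (\<lambda>x. (\<chi> j. aff q x $ j) \<bullet> outward_normal T e)"
   by (rule L2_inner_edge_flux[OF P(1), folded P(2), symmetric]) (rule C1_on_aff aff1)+
  also have "\<dots> = L2_inner (edge_measure e) (mesh_trace \<T> e u) (\<lambda>x. (\<chi> j. aff q x $ j) \<bullet> outward_normal T e)"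
   unfolding ext by (rule Qh_edge(2)[OF \<Omega> mesh u eE affine_polys_1])
  finally show ?thesis .
 qed
 have "(\<Sum>e | e edge_of T. flux T e (snd (Qh \<T> u) e) (aff_comp q) (aff_const_grad q))
   = (\<Sum>e | e edge_of T. L2_inner (edge_measure e) (mesh_trace \<T> e u) (\<lambda>x. (\<chi> j. aff q x $ j) \<bullet> outward_normal T e))"
  by (rule sum.cong[OF refl]) (simp only: edge mem_Collect_eq)
 then show ?thesis unfolding flux_diff_const[OF T(2)] flux_one_affine[OF T(2)] trace_green[OF \<Omega> mesh u T] c'[symmetric] by (simp add: algebra_simps)
qed

section \<open>Jumps controlled by the weak gradient\<close>

lemma aff_bary: "\<exists>q. \<forall>x. aff q x = bary P Q R x *\<^sub>R v"
proof -
 define g where "g = (1 / dbl_area P Q R) *\<^sub>R (vector [Q$2 - R$2, R$1 - Q$1] :: real^2)"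
 have b: "bary P Q R x = bary P Q R 0 + g \<bullet> x" for x by (rule trans[OF bary_affine[of P Q R x 0]]) (simp add: g_def)
 have "aff (bary P Q R 0 *\<^sub>R v, g$1 *\<^sub>R v, g$2 *\<^sub>R v) x = bary P Q R x *\<^sub>R v" for x
  unfolding b[of x] by (simp add: aff_def inner_vec2 scaleR_add_left mult.commute)
 then show ?thesis by blast
qed

lemma integral_unit_polynomials:
 fixes k :: real
 shows "(LINT s:{0..1}|lborel. (1 - s) * ((1 - s) * k)) = k / 3" "(LINT s:{0..1}|lborel. s * ((1 - s) * k)) = k / 6"
proof -
 have "(LINT s:{0..1}|lborel. (1 - s) * ((1 - s) * k)) = (- ((1 - 1)^3) * k / 3) - (- ((1 - 0)^3) * k / 3)" unfolding set_lebesgue_integral_def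
  by (rule integral_FTC_atLeastAtMost) (auto intro!: derivative_eq_intros continuous_intros simp: has_real_derivative_iff_has_vector_derivative[symmetric] power2_eq_square)
 then show "(LINT s:{0..1}|lborel. (1 - s) * ((1 - s) * k)) = k / 3" by simp
 have "(LINT s:{0..1}|lborel. s * ((1 - s) * k)) = (1^2/2 - 1^3/3) * k - (0^2/2 - 0^3/3) * k" unfolding set_lebesgue_integral_def
  by (rule integral_FTC_atLeastAtMost) (auto intro!: derivative_eq_intros continuous_intros simp: has_real_derivative_iff_has_vector_derivative[symmetric] power2_eq_square algebra_simps)
 then show "(LINT s:{0..1}|lborel. s * ((1 - s) * k)) = k / 6" by simp
qed

text \<open>On \<open>BC\<close> the hat function of \<open>A\<close> is zero and on
  \<open>CA\<close> the field is tangential. On \<open>AB\<close> its scaled normal component is the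
  doubled area times the hat function, and 1/3 and 1/6 are the integrals of the squared hat function
  of \<open>A\<close> and of its product with that of \<open>B\<close>.\<close>

lemma nodal_flux:
 assumes T: "is_tri T A B C" and q: "\<forall>x. aff q x = bary A B C x *\<^sub>R (A - C)"
 shows "(\<Sum>e | e edge_of T. flux T e (p e) (aff_comp q) (aff_const_grad q))
  = \<bar>dbl_area A B C\<bar> * (p (closed_segment A B) A / 3 + p (closed_segment A B) B / 6)"
proof -
 note T2 = is_tri_rotate[OF T] and T3 = is_tri_rotate[OF is_tri_rotate[OF T]]
 note nz = is_tri_nz[OF T] is_tri_nz[OF T2] is_tri_nz[OF T3]
 note em = edge_mom_C1[OF _ C1_on_aff[of _ q]] edge_mom_C1_swap[OF _ C1_on_aff[of _ q]]
 have v1: "aff q (A + s *\<^sub>R (B - A)) $ j = (1 - s) * (A - C) $ j" for s j using bary_param(1)[OF nz(1), of s 0] by (simp add: q)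
 have v2: "aff q (B + s *\<^sub>R (C - B)) $ j = 0" for s j using bary_param(3)[OF nz(2), of s 0] by (simp add: q)
 have v3: "aff q (C + s *\<^sub>R (A - C)) $ j = s * (A - C) $ j" for s j using bary_param(2)[OF nz(3), of s 0] by (simp add: q)
 have n1: "edge_normal A B C \<bullet> (A - C) = \<bar>dbl_area A B C\<bar>" using edge_normal_apex[of A B C] by (simp add: inner_diff_right)
 have n3: "edge_normal C A B \<bullet> (A - C) = 0" by (rule edge_normal_orth)
 have f1: "flux T (closed_segment A B) r (aff_comp q) (aff_const_grad q) = \<bar>dbl_area A B C\<bar> * (r A / 3 + r B / 6)" for r
  unfolding flux_eq[OF T] tri_flux_def em(1)[OF nz(1)] em(2)[OF nz(1)] v1 integral_unit_polynomials n1[symmetric] by (simp add: sum_2 inner_vec2 field_simps)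
 have f2: "flux T (closed_segment B C) r (aff_comp q) (aff_const_grad q) = 0" for r
  unfolding flux_eq[OF T2] tri_flux_def em(1)[OF nz(2)] em(2)[OF nz(2)] v2 by (simp add: set_lebesgue_integral_def)
 have f3: "flux T (closed_segment C A) r (aff_comp q) (aff_const_grad q) = 0" for r
 proof -
  define k1 k2 :: real where "k1 = (LINT s:{0..1}|lborel. (1 - s) * s)" and "k2 = (LINT s:{0..1}|lborel. s * s)"
  have "(LINT s:{0..1}|lborel. (1 - s) * (s * (A - C) $ j)) = k1 * (A - C) $ j" "(LINT s:{0..1}|lborel. s * (s * (A - C) $ j)) = k2 * (A - C) $ j" for j
   unfolding k1_def k2_def set_integral_mult_left[symmetric] by (simp_all only: mult.assoc)
  note I = this
  have "flux T (closed_segment C A) r (aff_comp q) (aff_const_grad q) = (r C * k1 + r A * k2) * (edge_normal C A B \<bullet> (A - C))"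
   unfolding flux_eq[OF T3] tri_flux_def em(1)[OF nz(3)] em(2)[OF nz(3)] v3 I by (simp add: sum_2 inner_vec2 algebra_simps)
  then show ?thesis unfolding n3 by simp
 qed
 show ?thesis unfolding is_tri_sum_edges(1)[OF T] f1 f2 f3 by simp
qed

lemma is_tri_dist_le_diameter:
 assumes T: "is_tri T A B C"
 shows "dist A B \<le> diameter T" "norm (A - C) \<le> diameter T" "0 \<le> diameter T"
proof -
 have hull: "T = convex hull {A, B, C}" by (rule is_tri_hull[OF T])
 have b: "bounded T" unfolding hull by (rule compact_imp_bounded[OF compact_triangle])
 have "A \<in> T" "B \<in> T" "C \<in> T" unfolding hull by (auto intro: hull_inc)
 then show "dist A B \<le> diameter T" "norm (A - C) \<le> diameter T"
  using diameter_bounded_bound[OF b, of A B] diameter_bounded_bound[OF b, of A C] by (auto simp: dist_norm)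
 then show "0 \<le> diameter T" using norm_ge_zero order_trans by blast
qed

lemma sq_norm_bary:
 assumes T: "is_tri T A B C"
 shows "sq_norm T (\<lambda>x. bary A B C x *\<^sub>R (A - C)) \<le> diameter T * sqrt (measure lborel T)"
  and "sq_integrable T (\<lambda>x. bary A B C x *\<^sub>R (A - C))"
proof -
 have hull: "T = convex hull {A, B, C}" by (rule is_tri_hull[OF T])
 show sq: "sq_integrable T (\<lambda>x. bary A B C x *\<^sub>R (A - C))" unfolding hull by (intro sq_integrable_continuous compact_triangle continuous_intros)
 have "(LBINT x:T. (norm (bary A B C x *\<^sub>R (A - C)))^2) \<le> (LBINT x:T. (diameter T)^2)" unfolding hull
 proof (rule set_integral_mono)
  show "set_integrable lborel (convex hull {A, B, C}) (\<lambda>x. (norm (bary A B C x *\<^sub>R (A - C)))^2)" using sq by (simp add: sq_integrable_def hull)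
  show "set_integrable lborel (convex hull {A, B, C}) (\<lambda>x. (diameter (convex hull {A, B, C}))^2)" by (rule triangle_const(1))
  fix x assume x: "x \<in> convex hull {A, B, C}"
  have "\<bar>bary A B C x\<bar> * norm (A - C) \<le> 1 * diameter T"
   using bary_bounds[OF is_tri_nz[OF T] x] is_tri_dist_le_diameter[OF T] by (intro mult_mono) auto
  then show "(norm (bary A B C x *\<^sub>R (A - C)))^2 \<le> (diameter (convex hull {A, B, C}))^2" unfolding norm_scaleR hull by (intro power_mono) auto
 qed
 also have "\<dots> = (diameter T * sqrt (measure lborel T))^2" unfolding hull triangle_const(2) by (simp add: power_mult_distrib)
 finally show "sq_norm T (\<lambda>x. bary A B C x *\<^sub>R (A - C)) \<le> diameter T * sqrt (measure lborel T)"
  unfolding sq_norm_def using is_tri_dist_le_diameter(3)[OF T] by (intro real_le_lsqrt) auto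
qed

text \<open>\<open>nodal_flux\<close> for both orders of the endpoints gives a linear system for the
  two nodal values of the jump, with right-hand sides bounded by Cauchy-Schwarz.\<close>

lemma nodal_bound:
 assumes T: "is_tri T A B C" and m: "\<And>q. mass T w q = (\<Sum>e | e edge_of T. flux T e (p e) (aff_comp q) (aff_const_grad q))"
 shows "\<bar>p (closed_segment A B) A\<bar> \<le> 6 * (diameter T * sqrt (measure lborel T) / \<bar>dbl_area A B C\<bar> * sq_norm T (aff w))"
  "\<bar>p (closed_segment A B) B\<bar> \<le> 6 * (diameter T * sqrt (measure lborel T) / \<bar>dbl_area A B C\<bar> * sq_norm T (aff w))"
proof -
 let ?K = "diameter T * sqrt (measure lborel T)" and ?p = "p (closed_segment A B)" and ?J = "\<bar>dbl_area A B C\<bar>"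
 have J: "?J > 0" using is_tri_nz[OF T] by simp
 have *: "\<bar>p (closed_segment P Q) P / 3 + p (closed_segment P Q) Q / 6\<bar> \<le> ?K / \<bar>dbl_area P Q R\<bar> * sq_norm T (aff w)" if P: "is_tri T P Q R" for P Q R
 proof -
  obtain q where q: "\<forall>x. aff q x = bary P Q R x *\<^sub>R (P - R)" using aff_bary by blast
  have hull: "T = convex hull {P, Q, R}" by (rule is_tri_hull[OF P])
  have "\<bar>dbl_area P Q R\<bar> * \<bar>p (closed_segment P Q) P / 3 + p (closed_segment P Q) Q / 6\<bar> = \<bar>mass T w q\<bar>"
   unfolding m nodal_flux[OF P q] by (simp add: abs_mult)
  also have "\<dots> \<le> sq_norm T (aff w) * sq_norm T (\<lambda>x. bary P Q R x *\<^sub>R (P - R))" unfolding mass_def q[rule_format]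
   by (rule sq_integrable_Cauchy_Schwarz[OF _ sq_norm_bary(2)[OF P]])
    (simp_all add: hull sq_integrable_continuous[OF compact_triangle continuous_on_aff])
  also have "\<dots> \<le> sq_norm T (aff w) * ?K" by (intro mult_left_mono sq_norm_bary(1)[OF P] sq_norm_nonneg)
  finally show ?thesis using is_tri_nz[OF P] by (simp add: field_simps)
 qed
 have a: "\<bar>?p A / 3 + ?p B / 6\<bar> \<le> ?K / ?J * sq_norm T (aff w)" by (rule *[OF T])
 have b: "\<bar>?p B / 3 + ?p A / 6\<bar> \<le> ?K / ?J * sq_norm T (aff w)"
  using *[OF is_tri_swap[OF T]] by (simp add: closed_segment_commute[of B A] dbl_area_swap[where A = A and B = B and C = C])
 \<comment> \<open>The matrix with entries 1/3 and 1/6 has the inverse with entries 4 and -2; the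
   row sum \<open>4 + 2\<close> is the constant 6.\<close>
 have pA: "?p A = 4 * (?p A / 3 + ?p B / 6) - 2 * (?p B / 3 + ?p A / 6)" and pB: "?p B = 4 * (?p B / 3 + ?p A / 6) - 2 * (?p A / 3 + ?p B / 6)"
  by (simp_all add: field_simps)
 show "\<bar>?p A\<bar> \<le> 6 * (?K / ?J * sq_norm T (aff w))" "\<bar>?p B\<bar> \<le> 6 * (?K / ?J * sq_norm T (aff w))" using a b pA pB by linarith+
qed

lemma edge_mom_bound:
 assumes T: "is_tri T A B C" and w: "sq_integrable T w" and G: "sq_integrable T G"
 shows "\<bar>edge_mom A B C w G\<bar> \<le> sqrt (measure lborel T) / \<bar>dbl_area A B C\<bar> * (diameter T * sq_norm T G + sq_norm T w)"
proof -
 have hull: "T = convex hull {A, B, C}" by (rule is_tri_hull[OF T])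
 then have Tb: "T \<in> sets borel" by simp
 let ?\<Phi> = "\<lambda>x. bary A B C x *\<^sub>R (A - C)"
 have one: "sq_integrable T (\<lambda>_. 1 :: real)" unfolding hull by (intro sq_integrable_continuous compact_triangle continuous_intros)
 have n1: "sq_norm T (\<lambda>_. 1 :: real) = sqrt (measure lborel T)" unfolding sq_norm_def hull by (simp add: triangle_const(2))
 have "(LBINT x:T. bary A B C x * (G x \<bullet> (A - C)) + w x) = (LBINT x:T. G x \<bullet> ?\<Phi> x + w x \<bullet> 1)" by simp
 also have "\<dots> = (LBINT x:T. G x \<bullet> ?\<Phi> x) + (LBINT x:T. w x \<bullet> 1)"
  by (rule set_integral_add(2)) (intro sq_integrable_inner G w one sq_norm_bary(2)[OF T] Tb)+
 finally have "\<bar>LBINT x:T. bary A B C x * (G x \<bullet> (A - C)) + w x\<bar> \<le> sq_norm T G * sq_norm T ?\<Phi> + sq_norm T w * sqrt (measure lborel T)"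
  using sq_integrable_Cauchy_Schwarz[OF G sq_norm_bary(2)[OF T] Tb] sq_integrable_Cauchy_Schwarz[OF w one Tb] unfolding n1 by linarith
 also have "\<dots> \<le> sq_norm T G * (diameter T * sqrt (measure lborel T)) + sq_norm T w * sqrt (measure lborel T)"
  by (intro add_right_mono mult_left_mono sq_norm_bary(1)[OF T] sq_norm_nonneg)
 finally have "\<bar>LBINT x:T. bary A B C x * (G x \<bullet> (A - C)) + w x\<bar> \<le> sqrt (measure lborel T) * (diameter T * sq_norm T G + sq_norm T w)"
  by (simp add: algebra_simps)
 then show ?thesis unfolding edge_mom_def hull[symmetric] abs_divide abs_abs using is_tri_nz[OF T] by (simp add: divide_right_mono)
qed

text \<open>Per edge: a normal of size at most the diameter, two endpoint terms, the factor 6 of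
  \<open>nodal_bound\<close>, and the measure \<open>J / 2\<close>, which appears as a product of
  two square roots. This gives 6 per edge and 18 for three edges. The remaining ratio of squared
  diameter to area is scale invariant.\<close>

lemma flux_bound:
 assumes T: "is_tri T A B C" and m: "\<And>q. mass T v q = (\<Sum>e | e edge_of T. flux T e (p e) (aff_comp q) (aff_const_grad q))"
  and w: "\<And>j. sq_integrable T (w j)" and G: "\<And>j. sq_integrable T (G j)"
 shows "\<bar>\<Sum>e | e edge_of T. flux T e (p e) w G\<bar>
  \<le> 18 * ((diameter T)^2 / \<bar>dbl_area A B C\<bar>) * sq_norm T (aff v) * (\<Sum>j\<in>UNIV. diameter T * sq_norm T (G j) + sq_norm T (w j))"
proof -
 let ?h = "diameter T" and ?J = "\<bar>dbl_area A B C\<bar>" and ?n = "sq_norm T (aff v)" and ?s = "sqrt (measure lborel T)"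
 let ?S = "\<lambda>j. ?h * sq_norm T (G j) + sq_norm T (w j)"
 have h: "0 \<le> ?h" by (rule is_tri_dist_le_diameter(3)[OF T])
 have S: "0 \<le> ?S j" for j by (intro add_nonneg_nonneg mult_nonneg_nonneg h sq_norm_nonneg)
 have J: "?J > 0" using is_tri_nz[OF T] by simp
 have s2: "?s * ?s = ?J / 2" using measure_triangle[OF is_tri_nz[OF T]] is_tri_hull[OF T] by simp
 define K where "K = 6 * (?h * ?s / ?J * ?n)"
 have K: "0 \<le> K" using h by (simp add: K_def sq_norm_nonneg)
 have e: "\<bar>flux T (closed_segment P Q) (p (closed_segment P Q)) w G\<bar> \<le> 6 * (?h^2 / ?J) * ?n * (\<Sum>j\<in>UNIV. ?S j)"
  if P: "is_tri T P Q R" and JP: "\<bar>dbl_area P Q R\<bar> = ?J" for P Q R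
 proof -
  let ?p = "p (closed_segment P Q)"
  have JP': "\<bar>dbl_area Q P R\<bar> = ?J" using JP dbl_area_swap[where A = P and B = Q and C = R] by simp
  have pb: "\<bar>?p P\<bar> \<le> K" "\<bar>?p Q\<bar> \<le> K" using nodal_bound[OF P m] unfolding JP K_def by auto
  have mb: "\<bar>edge_mom P Q R (w j) (G j)\<bar> \<le> ?s / ?J * ?S j" "\<bar>edge_mom Q P R (w j) (G j)\<bar> \<le> ?s / ?J * ?S j" for j
   using edge_mom_bound[OF P w G] edge_mom_bound[OF is_tri_swap[OF P] w G] unfolding JP JP' by auto
  have nb: "\<bar>edge_normal P Q R $ j\<bar> \<le> ?h" for j
   using component_le_norm_cart[of "edge_normal P Q R" j] edge_normal_norm[OF is_tri_nz[OF P]] is_tri_dist_le_diameter(1)[OF P] by simp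
  have "\<bar>edge_normal P Q R $ j * (?p P * edge_mom P Q R (w j) (G j) + ?p Q * edge_mom Q P R (w j) (G j))\<bar> \<le> ?h * (K * (?s / ?J * ?S j) + K * (?s / ?J * ?S j))" for j
   unfolding abs_mult by (intro mult_mono nb order_trans[OF abs_triangle_ineq] add_mono h abs_ge_zero) (unfold abs_mult, (intro mult_mono pb mb K abs_ge_zero)+)
  then have "\<bar>flux T (closed_segment P Q) ?p w G\<bar> \<le> (\<Sum>j\<in>UNIV. ?h * (K * (?s / ?J * ?S j) + K * (?s / ?J * ?S j)))"
   unfolding flux_eq[OF P] tri_flux_def by (intro order_trans[OF sum_abs] sum_mono)
  also have "\<dots> = (2 * ?h * K * ?s / ?J) * (\<Sum>j\<in>UNIV. ?S j)" unfolding sum_distrib_left by (rule sum.cong[OF refl]) (simp add: algebra_simps add_divide_distrib)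
  also have "2 * ?h * K * ?s / ?J = 12 * ?h^2 * ?n / ?J^2 * (?s * ?s)" by (simp add: K_def power2_eq_square field_simps)
  also have "\<dots> = 6 * (?h^2 / ?J) * ?n" unfolding s2 using J by (simp add: power2_eq_square field_simps)
  finally show ?thesis .
 qed
 have "\<bar>\<Sum>e | e edge_of T. flux T e (p e) w G\<bar> \<le> 3 * (6 * (?h^2 / ?J) * ?n * (\<Sum>j\<in>UNIV. ?S j))" unfolding is_tri_sum_edges(1)[OF T]
  using e[OF T refl] e[OF is_tri_rotate[OF T]] e[OF is_tri_rotate[OF is_tri_rotate[OF T]]]
  unfolding dbl_area_perm(1)[of B C A] dbl_area_perm(1)[of A B C] by (simp add: dbl_area_rotate[where A = A and B = B and C = C] dbl_area_rotate[where A = B and B = C and C = A])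
 then show ?thesis by (simp add: algebra_simps)
qed

section \<open>Shape regularity\<close>

lemma triangle_diameter_edge:
 assumes T: "is_tri T A B C"
 obtains P Q R where "is_tri T P Q R" "dbl_area P Q R = dbl_area A B C" "diameter T \<le> dist P Q"
proof -
 have hull: "T = convex hull {A, B, C}" by (rule is_tri_hull[OF T])
 let ?M = "max (dist A B) (max (dist B C) (dist C A))"
 have "diameter T \<le> ?M"
 proof (rule diameter_le)
  have "0 \<le> ?M" by (rule order_trans[OF zero_le_dist[of A B]]) simp
  then show "T \<noteq> {} \<or> 0 \<le> ?M" ..
  fix x y assume xy: "x \<in> T" "y \<in> T"
  have "\<exists>u\<in>{A, B, C}. \<exists>v\<in>{A, B, C}. norm (x - y) \<le> norm (u - v)" by (rule simplex_extremal_le_exists) (use xy hull in simp_all)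
  then obtain u v where uv: "u \<in> {A, B, C}" "v \<in> {A, B, C}" "norm (x - y) \<le> norm (u - v)" by blast
  from uv(1,2) have "dist u v \<le> ?M" by (auto simp: dist_commute le_max_iff_disj)
  then show "norm (x - y) \<le> ?M" using uv(3) by (simp add: dist_norm)
 qed
 then consider "diameter T \<le> dist A B" | "diameter T \<le> dist B C" | "diameter T \<le> dist C A" by linarith
 then show thesis
 proof cases
  case 1 then show ?thesis using that[OF T] by simp
 next
  case 2 then show ?thesis using that[OF is_tri_rotate[OF T]] by (simp add: dbl_area_perm(1)[where A = A and B = B and C = C])
 next
  case 3 then show ?thesis using that[OF is_tri_rotate[OF is_tri_rotate[OF T]]] by (simp add: dbl_area_perm(2)[where A = A and B = B and C = C])
 qed
qed

text \<open>Between the points at distance \<open>t\<close> from the centre on either side along the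
  normal of \<open>AB\<close>, the hat function of \<open>C\<close> changes by \<open>2 t\<close>
  times the length of \<open>AB\<close> over the doubled area; as it stays between 0 and 1, this is
  at most 1. The ball is open, so \<open>r\<close> is approached by \<open>t < r\<close>.\<close>

lemma ball_in_triangle:
 assumes T: "is_tri T A B C" and b: "ball x r \<subseteq> T"
 shows "2 * r * dist A B \<le> \<bar>dbl_area A B C\<bar>"
proof -
 have nz: "dbl_area A B C \<noteq> 0" and hull: "T = convex hull {A, B, C}" by (rule is_tri_nz[OF T], rule is_tri_hull[OF T])
 let ?d = "dist A B" and ?J = "\<bar>dbl_area A B C\<bar>" and ?N = "edge_normal A B C"
 have d: "?d > 0" using dbl_area_distinct[OF nz] by simp
 have J: "?J > 0" using nz by simp
 have "r \<le> ?J / (2 * ?d)"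
 proof (rule dense_le)
  fix t assume t: "t < r"
  show "t \<le> ?J / (2 * ?d)"
  proof (cases "t \<le> 0")
   case True
   then show ?thesis using d J by (intro order_trans[OF True]) simp
  next
   case False
   let ?y = "x + (t / ?d) *\<^sub>R ?N" and ?z = "x - (t / ?d) *\<^sub>R ?N"
   have nN: "norm ((t / ?d) *\<^sub>R ?N) = t" using d False by (simp add: edge_normal_norm[OF nz])
   have "?y \<in> ball x r" "?z \<in> ball x r" using t nN by (auto simp: dist_norm)
   then have mem: "?y \<in> convex hull {C, A, B}" "?z \<in> convex hull {C, A, B}" using b unfolding hull by (auto simp: insert_commute)
   have nz': "dbl_area C A B \<noteq> 0" using nz dbl_area_perm(2)[where A = A and B = B and C = C] by simp
   have "bary C A B ?z \<le> 1" "0 \<le> bary C A B ?y" using bary_bounds[OF nz' mem(1)] bary_bounds[OF nz' mem(2)] by auto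
   moreover have i: "?N \<bullet> (?z - ?y) = - (2 * t * ?d)"
   proof -
    have "?z - ?y = - (2 * t / ?d) *\<^sub>R ?N" by (simp add: scaleR_2[symmetric])
    then have "?N \<bullet> (?z - ?y) = - (2 * t / ?d) * (norm ?N)^2" by (simp add: power2_norm_eq_inner)
    then show ?thesis using d by (simp add: edge_normal_norm[OF nz] power2_eq_square)
   qed
   moreover have "bary C A B ?z = bary C A B ?y - (- (2 * t * ?d)) / ?J" unfolding i[symmetric] by (rule bary_edge_normal[OF nz])
   ultimately have "2 * t * ?d / ?J \<le> 1" unfolding minus_divide_left[symmetric] by linarith
   then show ?thesis using d J by (simp add: field_simps)
  qed
 qed
 then show ?thesis using d by (simp add: field_simps)
qed

text \<open>For a longest edge, whose length is the diameter, \<open>ball_in_triangle\<close> bounds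
  the inscribed diameter by the doubled area over the diameter. The absolute value covers a \<sigma>
  of either sign.\<close>

lemma shape_regular_area:
 assumes T: "is_tri T A B C" and sr: "diameter T \<le> \<sigma> * inscribed_diameter T"
 shows "(diameter T)^2 / \<bar>dbl_area A B C\<bar> \<le> \<bar>\<sigma>\<bar>"
proof -
 let ?h = "diameter T" and ?J = "\<bar>dbl_area A B C\<bar>" and ?S = "{2 * r | r x. 0 \<le> r \<and> ball x r \<subseteq> T}"
 have J: "?J > 0" using is_tri_nz[OF T] by simp
 have "dist A B > 0" using dbl_area_distinct[OF is_tri_nz[OF T]] by simp
 then have h: "?h > 0" using is_tri_dist_le_diameter(1)[OF T] by linarith
 obtain P Q R where P: "is_tri T P Q R" "dbl_area P Q R = dbl_area A B C" "?h \<le> dist P Q" using triangle_diameter_edge[OF T] .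
 have le: "s \<le> ?J / ?h" if s: "s \<in> ?S" for s
 proof -
  obtain r x where r: "s = 2 * r" "0 \<le> r" "ball x r \<subseteq> T" using s by blast
  have "2 * r * ?h \<le> 2 * r * dist P Q" using r(2) P(3) by (intro mult_left_mono) auto
  also have "\<dots> \<le> ?J" using ball_in_triangle[OF P(1) r(3)] P(2) by simp
  finally show ?thesis using h r(1) by (simp add: field_simps)
 qed
 have 0: "0 \<in> ?S" by (rule CollectI, rule exI[of _ 0], rule exI[of _ 0]) simp
 have up: "inscribed_diameter T \<le> ?J / ?h" unfolding inscribed_diameter_def by (rule cSup_least) (use 0 le in blast)+
 have "0 \<le> inscribed_diameter T" unfolding inscribed_diameter_def by (rule cSup_upper[OF 0]) (rule bdd_aboveI[OF le])
 then have "\<sigma> * inscribed_diameter T \<le> \<bar>\<sigma>\<bar> * (?J / ?h)" using up by (intro mult_mono) auto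
 then have "?h \<le> \<bar>\<sigma>\<bar> * (?J / ?h)" using sr by linarith
 then show ?thesis using h J by (simp add: field_simps power2_eq_square)
qed

section \<open>Poincare inequalities on a triangle\<close>

lemma sq_norm_interior:
 assumes T: "is_tri T A B C" and f: "f \<in> borel_measurable borel" and g: "g \<in> borel_measurable borel"
  and eq: "\<And>x. x \<in> interior T ==> norm (f x) = norm (g x)"
 shows "sq_norm T f = sq_norm (interior T) g"
proof -
 have hull: "T = convex hull {A, B, C}" by (rule is_tri_hull[OF T])
 have m: "(\<lambda>x. (norm (f x))^2) \<in> borel_measurable borel" using f by measurable
 have "(LBINT x:T. (norm (f x))^2) = (LBINT x:interior T. (norm (f x))^2)" unfolding hull by (rule set_integral_interior_triangle[OF m, symmetric])
 also have "\<dots> = (LBINT x:interior T. (norm (g x))^2)" by (rule set_lebesgue_integral_cong) (use eq in auto)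
 finally show ?thesis by (simp add: sq_norm_def)
qed

lemma is_tri_interior_nonempty:
 assumes T: "is_tri T A B C"
 shows "interior T \<noteq> {}"
proof
 assume e: "interior T = {}"
 have hull: "T = convex hull {A, B, C}" by (rule is_tri_hull[OF T])
 have "(LBINT x:T. 1::real) = (LBINT x:interior T. 1)" unfolding hull by (rule set_integral_interior_triangle[symmetric]) simp
 then have "measure lborel T = 0" unfolding e by (simp add: hull triangle_const(2) set_lebesgue_integral_def)
 then show False using measure_triangle[OF is_tri_nz[OF T]] is_tri_nz[OF T] by (simp add: hull)
qed

lemma poincare_triangle:
 assumes T: "is_tri T A B C" and H: "H1_fun (interior T) w g"
 shows "\<exists>m. sq_norm T (\<lambda>x. w x - m) \<le> 2 * diameter T * sq_norm T g"
proof -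
 have hull: "T = convex hull {A, B, C}" by (rule is_tri_hull[OF T])
 have b: "bounded T" unfolding hull by (rule compact_imp_bounded[OF compact_triangle])
 have d: "norm (y - x) \<le> diameter T" if "x \<in> interior T" "y \<in> interior T" for x y
  using diameter_bounded_bound[OF b, of y x] that interior_subset[of T] by (auto simp: dist_norm)
 have cv: "convex (interior T)" unfolding hull by (intro convex_interior convex_triangle)
 note [measurable] = H1_funD(5,6)[OF H]
 define m where "m = (LBINT x:interior T. w x) / measure lborel (interior T)"
 have "(LBINT x:interior T. (w x - m)^2) \<le> 4 * (diameter T)^2 * (LBINT x:interior T. (norm (g x))^2)" unfolding m_def
  by (rule poincare[OF H open_interior cv bounded_subset[OF b interior_subset] is_tri_interior_nonempty[OF T] d])
 then have "(sq_norm (interior T) (\<lambda>x. w x - m))^2 \<le> (2 * diameter T * sq_norm (interior T) g)^2" unfolding power_mult_distrib sq_norm_sq by simp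
 then have "sq_norm (interior T) (\<lambda>x. w x - m) \<le> 2 * diameter T * sq_norm (interior T) g"
  by (rule power2_le_imp_le) (intro mult_nonneg_nonneg is_tri_dist_le_diameter(3)[OF T] sq_norm_nonneg; simp)
 moreover have "sq_norm T (\<lambda>x. w x - m) = sq_norm (interior T) (\<lambda>x. w x - m)" by (rule sq_norm_interior[OF T]; ((measurable; fail) | simp))
 moreover have "sq_norm T g = sq_norm (interior T) g" by (rule sq_norm_interior[OF T]; ((measurable; fail) | simp))
 ultimately show ?thesis by (intro exI[of _ m]) simp
qed

lemma C_inf_affine: "(\<lambda>x. k + v \<bullet> x) \<in> C_inf" "partial i (\<lambda>x. k + v \<bullet> x) x = v $ i"
proof -
 have co: "(\<lambda>x::real^2. x $ j) \<in> C_inf" for j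
 proof -
  \<comment> \<open>The successive derivatives of the identity, in the form that
    \<open>C_k_coordinate\<close> expects.\<close>
  let ?D = "\<lambda>n t. if n = 0 then t else if n = 1 then 1 else (0::real)"
  have "(?D n has_real_derivative ?D (Suc n) t) (at t)" for n t
  proof (cases n)
   case 0
   then show ?thesis by (simp add: DERIV_ident)
  qed (cases "n = 1"; simp)
  from C_k_coordinate[of ?D, OF this, of 0 0 1 j] show ?thesis unfolding C_inf_iff by simp
 qed
 have "(\<lambda>x. k + (v $ 1 * x $ 1 + v $ 2 * x $ 2)) \<in> C_inf" by (intro C_inf_add C_inf_mult C_inf_const co)
 then show "(\<lambda>x. k + v \<bullet> x) \<in> C_inf" by (simp add: inner_vec2)
 have "((\<lambda>x. k + v \<bullet> x) has_derivative (\<lambda>h. v \<bullet> h)) (at x)" by (auto intro!: derivative_eq_intros)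
 from has_derivative_imp_partial[OF this] show "partial i (\<lambda>x. k + v \<bullet> x) x = v $ i" by (simp add: inner_axis)
qed

lemma set_integrable_const_bounded:
 fixes S :: "(real^2) set"
 assumes "bounded S" "S \<in> sets borel"
 shows "set_integrable lborel S (\<lambda>_. c :: 'b::euclidean_space)"
proof -
 have "emeasure lborel S < \<infinity>" by (rule emeasure_bounded_finite[OF assms(1)])
 then show ?thesis unfolding set_integrable_def using assms(2) by (intro integrable_scaleR_left) simp
qed

text \<open>\<open>H1_fun\<close> asks for integrability over the whole plane, which an affine
  function lacks; hence the cutoff to \<open>S\<close>. Test functions supported in \<open>S\<close>
  do not notice it.\<close>

lemma H1_fun_minus_affine:
 assumes H: "H1_fun S w g" and S: "open S" "bounded S"
 shows "H1_fun S (\<lambda>x. indicator S x *\<^sub>R (w x - (k + v \<bullet> x))) (\<lambda>x. indicator S x *\<^sub>R (g x - v))"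
proof -
 have Sb: "S \<in> sets borel" using S by simp
 let ?a = "\<lambda>x. k + v \<bullet> x"
 note aC = C_inf_affine(1)[of k v]
 have [measurable]: "w \<in> borel_measurable borel" "g \<in> borel_measurable borel" "?a \<in> borel_measurable borel" using H1_funD(5,6)[OF H] by auto
 have wa: "sq_integrable S w" "sq_integrable S g" by (rule sq_integrable_H1_fun[OF H Sb])+
 have sa: "sq_integrable S ?a" using C_inf_square_integrable[OF aC S(2) Sb] by (simp add: sq_integrable_def)
 have sv: "sq_integrable S (\<lambda>_. v)" using set_integrable_const_bounded[OF S(2) Sb] by (simp add: sq_integrable_def)
 have d1: "sq_integrable S (\<lambda>x. w x - ?a x)" "sq_integrable S (\<lambda>x. g x - v)" by (intro sq_integrable_diff wa sa sv Sb)+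
 have int: "integrable lborel (\<lambda>x. indicator S x *\<^sub>R f x)" if f: "sq_integrable S f" for f :: "real^2 => 'b::euclidean_space"
 proof -
  have "set_integrable lborel S f"
  proof (rule set_integrable_dominated[OF _ Sb])
   show "set_integrable lborel S (\<lambda>x. 1 + (norm (f x))^2)"
    using f by (intro set_integral_add(1) set_integrable_const_bounded S(2) Sb) (simp add: sq_integrable_def)
   show "f \<in> borel_measurable borel" using f by (simp add: sq_integrable_def)
   show "norm (f x) \<le> 1 + (norm (f x))^2" for x
    using sum_squares_bound[of 1 "norm (f x)"] norm_ge_zero[of "f x"] unfolding mult_1_right one_power2 by linarith
  qed
  then show ?thesis by (simp add: set_integrable_def)
 qed
 have int2: "integrable lborel (\<lambda>x. (norm (indicator S x *\<^sub>R f x))^2)" if f: "sq_integrable S f" for f :: "real^2 => 'b::euclidean_space"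
 proof -
  have "(norm (indicator S x *\<^sub>R f x))^2 = indicator S x *\<^sub>R (norm (f x))^2" for x by (simp add: indicator_def)
  then show ?thesis using f by (simp add: sq_integrable_def set_integrable_def)
 qed
 show ?thesis unfolding H1_fun_def
 proof (intro conjI ballI allI)
  show "integrable lborel (\<lambda>x. indicator S x *\<^sub>R (w x - ?a x))" "integrable lborel (\<lambda>x. indicator S x *\<^sub>R (g x - v))"
   by (intro int d1)+
  show "integrable lborel (\<lambda>x. (indicator S x *\<^sub>R (w x - ?a x))^2)" using int2[OF d1(1)] by simp
  show "integrable lborel (\<lambda>x. (norm (indicator S x *\<^sub>R (g x - v)))^2)" by (rule int2[OF d1(2)])
  fix \<phi> i assume \<phi>: "\<phi> \<in> test_functions S"
  note \<phi>z = test_functions_zero_outside[OF \<phi>] and d\<phi>z = test_functions_zero_outside[OF test_functions_partial[OF \<phi>]]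
  have comp: "integrable lborel (\<lambda>x. g x $ j)" for j using H1_funD(7)[OF H, of "axis j 1"] by (simp add: inner_axis)
  have ai: "integrable lborel (\<lambda>x. (indicator S x *\<^sub>R ?a x) * \<psi> x)" if "\<psi> \<in> test_functions S" for \<psi>
   by (rule test_functions_integrable_mult[OF that int[OF sa]])
  have ci: "integrable lborel (\<lambda>x. (indicator S x *\<^sub>R v) $ i * \<phi> x)"
  proof -
   have "integrable lborel (\<lambda>x. indicator S x *\<^sub>R v $ i)"
    using set_integrable_const_bounded[OF S(2) Sb, of "v $ i"] by (simp only: set_integrable_def)
   from test_functions_integrable_mult[OF \<phi> this] show ?thesis by simp
  qed
  have "(LBINT x. indicator S x *\<^sub>R (w x - ?a x) * partial i \<phi> x)
    = (LBINT x. w x * partial i \<phi> x - (indicator S x *\<^sub>R ?a x) * partial i \<phi> x)"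
   by (rule Bochner_Integration.integral_cong[OF refl]) (use d\<phi>z in \<open>auto simp: indicator_def algebra_simps\<close>)
  also have "\<dots> = (LBINT x. w x * partial i \<phi> x) - (LBINT x. (indicator S x *\<^sub>R ?a x) * partial i \<phi> x)"
   by (intro Bochner_Integration.integral_diff test_functions_integrable_mult[OF test_functions_partial[OF \<phi>]] H1_funD(1)[OF H] ai test_functions_partial[OF \<phi>])
  also have "(LBINT x. (indicator S x *\<^sub>R ?a x) * partial i \<phi> x) = (LBINT x. ?a x * partial i \<phi> x)"
   by (rule Bochner_Integration.integral_cong[OF refl]) (use d\<phi>z in \<open>auto simp: indicator_def\<close>)
  also have "\<dots> = - (LBINT x. v $ i * \<phi> x)" unfolding integral_by_parts_smooth[OF aC \<phi>] C_inf_affine(2) ..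
  also have "(LBINT x. v $ i * \<phi> x) = (LBINT x. (indicator S x *\<^sub>R v) $ i * \<phi> x)"
   by (rule Bochner_Integration.integral_cong[OF refl]) (use \<phi>z in \<open>auto simp: indicator_def\<close>)
  also have "(LBINT x. w x * partial i \<phi> x) = - (LBINT x. g x $ i * \<phi> x)" using H \<phi> by (simp add: H1_fun_def)
  also have "- (LBINT x. g x $ i * \<phi> x) - - (LBINT x. (indicator S x *\<^sub>R v) $ i * \<phi> x)
    = - (LBINT x. g x $ i * \<phi> x - (indicator S x *\<^sub>R v) $ i * \<phi> x)"
   using Bochner_Integration.integral_diff[OF test_functions_integrable_mult[OF \<phi> comp] ci] by simp
  also have "(LBINT x. g x $ i * \<phi> x - (indicator S x *\<^sub>R v) $ i * \<phi> x) = (LBINT x. (indicator S x *\<^sub>R (g x - v)) $ i * \<phi> x)"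
   by (rule Bochner_Integration.integral_cong[OF refl]) (use \<phi>z in \<open>auto simp: indicator_def algebra_simps\<close>)
  finally show "(LBINT x. indicator S x *\<^sub>R (w x - ?a x) * partial i \<phi> x) = - (LBINT x. (indicator S x *\<^sub>R (g x - v)) $ i * \<phi> x)" .
 qed
qed

lemma sq_norm_vec2:
 fixes g :: "real^2 => real^2"
 assumes g: "sq_integrable S g" and S: "S \<in> sets borel"
 shows "(sq_norm S g)^2 = (\<Sum>k\<in>UNIV. (sq_norm S (\<lambda>x. g x $ k))^2)" and "sq_integrable S (\<lambda>x. g x $ k)"
  and "sq_norm S g \<le> (\<Sum>k\<in>UNIV. sq_norm S (\<lambda>x. g x $ k))"
proof -
 have [measurable]: "g \<in> borel_measurable borel" using g by (simp add: sq_integrable_def)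
 have [measurable]: "(\<lambda>x. g x $ k) \<in> borel_measurable borel" for k
 proof -
  have "(\<lambda>x. g x \<bullet> axis k 1) \<in> borel_measurable borel" by measurable
  then show ?thesis by (simp add: inner_axis)
 qed
 show c: "sq_integrable S (\<lambda>x. g x $ k)" for k unfolding sq_integrable_def
 proof
  show "(\<lambda>x. g x $ k) \<in> borel_measurable borel" by measurable
  show "set_integrable lborel S (\<lambda>x. (norm (g x $ k))^2)"
  proof (rule set_integrable_dominated[OF _ S])
   show "set_integrable lborel S (\<lambda>x. (norm (g x))^2)" using g by (simp add: sq_integrable_def)
   show "norm ((norm (g x $ k))^2) \<le> (norm (g x))^2" for x using component_le_norm_cart[of "g x" k] by (simp add: abs_le_square_iff[symmetric])
  qed measurable
 qed
 have "(sq_norm S g)^2 = (LBINT x:S. (norm (g x $ 1))^2 + (norm (g x $ 2))^2)" by (simp add: sq_norm_sq norm_vec2_sq)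
 also have "\<dots> = (\<Sum>k\<in>UNIV. (sq_norm S (\<lambda>x. g x $ k))^2)"
  using c by (subst set_integral_add(2)) (auto simp: sq_integrable_def sq_norm_sq sum_2)
 finally show eq: "(sq_norm S g)^2 = (\<Sum>k\<in>UNIV. (sq_norm S (\<lambda>x. g x $ k))^2)" .
 show "sq_norm S g \<le> (\<Sum>k\<in>UNIV. sq_norm S (\<lambda>x. g x $ k))" by (rule power2_le_imp_le) (simp_all add: eq sum_2 power2_sum sq_norm_nonneg)
qed

text \<open>Componentwise, \<open>v\<close> is a Poincare constant of the gradient; subtracting
  \<open>v \<bullet> x\<close> leaves a function with gradient \<open>g - v\<close>, to which the
  inequality applies again. The same \<open>v\<close> must serve both estimates, since it becomes
  the linear part of one affine approximation.\<close>

lemma poincare_triangle_second: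
 assumes T: "is_tri T A B C" and H: "H1_fun (interior T) w g" and D: "\<And>k. H1_fun (interior T) (\<lambda>x. g x $ k) (D k)"
 shows "\<exists>m v. sq_norm T (\<lambda>x. g x - v) \<le> 2 * diameter T * sqrt (\<Sum>k\<in>UNIV. (sq_norm T (D k))^2)
  \<and> sq_norm T (\<lambda>x. w x - (m + v \<bullet> x)) \<le> 2 * diameter T * (2 * diameter T * sqrt (\<Sum>k\<in>UNIV. (sq_norm T (D k))^2))"
proof -
 let ?S = "interior T" and ?h = "diameter T" and ?R = "sqrt (\<Sum>k\<in>UNIV. (sq_norm T (D k))^2)"
 have hull: "T = convex hull {A, B, C}" by (rule is_tri_hull[OF T])
 have Tb: "T \<in> sets borel" unfolding hull by simp
 have b: "bounded ?S" unfolding hull by (rule bounded_subset[OF compact_imp_bounded[OF compact_triangle] interior_subset])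
 have h: "0 \<le> ?h" by (rule is_tri_dist_le_diameter(3)[OF T])
 have [measurable]: "w \<in> borel_measurable borel" "g \<in> borel_measurable borel" using H1_funD(5,6)[OF H] by auto
 have "\<forall>k. \<exists>m. sq_norm T (\<lambda>x. g x $ k - m) \<le> 2 * ?h * sq_norm T (D k)" using poincare_triangle[OF T D] by blast
 from choice[OF this] obtain mv where mv: "\<forall>k. sq_norm T (\<lambda>x. g x $ k - mv k) \<le> 2 * ?h * sq_norm T (D k)" ..
 define v where "v = (\<chi> k. mv k)"
 have sv: "sq_integrable T (\<lambda>x. g x - v)"
  by (intro sq_integrable_diff sq_integrable_H1_fun(2)[OF H] Tb) (simp add: hull sq_integrable_continuous[OF compact_triangle])
 have "(sq_norm T (\<lambda>x. g x - v))^2 = (\<Sum>k\<in>UNIV. (sq_norm T (\<lambda>x. g x $ k - mv k))^2)"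
  unfolding sq_norm_vec2(1)[OF sv Tb] by (simp add: v_def)
 also have "\<dots> \<le> (\<Sum>k\<in>UNIV. (2 * ?h * sq_norm T (D k))^2)" by (intro sum_mono power_mono mv[rule_format] sq_norm_nonneg)
 also have "\<dots> = (2 * ?h * ?R)^2" by (simp add: power_mult_distrib sum_distrib_left sum_nonneg)
 finally have g1: "sq_norm T (\<lambda>x. g x - v) \<le> 2 * ?h * ?R" by (rule power2_le_imp_le) (simp add: h sum_nonneg)
 let ?w = "\<lambda>x. indicator ?S x *\<^sub>R (w x - (0 + v \<bullet> x))" and ?g = "\<lambda>x. indicator ?S x *\<^sub>R (g x - v)"
 note H' = H1_fun_minus_affine[OF H open_interior b, of 0 v]
 obtain m where m: "sq_norm T (\<lambda>x. ?w x - m) \<le> 2 * ?h * sq_norm T ?g" using poincare_triangle[OF T H'] by blast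
 have [measurable]: "?w \<in> borel_measurable borel" "?g \<in> borel_measurable borel" by (rule H1_funD(5)[OF H'], rule H1_funD(6)[OF H'])
 have "sq_norm T (\<lambda>x. ?w x - m) = sq_norm ?S (\<lambda>x. w x - (m + v \<bullet> x))" by (rule sq_norm_interior[OF T]; ((measurable; fail) | simp))
 also have "\<dots> = sq_norm T (\<lambda>x. w x - (m + v \<bullet> x))" by (rule sq_norm_interior[OF T, symmetric]; ((measurable; fail) | simp))
 finally have e1: "sq_norm T (\<lambda>x. ?w x - m) = sq_norm T (\<lambda>x. w x - (m + v \<bullet> x))" .
 have "sq_norm T ?g = sq_norm ?S (\<lambda>x. g x - v)" by (rule sq_norm_interior[OF T]; ((measurable; fail) | simp))
 also have "\<dots> = sq_norm T (\<lambda>x. g x - v)" by (rule sq_norm_interior[OF T, symmetric]; ((measurable; fail) | simp))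
 finally have e2: "sq_norm T ?g = sq_norm T (\<lambda>x. g x - v)" .
 have "sq_norm T (\<lambda>x. w x - (m + v \<bullet> x)) \<le> 2 * ?h * (2 * ?h * ?R)"
  using m unfolding e1 e2 by (rule order_trans) (intro mult_left_mono g1; simp add: h)
 with g1 show ?thesis by blast
qed

section \<open>Linearity of fluxes and summation over the mesh\<close>

lemma edge_mom_diff:
 assumes nz: "dbl_area A B C \<noteq> 0"
  and w: "set_integrable lborel (convex hull {A, B, C}) w" "set_integrable lborel (convex hull {A, B, C}) w'"
  and G: "set_integrable lborel (convex hull {A, B, C}) G" "set_integrable lborel (convex hull {A, B, C}) G'"
 shows "edge_mom A B C (\<lambda>x. w x - w' x) (\<lambda>x. G x - G' x) = edge_mom A B C w G - edge_mom A B C w' G'"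
proof -
 have eq: "bary A B C x * ((G x - G' x) \<bullet> (A - C)) + (w x - w' x)
   = (bary A B C x * (G x \<bullet> (A - C)) + w x) - (bary A B C x * (G' x \<bullet> (A - C)) + w' x)" for x by (simp only: inner_diff_left right_diff_distrib)
 show ?thesis unfolding edge_mom_def eq set_integral_diff(2)[OF edge_mom_integrable[OF nz w(1) G(1)] edge_mom_integrable[OF nz w(2) G(2)]] diff_divide_distrib ..
qed

lemma flux_diff:
 assumes T: "is_tri T A B C" and w: "\<And>j. set_integrable lborel T (w j)" "\<And>j. set_integrable lborel T (w' j)"
  and G: "\<And>j. set_integrable lborel T (G j)" "\<And>j. set_integrable lborel T (G' j)"
 shows "(\<Sum>e | e edge_of T. flux T e (p e) (\<lambda>j x. w j x - w' j x) (\<lambda>j x. G j x - G' j x))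
  = (\<Sum>e | e edge_of T. flux T e (p e) w G) - (\<Sum>e | e edge_of T. flux T e (p e) w' G')"
proof -
 have tf: "tri_flux P Q R r (\<lambda>j x. w j x - w' j x) (\<lambda>j x. G j x - G' j x) = tri_flux P Q R r w G - tri_flux P Q R r w' G'" if P: "is_tri T P Q R" for P Q R r
 proof -
  note e1 = edge_mom_diff[OF is_tri_nz[OF P], folded is_tri_hull[OF P], OF w G]
  note e2 = edge_mom_diff[OF is_tri_nz[OF is_tri_swap[OF P]], folded is_tri_hull[OF is_tri_swap[OF P]], OF w G]
  show ?thesis unfolding tri_flux_def e1 e2 sum_2 by (simp only: algebra_simps)
 qed
 note T2 = is_tri_rotate[OF T] and T3 = is_tri_rotate[OF is_tri_rotate[OF T]]
 show ?thesis unfolding is_tri_sum_edges(1)[OF T] flux_eq[OF T] flux_eq[OF T2] flux_eq[OF T3] tf[OF T] tf[OF T2] tf[OF T3] by simp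
qed

lemma flux_diff_left:
 assumes T: "is_tri T A B C"
 shows "(\<Sum>e | e edge_of T. flux T e (\<lambda>x. p e x - p' e x) w G) = (\<Sum>e | e edge_of T. flux T e (p e) w G) - (\<Sum>e | e edge_of T. flux T e (p' e) w G)"
proof -
 have tf: "tri_flux P Q R (\<lambda>x. r x - r' x) w G = tri_flux P Q R r w G - tri_flux P Q R r' w G" for P Q R r r'
  unfolding tri_flux_def sum_2 by (simp only: algebra_simps)
 show ?thesis unfolding is_tri_sum_edges(1)[OF T] flux_eq[OF T] flux_eq[OF is_tri_rotate[OF T]] flux_eq[OF is_tri_rotate[OF is_tri_rotate[OF T]]] tf by simp
qed

lemma triangulation_disjoint_interiors:
 assumes "triangulation \<T>" "T \<in> \<T>" "T' \<in> \<T>" "T \<noteq> T'"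
 shows "interior T \<inter> interior T' = {}"
proof (rule ccontr)
 assume "interior T \<inter> interior T' \<noteq> {}"
 then obtain x where x: "x \<in> interior T" "x \<in> interior T'" by blast
 then have xTT: "x \<in> T \<inter> T'" using interior_subset by blast
 have "T \<inter> T' face_of T" "T' \<inter> T face_of T'" using assms by (simp_all add: triangulation_def)
 then have f: "T \<inter> T' face_of T" "T \<inter> T' face_of T'" by (simp_all add: Int_commute)
 have "T \<inter> T' = T" using face_of_disjoint_interior[OF f(1)] x(1) xTT by blast
 moreover have "T \<inter> T' = T'" using face_of_disjoint_interior[OF f(2)] x(2) xTT by blast
 ultimately show False using assms(4) by simp
qed

text \<open>Interiors of distinct triangles are disjoint and the rest is null, so local squared
  norms add up without overlap.\<close>

lemma sum_sq_norm_le: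
 assumes \<Omega>: "polygonal_domain \<Omega>" and mesh: "conforming_mesh \<Omega> \<T>"
  and g: "g \<in> borel_measurable borel" "integrable lborel (\<lambda>x. (norm (g x))^2)"
 shows "(\<Sum>T\<in>\<T>. (sq_norm T g)^2) \<le> (LBINT x. (norm (g x))^2)"
proof -
 have fin: "finite \<T>" by (rule finite_edges(1)[OF \<Omega> mesh])
 have tr: "triangulation \<T>" using mesh by (simp add: conforming_mesh_def)
 have i: "integrable lborel (\<lambda>x. indicator (interior T) x *\<^sub>R (norm (g x))^2)" for T :: "(real^2) set"
  using integrable_imp_set_integrable[OF g(2), of "interior T"] by (simp add: set_integrable_def)
 have "(sq_norm T g)^2 = (LBINT x. indicator (interior T) x *\<^sub>R (norm (g x))^2)" if T: "T \<in> \<T>" for T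
 proof -
  obtain A B C where P: "is_tri T A B C" using simplex_is_tri[OF conforming_mesh_triangle(1)[OF \<Omega> mesh T]] .
  show ?thesis unfolding sq_norm_interior[OF P g(1) g(1) refl] sq_norm_sq set_lebesgue_integral_def ..
 qed
 then have "(\<Sum>T\<in>\<T>. (sq_norm T g)^2) = (\<Sum>T\<in>\<T>. (LBINT x. indicator (interior T) x *\<^sub>R (norm (g x))^2))" by simp
 also have "\<dots> = (LBINT x. (\<Sum>T\<in>\<T>. indicator (interior T) x *\<^sub>R (norm (g x))^2))"
  by (rule Bochner_Integration.integral_sum[symmetric]) (rule i)
 also have "\<dots> \<le> (LBINT x. (norm (g x))^2)"
 proof (rule integral_mono)
  show "integrable lborel (\<lambda>x. \<Sum>T\<in>\<T>. indicator (interior T) x *\<^sub>R (norm (g x))^2)" by (rule Bochner_Integration.integrable_sum) (rule i)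
  show "integrable lborel (\<lambda>x. (norm (g x))^2)" by (rule g(2))
  fix x
  have dj: "disjoint_family_on interior \<T>" using triangulation_disjoint_interiors[OF tr] by (simp add: disjoint_family_on_def)
  have s: "(\<Sum>T\<in>\<T>. indicator (interior T) x :: real) = indicator (\<Union>T\<in>\<T>. interior T) x"
   by (rule indicator_UN_disjoint[OF fin dj, symmetric])
  have "(\<Sum>T\<in>\<T>. indicator (interior T) x *\<^sub>R (norm (g x))^2) = indicator (\<Union>T\<in>\<T>. interior T) x * (norm (g x))^2"
   by (simp only: s[symmetric] sum_distrib_right real_scaleR_def)
  also have "\<dots> \<le> 1 * (norm (g x))^2" by (rule mult_right_mono) (auto simp: indicator_def)
  finally show "(\<Sum>T\<in>\<T>. indicator (interior T) x *\<^sub>R (norm (g x))^2) \<le> (norm (g x))^2" by simp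
 qed
 finally show ?thesis .
qed

lemma polys_diff:
 assumes "p \<in> polys k S" "q \<in> polys k S"
 shows "p - q \<in> polys k S"
proof -
 obtain c d where c: "p = (\<lambda>x. if x \<in> S then \<Sum>\<alpha>\<in>multi_indices k. c \<alpha> * (x $ 1) ^ fst \<alpha> * (x $ 2) ^ snd \<alpha> else 0)"
  and d: "q = (\<lambda>x. if x \<in> S then \<Sum>\<alpha>\<in>multi_indices k. d \<alpha> * (x $ 1) ^ fst \<alpha> * (x $ 2) ^ snd \<alpha> else 0)"
  using assms unfolding polys_def by blast
 have "p - q = (\<lambda>x. if x \<in> S then \<Sum>\<alpha>\<in>multi_indices k. (c \<alpha> - d \<alpha>) * (x $ 1) ^ fst \<alpha> * (x $ 2) ^ snd \<alpha> else 0)"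
  unfolding c d by (simp add: fun_eq_iff left_diff_distrib sum_subtractf)
 then show ?thesis unfolding polys_def mem_Collect_eq by (rule exI[of _ "\<lambda>\<alpha>. c \<alpha> - d \<alpha>"])
qed

lemma Vh0D:
 assumes "v \<in> Vh0 \<Omega> \<T>"
 shows "T \<in> \<T> ==> \<exists>c. fst v T = zero_ext T (\<lambda>_. c)" "T \<notin> \<T> ==> fst v T = (\<lambda>_. 0)"
  "e \<in> edges \<T> ==> snd v e \<in> polys 1 e" "e \<notin> edges \<T> ==> snd v e = (\<lambda>_. 0)"
  "e \<in> edges \<T> ==> e \<subseteq> frontier \<Omega> ==> x \<in> e ==> snd v e x = 0"
  "T \<in> \<T> ==> fst v T \<in> polys 0 T"
proof -
 have v: "v \<in> Vh \<T>" using assms by (simp add: Vh0_def)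
 have a: "\<forall>T. if T \<in> \<T> then fst v T \<in> polys 0 T else fst v T = (\<lambda>_. 0)"
  and b: "\<forall>e. if e \<in> edges \<T> then snd v e \<in> polys 1 e else snd v e = (\<lambda>_. 0)"
  using v unfolding Vh_def by (auto simp only: split_beta mem_Collect_eq fst_conv snd_conv split: prod.splits)
 show "T \<in> \<T> ==> fst v T \<in> polys 0 T" using a[rule_format, of T] by simp
 then show "T \<in> \<T> ==> \<exists>c. fst v T = zero_ext T (\<lambda>_. c)" unfolding polys_0 by blast
 show "T \<notin> \<T> ==> fst v T = (\<lambda>_. 0)" using a[rule_format, of T] by simp
 show "e \<in> edges \<T> ==> snd v e \<in> polys 1 e" "e \<notin> edges \<T> ==> snd v e = (\<lambda>_. 0)" using b[rule_format, of e] by simp_all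
 show "e \<in> edges \<T> ==> e \<subseteq> frontier \<Omega> ==> x \<in> e ==> snd v e x = 0" using assms by (simp add: Vh0_def)
qed

lemma Vh0_diff:
 assumes v: "v \<in> Vh0 \<Omega> \<T>" and w: "w \<in> Vh0 \<Omega> \<T>"
 shows "v - w \<in> Vh0 \<Omega> \<T>"
proof -
 have "fst (v - w) T \<in> polys 0 T" if "T \<in> \<T>" for T using polys_diff[OF Vh0D(6)[OF v that] Vh0D(6)[OF w that]] by simp
 moreover have "fst (v - w) T = (\<lambda>_. 0)" if "T \<notin> \<T>" for T using Vh0D(2)[OF v that] Vh0D(2)[OF w that] by (simp add: fun_eq_iff)
 moreover have "snd (v - w) e \<in> polys 1 e" if "e \<in> edges \<T>" for e using polys_diff[OF Vh0D(3)[OF v that] Vh0D(3)[OF w that]] by simp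
 moreover have "snd (v - w) e = (\<lambda>_. 0)" if "e \<notin> edges \<T>" for e using Vh0D(4)[OF v that] Vh0D(4)[OF w that] by (simp add: fun_eq_iff)
 ultimately have "v - w \<in> Vh \<T>" unfolding Vh_def by (simp add: mem_Times_iff)
 moreover have "snd (v - w) e x = 0" if "e \<in> edges \<T>" "e \<subseteq> frontier \<Omega>" "x \<in> e" for e x
  using Vh0D(5)[OF v that] Vh0D(5)[OF w that] by simp
 ultimately show ?thesis unfolding Vh0_def by simp
qed

lemma L2_inner_piecewise:
 assumes \<Omega>: "polygonal_domain \<Omega>" and mesh: "conforming_mesh \<Omega> \<T>"
  and F: "integrable lborel F" and f: "AE x in lebesgue_on \<Omega>. f x = F x"
  and v: "\<And>T. T \<in> \<T> ==> v T = zero_ext T (\<lambda>_. c T)"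
 shows "L2_inner (lebesgue_on \<Omega>) f (piecewise \<T> v) = (\<Sum>T\<in>\<T>. c T * (LBINT x:T. F x))"
proof -
 have fin: "finite \<T>" by (rule finite_edges(1)[OF \<Omega> mesh])
 have \<Omega>b: "\<Omega> \<in> sets borel" using \<Omega> by (simp add: polygonal_domain_def)
 have \<Omega>l: "\<Omega> \<inter> space lebesgue \<in> sets lebesgue" using \<Omega>b by (simp add: sets_completionI_sets)
 have [measurable]: "F \<in> borel_measurable borel" using borel_measurable_integrable[OF F] by simp
 let ?h = "\<lambda>x. \<Sum>T\<in>\<T>. c T * (indicator (interior T) x *\<^sub>R F x)"
 have pw: "piecewise \<T> v x = (\<Sum>T\<in>\<T>. c T * indicator (interior T) x)" for x
  unfolding piecewise_def by (rule sum.cong[OF refl]) (use v interior_subset in \<open>auto simp: indicator_def\<close>)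
 have ae: "AE x in lborel. x \<in> \<Omega> --> f x \<bullet> piecewise \<T> v x = ?h x"
 proof -
  have "AE x in lborel. x \<in> \<Omega> --> f x = F x" using f unfolding AE_restrict_space_iff[OF \<Omega>l] AE_completion_iff .
  then show ?thesis by eventually_elim (simp add: pw sum_distrib_left mult_ac)
 qed
 have hm: "?h \<in> borel_measurable borel" by measurable
 have i: "integrable lborel (\<lambda>x. indicator (interior T) x *\<^sub>R F x)" for T :: "(real^2) set"
  using integrable_imp_set_integrable[OF F, of "interior T"] by (simp add: set_integrable_def)
 have h0: "?h x = 0" if x: "x \<notin> \<Omega>" for x
 proof (rule sum.neutral, rule ballI)
  fix T assume "T \<in> \<T>"
  then have "x \<notin> interior T" using conforming_mesh_triangle(3)[OF \<Omega> mesh] x by blast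
  then show "c T * (indicator (interior T) x *\<^sub>R F x) = 0" by simp
 qed
 have "L2_inner (lebesgue_on \<Omega>) f (piecewise \<T> v) = (LBINT x:\<Omega>. ?h x)" unfolding L2_inner_def by (rule integral_lebesgue_on_eq[OF \<Omega>b hm ae])
 also have "\<dots> = (LBINT x. ?h x)" by (rule set_integral_zero_outside(1)[OF h0])
 also have "\<dots> = (\<Sum>T\<in>\<T>. (LBINT x. c T * (indicator (interior T) x *\<^sub>R F x)))"
  by (rule Bochner_Integration.integral_sum) (rule integrable_mult_right, rule i)
 also have "\<dots> = (\<Sum>T\<in>\<T>. c T * (LBINT x:T. F x))"
 proof (rule sum.cong[OF refl])
  fix T assume T: "T \<in> \<T>"
  obtain A B C where P: "is_tri T A B C" using simplex_is_tri[OF conforming_mesh_triangle(1)[OF \<Omega> mesh T]] .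
  have "(LBINT x. indicator (interior T) x *\<^sub>R F x) = (LBINT x:T. F x)"
   unfolding set_lebesgue_integral_def[symmetric] is_tri_hull[OF P] by (rule set_integral_interior_triangle) measurable
  then show "(LBINT x. c T * (indicator (interior T) x *\<^sub>R F x)) = c T * (LBINT x:T. F x)" by simp
 qed
 finally show ?thesis .
qed

section \<open>The error equation\<close>

definition unit_index :: "2 => nat \<times> nat" where
 "unit_index j = (if j = 1 then (1, 0) else (0, 1))"

lemma unit_index_le: "fst (unit_index j) + snd (unit_index j) = 1"
 by (simp add: unit_index_def)

lemma wgrad_component: "wgrad \<Omega> \<alpha> u x $ k = wderiv \<Omega> (fst \<alpha> + fst (unit_index k), snd \<alpha> + snd (unit_index k)) u x"
 using exhaust_2[of k] by (auto simp: wgrad_def unit_index_def)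

text \<open>\<open>R T\<close> bounds, for one affine \<open>q\<close>, the distance of grad u from
  \<open>q\<close> together with the scaled distance of its derivatives. It enters twice: with
  factor 1 in the volume term, grad u minus \<open>q\<close> against the weak gradient of the error,
  and with factor \<open>18 * \<bar>\<sigma>\<bar>\<close> from \<open>flux_bound\<close> and
  \<open>shape_regular_area\<close> in the edge term. Cauchy-Schwarz over the mesh leaves one energy
  norm to cancel.\<close>

lemma energy_error_bound:
 fixes u :: "real^2 => real" and R :: "(real^2) set => real"
 assumes \<Omega>: "polygonal_domain \<Omega>" and mesh: "conforming_mesh \<Omega> \<T>" and sr: "shape_regular \<sigma> \<T>"
  and u: "u \<in> H1_0 \<Omega>" "u \<in> Hk 2 \<Omega>"
  and f: "AE x in lebesgue_on \<Omega>. - laplacian \<Omega> u x = f x" and uh: "wg_solution \<Omega> \<T> f uh"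
 defines "w \<equiv> \<lambda>j. wderiv \<Omega> (unit_index j) u" and "G \<equiv> \<lambda>j. wgrad \<Omega> (unit_index j) u"
 assumes R: "\<And>T. T \<in> \<T> ==> \<exists>q. (\<Sum>j\<in>UNIV. diameter T * sq_norm T (\<lambda>x. G j x - aff_grad q j) + sq_norm T (\<lambda>x. w j x - aff q x $ j)) \<le> R T"
 shows "energy_norm \<T> (Qh \<T> u - uh) \<le> (1 + 18 * \<bar>\<sigma>\<bar>) * sqrt (\<Sum>T\<in>\<T>. (R T)^2)"
proof -
 have o: "open \<Omega>" "bounded \<Omega>" using \<Omega> by (auto simp: polygonal_domain_def)
 have u1: "u \<in> Hk 1 \<Omega>" using u(1) by (simp add: H1_0_def)
 have fin: "finite \<T>" by (rule finite_edges(1)[OF \<Omega> mesh])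
 have H: "H1_fun \<Omega> (w j) (G j)" for j unfolding w_def G_def by (rule H1_fun_wderiv[OF o u(2)]) (simp add: unit_index_le)
 have tri: "\<exists>A B C. is_tri T A B C" if "T \<in> \<T>" for T using simplex_is_tri[OF conforming_mesh_triangle(1)[OF \<Omega> mesh that]] by blast
 have Tb: "T \<in> sets borel" if "is_tri T A B C" for T A B C unfolding is_tri_hull[OF that] by simp
 let ?V = "wgrad \<Omega> (0, 0) u"
 define e where "e = Qh \<T> u - uh"
 have Q0: "Qh \<T> u \<in> Vh0 \<Omega> \<T>" by (rule Qh_Vh0[OF \<Omega> mesh u(1)])
 have uh0: "uh \<in> Vh0 \<Omega> \<T>" using uh by (simp add: wg_solution_def)
 have e0: "e \<in> Vh0 \<Omega> \<T>" unfolding e_def by (rule Vh0_diff[OF Q0 uh0])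
 have edgeE: "E \<in> edges \<T>" if "T \<in> \<T>" "E edge_of T" for T E using that by (auto simp: edges_def)
 \<comment> \<open>Everything known on one triangle, packed so that a single choice yields all
   parameters. The last clause combines \<open>Qh_flux\<close> with linearity in the jump.\<close>
 define \<Phi> where "\<Phi> T pu pe c \<longleftrightarrow> weak_grad uh T = zero_ext T (aff pu) \<and> weak_grad e T = zero_ext T (aff pe) \<and> fst e T = zero_ext T (\<lambda>_. c) \<and>
  (\<forall>q. mass T pe q = (\<Sum>E | E edge_of T. flux T E (\<lambda>x. snd e E x - c) (aff_comp q) (aff_const_grad q))) \<and>
  (\<forall>q. mass T pe q = (LBINT x:T. ?V x \<bullet> aff q x) - mass T pu q)" for T pu pe c
 have "\<forall>T\<in>\<T>. \<exists>t. \<Phi> T (fst t) (fst (snd t)) (snd (snd t))"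
 proof
  fix T assume T: "T \<in> \<T>"
  obtain A B C where P: "is_tri T A B C" using tri[OF T] by blast
  obtain cQ where cQ: "fst (Qh \<T> u) T = zero_ext T (\<lambda>_. cQ)" using Vh0D(1)[OF Q0 T] by blast
  obtain cu where cu: "fst uh T = zero_ext T (\<lambda>_. cu)" using Vh0D(1)[OF uh0 T] by blast
  have ce: "fst e T = zero_ext T (\<lambda>_. cQ - cu)" by (simp add: e_def cQ cu fun_eq_iff)
  obtain pu where pu: "weak_grad uh T = zero_ext T (aff pu)"
   "\<And>q. mass T pu q = (\<Sum>E | E edge_of T. flux T E (\<lambda>x. snd uh E x - cu) (aff_comp q) (aff_const_grad q))"
   by (rule weak_grad_triangle[OF P cu Vh0D(3)[OF uh0 edgeE[OF T]]], assumption) (rule that)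
  obtain pe where pe: "weak_grad e T = zero_ext T (aff pe)"
   "\<And>q. mass T pe q = (\<Sum>E | E edge_of T. flux T E (\<lambda>x. snd e E x - (cQ - cu)) (aff_comp q) (aff_const_grad q))"
   by (rule weak_grad_triangle[OF P ce Vh0D(3)[OF e0 edgeE[OF T]]], assumption) (rule that)
  have se: "snd e E x - (cQ - cu) = (snd (Qh \<T> u) E x - cQ) - (snd uh E x - cu)" for E x by (simp add: e_def)
  have "mass T pe q = (LBINT x:T. ?V x \<bullet> aff q x) - mass T pu q" for q
   unfolding pe(2) se pu(2) Qh_flux[OF \<Omega> mesh u(1) T P cQ, symmetric] by (rule flux_diff_left[OF P])
  then have "\<Phi> T pu pe (cQ - cu)" unfolding \<Phi>_def using pu(1) pe ce by blast
  then show "\<exists>t. \<Phi> T (fst t) (fst (snd t)) (snd (snd t))" by (intro exI[of _ "(pu, pe, cQ - cu)"]) simp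
 qed
 from bchoice[OF this] obtain t where t: "\<forall>T\<in>\<T>. \<Phi> T (fst (t T)) (fst (snd (t T))) (snd (snd (t T)))" ..
 define PU PE c where "PU T = fst (t T)" and "PE T = fst (snd (t T))" and "c T = snd (snd (t T))" for T
 have wu: "weak_grad uh T = zero_ext T (aff (PU T))" and we: "weak_grad e T = zero_ext T (aff (PE T))"
  and ce: "fst e T = zero_ext T (\<lambda>_. c T)"
  and me: "mass T (PE T) q = (\<Sum>E | E edge_of T. flux T E (\<lambda>x. snd e E x - c T) (aff_comp q) (aff_const_grad q))"
  and md: "mass T (PE T) q = (LBINT x:T. ?V x \<bullet> aff q x) - mass T (PU T) q" if "T \<in> \<T>" for T q
  using t[rule_format, OF that] unfolding \<Phi>_def PU_def PE_def c_def by blast+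
 have inner: "L2_inner (lebesgue_on T) (zero_ext T (aff p)) (zero_ext T (aff q)) = mass T p q" if "T \<in> \<T>" for T p q
 proof -
  obtain A B C where P: "is_tri T A B C" using tri[OF \<open>T \<in> \<T>\<close>] by blast
  show ?thesis unfolding mass_def by (rule L2_inner_triangle[OF Tb[OF P]]) auto
 qed
 \<comment> \<open>\<open>?F\<close> is minus the Laplacian in Borel form; by the differential
   equation it represents \<open>f\<close>.\<close>
 let ?E = "energy_norm \<T> e" and ?F = "\<lambda>x. - (G 1 x $ 1 + G 2 x $ 2)"
 define n where "n T = sq_norm T (aff (PE T))" for T
 have nsq: "(n T)^2 = mass T (PE T) (PE T)" for T by (simp add: n_def sq_norm_sq mass_def power2_norm_eq_inner)
 have E2: "?E^2 = (\<Sum>T\<in>\<T>. (n T)^2)"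
  unfolding energy_norm_def nsq by (simp add: sum_nonneg L2_inner_self_nonneg) (rule sum.cong[OF refl], simp only: we inner)
 have Gint: "integrable lborel (\<lambda>x. G j x $ j)" for j using H1_funD(7)[OF H, of j "axis j 1"] by (simp add: inner_axis)
 have Fint: "integrable lborel ?F" by (rule Bochner_Integration.integrable_minus[OF Bochner_Integration.integrable_add[OF Gint[of 1] Gint[of 2]]])
 have fF: "AE x in lebesgue_on \<Omega>. f x = ?F x"
 proof -
  have \<Omega>l: "\<Omega> \<inter> space lebesgue \<in> sets lebesgue" using o by (simp add: sets_completionI_sets)
  have le: "fst (2::nat, 0::nat) + snd (2::nat, 0::nat) \<le> 2" "fst (0::nat, 2::nat) + snd (0::nat, 2::nat) \<le> 2" by auto
  have G12: "G 1 x $ 1 = wderiv \<Omega> (2, 0) u x" "G 2 x $ 2 = wderiv \<Omega> (0, 2) u x" for x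
   by (simp_all add: G_def wgrad_component unit_index_def numeral_2_eq_2)
  have "AE x in lborel. x \<in> \<Omega> --> - laplacian \<Omega> u x = f x" using f unfolding AE_restrict_space_iff[OF \<Omega>l] AE_completion_iff .
  then have "AE x in lborel. x \<in> \<Omega> --> f x = ?F x" using wderiv_props(5)[OF o u(2) le(1)] wderiv_props(5)[OF o u(2) le(2)]
   by eventually_elim (simp add: laplacian_def G12)
  then show ?thesis unfolding AE_restrict_space_iff[OF \<Omega>l] AE_completion_iff .
 qed
 have gal: "(\<Sum>T\<in>\<T>. mass T (PU T) (PE T)) = (\<Sum>T\<in>\<T>. c T * (LBINT x:T. ?F x))"
 proof -
  have "(\<Sum>T\<in>\<T>. L2_inner (lebesgue_on T) (weak_grad uh T) (weak_grad e T)) = L2_inner (lebesgue_on \<Omega>) f (piecewise \<T> (fst e))"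
   using uh e0 by (simp add: wg_solution_def)
  also have "\<dots> = (\<Sum>T\<in>\<T>. c T * (LBINT x:T. ?F x))" by (rule L2_inner_piecewise[OF \<Omega> mesh Fint fF ce])
  also have "(\<Sum>T\<in>\<T>. L2_inner (lebesgue_on T) (weak_grad uh T) (weak_grad e T)) = (\<Sum>T\<in>\<T>. mass T (PU T) (PE T))"
   by (rule sum.cong[OF refl]) (simp only: wu we inner)
  finally show ?thesis .
 qed
 \<comment> \<open>The flux of grad u weighted with the jump of the error.\<close>
 define L where "L T = (\<Sum>E | E edge_of T. flux T E (\<lambda>x. snd e E x - c T) w G)" for T
 have Ti: "set_integrable lborel T (w j)" "set_integrable lborel T (G j)" if P: "is_tri T A B C" for T A B C j
  by (rule integrable_imp_set_integrable[OF H1_funD(1)[OF H] Tb[OF P]], rule integrable_imp_set_integrable[OF H1_funD(3)[OF H] Tb[OF P]])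
 have sumL: "(\<Sum>T\<in>\<T>. L T) = (\<Sum>T\<in>\<T>. c T * (LBINT x:T. ?F x))"
 proof -
  \<comment> \<open>Splitting the jump: the part with the edge values cancels over the mesh, the
    part with the constant is the divergence theorem. So the fluxes sum to the right-hand side of
    the scheme.\<close>
  have "L T = (\<Sum>E | E edge_of T. flux T E (snd e E) w G) + c T * (LBINT x:T. ?F x)" if T: "T \<in> \<T>" for T
  proof -
   obtain A B C where P: "is_tri T A B C" using tri[OF T] by blast
   have gi: "set_integrable lborel T (\<lambda>x. G j x $ j)" for j by (rule integrable_imp_set_integrable[OF Gint Tb[OF P]])
   have FI: "(LBINT x:T. ?F x) = - ((LBINT x:T. G 1 x $ 1) + (LBINT x:T. G 2 x $ 2))"
    unfolding set_integral_add(2)[OF gi[of 1] gi[of 2], symmetric] unfolding set_lebesgue_integral_def scaleR_minus_right by (rule Bochner_Integration.integral_minus)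
   show ?thesis unfolding L_def flux_diff_const[OF P] flux_divergence[OF P Ti[OF P]] FI by (simp only: mult_minus_right diff_conv_add_uminus)
  qed
  then have "(\<Sum>T\<in>\<T>. L T) = (\<Sum>T\<in>\<T>. \<Sum>E | E edge_of T. flux T E (snd e E) w G) + (\<Sum>T\<in>\<T>. c T * (LBINT x:T. ?F x))"
   by (simp add: sum.distrib)
  moreover have "(\<Sum>T\<in>\<T>. \<Sum>E | E edge_of T. flux T E (snd e E) w G) = 0" by (rule flux_sum_zero[OF \<Omega> mesh H]) (rule Vh0D(5)[OF e0])
  ultimately show ?thesis by simp
 qed
 have bound: "(LBINT x:T. ?V x \<bullet> aff (PE T) x) - L T \<le> (1 + 18 * \<bar>\<sigma>\<bar>) * (R T * n T)" if T: "T \<in> \<T>" for T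
 proof -
  obtain A B C where P: "is_tri T A B C" using tri[OF T] by blast
  have hull: "T = convex hull {A, B, C}" by (rule is_tri_hull[OF P])
  have Tc: "compact T" unfolding hull by (rule compact_triangle)
  obtain q where q: "(\<Sum>j\<in>UNIV. diameter T * sq_norm T (\<lambda>x. G j x - aff_grad q j) + sq_norm T (\<lambda>x. w j x - aff q x $ j)) \<le> R T"
   using R[OF T] by blast
  let ?S = "\<Sum>j\<in>UNIV. diameter T * sq_norm T (\<lambda>x. G j x - aff_grad q j) + sq_norm T (\<lambda>x. w j x - aff q x $ j)"
  have sV: "sq_integrable T ?V" by (rule sq_integrable_H1_fun(2)[OF H1_fun_wderiv[OF o u1] Tb[OF P]]) simp
  have sa: "sq_integrable T (aff p)" for p by (rule sq_integrable_continuous[OF Tc continuous_on_aff])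
  have sd: "sq_integrable T (\<lambda>x. ?V x - aff q x)" by (rule sq_integrable_diff[OF sV sa Tb[OF P]])
  have sw: "sq_integrable T (\<lambda>x. w j x - aff q x $ j)" "sq_integrable T (\<lambda>x. G j x - aff_grad q j)" for j
  proof -
   show "sq_integrable T (\<lambda>x. w j x - aff q x $ j)"
    by (intro sq_integrable_diff sq_integrable_H1_fun(1)[OF H] sq_integrable_continuous[OF Tc] Tb[OF P] continuous_intros)
   show "sq_integrable T (\<lambda>x. G j x - aff_grad q j)"
    by (intro sq_integrable_diff sq_integrable_H1_fun(2)[OF H] sq_integrable_continuous[OF Tc] Tb[OF P] continuous_intros)
  qed
  have ai: "set_integrable lborel T (aff_comp q j)" "set_integrable lborel T (aff_const_grad q j)" for j
   by (rule sq_integrable_set_integrable[OF sq_integrable_continuous[OF Tc] Tc], intro continuous_intros)+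
  have Vw: "?V x $ j = w j x" for x j by (simp add: wgrad_component w_def)
  \<comment> \<open>The mass term is the flux of \<open>q\<close> with the same weight, by the
    definition of the weak gradient. Subtracting it replaces grad u by grad u minus
    \<open>q\<close>.\<close>
  have eqF: "(\<Sum>E | E edge_of T. flux T E (\<lambda>x. snd e E x - c T) (\<lambda>j x. w j x - aff q x $ j) (\<lambda>j x. G j x - aff_grad q j)) = L T - mass T (PE T) q"
   unfolding flux_diff[OF P Ti(1)[OF P] ai(1) Ti(2)[OF P] ai(2)] me[OF T] L_def ..
  have b1: "\<bar>L T - mass T (PE T) q\<bar> \<le> 18 * ((diameter T)^2 / \<bar>dbl_area A B C\<bar>) * n T * ?S"
   unfolding eqF[symmetric] n_def by (rule flux_bound[OF P me[OF T] sw])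
  have S0: "0 \<le> ?S" by (intro sum_nonneg add_nonneg_nonneg mult_nonneg_nonneg sq_norm_nonneg is_tri_dist_le_diameter(3)[OF P])
  have n0: "0 \<le> n T" by (simp add: n_def sq_norm_nonneg)
  have "diameter T \<le> \<sigma> * inscribed_diameter T" using sr T by (simp add: shape_regular_def)
  then have area: "(diameter T)^2 / \<bar>dbl_area A B C\<bar> \<le> \<bar>\<sigma>\<bar>" by (rule shape_regular_area[OF P])
  have "18 * ((diameter T)^2 / \<bar>dbl_area A B C\<bar>) * n T * ?S \<le> 18 * \<bar>\<sigma>\<bar> * n T * R T"
   by (intro mult_mono area q order_refl mult_nonneg_nonneg n0 S0) auto
  then have b2: "\<bar>L T - mass T (PE T) q\<bar> \<le> 18 * \<bar>\<sigma>\<bar> * (R T * n T)" using b1 by (simp add: mult_ac)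
  \<comment> \<open>The same \<open>q\<close> is inserted in the volume term; by symmetry of
    \<open>mass\<close> its two occurrences cancel in the difference.\<close>
  have "(LBINT x:T. (?V x - aff q x) \<bullet> aff (PE T) x) = (LBINT x:T. ?V x \<bullet> aff (PE T) x) - mass T q (PE T)"
   unfolding inner_diff_left mass_def by (rule set_integral_diff(2)) (intro sq_integrable_inner sV sa Tb[OF P])+
  moreover have "mass T q (PE T) = mass T (PE T) q" by (simp add: mass_def inner_commute)
  moreover have "\<bar>LBINT x:T. (?V x - aff q x) \<bullet> aff (PE T) x\<bar> \<le> sq_norm T (\<lambda>x. ?V x - aff q x) * n T"
   unfolding n_def by (rule sq_integrable_Cauchy_Schwarz[OF sd sa Tb[OF P]])
  moreover have "sq_norm T (\<lambda>x. ?V x - aff q x) \<le> R T"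
  proof -
   have "sq_norm T (\<lambda>x. ?V x - aff q x) \<le> (\<Sum>k\<in>UNIV. sq_norm T (\<lambda>x. (?V x - aff q x) $ k))" by (rule sq_norm_vec2(3)[OF sd Tb[OF P]])
   also have "\<dots> \<le> ?S" unfolding vector_minus_component Vw
    by (rule sum_mono) (simp add: mult_nonneg_nonneg[OF is_tri_dist_le_diameter(3)[OF P] sq_norm_nonneg])
   finally show ?thesis using q by linarith
  qed
  then have "sq_norm T (\<lambda>x. ?V x - aff q x) * n T \<le> R T * n T" by (rule mult_right_mono[OF _ n0])
  ultimately have "(LBINT x:T. ?V x \<bullet> aff (PE T) x) - L T \<le> R T * n T + 18 * \<bar>\<sigma>\<bar> * (R T * n T)" using b2 by linarith
  then show ?thesis by (simp add: algebra_simps)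
 qed
 \<comment> \<open>The discrete gradient tested with the error becomes the sum of the fluxes
   \<open>L\<close>, through the scheme \<open>gal\<close> and \<open>sumL\<close>.\<close>
 have "?E^2 = (\<Sum>T\<in>\<T>. (LBINT x:T. ?V x \<bullet> aff (PE T) x) - mass T (PU T) (PE T))" unfolding E2 nsq by (rule sum.cong[OF refl]) (rule md)
 also have "\<dots> = (\<Sum>T\<in>\<T>. (LBINT x:T. ?V x \<bullet> aff (PE T) x) - L T)" unfolding sum_subtractf gal sumL ..
 also have "\<dots> \<le> (\<Sum>T\<in>\<T>. (1 + 18 * \<bar>\<sigma>\<bar>) * (R T * n T))" by (rule sum_mono[OF bound])
 also have "\<dots> = (1 + 18 * \<bar>\<sigma>\<bar>) * (\<Sum>T\<in>\<T>. R T * n T)" by (simp add: sum_distrib_left)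
 also have "(\<Sum>T\<in>\<T>. R T * n T) \<le> sqrt (\<Sum>T\<in>\<T>. (R T)^2) * ?E"
 proof -
  have "(\<Sum>T\<in>\<T>. R T * n T)^2 \<le> (\<Sum>T\<in>\<T>. (R T)^2) * ?E^2" unfolding E2 by (rule Cauchy_Schwarz_ineq_sum)
  then have "(\<Sum>T\<in>\<T>. R T * n T) \<le> sqrt ((\<Sum>T\<in>\<T>. (R T)^2) * ?E^2)" by (rule real_le_rsqrt)
  moreover have "0 \<le> ?E" by (simp add: energy_norm_def sum_nonneg L2_inner_self_nonneg)
  ultimately show ?thesis by (simp add: real_sqrt_mult)
 qed
 finally have fin_le: "?E^2 \<le> (1 + 18 * \<bar>\<sigma>\<bar>) * sqrt (\<Sum>T\<in>\<T>. (R T)^2) * ?E" by (simp add: mult.assoc mult_left_mono)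
 show ?thesis
 proof (cases "?E = 0")
  case True
  have "0 \<le> (1 + 18 * \<bar>\<sigma>\<bar>) * sqrt (\<Sum>T\<in>\<T>. (R T)^2)" by (simp add: sum_nonneg)
  then show ?thesis using True unfolding e_def by simp
 next
  case False
  moreover have "0 \<le> ?E" by (simp add: energy_norm_def sum_nonneg L2_inner_self_nonneg)
  ultimately have "0 < ?E" by simp
  then show ?thesis using fin_le unfolding power2_eq_square e_def[symmetric] by (simp only: mult_le_cancel_right_pos)
 qed
qed

section \<open>Local approximation and the rate of convergence\<close>

lemma wderiv_integral_le:
 assumes \<Omega>: "open \<Omega>" "bounded \<Omega>" and u: "u \<in> Hk k \<Omega>" and \<alpha>: "fst \<alpha> + snd \<alpha> \<le> k"
 shows "(LBINT x. (wderiv \<Omega> \<alpha> u x)^2) \<le> (Hk_norm k \<Omega> u)^2"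
 unfolding Hk_norm_eq[OF \<Omega> u] by (rule member_le_sum) (use \<alpha> finite_multi_indices in \<open>auto simp: multi_indices_def\<close>)

lemma wgrad_integral_le:
 assumes \<Omega>: "open \<Omega>" "bounded \<Omega>" and u: "u \<in> Hk k \<Omega>" and \<alpha>: "fst \<alpha> + snd \<alpha> < k"
 shows "(LBINT x. (norm (wgrad \<Omega> \<alpha> u x))^2) \<le> 2 * (Hk_norm k \<Omega> u)^2"
proof -
 have le: "fst (Suc (fst \<alpha>), snd \<alpha>) + snd (Suc (fst \<alpha>), snd \<alpha>) \<le> k" "fst (fst \<alpha>, Suc (snd \<alpha>)) + snd (fst \<alpha>, Suc (snd \<alpha>)) \<le> k"
  using \<alpha> by auto
 have "(LBINT x. (norm (wgrad \<Omega> \<alpha> u x))^2)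
   = (LBINT x. (wderiv \<Omega> (Suc (fst \<alpha>), snd \<alpha>) u x)^2) + (LBINT x. (wderiv \<Omega> (fst \<alpha>, Suc (snd \<alpha>)) u x)^2)"
  using Bochner_Integration.integral_add[OF wderiv_props(4)[OF \<Omega> u le(1)] wderiv_props(4)[OF \<Omega> u le(2)]] by (simp add: norm_vec2_sq wgrad_def)
 also have "\<dots> \<le> 2 * (Hk_norm k \<Omega> u)^2" using wderiv_integral_le[OF \<Omega> u le(1)] wderiv_integral_le[OF \<Omega> u le(2)] by simp
 finally show ?thesis .
qed

text \<open>The approximating field is constant on \<open>T\<close>, so its gradient error is the
  full second derivative with factor 1; Poincare contributes the factor 2.\<close>

lemma first_order_approximation:
 assumes \<Omega>: "open \<Omega>" "bounded \<Omega>" and u: "u \<in> Hk 2 \<Omega>" and T: "is_tri T A B C" "interior T \<subseteq> \<Omega>"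
 shows "\<exists>q. (\<Sum>j\<in>UNIV. diameter T * sq_norm T (\<lambda>x. wgrad \<Omega> (unit_index j) u x - aff_grad q j)
   + sq_norm T (\<lambda>x. wderiv \<Omega> (unit_index j) u x - aff q x $ j))
  \<le> 3 * diameter T * (\<Sum>j\<in>UNIV. sq_norm T (wgrad \<Omega> (unit_index j) u))"
proof -
 have H: "H1_fun (interior T) (wderiv \<Omega> (unit_index j) u) (wgrad \<Omega> (unit_index j) u)" for j
  by (rule H1_fun_mono[OF H1_fun_wderiv[OF \<Omega> u] T(2)]) (simp add: unit_index_le)
 have "\<forall>j. \<exists>m. sq_norm T (\<lambda>x. wderiv \<Omega> (unit_index j) u x - m) \<le> 2 * diameter T * sq_norm T (wgrad \<Omega> (unit_index j) u)"
  using poincare_triangle[OF T(1) H] by blast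
 from choice[OF this] obtain m where m: "\<forall>j. sq_norm T (\<lambda>x. wderiv \<Omega> (unit_index j) u x - m j) \<le> 2 * diameter T * sq_norm T (wgrad \<Omega> (unit_index j) u)" ..
 let ?q = "((\<chi> j. m j) :: real^2, 0 :: real^2, 0 :: real^2)"
 have q: "aff_grad ?q j = 0" "aff ?q x $ j = m j" for j x by (simp_all add: aff_grad_def aff_def vec2_eq_iff)
 have "(\<Sum>j\<in>UNIV. diameter T * sq_norm T (\<lambda>x. wgrad \<Omega> (unit_index j) u x - aff_grad ?q j) + sq_norm T (\<lambda>x. wderiv \<Omega> (unit_index j) u x - aff ?q x $ j))
   \<le> (\<Sum>j\<in>UNIV. diameter T * sq_norm T (wgrad \<Omega> (unit_index j) u) + 2 * diameter T * sq_norm T (wgrad \<Omega> (unit_index j) u))"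
  unfolding q diff_zero by (intro sum_mono add_left_mono m[rule_format])
 also have "\<dots> = 3 * diameter T * (\<Sum>j\<in>UNIV. sq_norm T (wgrad \<Omega> (unit_index j) u))"
  unfolding sum_distrib_left by (rule sum.cong[OF refl]) (simp add: algebra_simps)
 finally show ?thesis by (rule exI)
qed

text \<open>The gradient error contributes 2 and the function error, after two uses of Poincare,
  contributes 4 times the squared diameter. The pairs given by
  \<open>poincare_triangle_second\<close> for the two components of grad u are assembled into one
  affine field.\<close>

lemma second_order_approximation:
 assumes \<Omega>: "open \<Omega>" "bounded \<Omega>" and u: "u \<in> Hk 3 \<Omega>" and T: "is_tri T A B C" "interior T \<subseteq> \<Omega>"
 defines "D \<equiv> \<lambda>j k. wgrad \<Omega> (fst (unit_index j) + fst (unit_index k), snd (unit_index j) + snd (unit_index k)) u"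
 shows "\<exists>q. (\<Sum>j\<in>UNIV. diameter T * sq_norm T (\<lambda>x. wgrad \<Omega> (unit_index j) u x - aff_grad q j)
   + sq_norm T (\<lambda>x. wderiv \<Omega> (unit_index j) u x - aff q x $ j))
  \<le> 6 * (diameter T)^2 * (\<Sum>j\<in>UNIV. sqrt (\<Sum>k\<in>UNIV. (sq_norm T (D j k))^2))"
proof -
 let ?h = "diameter T" and ?R = "\<lambda>j. sqrt (\<Sum>k\<in>UNIV. (sq_norm T (D j k))^2)"
 have h: "0 \<le> ?h" by (rule is_tri_dist_le_diameter(3)[OF T(1)])
 have H: "H1_fun (interior T) (wderiv \<Omega> (unit_index j) u) (wgrad \<Omega> (unit_index j) u)" for j
  by (rule H1_fun_mono[OF H1_fun_wderiv[OF \<Omega> u] T(2)]) (simp add: unit_index_le)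
 have H2: "H1_fun (interior T) (\<lambda>x. wgrad \<Omega> (unit_index j) u x $ k) (D j k)" for j k unfolding wgrad_component D_def
  by (rule H1_fun_mono[OF H1_fun_wderiv[OF \<Omega> u] T(2)]) (simp add: unit_index_def)
 have "\<forall>j. \<exists>p. sq_norm T (\<lambda>x. wgrad \<Omega> (unit_index j) u x - snd p) \<le> 2 * ?h * ?R j
   \<and> sq_norm T (\<lambda>x. wderiv \<Omega> (unit_index j) u x - (fst p + snd p \<bullet> x)) \<le> 2 * ?h * (2 * ?h * ?R j)"
  using poincare_triangle_second[OF T(1) H H2] by simp
 from choice[OF this] obtain p where p: "\<forall>j. sq_norm T (\<lambda>x. wgrad \<Omega> (unit_index j) u x - snd (p j)) \<le> 2 * ?h * ?R j
   \<and> sq_norm T (\<lambda>x. wderiv \<Omega> (unit_index j) u x - (fst (p j) + snd (p j) \<bullet> x)) \<le> 2 * ?h * (2 * ?h * ?R j)" ..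
 let ?q = "((\<chi> j. fst (p j)) :: real^2, (\<chi> j. snd (p j) $ 1) :: real^2, (\<chi> j. snd (p j) $ 2) :: real^2)"
 have q: "aff_grad ?q j = snd (p j)" "aff ?q x $ j = fst (p j) + snd (p j) \<bullet> x" for j x by (simp_all add: aff_grad_def aff_def vec2_eq_iff inner_vec2)
 have "(\<Sum>j\<in>UNIV. ?h * sq_norm T (\<lambda>x. wgrad \<Omega> (unit_index j) u x - aff_grad ?q j) + sq_norm T (\<lambda>x. wderiv \<Omega> (unit_index j) u x - aff ?q x $ j))
   \<le> (\<Sum>j\<in>UNIV. ?h * (2 * ?h * ?R j) + 2 * ?h * (2 * ?h * ?R j))"
  unfolding q by (intro sum_mono add_mono mult_left_mono conjunct1[OF p[rule_format]] conjunct2[OF p[rule_format]] h)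
 also have "\<dots> = 6 * ?h^2 * (\<Sum>j\<in>UNIV. ?R j)" unfolding sum_distrib_left by (rule sum.cong[OF refl]) (simp add: power2_eq_square algebra_simps)
 finally show ?thesis by (rule exI)
qed

text \<open>The factor 6 in \<open>R\<close> covers both local estimates. Squared, with
  \<open>(a + b)^2 \<le> 2 a^2 + 2 b^2\<close> over the two components and \<open>4 * ?N^2\<close>
  for each of them, it gives \<open>36 * 16\<close>, the square of 24.\<close>

lemma energy_error_order:
 assumes \<Omega>: "polygonal_domain \<Omega>" and mesh: "conforming_mesh \<Omega> \<T>" and sr: "shape_regular \<sigma> \<T>"
  and i: "i \<in> {0, 1}" and u: "u \<in> H1_0 \<Omega>" "u \<in> Hk (2 + i) \<Omega>"
  and f: "AE x in lebesgue_on \<Omega>. - laplacian \<Omega> u x = f x" and uh: "wg_solution \<Omega> \<T> f uh"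
 shows "energy_norm \<T> (Qh \<T> u - uh) \<le> 24 * (1 + 18 * \<bar>\<sigma>\<bar>) * mesh_size \<T> ^ (1 + i) * Hk_norm (2 + i) \<Omega> u"
proof -
 have o: "open \<Omega>" "bounded \<Omega>" using \<Omega> by (auto simp: polygonal_domain_def)
 have fin: "finite \<T>" by (rule finite_edges(1)[OF \<Omega> mesh])
 have u2: "u \<in> Hk 2 \<Omega>" using u(2) by (auto simp: Hk_def multi_indices_def)
 let ?N = "Hk_norm (2 + i) \<Omega> u" and ?H = "mesh_size \<T>"
 define D where "D j k = wgrad \<Omega> (fst (unit_index j) + fst (unit_index k), snd (unit_index j) + snd (unit_index k)) u" for j k
 define S where "S j T = (if i = 0 then sq_norm T (wgrad \<Omega> (unit_index j) u) else sqrt (\<Sum>k\<in>UNIV. (sq_norm T (D j k))^2))" for j T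
 define R where "R T = 6 * ?H ^ (1 + i) * (\<Sum>j\<in>UNIV. S j T)" for T
 have S0: "0 \<le> S j T" for j T by (simp add: S_def sq_norm_nonneg sum_nonneg)
 \<comment> \<open>Each gradient has two components bounded by the full norm, a factor 2. For
   \<open>i = 1\<close> two gradients are summed, a factor 4, which also covers
   \<open>i = 0\<close>.\<close>
 have SS: "(\<Sum>T\<in>\<T>. (S j T)^2) \<le> 4 * ?N^2" for j
 proof (cases "i = 0")
  case True
  have le: "fst (unit_index j) + snd (unit_index j) < 2 + i" by (simp add: unit_index_le)
  note H = H1_funD[OF H1_fun_wderiv[OF o u(2) le]]
  have "(\<Sum>T\<in>\<T>. (S j T)^2) \<le> (LBINT x. (norm (wgrad \<Omega> (unit_index j) u x))^2)"
   using sum_sq_norm_le[OF \<Omega> mesh H(6,4)] True by (simp add: S_def)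
  also have "\<dots> \<le> 2 * ?N^2" by (rule wgrad_integral_le[OF o u(2) le])
  finally show ?thesis using zero_le_power2[of ?N] by linarith
 next
  case False
  then have i1: "i = 1" using i by simp
  have D: "(\<Sum>T\<in>\<T>. (sq_norm T (D j k))^2) \<le> 2 * ?N^2" for k
  proof -
   let ?a = "(fst (unit_index j) + fst (unit_index k), snd (unit_index j) + snd (unit_index k))"
   have le: "fst ?a + snd ?a < 2 + i" using i1 by (simp add: unit_index_def)
   note H = H1_funD[OF H1_fun_wderiv[OF o u(2) le]]
   show ?thesis using sum_sq_norm_le[OF \<Omega> mesh H(6,4)] wgrad_integral_le[OF o u(2) le] unfolding D_def by linarith
  qed
  have "(\<Sum>T\<in>\<T>. (S j T)^2) = (\<Sum>T\<in>\<T>. \<Sum>k\<in>UNIV. (sq_norm T (D j k))^2)" using False by (simp add: S_def sum_nonneg)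
  also have "\<dots> = (\<Sum>k\<in>UNIV. \<Sum>T\<in>\<T>. (sq_norm T (D j k))^2)" by (rule sum.swap)
  also have "\<dots> \<le> 4 * ?N^2" using D[of 1] D[of 2] by (simp add: sum_2)
  finally show ?thesis .
 qed
 have h: "diameter T \<le> ?H" if "T \<in> \<T>" for T unfolding mesh_size_def using fin that by (intro Max_ge) auto
 have approx: "\<exists>q. (\<Sum>j\<in>UNIV. diameter T * sq_norm T (\<lambda>x. wgrad \<Omega> (unit_index j) u x - aff_grad q j) + sq_norm T (\<lambda>x. wderiv \<Omega> (unit_index j) u x - aff q x $ j)) \<le> R T"
  if T: "T \<in> \<T>" for T
 proof -
  obtain A B C where P: "is_tri T A B C" using simplex_is_tri[OF conforming_mesh_triangle(1)[OF \<Omega> mesh T]] .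
  note sub = conforming_mesh_triangle(3)[OF \<Omega> mesh T]
  have h0: "0 \<le> diameter T" by (rule is_tri_dist_le_diameter(3)[OF P])
  have R': "c * (\<Sum>j\<in>UNIV. S j T) \<le> R T" if "c \<le> 6 * ?H ^ (1 + i)" for c unfolding R_def using that by (intro mult_right_mono sum_nonneg S0)
  show ?thesis
  proof (cases "i = 0")
   case True
   obtain q where q: "(\<Sum>j\<in>UNIV. diameter T * sq_norm T (\<lambda>x. wgrad \<Omega> (unit_index j) u x - aff_grad q j) + sq_norm T (\<lambda>x. wderiv \<Omega> (unit_index j) u x - aff q x $ j))
     \<le> 3 * diameter T * (\<Sum>j\<in>UNIV. S j T)" using first_order_approximation[OF o u2 P sub] True by (auto simp: S_def)
   have "3 * diameter T \<le> 6 * ?H ^ (1 + i)" using h[OF T] h0 True by simp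
   from order_trans[OF q R'[OF this]] show ?thesis by (rule exI)
  next
   case False
   then have i1: "i = 1" using i by simp
   then have u3: "u \<in> Hk 3 \<Omega>" using u(2) by (simp add: numeral_3_eq_3)
   obtain q where q: "(\<Sum>j\<in>UNIV. diameter T * sq_norm T (\<lambda>x. wgrad \<Omega> (unit_index j) u x - aff_grad q j) + sq_norm T (\<lambda>x. wderiv \<Omega> (unit_index j) u x - aff q x $ j))
     \<le> 6 * (diameter T)^2 * (\<Sum>j\<in>UNIV. S j T)" using second_order_approximation[OF o u3 P sub] False unfolding S_def D_def by auto
   have "6 * (diameter T)^2 \<le> 6 * ?H ^ (1 + i)" using power_mono[OF h[OF T] h0, of 2] i1 by (simp add: numeral_2_eq_2)
   from order_trans[OF q R'[OF this]] show ?thesis by (rule exI)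
  qed
 qed
 \<comment> \<open>\<open>mesh_size\<close> is a maximum, with a sign known only for a nonempty
   mesh; an empty one would make \<Omega> empty.\<close>
 have H0: "0 \<le> ?H ^ (1 + i)"
 proof (cases "\<T> = {}")
  case True
  then have "\<Omega> = {}" using mesh closure_subset[of \<Omega>] by (simp add: conforming_mesh_def)
  then show ?thesis using \<Omega> by (simp add: polygonal_domain_def)
 next
  case False
  then obtain T where T: "T \<in> \<T>" by blast
  obtain A B C where P: "is_tri T A B C" using simplex_is_tri[OF conforming_mesh_triangle(1)[OF \<Omega> mesh T]] .
  show ?thesis using order_trans[OF is_tri_dist_le_diameter(3)[OF P] h[OF T]] by (rule zero_le_power)
 qed
 have N0: "0 \<le> ?N" by (simp add: Hk_norm_def sum_nonneg)
 have "(\<Sum>T\<in>\<T>. (R T)^2) = 36 * (?H ^ (1 + i))^2 * (\<Sum>T\<in>\<T>. (\<Sum>j\<in>UNIV. S j T)^2)"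
  unfolding R_def power_mult_distrib by (simp add: sum_distrib_left)
 also have "\<dots> \<le> 36 * (?H ^ (1 + i))^2 * (\<Sum>T\<in>\<T>. 2 * (S 1 T)^2 + 2 * (S 2 T)^2)"
 proof (intro mult_left_mono sum_mono)
  show "(\<Sum>j\<in>UNIV. S j T)^2 \<le> 2 * (S 1 T)^2 + 2 * (S 2 T)^2" for T using sum_squares_bound[of "S 1 T" "S 2 T"] by (simp add: sum_2 power2_sum)
 qed simp
 also have "\<dots> \<le> 36 * (?H ^ (1 + i))^2 * (16 * ?N^2)"
  using SS[of 1] SS[of 2] by (intro mult_left_mono) (simp_all add: sum.distrib sum_distrib_left[symmetric])
 also have "\<dots> = (24 * ?H ^ (1 + i) * ?N)^2" by (simp add: power_mult_distrib)
 finally have "sqrt (\<Sum>T\<in>\<T>. (R T)^2) \<le> 24 * ?H ^ (1 + i) * ?N" using H0 N0 by (intro real_le_lsqrt) auto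
 then have "(1 + 18 * \<bar>\<sigma>\<bar>) * sqrt (\<Sum>T\<in>\<T>. (R T)^2) \<le> (1 + 18 * \<bar>\<sigma>\<bar>) * (24 * ?H ^ (1 + i) * ?N)"
  by (rule mult_left_mono) simp
 with energy_error_bound[OF \<Omega> mesh sr u(1) u2 f uh approx]
 have "energy_norm \<T> (Qh \<T> u - uh) \<le> (1 + 18 * \<bar>\<sigma>\<bar>) * (24 * ?H ^ (1 + i) * ?N)" by (rule order_trans)
 then show ?thesis by (simp only: mult_ac)
qed

theorem theorem4p2:
  fixes \<Omega> :: "(real^2) set" and \<sigma> \<tau> :: real and i :: nat
  assumes "polygonal_domain \<Omega>" and "i \<in> {0, 1}"
  shows "\<exists>C>0. \<forall>\<T> f u uh.
           conforming_mesh \<Omega> \<T> \<longrightarrow> shape_regular \<sigma> \<T> \<longrightarrow> quasi_uniform \<tau> \<T> \<longrightarrow>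
           f \<in> L2 (lebesgue_on \<Omega>) \<longrightarrow>
           u \<in> Hk (2 + i) \<Omega> \<inter> H1_0 \<Omega> \<longrightarrow>
           (AE x in lebesgue_on \<Omega>. - laplacian \<Omega> u x = f x) \<longrightarrow>
           wg_solution \<Omega> \<T> f uh \<longrightarrow>
           energy_norm \<T> (Qh \<T> u - uh) \<le> C * mesh_size \<T> ^ (1 + i) * Hk_norm (2 + i) \<Omega> u"
proof (intro exI[of _ "24 * (1 + 18 * \<bar>\<sigma>\<bar>)"] conjI allI impI)
  show "0 < 24 * (1 + 18 * \<bar>\<sigma>\<bar>)" by (simp add: add_pos_nonneg)
qed (use energy_error_order assms in blast)

end
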